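(* Let $2\le k\le d$ be integers. There exist constants $K,c>0$ depending only on $d$ and $k$ such that the following holds for every prime power $q$. Let $\Delta_{k-1}$ be a non-degenerate $(k-1)$-simplex in $\mathbb{F}_q^d$ with nonzero side-lengths, and let $A_1,\dots,A_{k+1}\subset\mathbb{F}_q^d$. Assume that \[\prod_{i=1}^{k+1}|A_i|\ge K q^{dk+1}\quad\text{and}\quad |A_i|\ge K q^{\frac{d-1}{2}+k-1}\ \text{ for all } 1\le i\le k.\] Then the number of congruence classes of $k$-simplices with vertices in $\prod_{i=1}^{k+1}A_i$ containing a copy of $\Delta_{k-1}$ is at least $c\,q^k$.
   Context: $\mathbb{F}_q$ is the finite field of order $q$. $O(d)$ is the group of $d\times d$ orthogonal matrices over $\mathbb{F}_q$ ($g^Tg=I$). A $k$-simplex in $\mathbb{F}_q^d$ is an ordered tuple $\mathbf{x}=(x^1,\dots,x^{k+1})$ of points of $\mathbb{F}_q^d$; $\dim(\mathbf{x})$ is the dimension of the span of $\{x^2-x^1,\dots,x^{k+1}-x^1\}$, and $\mathbf{x}$ is non-degenerate if $\dim(\mathbf{x})=\min\{k,d\}$. Two $k$-simplices $\mathbf{x},\mathbf{y}$ are in the same congruence class if there exist $g\in O(d)$, $z\in\mathbb{F}_q^d$ with $gx^i+z=y^i$ for all $1\le i\le k+1$. The simplex $\mathbf{x}$ has vertices in $\prod_{i=1}^{k+1}A_i$ if $x^i\in A_i$ for all $i$. The side-lengths of a simplex are the values $\|x^i-x^j\|$ for $i\ne j$, where $\|x\|=x_1^2+\cdots+x_d^2$.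 A $k$-simplex contains a copy of $\Delta_{k-1}$ if some $k$ of its vertices, in some order, form a $(k-1)$-simplex in the same congruence class as $\Delta_{k-1}$. The number of congruence classes of simplices with a given property is the number of classes containing at least one such simplex.
   Formalization: The prime power q is assumed odd; for even q the claim fails, since ‖x‖=(x_1+...+x_d)^2 and, e.g. with d=6, k=2, taking every A_i to be the hyperplane x_1+...+x_d=0 gives no copy of Δ_1=(0,e_1). *)

theory Defs
  imports
    "Jordan_Normal_Form.Missing_VectorSpace"
    "HOL-Number_Theory.Prime_Powers"
    Complex_Main
begin

text \<open>
  Fields are HOL-Algebra records, so that a statement can quantify over all finite fields below an
  existential quantifier.  The space \<open>F^d\<close> is the function space on the index set \<open>{1..d}\<close>; its
  points are extensional functions.
\<close>

abbreviation coord_space :: "'a ring \<Rightarrow> nat \<Rightarrow> ('a, nat \<Rightarrow> 'a) module" where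
  "coord_space F d \<equiv> ring.func_space F {1..d}"

definition sq_norm :: "'a ring \<Rightarrow> nat \<Rightarrow> (nat \<Rightarrow> 'a) \<Rightarrow> 'a" where
  "sq_norm F d x = (\<Oplus>\<^bsub>F\<^esub> i \<in> {1..d}. x i [^]\<^bsub>F\<^esub> (2::nat))"

text \<open>A matrix is given by \<open>g i j\<close>, the entry in row \<open>i\<close> and column \<open>j\<close>.\<close>

definition orthogonal_matrices :: "'a ring \<Rightarrow> nat \<Rightarrow> (nat \<Rightarrow> nat \<Rightarrow> 'a) set" where
  "orthogonal_matrices F d =
     {g \<in> {1..d} \<rightarrow>\<^sub>E ({1..d} \<rightarrow>\<^sub>E carrier F).
        \<forall>i\<in>{1..d}. \<forall>j\<in>{1..d}.
          (\<Oplus>\<^bsub>F\<^esub> l \<in> {1..d}. g l i \<otimes>\<^bsub>F\<^esub> g l j) = (if i = j then \<one>\<^bsub>F\<^esub> else \<zero>\<^bsub>F\<^esub>)}"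

definition apply_matrix ::
    "'a ring \<Rightarrow> nat \<Rightarrow> (nat \<Rightarrow> nat \<Rightarrow> 'a) \<Rightarrow> (nat \<Rightarrow> 'a) \<Rightarrow> (nat \<Rightarrow> 'a)" where
  "apply_matrix F d g x = (\<lambda>i\<in>{1..d}. \<Oplus>\<^bsub>F\<^esub> j \<in> {1..d}. g i j \<otimes>\<^bsub>F\<^esub> x j)"

text \<open>A \<open>k\<close>-simplex is a tuple of \<open>k + 1\<close> points, indexed by \<open>{1..k+1}\<close>.\<close>

definition simplices :: "'a ring \<Rightarrow> nat \<Rightarrow> nat \<Rightarrow> (nat \<Rightarrow> nat \<Rightarrow> 'a) set" where
  "simplices F d k = {1..k+1} \<rightarrow>\<^sub>E carrier (coord_space F d)"

definition simplex_dim :: "'a ring \<Rightarrow> nat \<Rightarrow> nat \<Rightarrow> (nat \<Rightarrow> nat \<Rightarrow> 'a) \<Rightarrow> nat" where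
  "simplex_dim F d k x =
     vectorspace.dim F
       (module.span_vs F (coord_space F d)
          ((\<lambda>i. x i \<ominus>\<^bsub>coord_space F d\<^esub> x 1) ` {2..k+1}))"

definition nondegenerate :: "'a ring \<Rightarrow> nat \<Rightarrow> nat \<Rightarrow> (nat \<Rightarrow> nat \<Rightarrow> 'a) \<Rightarrow> bool" where
  "nondegenerate F d k x \<longleftrightarrow> simplex_dim F d k x = min k d"

definition side_lengths :: "'a ring \<Rightarrow> nat \<Rightarrow> nat \<Rightarrow> (nat \<Rightarrow> nat \<Rightarrow> 'a) \<Rightarrow> 'a set" where
  "side_lengths F d k x =
     {sq_norm F d (x i \<ominus>\<^bsub>coord_space F d\<^esub> x j) | i j.
        i \<in> {1..k+1} \<and> j \<in> {1..k+1} \<and> i \<noteq> j}"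

definition congruence_rel ::
    "'a ring \<Rightarrow> nat \<Rightarrow> nat \<Rightarrow> ((nat \<Rightarrow> nat \<Rightarrow> 'a) \<times> (nat \<Rightarrow> nat \<Rightarrow> 'a)) set" where
  "congruence_rel F d k =
     {(x, y). x \<in> simplices F d k \<and> y \<in> simplices F d k \<and>
        (\<exists>g \<in> orthogonal_matrices F d. \<exists>z \<in> carrier (coord_space F d).
           \<forall>i\<in>{1..k+1}. apply_matrix F d g (x i) \<oplus>\<^bsub>coord_space F d\<^esub> z = y i)}"

definition has_vertices_in ::
    "nat \<Rightarrow> (nat \<Rightarrow> (nat \<Rightarrow> 'a) set) \<Rightarrow> (nat \<Rightarrow> nat \<Rightarrow> 'a) \<Rightarrow> bool" where
  "has_vertices_in k A x \<longleftrightarrow> (\<forall>i\<in>{1..k+1}. x i \<in> A i)"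

text \<open>
  \<open>y\<close> is a \<open>(k-1)\<close>-simplex with \<open>k \<ge> 1\<close>; the injection \<open>s\<close> picks \<open>k\<close> of the \<open>k + 1\<close> vertices of
  \<open>x\<close> in some order.
\<close>

definition contains_copy ::
    "'a ring \<Rightarrow> nat \<Rightarrow> nat \<Rightarrow> (nat \<Rightarrow> nat \<Rightarrow> 'a) \<Rightarrow> (nat \<Rightarrow> nat \<Rightarrow> 'a) \<Rightarrow> bool" where
  "contains_copy F d k y x \<longleftrightarrow>
     (\<exists>s. s \<in> {1..k} \<rightarrow> {1..k+1} \<and> inj_on s {1..k} \<and>
        ((\<lambda>i\<in>{1..k}. x (s i)), y) \<in> congruence_rel F d (k - 1))"

definition num_congruence_classes ::
    "'a ring \<Rightarrow> nat \<Rightarrow> nat \<Rightarrow> ((nat \<Rightarrow> nat \<Rightarrow> 'a) \<Rightarrow> bool) \<Rightarrow> nat" where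
  "num_congruence_classes F d k P =
     card {C \<in> simplices F d k // congruence_rel F d k. \<exists>x\<in>C. P x}"

end

theory Submission
  imports Defs "HOL-Analysis.Convex" "HOL-Library.FuncSet" "HOL-Library.Function_Algebras"
begin

text \<open>
  Let \<open>y\<close> be the vertices of \<open>\<Delta>\<close> and \<open>G\<close> the group of rigid motions. Choose \<open>k\<close> of the
  sets \<open>A_i\<close>, call them \<open>B_1, ..., B_k\<close>, and let \<open>A\<close> be the remaining one. A motion \<open>g\<close> with
  \<open>g y_i \<in> B_i\<close> for all \<open>i\<close> places a copy of \<open>\<Delta>\<close> in \<open>B_1 \<times> ... \<times> B_k\<close>; let \<open>T\<close> be the set
  of these motions. A point \<open>w\<close> with \<open>g w \<in> A\<close> for some \<open>g \<in> T\<close> completes that copy to a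
  \<open>k\<close>-simplex which is congruent to \<open>(y, w)\<close>. The distances from \<open>w\<close> to the points \<open>y_i\<close> are
  congruence invariants of this simplex, so it suffices to find \<open>c q^k\<close> distance vectors among
  the points \<open>w\<close> that are reached in this way (\<open>distance_vectors_le_congruence_classes\<close>).

  The map from \<open>w\<close> to its distance vector has fibres of size at most \<open>2 q^(d-k)\<close>
  (\<open>distance_fiber\<close>), so it is enough that half of all points are reached. The orthogonal group
  acts transitively on the nonzero vectors of a given norm, and there are about \<open>q^(d-1)\<close> of
  these. Hence a function of mean zero is nearly uncorrelated with its image under most motions,
  and a second moment computation bounds the number of points that no motion in \<open>T\<close> sends to \<open>A\<close>
  by a multiple of \<open>q |G| q^d / (|T| |A|)\<close> (\<open>rigid_motion_mixing\<close>). What is left is a lower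
  bound for \<open>|T|\<close>.

  By Witt's theorem (\<open>witt\<close>) every nondegenerate tuple in \<open>B_1 \<times> ... \<times> B_k\<close> with the same
  pairwise distances as \<open>y\<close> is a placement of \<open>y\<close>, and the degenerate tuples are few
  (\<open>card_degenerate\<close>). Tuples with prescribed distances are counted by removing the distance
  conditions one at a time (\<open>edge_removal\<close>, \<open>config_count\<close>): the number of them is about
  \<open>q^(-k(k-1)/2) |B_1| ... |B_k|\<close> for every choice of nonzero distances, in particular when all
  \<open>B_i\<close> are the whole space, which bounds the number of placements altogether
  (\<open>card_placements_in_product\<close>).

  Removing one condition needs an estimate for the number of pairs \<open>(a, b)\<close> at a given nonzero
  distance with \<open>a\<close> and \<open>b\<close> in given sets. When both points are also tied to a third point, the
  sets lie on spheres around it, the condition becomes a prescribed dot product, and \<open>dot_pairs\<close>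
  bounds the error by \<open>q^((d-1)/2)\<close> times the square root of the product of the two set sizes.
  Otherwise the error term is governed by Kloosterman sums. For \<open>k \<ge> 3\<close> the two points are then
  tied to at most \<open>k - 2\<close> other points in total, and the trivial bound \<open>q\<close> suffices. For \<open>k = 2\<close>
  the two largest of the three sets serve as \<open>B_1, B_2\<close>, which leaves room for elementary
  bounds: the exponent \<open>3/4\<close> of the fourth moment for \<open>d \<ge> 3\<close> (\<open>kloosterman_bound_4\<close>), and the
  exponent \<open>2/3\<close> of the sixth moment for \<open>d = 2\<close> (\<open>kloosterman_bound_6\<close>).

  The size hypotheses force \<open>q\<close> to be large and \<open>2 k \<le> d + 2\<close>, because no \<open>A_i\<close> has more than
  \<open>q^d\<close> points. The second inequality is what makes the orthogonal complements that occur large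
  enough to contain vectors of nonzero norm.

  A field on a set of natural numbers is not a type. All of these fields embed as ideals in a
  single commutative ring, the product of all commutative rings on sets of natural numbers
  (\<open>ring_product\<close>), and the analysis takes place in finite ideals that are fields.
\<close>

section \<open>Finite fields as ideals of a commutative ring\<close>

text \<open>
  \<open>K\<close> is a field with unit \<open>e\<close>, embedded as an ideal: \<open>e\<close> is an idempotent of the surrounding
  ring, which has a unit of its own. In this way a field that is given by a set of elements is
  accessible to type class arithmetic, with sums and numerals. A numeral \<open>n\<close> acts on \<open>K\<close> as
  \<open>n * e\<close>, which lies in \<open>K\<close>, while the numeral itself need not.
\<close>

locale finite_field_ideal =
  fixes K :: "'r::comm_ring_1 set" and e :: 'r
  assumes finite_K [simp]: "finite K"
    and zero_K [simp]: "0 \<in> K"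
    and add_K [simp]: "x \<in> K \<Longrightarrow> y \<in> K \<Longrightarrow> x + y \<in> K"
    and mult_K [simp]: "x \<in> K \<Longrightarrow> x * y \<in> K"
    and e_K [simp]: "e \<in> K"
    and e_mult [simp]: "x \<in> K \<Longrightarrow> e * x = x"
    and e_nonzero [simp]: "e \<noteq> 0"
    and ex_inverse: "x \<in> K \<Longrightarrow> x \<noteq> 0 \<Longrightarrow> \<exists>y\<in>K. x * y = e"
    and odd_card: "odd (card K)"
begin

definition q :: nat where "q = card K"

definition kinv :: "'r \<Rightarrow> 'r" where
  "kinv x = (if x = 0 then 0 else SOME y. y \<in> K \<and> x * y = e)"

lemma mult_K2 [simp]: "y \<in> K \<Longrightarrow> x * y \<in> K"
  by (metis mult_K mult.commute)

lemma minus_K [simp]: "x \<in> K \<Longrightarrow> - x \<in> K"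
  by (metis mult_K2 mult_minus1)

lemma diff_K [simp]: "x \<in> K \<Longrightarrow> y \<in> K \<Longrightarrow> x - y \<in> K"
  by (metis add_K diff_conv_add_uminus minus_K)

lemma sum_K [simp]: "(\<And>i. i \<in> I \<Longrightarrow> f i \<in> K) \<Longrightarrow> sum f I \<in> K"
  by (induction I rule: infinite_finite_induct) auto

lemma e_mult2 [simp]: "x \<in> K \<Longrightarrow> x * e = x"
  by (metis e_mult mult.commute)

lemma kinv_K [simp]: "x \<in> K \<Longrightarrow> kinv x \<in> K"
  using someI_ex[of "\<lambda>y. y \<in> K \<and> x * y = e"] ex_inverse[of x] by (auto simp: kinv_def)

lemma kinv_right [simp]: "x \<in> K \<Longrightarrow> x \<noteq> 0 \<Longrightarrow> x * kinv x = e"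
  using someI_ex[of "\<lambda>y. y \<in> K \<and> x * y = e"] ex_inverse[of x] by (auto simp: kinv_def)

lemma kinv_left [simp]: "x \<in> K \<Longrightarrow> x \<noteq> 0 \<Longrightarrow> kinv x * x = e"
  by (metis kinv_right mult.commute)

lemma kinv_cancel [simp]:
  assumes "x \<in> K" "x \<noteq> 0" "y \<in> K"
  shows "x * (kinv x * y) = y" "kinv x * (x * y) = y" "y * (x * kinv x) = y"
    "x * (y * kinv x) = y" "kinv x * (y * x) = y"
proof -
  show "x * (kinv x * y) = y" using assms by (metis kinv_right mult.assoc e_mult)
  show "kinv x * (x * y) = y" using assms by (metis kinv_left mult.assoc e_mult)
  show "y * (x * kinv x) = y" using assms by simp
  show "x * (y * kinv x) = y" using assms by (metis kinv_right mult.left_commute e_mult2)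
  show "kinv x * (y * x) = y" using assms by (metis kinv_left mult.left_commute e_mult2)
qed

lemma mult_eq_0_K: "x \<in> K \<Longrightarrow> y \<in> K \<Longrightarrow> x * y = 0 \<longleftrightarrow> x = 0 \<or> y = 0"
  by (metis kinv_cancel(2) mult_zero_right mult_zero_left)

lemma mult_left_cancel_K: "c \<in> K \<Longrightarrow> c \<noteq> 0 \<Longrightarrow> x \<in> K \<Longrightarrow> y \<in> K \<Longrightarrow> c * x = c * y \<longleftrightarrow> x = y"
  by (metis kinv_cancel(2))

lemma kinv_nonzero [simp]: "x \<in> K \<Longrightarrow> kinv x = 0 \<longleftrightarrow> x = 0"
  by (metis kinv_right mult_zero_right e_nonzero kinv_def)

lemma kinv_unique: "x \<in> K \<Longrightarrow> y \<in> K \<Longrightarrow> x * y = e \<Longrightarrow> kinv x = y"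
  by (metis e_nonzero kinv_cancel(2) mult_zero_left e_mult2 kinv_K)

lemma kinv_kinv [simp]: "x \<in> K \<Longrightarrow> kinv (kinv x) = x"
  by (metis kinv_K kinv_def kinv_left kinv_unique)

lemma kinv_mult:
  assumes "x \<in> K" "y \<in> K"
  shows "kinv (x * y) = kinv x * kinv y"
proof (cases "x = 0 \<or> y = 0")
  case False
  hence inv: "x * kinv x = e" "y * kinv y = e" using assms by simp_all
  have "x * y * (kinv x * kinv y) = (x * kinv x) * (y * kinv y)" by (simp only: ac_simps)
  also have "\<dots> = e" by (simp only: inv e_mult[OF e_K])
  finally show ?thesis using assms by (intro kinv_unique) auto
qed (auto simp: kinv_def)

lemma q_ge_3: "q \<ge> 3"
proof -
  have "card {0, e} \<le> card K" by (intro card_mono) auto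
  moreover have "card {0, e} = 2" using e_nonzero by (metis card_2_iff)
  ultimately have "q \<ge> 2" unfolding q_def by simp
  moreover have "q \<noteq> 2" using odd_card unfolding q_def by auto
  ultimately show ?thesis by simp
qed

lemma q_pos [simp]: "q > 0" "real q > 0" "q \<noteq> 0"
  using q_ge_3 by auto

lemma bij_add: "a \<in> K \<Longrightarrow> bij_betw (\<lambda>x. x + a) K K"
  by (rule bij_betwI[where g="\<lambda>x. x - a"]) auto

lemma bij_mult: "a \<in> K \<Longrightarrow> a \<noteq> 0 \<Longrightarrow> bij_betw (\<lambda>x. a * x) K K"
  by (rule bij_betwI[where g="\<lambda>x. kinv a * x"]) auto

lemma bij_mult_units: "a \<in> K \<Longrightarrow> a \<noteq> 0 \<Longrightarrow> bij_betw (\<lambda>x. a * x) (K - {0}) (K - {0})"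
  by (rule bij_betwI[where g="\<lambda>x. kinv a * x"]) (auto simp: mult_eq_0_K)

lemma card_units: "card (K - {0}) = q - 1"
  by (simp add: q_def)

text \<open>
  Translation by \<open>x\<close> permutes \<open>K\<close>, so it does not change the sum of all elements.
\<close>

lemma q_mult_eq_0: "x \<in> K \<Longrightarrow> of_nat q * x = 0"
proof -
  assume x: "x \<in> K"
  have "(\<Sum>y\<in>K. y) = (\<Sum>y\<in>K. y + x)"
    using sum.reindex_bij_betw[OF bij_add[OF x], of "\<lambda>y. y"] by simp
  also have "\<dots> = (\<Sum>y\<in>K. y) + of_nat q * x" by (simp add: sum.distrib q_def)
  finally show ?thesis by simp
qed

text \<open>
  \<open>q x = 0\<close> for all \<open>x\<close> in \<open>K\<close>; since \<open>q\<close> is odd, \<open>2 x = 0\<close> leaves only \<open>x = 0\<close>.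
\<close>

lemma two_mult_eq_0: "x \<in> K \<Longrightarrow> 2 * x = 0 \<longleftrightarrow> x = 0"
proof
  assume x: "x \<in> K" and 2: "2 * x = 0"
  obtain m where m: "q = 2 * m + 1" using odd_card unfolding q_def by (auto elim: oddE)
  have "of_nat q * x = of_nat m * (2 * x) + x" unfolding m by (simp add: algebra_simps)
  thus "x = 0" using 2 q_mult_eq_0[OF x] by simp
qed auto

lemma four_mult_eq_0: "x \<in> K \<Longrightarrow> 4 * x = 0 \<longleftrightarrow> x = 0"
proof -
  assume x: "x \<in> K"
  have "4 * x = 2 * (2 * x)" by (simp add: algebra_simps)
  thus ?thesis using two_mult_eq_0[of "2 * x"] two_mult_eq_0[OF x] x by simp
qed

lemma square_eq_iff_K: "x \<in> K \<Longrightarrow> y \<in> K \<Longrightarrow> x * x = y * y \<longleftrightarrow> x = y \<or> x = - y"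
proof
  assume xy: "x \<in> K" "y \<in> K" and eq: "x * x = y * y"
  have "(x - y) * (x + y) = 0" using eq by (simp add: algebra_simps)
  hence "x - y = 0 \<or> x + y = 0" using mult_eq_0_K[of "x - y" "x + y"] xy by simp
  thus "x = y \<or> x = - y" by (auto simp: eq_neg_iff_add_eq_0)
qed auto

lemma neg_eq_self: "x \<in> K \<Longrightarrow> - x = x \<longleftrightarrow> x = 0"
proof -
  assume x: "x \<in> K"
  have "- x = x \<longleftrightarrow> 2 * x = 0" by (metis mult_2 neg_eq_iff_add_eq_0)
  thus ?thesis using two_mult_eq_0[OF x] by simp
qed

section \<open>An additive character\<close>

definition additive_subgroup :: "'r set \<Rightarrow> bool" where
  "additive_subgroup H \<longleftrightarrow> H \<subseteq> K \<and> 0 \<in> H \<and> (\<forall>x\<in>H. \<forall>y\<in>H. x - y \<in> H)"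

lemma additive_subgroup_add: "additive_subgroup H \<Longrightarrow> x \<in> H \<Longrightarrow> y \<in> H \<Longrightarrow> x + y \<in> H"
  unfolding additive_subgroup_def by (metis diff_0 diff_minus_eq_add)

lemma additive_subgroup_of_int: "additive_subgroup H \<Longrightarrow> x \<in> H \<Longrightarrow> of_int j * x \<in> H"
proof (induction j rule: int_induct[where k=0])
  case base thus ?case by (simp add: additive_subgroup_def)
next
  case (step1 i) thus ?case by (simp add: algebra_simps additive_subgroup_add)
next
  case (step2 i) thus ?case by (simp add: algebra_simps) (simp add: additive_subgroup_def)
qed

lemma exists_maximal_subgroup:
  "\<exists>H. additive_subgroup H \<and> H \<noteq> K \<and> (\<forall>H'. additive_subgroup H' \<longrightarrow> H \<subset> H' \<longrightarrow> H' = K)"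
proof -
  let ?S = "{H. additive_subgroup H \<and> H \<noteq> K}"
  have "finite ?S" by (rule finite_subset[of _ "Pow K"]) (auto simp: additive_subgroup_def)
  moreover have "K \<noteq> {0}" using e_nonzero e_K by (metis singletonD)
  hence "{0} \<in> ?S" by (auto simp: additive_subgroup_def)
  ultimately obtain H where "H \<in> ?S" "\<forall>H'\<in>?S. H \<subseteq> H' \<longrightarrow> H = H'"
    using finite_has_maximal[of ?S] by blast
  thus ?thesis by blast
qed

text \<open>
  The quotient of \<open>K\<close> by a maximal proper additive subgroup \<open>H\<close> is generated by any \<open>b \<notin> H\<close>, so
  it is cyclic of some order \<open>m\<close>, and \<open>b\<close> can be sent to a primitive root of unity of order \<open>m\<close>.
  This avoids the trace to the prime field. Composition with multiplication by \<open>e\<close> extends the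
  character from \<open>K\<close> to the whole ring, so that additivity holds without side conditions.
\<close>

lemma exists_character:
  "\<exists>\<chi> :: 'r \<Rightarrow> complex. (\<forall>x y. \<chi> (x + y) = \<chi> x * \<chi> y) \<and> (\<forall>x. cmod (\<chi> x) = 1)
     \<and> (\<forall>x. \<chi> (e * x) = \<chi> x) \<and> (\<exists>x\<in>K. \<chi> x \<noteq> 1)"
proof -
  obtain H where H: "additive_subgroup H" "H \<noteq> K"
    and max: "\<And>H'. additive_subgroup H' \<Longrightarrow> H \<subset> H' \<Longrightarrow> H' = K"
    using exists_maximal_subgroup by blast
  have HK: "H \<subseteq> K" using H by (simp add: additive_subgroup_def)
  obtain b where b: "b \<in> K" "b \<notin> H" using H HK by blast
  have bK: "of_int j * b \<in> K" for j using b by simp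
  \<comment> \<open>\<open>H'\<close> is the subgroup generated by \<open>H\<close> and \<open>b\<close>; by maximality it is all of \<open>K\<close>.\<close>
  define H' where "H' = {y \<in> K. \<exists>j::int. y - of_int j * b \<in> H}"
  have "additive_subgroup H'"
    unfolding additive_subgroup_def
  proof (intro conjI ballI)
    show "0 \<in> H'" unfolding H'_def using H by (auto intro!: exI[of _ 0] simp: additive_subgroup_def)
    fix x y assume "x \<in> H'" "y \<in> H'"
    then obtain i j :: int where ij: "x \<in> K" "y \<in> K" "x - of_int i * b \<in> H" "y - of_int j * b \<in> H"
      unfolding H'_def by blast
    hence "(x - of_int i * b) - (y - of_int j * b) \<in> H" using H by (auto simp: additive_subgroup_def)
    also have "(x - of_int i * b) - (y - of_int j * b) = (x - y) - of_int (i - j) * b"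
      by (simp add: algebra_simps)
    finally have "\<exists>j::int. (x - y) - of_int j * b \<in> H" by (rule exI)
    thus "x - y \<in> H'" using ij(1,2) unfolding H'_def by simp
  qed (auto simp: H'_def)
  moreover have "H \<subseteq> H'" unfolding H'_def using HK by (auto intro!: exI[of _ 0])
  moreover have "b \<in> H'" unfolding H'_def using b H by (auto intro!: exI[of _ 1] simp: additive_subgroup_def)
  ultimately have H'K: "H' = K" using max[of H'] b by blast
  define m where "m = (LEAST m::nat. 0 < m \<and> of_nat m * b \<in> H)"
  have "0 < q \<and> of_nat q * b \<in> H" using q_mult_eq_0[OF b(1)] H by (simp add: additive_subgroup_def)
  hence m: "0 < m \<and> of_nat m * b \<in> H" unfolding m_def by (rule LeastI)
  have m_min: "m \<le> n" if "0 < n" "of_nat n * b \<in> H" for n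
    unfolding m_def using that by (intro Least_le) auto
  have dvd: "int m dvd j" if "of_int j * b \<in> H" for j
  proof (rule ccontr)
    assume nd: "\<not> int m dvd j"
    have "j mod int m = j - j div int m * int m" by (simp only: minus_div_mult_eq_mod)
    hence "of_int (j mod int m) * b = of_int (j - j div int m * int m) * b" by simp
    also have "\<dots> = of_int j * b - of_int (j div int m) * (of_nat m * b)"
      by (simp only: of_int_diff of_int_mult of_int_of_nat_eq left_diff_distrib mult.assoc)
    also have "\<dots> \<in> H"
    proof -
      have "of_int (j div int m) * (of_nat m * b) \<in> H"
        using m by (intro additive_subgroup_of_int[OF H(1)]) blast
      with that show ?thesis using H(1) unfolding additive_subgroup_def by blast
    qed
    finally have "of_nat (nat (j mod int m)) * b \<in> H" using m by simp
    moreover have "0 < nat (j mod int m)" "nat (j mod int m) < m"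
      using pos_mod_sign[of "int m" j] pos_mod_bound[of "int m" j] nd m
      unfolding dvd_eq_mod_eq_0 by linarith+
    ultimately show False using m_min[of "nat (j mod int m)"] by linarith
  qed
  define J where "J y = (SOME j::int. y - of_int j * b \<in> H)" for y
  have J: "y - of_int (J y) * b \<in> H" if "y \<in> K" for y
    unfolding J_def by (rule someI_ex) (use that H'K H'_def in blast)
  define \<omega> where "\<omega> j = cis (2 * pi * of_int j / of_nat m)" for j :: int
  have \<omega>_eq: "\<omega> i = \<omega> j" if "int m dvd i - j" for i j
  proof -
    obtain t where t: "i - j = int m * t" using \<open>int m dvd i - j\<close> by blast
    hence "i = j + int m * t" by simp
    hence "2 * pi * of_int i / of_nat m = 2 * pi * of_int j / of_nat m + 2 * pi * of_int t"
      using m by (simp add: field_simps)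
    thus ?thesis by (metis \<omega>_def cis_mult cis_multiple_2pi Ints_of_int mult.right_neutral)
  qed
  define \<chi> where "\<chi> x = \<omega> (J (e * x))" for x
  have J_add: "int m dvd J (x + y) - (J x + J y)" if "x \<in> K" "y \<in> K" for x y
  proof (rule dvd)
    have "((x - of_int (J x) * b) + (y - of_int (J y) * b)) - (x + y - of_int (J (x + y)) * b) \<in> H"
      using J[of x] J[of y] J[of "x + y"] that H(1) additive_subgroup_add[OF H(1)] add_K
      unfolding additive_subgroup_def by blast
    also have "((x - of_int (J x) * b) + (y - of_int (J y) * b)) - (x + y - of_int (J (x + y)) * b)
        = of_int (J (x + y) - (J x + J y)) * b" by (simp add: algebra_simps)
    finally show "of_int (J (x + y) - (J x + J y)) * b \<in> H" .
  qed
  have "\<chi> (x + y) = \<chi> x * \<chi> y" for x y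
  proof -
    have "\<chi> (x + y) = \<omega> (J (e * x + e * y))" by (simp add: \<chi>_def distrib_left)
    also have "\<dots> = \<omega> (J (e * x) + J (e * y))" by (rule \<omega>_eq[OF J_add]) auto
    also have "\<dots> = \<chi> x * \<chi> y" by (simp add: \<chi>_def \<omega>_def cis_mult ring_distribs add_divide_distrib)
    finally show ?thesis .
  qed
  moreover have "cmod (\<chi> x) = 1" for x by (simp add: \<chi>_def \<omega>_def)
  moreover have "\<chi> (e * x) = \<chi> x" for x by (simp add: \<chi>_def)
  moreover have "\<chi> b \<noteq> 1"
  proof -
    have "m \<noteq> 1" using m b by auto
    hence m2: "m \<ge> 2" using m by linarith
    have "int m dvd J b - 1"
    proof (rule dvd)
      have "0 - (b - of_int (J b) * b) \<in> H" using J[OF b(1)] H(1) unfolding additive_subgroup_def by blast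
      also have "0 - (b - of_int (J b) * b) = of_int (J b - 1) * b" by (simp add: algebra_simps)
      finally show "of_int (J b - 1) * b \<in> H" .
    qed
    hence eq: "\<chi> b = \<omega> 1" unfolding \<chi>_def using b by (simp add: \<omega>_eq)
    have "\<omega> 1 \<noteq> 1"
    proof
      assume "\<omega> 1 = 1"
      hence "cos (2 * pi / m) = 1" unfolding \<omega>_def by (simp add: complex_eq_iff)
      then obtain n :: int where n: "2 * pi / m = of_int n * 2 * pi" using cos_one_2pi_int by auto
      hence "of_int n * real m = 1" using m by (simp add: field_simps)
      hence "n * int m = 1" by (metis of_int_1 of_int_eq_iff of_int_mult of_int_of_nat_eq)
      thus False using m2 by (auto simp: zmult_eq_1_iff)
    qed
    thus ?thesis using eq by simp
  qed
  ultimately show ?thesis using b by blast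
qed

definition chi :: "'r \<Rightarrow> complex" where
  "chi = (SOME \<chi>. (\<forall>x y. \<chi> (x + y) = \<chi> x * \<chi> y) \<and> (\<forall>x. cmod (\<chi> x) = 1)
     \<and> (\<forall>x. \<chi> (e * x) = \<chi> x) \<and> (\<exists>x\<in>K. \<chi> x \<noteq> 1))"

lemma chi_add: "chi (x + y) = chi x * chi y"
  and norm_chi [simp]: "cmod (chi x) = 1"
  and chi_nontrivial: "\<exists>x\<in>K. chi x \<noteq> 1"
  using someI_ex[OF exists_character, folded chi_def] by auto

lemma chi_0 [simp]: "chi 0 = 1"
  by (metis chi_add add_0 mult_cancel_right2 norm_chi norm_zero zero_neq_one)

lemma chi_nonzero [simp]: "chi x \<noteq> 0"
  by (metis norm_chi norm_zero zero_neq_one)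

lemma chi_minus: "chi (- x) = cnj (chi x)"
proof -
  have "chi (- x) * chi x = 1" by (metis chi_add chi_0 ab_left_minus)
  moreover have "cnj (chi x) * chi x = 1"
    by (metis complex_norm_square mult.commute norm_chi of_real_1 one_power2)
  ultimately show ?thesis by (metis chi_nonzero mult_cancel_right)
qed

lemma chi_diff: "chi (x - y) = chi x * cnj (chi y)"
  by (metis chi_add chi_minus diff_conv_add_uminus)

lemma chi_sum: "chi (sum f I) = (\<Prod>i\<in>I. chi (f i))"
  by (induction I rule: infinite_finite_induct) (auto simp: chi_add)

lemma sum_chi: "(\<Sum>x\<in>K. chi x) = 0"
proof -
  obtain a where a: "a \<in> K" "chi a \<noteq> 1" using chi_nontrivial by blast
  have "(\<Sum>x\<in>K. chi x) = (\<Sum>x\<in>K. chi (x + a))"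
    using sum.reindex_bij_betw[OF bij_add[OF a(1)], of chi] by simp
  also have "\<dots> = (\<Sum>x\<in>K. chi x) * chi a" by (simp add: chi_add sum_distrib_right)
  finally show ?thesis using a by simp
qed

lemma sum_chi_mult: "y \<in> K \<Longrightarrow> (\<Sum>x\<in>K. chi (x * y)) = (if y = 0 then of_nat q else 0)"
proof (cases "y = 0")
  case False
  assume "y \<in> K"
  thus ?thesis using False sum.reindex_bij_betw[OF bij_mult[of y], of chi] sum_chi
    by (simp add: mult.commute)
qed (simp add: q_def)

end

section \<open>The quadratic character\<close>

context finite_field_ideal begin

definition eta :: "'r \<Rightarrow> real" where
  "eta x = (if x = 0 then 0 else if \<exists>y\<in>K. y * y = x then 1 else - 1)"

lemma eta_0 [simp]: "eta 0 = 0"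
  by (simp add: eta_def)

lemma eta_bounds: "- 1 \<le> eta x" "eta x \<le> 1" "\<bar>eta x\<bar> \<le> 1"
  by (auto simp: eta_def)

lemma eta_sq: "x \<noteq> 0 \<Longrightarrow> eta x * eta x = 1"
  by (auto simp: eta_def)

lemma eta_square [simp]: "x \<in> K \<Longrightarrow> x \<noteq> 0 \<Longrightarrow> eta (x * x) = 1"
  by (auto simp: eta_def mult_eq_0_K)

text \<open>
  Nonzero squares have exactly two roots, because \<open>x \<noteq> - x\<close> for \<open>x \<noteq> 0\<close>.
\<close>

lemma card_square_roots: "x \<in> K \<Longrightarrow> real (card {y \<in> K. y * y = x}) = 1 + eta x"
proof -
  assume x: "x \<in> K"
  consider "x = 0" | y where "x \<noteq> 0" "y \<in> K" "y * y = x" | "x \<noteq> 0" "\<not> (\<exists>y\<in>K. y * y = x)"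
    by blast
  thus ?thesis
  proof cases
    case 1
    hence "{y \<in> K. y * y = x} = {0}" by (auto simp: mult_eq_0_K)
    thus ?thesis using 1 by simp
  next
    case 2
    hence "{y \<in> K. y * y = x} = {y, - y}" by (auto simp: square_eq_iff_K)
    moreover have "y \<noteq> - y" using neg_eq_self[of y] 2 by auto
    ultimately show ?thesis using 2 by (auto simp: eta_def)
  next
    case 3
    hence "{y \<in> K. y * y = x} = {}" by blast
    thus ?thesis using 3 by (simp only: eta_def) simp
  qed
qed

lemma sum_over_squares:
  fixes f :: "'r \<Rightarrow> 'b::real_algebra_1"
  shows "(\<Sum>y\<in>K. f (y * y)) = (\<Sum>x\<in>K. of_real (1 + eta x) * f x)"
proof -
  have "(\<Sum>y\<in>K. f (y * y)) = (\<Sum>x\<in>K. \<Sum>y\<in>{y \<in> K. y * y = x}. f (y * y))"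
    by (rule sum.group[symmetric]) auto
  also have "\<dots> = (\<Sum>x\<in>K. of_real (1 + eta x) * f x)"
  proof (rule sum.cong[OF refl])
    fix x assume x: "x \<in> K"
    have "(\<Sum>y\<in>{y \<in> K. y * y = x}. f (y * y)) = (\<Sum>y\<in>{y \<in> K. y * y = x}. f x)"
      by (rule sum.cong) auto
    also have "\<dots> = of_real (real (card {y \<in> K. y * y = x})) * f x" by simp
    finally show "(\<Sum>y\<in>{y \<in> K. y * y = x}. f (y * y)) = of_real (1 + eta x) * f x"
      unfolding card_square_roots[OF x] .
  qed
  finally show ?thesis .
qed

lemma sum_eta: "(\<Sum>x\<in>K. eta x) = 0"
  using sum_over_squares[of "\<lambda>_. 1::real"] by (simp add: sum.distrib)

lemma sum_eta_mult: "c \<in> K \<Longrightarrow> c \<noteq> 0 \<Longrightarrow> (\<Sum>x\<in>K. eta (c * x)) = 0"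
  using sum.reindex_bij_betw[OF bij_mult[of c], of eta] sum_eta by simp

lemma sum_eta_affine: "c \<in> K \<Longrightarrow> c \<noteq> 0 \<Longrightarrow> b \<in> K \<Longrightarrow> (\<Sum>x\<in>K. eta (c * x + b)) = 0"
  using sum.reindex_bij_betw[OF bij_mult[of c], of "\<lambda>x. eta (x + b)"]
    sum.reindex_bij_betw[OF bij_add[of b], of eta] sum_eta by simp

lemma eta_mult_square: "s \<in> K \<Longrightarrow> s \<noteq> 0 \<Longrightarrow> y \<in> K \<Longrightarrow> eta (s * s * y) = eta y"
proof -
  assume s: "s \<in> K" "s \<noteq> 0" and y: "y \<in> K"
  have "(\<exists>z\<in>K. z * z = s * s * y) \<longleftrightarrow> (\<exists>w\<in>K. w * w = y)"
  proof
    assume "\<exists>z\<in>K. z * z = s * s * y"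
    then obtain z where z: "z \<in> K" "z * z = s * s * y" by blast
    have "(kinv s * z) * (kinv s * z) = kinv s * (kinv s * (z * z))" by (simp only: ac_simps)
    also have "\<dots> = y" using s y z by (simp add: mult.assoc)
    finally show "\<exists>w\<in>K. w * w = y" using s z by (intro bexI[of _ "kinv s * z"]) auto
  next
    assume "\<exists>w\<in>K. w * w = y"
    then obtain w where w: "w \<in> K" "w * w = y" by blast
    have "(s * w) * (s * w) = s * s * y" using w by (simp add: ac_simps)
    thus "\<exists>z\<in>K. z * z = s * s * y" using s w by (intro bexI[of _ "s * w"]) auto
  qed
  moreover have "s * s * y = 0 \<longleftrightarrow> y = 0" using s y by (simp add: mult_eq_0_K)
  ultimately show ?thesis by (simp add: eta_def)
qed

text \<open>
  The case of two nonsquares is a counting argument: for a nonsquare \<open>x\<close>, multiplication by \<open>x\<close>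
  permutes \<open>K\<close> and sends squares to nonsquares, and \<open>eta\<close> has sum zero. Thus \<open>eta (x z) + eta z\<close>
  is nowhere positive and has sum zero.
\<close>

lemma eta_mult:
  assumes x: "x \<in> K" and y: "y \<in> K"
  shows "eta (x * y) = eta x * eta y"
proof -
  consider "x = 0 \<or> y = 0" | "x \<noteq> 0" "y \<noteq> 0" "\<exists>s\<in>K. s * s = x" | "x \<noteq> 0" "y \<noteq> 0" "\<exists>s\<in>K. s * s = y"
    | "x \<noteq> 0" "y \<noteq> 0" "\<not> (\<exists>s\<in>K. s * s = x)" "\<not> (\<exists>s\<in>K. s * s = y)" by blast
  thus ?thesis
  proof cases
    case 2
    then obtain s where s: "s \<in> K" "s * s = x" "s \<noteq> 0" by (metis mult_zero_left)
    show ?thesis using eta_mult_square[OF s(1,3) y] eta_square[OF s(1,3)] s(2) by simp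
  next
    case 3
    then obtain s where s: "s \<in> K" "s * s = y" "s \<noteq> 0" by (metis mult_zero_left)
    show ?thesis using eta_mult_square[OF s(1,3) x] eta_square[OF s(1,3)] s(2) by (simp add: mult.commute)
  next
    case 4
    have le: "eta (x * z) + eta z \<le> 0" if z: "z \<in> K" for z
    proof (cases "z \<noteq> 0 \<and> (\<exists>s\<in>K. s * s = z)")
      case True
      then obtain s where s: "s \<in> K" "s * s = z" "s \<noteq> 0" by (metis mult_zero_left)
      show ?thesis
        using eta_mult_square[OF s(1,3) x] eta_square[OF s(1,3)] s(2) 4 by (simp add: mult.commute eta_def)
    next
      case False
      thus ?thesis using eta_bounds[of "x * z"] by (auto simp: eta_def)
    qed
    have "(\<Sum>z\<in>K. - (eta (x * z) + eta z)) = 0"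
      using sum_eta_mult[OF x] sum_eta 4 by (simp add: sum.distrib sum_negf sum_subtractf)
    hence "eta (x * y) + eta y = 0"
      using sum_nonneg_eq_0_iff[of K "\<lambda>z. - (eta (x * z) + eta z)"] le y by fastforce
    thus ?thesis using 4 by (simp add: eta_def)
  qed auto
qed

lemma eta_kinv: "x \<in> K \<Longrightarrow> eta (kinv x) = eta x"
proof (cases "x = 0")
  case False
  assume x: "x \<in> K"
  have "eta (kinv x) = eta (x * x * kinv x)" using eta_mult_square[of x "kinv x"] x False by simp
  also have "x * x * kinv x = x" using x False by (simp add: mult.assoc)
  finally show ?thesis .
qed (simp add: kinv_def)

lemma eta_4_mult: "x \<in> K \<Longrightarrow> eta (4 * x) = eta x"
proof -
  assume x: "x \<in> K"
  have "2 * e \<noteq> 0" using two_mult_eq_0[of e] by simp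
  hence "eta ((2 * e) * (2 * e) * x) = eta x" using x by (intro eta_mult_square) auto
  also have "(2 * e) * (2 * e) * x = 4 * x" using x by (simp add: mult.assoc)
  finally show ?thesis .
qed

section \<open>Gauss sums\<close>

definition gauss :: "'r \<Rightarrow> complex" where
  "gauss c = (\<Sum>x\<in>K. chi (c * (x * x)))"

lemma gauss_eta: "c \<in> K \<Longrightarrow> c \<noteq> 0 \<Longrightarrow> gauss c = of_real (eta c) * gauss e"
proof -
  have *: "gauss c = (\<Sum>u\<in>K. of_real (eta u) * chi (c * u))" if "c \<in> K" "c \<noteq> 0" for c
    using sum_over_squares[of "\<lambda>y. chi (c * y)"] sum_chi_mult[OF that(1)] that
    by (simp add: gauss_def sum.distrib ring_distribs mult.commute[of c])
  assume c: "c \<in> K" "c \<noteq> 0"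
  have "of_real (eta c) * gauss e = (\<Sum>u\<in>K. of_real (eta c * eta u) * chi u)"
    by (simp add: * sum_distrib_left mult.assoc)
  also have "\<dots> = (\<Sum>u\<in>K. of_real (eta c * eta (c * u)) * chi (c * u))"
    using sum.reindex_bij_betw[OF bij_mult[of c], of "\<lambda>u. of_real (eta c * eta u) * chi u"] c by simp
  also have "\<dots> = (\<Sum>u\<in>K. of_real (eta u) * chi (c * u))"
    using c eta_sq[of c] by (intro sum.cong refl) (simp add: eta_mult flip: mult.assoc)
  finally show ?thesis using *[OF c] by simp
qed

lemma norm_sum_sq: "of_real ((cmod (\<Sum>x\<in>A. f x))\<^sup>2) = (\<Sum>x\<in>A. \<Sum>y\<in>A. f x * cnj (f y))"
  unfolding complex_norm_square by (simp add: sum_product cnj_sum)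

text \<open>
  The squared modulus is a double sum over \<open>x\<close> and \<open>y\<close> of \<open>chi (c (x - y) (x + y))\<close>.
  Substituting \<open>x = y + h\<close> makes the exponent linear in \<open>y\<close>, and only \<open>h = 0\<close> survives.
\<close>

lemma norm_gauss:
  assumes c: "c \<in> K" "c \<noteq> 0"
  shows "(cmod (gauss c))\<^sup>2 = real q"
proof -
  have "of_real ((cmod (gauss c))\<^sup>2) = (\<Sum>x\<in>K. \<Sum>y\<in>K. chi (c * (x * x)) * cnj (chi (c * (y * y))))"
    unfolding gauss_def norm_sum_sq ..
  also have "\<dots> = (\<Sum>y\<in>K. \<Sum>x\<in>K. chi (c * (x * x)) * cnj (chi (c * (y * y))))"
    by (rule sum.swap)
  also have "\<dots> = (\<Sum>y\<in>K. \<Sum>h\<in>K. chi (c * ((h + y) * (h + y))) * cnj (chi (c * (y * y))))"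
  proof (rule sum.cong[OF refl])
    fix y assume "y \<in> K"
    from sum.reindex_bij_betw[OF bij_add[OF this], of "\<lambda>x. chi (c * (x * x)) * cnj (chi (c * (y * y)))"]
    show "(\<Sum>x\<in>K. chi (c * (x * x)) * cnj (chi (c * (y * y))))
        = (\<Sum>h\<in>K. chi (c * ((h + y) * (h + y))) * cnj (chi (c * (y * y))))" by simp
  qed
  also have "\<dots> = (\<Sum>y\<in>K. \<Sum>h\<in>K. chi (c * (h * h)) * chi (y * (2 * c * h)))"
  proof (intro sum.cong refl)
    fix y h
    have "chi (c * ((h + y) * (h + y))) * cnj (chi (c * (y * y))) = chi (c * (h * h) + y * (2 * c * h))"
      unfolding chi_diff[symmetric] by (rule arg_cong[of _ _ chi]) (simp add: algebra_simps)
    thus "chi (c * ((h + y) * (h + y))) * cnj (chi (c * (y * y))) = chi (c * (h * h)) * chi (y * (2 * c * h))"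
      by (simp only: chi_add)
  qed
  also have "\<dots> = (\<Sum>h\<in>K. chi (c * (h * h)) * (\<Sum>y\<in>K. chi (y * (2 * c * h))))"
    by (subst sum.swap) (simp add: sum_distrib_left)
  also have "\<dots> = (\<Sum>h\<in>K. if h = 0 then of_nat q else 0)"
  proof (intro sum.cong refl)
    fix h assume h: "h \<in> K"
    have "2 * c * h = 0 \<longleftrightarrow> h = 0"
      using two_mult_eq_0[of "c * h"] c h by (simp add: mult.assoc mult_eq_0_K)
    thus "chi (c * (h * h)) * (\<Sum>y\<in>K. chi (y * (2 * c * h))) = (if h = 0 then of_nat q else 0)"
      using sum_chi_mult[of "2 * c * h"] c h by simp
  qed
  also have "\<dots> = of_real (real q)" by simp
  finally show ?thesis by (simp only: of_real_eq_iff)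
qed

section \<open>Parseval identities\<close>

lemma parseval_K: "(\<Sum>a\<in>K. (cmod (\<Sum>u\<in>K. f u * chi (a * u)))\<^sup>2) = real q * (\<Sum>u\<in>K. (cmod (f u))\<^sup>2)"
proof -
  have "of_real (\<Sum>a\<in>K. (cmod (\<Sum>u\<in>K. f u * chi (a * u)))\<^sup>2)
      = (\<Sum>a\<in>K. \<Sum>u\<in>K. \<Sum>v\<in>K. f u * cnj (f v) * chi (a * (u - v)))"
    unfolding of_real_sum norm_sum_sq
    by (intro sum.cong refl) (simp add: right_diff_distrib chi_diff)
  also have "\<dots> = (\<Sum>u\<in>K. \<Sum>v\<in>K. \<Sum>a\<in>K. f u * cnj (f v) * chi (a * (u - v)))"
    by (subst sum.swap) (intro sum.cong refl sum.swap)
  also have "\<dots> = (\<Sum>u\<in>K. \<Sum>v\<in>K. if v = u then of_nat q * (f u * cnj (f v)) else 0)"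
  proof (intro sum.cong refl)
    fix u v assume "u \<in> K" "v \<in> K"
    thus "(\<Sum>a\<in>K. f u * cnj (f v) * chi (a * (u - v))) = (if v = u then of_nat q * (f u * cnj (f v)) else 0)"
      using sum_chi_mult[of "u - v"] by (simp flip: sum_distrib_left)
  qed
  also have "\<dots> = (\<Sum>u\<in>K. of_nat q * (f u * cnj (f u)))" by simp
  also have "\<dots> = of_real (real q * (\<Sum>u\<in>K. (cmod (f u))\<^sup>2))"
    by (simp add: sum_distrib_left complex_norm_square del: of_real_power)
  finally show ?thesis by (simp only: of_real_eq_iff)
qed

lemma parseval_K2:
  "(\<Sum>a\<in>K. \<Sum>b\<in>K. (cmod (\<Sum>u\<in>K. \<Sum>v\<in>K. F u v * chi (a * u + b * v)))\<^sup>2)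
    = (real q)\<^sup>2 * (\<Sum>u\<in>K. \<Sum>v\<in>K. (cmod (F u v))\<^sup>2)"
proof -
  have "(\<Sum>a\<in>K. \<Sum>b\<in>K. (cmod (\<Sum>u\<in>K. \<Sum>v\<in>K. F u v * chi (a * u + b * v)))\<^sup>2)
      = (\<Sum>a\<in>K. \<Sum>b\<in>K. (cmod (\<Sum>v\<in>K. (\<Sum>u\<in>K. F u v * chi (a * u)) * chi (b * v)))\<^sup>2)"
    by (subst sum.swap) (simp add: chi_add sum_distrib_right mult.assoc)
  also have "\<dots> = real q * (\<Sum>a\<in>K. \<Sum>v\<in>K. (cmod (\<Sum>u\<in>K. F u v * chi (a * u)))\<^sup>2)"
    unfolding parseval_K by (simp add: sum_distrib_left)
  also have "(\<Sum>a\<in>K. \<Sum>v\<in>K. (cmod (\<Sum>u\<in>K. F u v * chi (a * u)))\<^sup>2)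
      = (\<Sum>v\<in>K. real q * (\<Sum>u\<in>K. (cmod (F u v))\<^sup>2))"
    by (subst sum.swap) (simp add: parseval_K)
  also have "\<dots> = real q * (\<Sum>u\<in>K. \<Sum>v\<in>K. (cmod (F u v))\<^sup>2)"
    by (subst sum.swap) (simp add: sum_distrib_left)
  finally show ?thesis by (simp add: power2_eq_square mult.assoc)
qed

lemma sum_chi_group:
  assumes "finite X" "\<And>x. x \<in> X \<Longrightarrow> p x \<in> K" "\<And>x. x \<in> X \<Longrightarrow> w x \<in> K"
  shows "(\<Sum>x\<in>X. g x * chi (a * p x + b * w x))
    = (\<Sum>u\<in>K. \<Sum>v\<in>K. (\<Sum>x\<in>{x \<in> X. p x = u \<and> w x = v}. g x) * chi (a * u + b * v))"
proof -
  have "(\<Sum>u\<in>K. \<Sum>v\<in>K. (\<Sum>x\<in>{x \<in> X. p x = u \<and> w x = v}. g x) * chi (a * u + b * v))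
    = (\<Sum>u\<in>K. \<Sum>v\<in>K. \<Sum>x\<in>{x \<in> X. (p x, w x) = (u, v)}. g x * chi (a * p x + b * w x))"
    by (intro sum.cong refl) (auto simp: sum_distrib_right intro!: sum.cong)
  also have "\<dots> = (\<Sum>y\<in>K \<times> K. \<Sum>x\<in>{x \<in> X. (p x, w x) = y}. g x * chi (a * p x + b * w x))"
    unfolding sum.cartesian_product by (rule sum.cong) auto
  also have "\<dots> = (\<Sum>x\<in>X. g x * chi (a * p x + b * w x))"
    by (rule sum.group) (use assms in auto)
  finally show ?thesis by simp
qed

end

lemma sum_comp_le:
  fixes f :: "'b \<Rightarrow> real"
  assumes "finite D" "finite E" "\<phi> ` D \<subseteq> E" "\<And>y. y \<in> E \<Longrightarrow> f y \<ge> 0"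
    and "\<And>y. y \<in> E \<Longrightarrow> card {x \<in> D. \<phi> x = y} \<le> m"
  shows "(\<Sum>x\<in>D. f (\<phi> x)) \<le> real m * (\<Sum>y\<in>E. f y)"
proof -
  have "(\<Sum>x\<in>D. f (\<phi> x)) = (\<Sum>y\<in>E. \<Sum>x\<in>{x \<in> D. \<phi> x = y}. f (\<phi> x))"
    by (rule sum.group[symmetric]) (use assms in auto)
  also have "\<dots> = (\<Sum>y\<in>E. real (card {x \<in> D. \<phi> x = y}) * f y)"
    by (intro sum.cong refl) simp
  also have "\<dots> \<le> (\<Sum>y\<in>E. real m * f y)"
    using assms by (intro sum_mono mult_right_mono) auto
  finally show ?thesis by (simp add: sum_distrib_left)
qed

context finite_field_ideal begin

section \<open>Roots of polynomials\<close>

text \<open>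
  Polynomials over \<open>K\<close> are represented by their coefficient functions, since \<open>K\<close> is not a type.
  Dividing by \<open>x - a\<close> leaves a polynomial with the same leading coefficient, which is what the
  induction in the bound for the number of roots needs.
\<close>

lemma poly_factor:
  assumes "a \<in> K" "\<forall>i\<le>Suc n. c i \<in> K"
  shows "\<exists>d. (\<forall>j\<le>n. d j \<in> K) \<and> d n = c (Suc n) \<and>
     (\<forall>x\<in>K. (\<Sum>i\<le>Suc n. c i * x ^ i) - (\<Sum>i\<le>Suc n. c i * a ^ i) = (x - a) * (\<Sum>j\<le>n. d j * x ^ j))"
  using assms(2)
proof (induction n arbitrary: c)
  case 0
  thus ?case by (intro exI[of _ "\<lambda>_. c 1"]) (auto simp: algebra_simps)
next
  case (Suc n)
  let ?c = "\<lambda>i. c (Suc i)"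
  obtain d where d: "\<forall>j\<le>n. d j \<in> K" "d n = ?c (Suc n)"
    "\<forall>x\<in>K. (\<Sum>i\<le>Suc n. ?c i * x ^ i) - (\<Sum>i\<le>Suc n. ?c i * a ^ i) = (x - a) * (\<Sum>j\<le>n. d j * x ^ j)"
    using Suc.IH[of ?c] Suc.prems by auto
  define P where "P x = (\<Sum>i\<le>Suc n. ?c i * x ^ i)" for x
  define d' where "d' j = (case j of 0 \<Rightarrow> P a | Suc i \<Rightarrow> d i)" for j
  have P: "(\<Sum>i\<le>Suc (Suc n). c i * x ^ i) = c 0 + x * P x" for x
    by (subst sum.atMost_Suc_shift) (simp add: P_def sum_distrib_left ac_simps del: sum.atMost_Suc)
  have D: "(\<Sum>j\<le>Suc n. d' j * x ^ j) = P a + x * (\<Sum>j\<le>n. d j * x ^ j)" for x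
    by (subst sum.atMost_Suc_shift) (simp add: d'_def sum_distrib_left ac_simps del: sum.atMost_Suc)
  have PK: "P a \<in> K" unfolding P_def by (intro sum_K mult_K) (use Suc.prems in simp)
  show ?case
  proof (intro exI[of _ d'] conjI ballI)
    show "\<forall>j\<le>Suc n. d' j \<in> K" using d(1) PK by (auto simp: d'_def split: nat.split)
    show "d' (Suc n) = c (Suc (Suc n))" using d(2) by (simp add: d'_def)
    fix x assume "x \<in> K"
    with d(3) have *: "P x - P a = (x - a) * (\<Sum>j\<le>n. d j * x ^ j)" by (simp add: P_def)
    have "c 0 + x * P x - (c 0 + a * P a) = (x - a) * P a + x * (P x - P a)" by (simp add: algebra_simps)
    thus "(\<Sum>i\<le>Suc (Suc n). c i * x ^ i) - (\<Sum>i\<le>Suc (Suc n). c i * a ^ i)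
        = (x - a) * (\<Sum>j\<le>Suc n. d' j * x ^ j)"
      unfolding P D * by (simp add: algebra_simps)
  qed
qed

lemma card_roots:
  assumes "\<forall>i\<le>n. c i \<in> K" "c n \<noteq> 0"
  shows "card {x \<in> K. (\<Sum>i\<le>n. c i * x ^ i) = 0} \<le> n"
  using assms
proof (induction n arbitrary: c)
  case (Suc n)
  show ?case
  proof (cases "\<exists>a\<in>K. (\<Sum>i\<le>Suc n. c i * a ^ i) = 0")
    case True
    then obtain a where a: "a \<in> K" "(\<Sum>i\<le>Suc n. c i * a ^ i) = 0" by blast
    obtain d where d: "\<forall>j\<le>n. d j \<in> K" "d n = c (Suc n)"
      "\<forall>x\<in>K. (\<Sum>i\<le>Suc n. c i * x ^ i) = (x - a) * (\<Sum>j\<le>n. d j * x ^ j)"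
      using poly_factor[OF a(1) Suc.prems(1)] unfolding a(2) diff_zero by blast
    have "{x \<in> K. (\<Sum>i\<le>Suc n. c i * x ^ i) = 0} \<subseteq> insert a {x \<in> K. (\<Sum>j\<le>n. d j * x ^ j) = 0}"
    proof
      fix x assume "x \<in> {x \<in> K. (\<Sum>i\<le>Suc n. c i * x ^ i) = 0}"
      hence x: "x \<in> K" "(x - a) * (\<Sum>j\<le>n. d j * x ^ j) = 0" using d(3) by auto
      moreover have "(\<Sum>j\<le>n. d j * x ^ j) \<in> K" by (intro sum_K mult_K) (use d(1) in simp)
      ultimately show "x \<in> insert a {x \<in> K. (\<Sum>j\<le>n. d j * x ^ j) = 0}"
        using mult_eq_0_K[of "x - a" "\<Sum>j\<le>n. d j * x ^ j"] a by auto
    qed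
    hence "card {x \<in> K. (\<Sum>i\<le>Suc n. c i * x ^ i) = 0} \<le> card (insert a {x \<in> K. (\<Sum>j\<le>n. d j * x ^ j) = 0})"
      by (intro card_mono) auto
    also have "\<dots> \<le> Suc n"
      using Suc.IH[of d] d Suc.prems by (simp add: card_insert_le_m1 card.insert_remove le_SucI)
         (meson card_Diff1_le le_trans)
    finally show ?thesis .
  next
    case False
    hence "{x \<in> K. (\<Sum>i\<le>Suc n. c i * x ^ i) = 0} = {}" by blast
    thus ?thesis by (simp only: card.empty)
  qed
qed auto

section \<open>The fourth moment of twisted Kloosterman sums\<close>

definition unit_character :: "('r \<Rightarrow> complex) \<Rightarrow> bool" where
  "unit_character \<epsilon> \<longleftrightarrow> (\<forall>x\<in>K - {0}. \<forall>y\<in>K - {0}. \<epsilon> (x * y) = \<epsilon> x * \<epsilon> y) \<and> (\<forall>x\<in>K - {0}. cmod (\<epsilon> x) = 1)"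

definition kloosterman :: "('r \<Rightarrow> complex) \<Rightarrow> 'r \<Rightarrow> 'r \<Rightarrow> complex" where
  "kloosterman \<epsilon> a b = (\<Sum>x\<in>K - {0}. \<epsilon> x * chi (a * x + b * kinv x))"

lemma unit_character_1: "unit_character (\<lambda>_. 1)"
  by (simp add: unit_character_def)

lemma unit_character_eta_power: "unit_character (\<lambda>x. of_real (eta x) ^ n)"
proof -
  have "cmod (of_real (eta x)) = 1" if "x \<noteq> 0" for x using that by (simp add: eta_def)
  thus ?thesis by (auto simp: unit_character_def eta_mult power_mult_distrib norm_power)
qed

text \<open>
  Substitute \<open>c x\<close> for \<open>x\<close>.
\<close>

lemma kloosterman_scale:
  assumes \<epsilon>: "unit_character \<epsilon>" and c: "c \<in> K" "c \<noteq> 0" and ab: "a \<in> K" "b \<in> K"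
  shows "cmod (kloosterman \<epsilon> (a * c) (b * kinv c)) = cmod (kloosterman \<epsilon> a b)"
proof -
  have "kloosterman \<epsilon> a b = (\<Sum>x\<in>K - {0}. \<epsilon> (c * x) * chi (a * (c * x) + b * kinv (c * x)))"
    unfolding kloosterman_def by (rule sum.reindex_bij_betw[OF bij_mult_units[OF c], symmetric])
  also have "\<dots> = (\<Sum>x\<in>K - {0}. \<epsilon> c * (\<epsilon> x * chi (a * c * x + b * kinv c * kinv x)))"
    using \<epsilon> c by (intro sum.cong refl) (auto simp: unit_character_def kinv_mult mult.assoc)
  also have "\<dots> = \<epsilon> c * kloosterman \<epsilon> (a * c) (b * kinv c)"
    unfolding kloosterman_def by (simp add: sum_distrib_left)
  finally show ?thesis using \<epsilon> c by (simp add: norm_mult unit_character_def)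
qed

text \<open>
  The modulus is constant on the orbit of \<open>(a, b)\<close> under \<open>(a c, b / c)\<close>, and the orbit has
  \<open>q - 1\<close> elements. So a bound for a moment over all parameters gives a bound for every single
  sum that is better by the factor \<open>q - 1\<close>.
\<close>

lemma kloosterman_orbit:
  assumes \<epsilon>: "unit_character \<epsilon>" and ab: "a \<in> K" "b \<in> K" "(a, b) \<noteq> (0, 0)"
  shows "real (q - 1) * cmod (kloosterman \<epsilon> a b) ^ n
    \<le> (\<Sum>(a,b)\<in>K \<times> K - {(0,0)}. cmod (kloosterman \<epsilon> a b) ^ n)"
proof -
  let ?f = "\<lambda>c. (a * c, b * kinv c)"
  have inj: "inj_on ?f (K - {0})"
  proof (rule inj_onI)
    fix c c' assume c: "c \<in> K - {0}" "c' \<in> K - {0}" and eq: "?f c = ?f c'"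
    show "c = c'"
    proof (cases "a = 0")
      case True
      hence "kinv c = kinv c'" using ab eq c mult_left_cancel_K[of b "kinv c" "kinv c'"] by auto
      thus ?thesis using c kinv_kinv by (metis DiffD1)
    next
      case False
      thus ?thesis using ab eq c mult_left_cancel_K[of a c c'] by auto
    qed
  qed
  have "real (q - 1) * cmod (kloosterman \<epsilon> a b) ^ n
      = (\<Sum>c\<in>K - {0}. cmod (kloosterman \<epsilon> (a * c) (b * kinv c)) ^ n)"
    using kloosterman_scale[OF \<epsilon> _ _ ab(1,2)] by (simp add: q_def)
  also have "\<dots> = (\<Sum>(a,b)\<in>?f ` (K - {0}). cmod (kloosterman \<epsilon> a b) ^ n)"
    by (simp add: sum.reindex[OF inj] case_prod_beta)
  also have "\<dots> \<le> (\<Sum>(a,b)\<in>K \<times> K - {(0,0)}. cmod (kloosterman \<epsilon> a b) ^ n)"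
    using ab by (intro sum_mono2) (auto simp: mult_eq_0_K)
  finally show ?thesis .
qed

text \<open>
  The number of ways in which the frequency \<open>(u, v)\<close> arises when the Kloosterman sum is squared.
\<close>

definition pair_count :: "'r \<Rightarrow> 'r \<Rightarrow> nat" where
  "pair_count u v = card {(x, y) \<in> (K - {0}) \<times> (K - {0}). x + y = u \<and> kinv x + kinv y = v}"

lemma kinv_minus: "x \<in> K \<Longrightarrow> kinv (- x) = - kinv x"
  by (cases "x = 0") (auto simp: kinv_def[of 0] intro!: kinv_unique)

lemma kinv_add: "x \<in> K \<Longrightarrow> y \<in> K \<Longrightarrow> x \<noteq> 0 \<Longrightarrow> y \<noteq> 0 \<Longrightarrow> (kinv x + kinv y) * (x * y) = x + y"
proof -
  assume *: "x \<in> K" "y \<in> K" "x \<noteq> 0" "y \<noteq> 0"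
  have "(kinv x + kinv y) * (x * y) = kinv x * (x * y) + kinv y * (x * y)" by (rule distrib_right)
  also have "\<dots> = x + y" using * by simp
  finally show ?thesis .
qed

lemma pair_count_zero: "pair_count 0 0 = q - 1"
proof -
  have "{(x, y) \<in> (K - {0}) \<times> (K - {0}). x + y = 0 \<and> kinv x + kinv y = 0} = (\<lambda>x. (x, - x)) ` (K - {0})"
  proof (intro equalityI subsetI)
    fix p assume "p \<in> {(x, y) \<in> (K - {0}) \<times> (K - {0}). x + y = 0 \<and> kinv x + kinv y = 0}"
    then obtain x y where p: "p = (x, y)" "x \<in> K - {0}" "x + y = 0" by blast
    have "y = - x" using p(3) by (rule minus_unique[symmetric])
    thus "p \<in> (\<lambda>x. (x, - x)) ` (K - {0})" using p by blast
  qed (auto simp: kinv_minus)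
  moreover have "inj_on (\<lambda>x. (x, - x)) (K - {0})" by (rule inj_onI) auto
  ultimately show ?thesis unfolding pair_count_def by (simp add: card_image q_def)
qed

lemma pair_count_degenerate:
  assumes "(u = 0) \<noteq> (v = 0)" shows "pair_count u v = 0"
proof -
  have "{(x, y) \<in> (K - {0}) \<times> (K - {0}). x + y = u \<and> kinv x + kinv y = v} = {}"
  proof (rule ccontr)
    assume "\<not> ?thesis"
    then obtain x y where xy: "x \<in> K" "y \<in> K" "x \<noteq> 0" "y \<noteq> 0" "x + y = u" "kinv x + kinv y = v" by blast
    have "v * (x * y) = u" using kinv_add[OF xy(1-4)] xy(5,6) by simp
    moreover have "v \<in> K" using xy by auto
    ultimately have "u = 0 \<longleftrightarrow> v = 0" using xy(1-4) mult_eq_0_K[of v "x * y"] mult_eq_0_K[of x y] by auto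
    thus False using assms by blast
  qed
  thus ?thesis unfolding pair_count_def by (simp only: card.empty)
qed

text \<open>
  The sum \<open>u\<close> and the product \<open>u / v\<close> of \<open>x\<close> and \<open>y\<close> are known, so \<open>x\<close> and \<open>y\<close> are the two roots
  of a quadratic with discriminant \<open>u^2 - 4 u / v\<close>, which differs from \<open>u v (u v - 4)\<close> by the
  square \<open>v^2\<close>.
\<close>

lemma pair_count_eta:
  assumes u: "u \<in> K" "u \<noteq> 0" and v: "v \<in> K" "v \<noteq> 0"
  shows "real (pair_count u v) = 1 + eta ((u * v) * (u * v - 4 * e))"
proof -
  define D where "D = u * u - 4 * (u * kinv v)"
  define h where "h = kinv (2 * e)"
  have h: "h \<in> K" "2 * h = e"
  proof -
    show "h \<in> K" by (simp add: h_def)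
    have "2 * e \<noteq> 0" using two_mult_eq_0[of e] by simp
    hence "(2 * e) * h = e" unfolding h_def by (intro kinv_right) auto
    thus "2 * h = e" using \<open>h \<in> K\<close> by (simp add: mult.assoc)
  qed
  have DK: "D \<in> K" using u v by (simp add: D_def)
  have half: "h * (2 * x) = x" "2 * (h * x) = x" if "x \<in> K" for x
    using h that by (metis mult.assoc mult.left_commute e_mult)+
  have "{(x, y) \<in> (K - {0}) \<times> (K - {0}). x + y = u \<and> kinv x + kinv y = v}
      = (\<lambda>z. (h * (u + z), h * (u - z))) ` {z \<in> K. z * z = D}"
  proof (intro equalityI subsetI)
    fix p assume "p \<in> {(x, y) \<in> (K - {0}) \<times> (K - {0}). x + y = u \<and> kinv x + kinv y = v}"
    then obtain x y where p: "p = (x, y)" "x \<in> K" "y \<in> K" "x \<noteq> 0" "y \<noteq> 0" "x + y = u" "kinv x + kinv y = v"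
      by blast
    have "v * (x * y) = u" using kinv_add[of x y] p by simp
    hence "kinv v * u = x * y" using kinv_cancel(2)[of v "x * y"] v p by simp
    hence xy: "u * kinv v = x * y" by (simp add: mult.commute)
    have "(x - y) * (x - y) = D" unfolding D_def xy using p(6)[symmetric] by (simp add: algebra_simps)
    moreover have eq: "u + (x - y) = 2 * x" "u - (x - y) = 2 * y" using p(6)[symmetric] by simp_all
    have "h * (u + (x - y)) = x" "h * (u - (x - y)) = y"
      by (simp_all only: eq half(1)[OF p(2)] half(1)[OF p(3)])
    ultimately show "p \<in> (\<lambda>z. (h * (u + z), h * (u - z))) ` {z \<in> K. z * z = D}"
      using p(1-3) by (intro image_eqI[of _ _ "x - y"]) simp_all
  next
    fix p assume "p \<in> (\<lambda>z. (h * (u + z), h * (u - z))) ` {z \<in> K. z * z = D}"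
    then obtain z where z: "z \<in> K" "z * z = D" "p = (h * (u + z), h * (u - z))" by blast
    define x y where "x = h * (u + z)" and "y = h * (u - z)"
    have xyK: "x \<in> K" "y \<in> K" using h by (auto simp: x_def y_def)
    have "2 * x = u + z" "2 * y = u - z" unfolding x_def y_def using half u z by auto
    have sum: "x + y = u"
    proof -
      have "x + y = h * (2 * u)" unfolding x_def y_def by (simp add: algebra_simps)
      thus ?thesis using half u by simp
    qed
    have "4 * (x * y) = (2 * x) * (2 * y)" by (simp add: algebra_simps)
    also have "\<dots> = u * u - D" unfolding \<open>2 * x = u + z\<close> \<open>2 * y = u - z\<close> z(2)[symmetric]
      by (simp add: algebra_simps)
    also have "\<dots> = 4 * (u * kinv v)" by (simp add: D_def)
    finally have "4 * (x * y - u * kinv v) = 0" by (simp add: right_diff_distrib)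
    hence prod: "x * y = u * kinv v" using four_mult_eq_0[of "x * y - u * kinv v"] xyK u v by simp
    hence "x * y \<noteq> 0" using u v by (simp add: mult_eq_0_K)
    hence nz: "x \<noteq> 0" "y \<noteq> 0" by auto
    have "(kinv x + kinv y) * (x * y) = u" using kinv_add[OF xyK nz] sum by simp
    moreover have "v * (x * y) = u" unfolding prod using u v by simp
    ultimately have "kinv x + kinv y = v"
      using mult_left_cancel_K[of "x * y" "kinv x + kinv y" v] \<open>x * y \<noteq> 0\<close> xyK v by (simp add: mult.commute)
    thus "p \<in> {(x, y) \<in> (K - {0}) \<times> (K - {0}). x + y = u \<and> kinv x + kinv y = v}"
      using xyK nz sum z by (simp add: x_def y_def)
  qed
  moreover have "inj_on (\<lambda>z. (h * (u + z), h * (u - z))) {z \<in> K. z * z = D}"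
  proof (rule inj_onI)
    fix z z' assume z: "z \<in> {z \<in> K. z * z = D}" "z' \<in> {z \<in> K. z * z = D}"
      and "(h * (u + z), h * (u - z)) = (h * (u + z'), h * (u - z'))"
    hence "2 * (h * (u + z)) = 2 * (h * (u + z'))" by simp
    thus "z = z'" using half(2)[of "u + z"] half(2)[of "u + z'"] z u by simp
  qed
  ultimately have "real (pair_count u v) = 1 + eta D"
    unfolding pair_count_def using card_square_roots[OF DK] by (simp add: card_image)
  also have "eta D = eta (v * v * D)" using eta_mult_square[OF v DK] by simp
  also have "v * v * D = (u * v) * (u * v - 4 * e)"
  proof -
    have "v * v * D = u * u * v * v - 4 * (u * (v * (v * kinv v)))" unfolding D_def by (simp add: algebra_simps)
    also have "\<dots> = (u * v) * (u * v) - 4 * (u * v)" using u v by (simp add: ac_simps)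
    also have "\<dots> = (u * v) * (u * v - 4 * e)" using u v by (simp add: right_diff_distrib mult.left_commute[of _ 4])
    finally show ?thesis .
  qed
  finally show ?thesis .
qed

lemma pair_count_le: "u \<in> K \<Longrightarrow> v \<in> K \<Longrightarrow> (u, v) \<noteq> (0, 0) \<Longrightarrow> pair_count u v \<le> 2"
proof (cases "u = 0 \<or> v = 0")
  case False
  assume "u \<in> K" "v \<in> K"
  hence "real (pair_count u v) \<le> 2"
    using pair_count_eta[of u v] False eta_bounds(2)[of "(u * v) * (u * v - 4 * e)"] by simp
  thus ?thesis by linarith
qed (use pair_count_degenerate[of u v] in auto)

text \<open>
  By Parseval the fourth moment over all \<open>(a, b)\<close> is \<open>q^2\<close> times a sum of squared
  multiplicities. A frequency \<open>(u, v)\<close> other than zero has multiplicity at most 2, and the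
  frequency zero has multiplicity \<open>q - 1\<close>, so the moment is at most \<open>5 q^4\<close>. One orbit is a
  fraction \<open>1 / (q - 1)\<close> of it.
\<close>

lemma kloosterman_bound_4:
  assumes \<epsilon>: "unit_character \<epsilon>" and ab: "a \<in> K" "b \<in> K" "(a, b) \<noteq> (0, 0)"
  shows "cmod (kloosterman \<epsilon> a b) ^ 4 \<le> 10 * real q ^ 3"
proof -
  let ?X = "(K - {0}) \<times> (K - {0})"
  define F where "F u v = (\<Sum>z\<in>{z \<in> ?X. fst z + snd z = u \<and> kinv (fst z) + kinv (snd z) = v}.
    \<epsilon> (fst z) * \<epsilon> (snd z))" for u v
  have sq: "(kloosterman \<epsilon> a b)\<^sup>2 = (\<Sum>u\<in>K. \<Sum>v\<in>K. F u v * chi (a * u + b * v))" for a b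
  proof -
    have "(kloosterman \<epsilon> a b)\<^sup>2 = (\<Sum>z\<in>?X. (\<epsilon> (fst z) * \<epsilon> (snd z)) *
        chi (a * (fst z + snd z) + b * (kinv (fst z) + kinv (snd z))))"
      unfolding power2_eq_square kloosterman_def sum_product sum.cartesian_product
      by (intro sum.cong refl) (auto simp: chi_add algebra_simps)
    also have "\<dots> = (\<Sum>u\<in>K. \<Sum>v\<in>K. (\<Sum>z\<in>{z \<in> ?X. fst z + snd z = u \<and> kinv (fst z) + kinv (snd z) = v}.
        \<epsilon> (fst z) * \<epsilon> (snd z)) * chi (a * u + b * v))"
      by (rule sum_chi_group) auto
    finally show ?thesis unfolding F_def .
  qed
  have norm_\<epsilon>: "cmod (\<epsilon> x) = 1" if "x \<in> K" "x \<noteq> 0" for x using \<epsilon> that by (simp add: unit_character_def)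
  have F: "cmod (F u v) \<le> real (pair_count u v)" for u v
  proof -
    have "cmod (F u v) \<le> (\<Sum>z\<in>{z \<in> ?X. fst z + snd z = u \<and> kinv (fst z) + kinv (snd z) = v}. 1)"
      unfolding F_def
    proof (rule sum_norm_le)
      fix z assume "z \<in> {z \<in> ?X. fst z + snd z = u \<and> kinv (fst z) + kinv (snd z) = v}"
      hence "fst z \<in> K" "fst z \<noteq> 0" "snd z \<in> K" "snd z \<noteq> 0" by auto
      thus "cmod (\<epsilon> (fst z) * \<epsilon> (snd z)) \<le> 1" by (simp add: norm_mult norm_\<epsilon>)
    qed
    moreover have "{z \<in> ?X. fst z + snd z = u \<and> kinv (fst z) + kinv (snd z) = v}
      = {(x, y) \<in> ?X. x + y = u \<and> kinv x + kinv y = v}" by auto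
    ultimately show ?thesis unfolding pair_count_def by simp
  qed
  have sq_le: "(real (pair_count u v))\<^sup>2 \<le> 4 + (if u = 0 \<and> v = 0 then (real q)\<^sup>2 else 0)"
    if "u \<in> K" "v \<in> K" for u v
  proof (cases "u = 0 \<and> v = 0")
    case True
    have "(real (q - 1))\<^sup>2 \<le> (real q)\<^sup>2" by (intro power_mono) auto
    hence "(real (pair_count 0 0))\<^sup>2 \<le> 4 + (real q)\<^sup>2" unfolding pair_count_zero by linarith
    thus ?thesis using True by simp
  next
    case False
    hence "real (pair_count u v) \<le> 2" using pair_count_le[OF that] by auto
    hence "(real (pair_count u v))\<^sup>2 \<le> 2\<^sup>2" by (intro power_mono) auto
    thus ?thesis using False by auto
  qed
  have F2: "(cmod (F u v))\<^sup>2 \<le> 4 + (if u = 0 \<and> v = 0 then (real q)\<^sup>2 else 0)"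
    if "u \<in> K" "v \<in> K" for u v
    by (rule order_trans[OF power_mono[OF F norm_ge_zero] sq_le[OF that]])
  have "(\<Sum>(a,b)\<in>K \<times> K - {(0,0)}. cmod (kloosterman \<epsilon> a b) ^ 4)
      \<le> (\<Sum>(a,b)\<in>K \<times> K. cmod (kloosterman \<epsilon> a b) ^ 4)" by (intro sum_mono2) auto
  also have "\<dots> = (\<Sum>a\<in>K. \<Sum>b\<in>K. (cmod ((kloosterman \<epsilon> a b)\<^sup>2))\<^sup>2)"
    by (simp add: sum.cartesian_product norm_power flip: power_mult)
  also have "\<dots> = (real q)\<^sup>2 * (\<Sum>u\<in>K. \<Sum>v\<in>K. (cmod (F u v))\<^sup>2)" unfolding sq by (rule parseval_K2)
  also have "\<dots> \<le> (real q)\<^sup>2 * (\<Sum>u\<in>K. \<Sum>v\<in>K. 4 + (if u = 0 \<and> v = 0 then (real q)\<^sup>2 else 0))"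
    by (intro mult_left_mono sum_mono F2) auto
  also have "(\<Sum>u\<in>K. \<Sum>v\<in>K. 4 + (if u = 0 \<and> v = 0 then (real q)\<^sup>2 else 0)) = 5 * (real q)\<^sup>2"
  proof -
    have "(\<Sum>v\<in>K. 4 + (if u = 0 \<and> v = 0 then (real q)\<^sup>2 else 0)) = 4 * real q + (if u = 0 then (real q)\<^sup>2 else 0)" for u
      by (cases "u = 0") (simp_all add: sum.distrib q_def)
    hence "(\<Sum>u\<in>K. \<Sum>v\<in>K. 4 + (if u = 0 \<and> v = 0 then (real q)\<^sup>2 else 0))
        = (\<Sum>u\<in>K. 4 * real q + (if u = 0 then (real q)\<^sup>2 else 0))" by (intro sum.cong refl)
    also have "\<dots> = 5 * (real q)\<^sup>2" by (simp add: sum.distrib power2_eq_square q_def)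
    finally show ?thesis .
  qed
  finally have "(\<Sum>(a,b)\<in>K \<times> K - {(0,0)}. cmod (kloosterman \<epsilon> a b) ^ 4) \<le> 5 * real q ^ 4"
    by (simp add: power4_eq_xxxx power2_eq_square)
  hence "real (q - 1) * cmod (kloosterman \<epsilon> a b) ^ 4 \<le> 5 * real q ^ 4"
    using kloosterman_orbit[OF \<epsilon> ab, of 4] by linarith
  moreover have "real q / 2 * cmod (kloosterman \<epsilon> a b) ^ 4 \<le> real (q - 1) * cmod (kloosterman \<epsilon> a b) ^ 4"
    using q_ge_3 by (intro mult_right_mono) (auto simp: of_nat_diff)
  ultimately have "real q * cmod (kloosterman \<epsilon> a b) ^ 4 \<le> 10 * real q ^ 4" by linarith
  also have "10 * real q ^ 4 = real q * (10 * real q ^ 3)" by (simp add: eval_nat_numeral)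
  finally have "real q * cmod (kloosterman \<epsilon> a b) ^ 4 \<le> real q * (10 * real q ^ 3)" .
  thus ?thesis by (simp only: mult_le_cancel_left_pos q_pos)
qed

end

context finite_field_ideal begin

lemma e_mult3 [simp]: "x \<in> K \<Longrightarrow> x * (e * y) = x * y"
  by (simp flip: mult.assoc)

section \<open>Cubic character sums on average\<close>

text \<open>
  The deviation from \<open>q\<close> of the number of affine points on the curve \<open>y^2 = x (x^2 + a x + b)\<close>.
\<close>

definition cubic_sum :: "'r \<Rightarrow> 'r \<Rightarrow> real" where
  "cubic_sum a b = (\<Sum>x\<in>K. eta (x * (x * x + a * x + b)))"

lemma cubic_sum_scale:
  assumes c: "c \<in> K" "c \<noteq> 0" and ab: "a \<in> K" "b \<in> K"
  shows "cubic_sum (c * a) (c * c * b) = eta c * cubic_sum a b"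
proof -
  have "cubic_sum (c * a) (c * c * b) = (\<Sum>x\<in>K. eta ((c * x) * ((c * x) * (c * x) + c * a * (c * x) + c * c * b)))"
    unfolding cubic_sum_def by (rule sum.reindex_bij_betw[OF bij_mult[OF c], symmetric])
  also have "\<dots> = (\<Sum>x\<in>K. eta c * eta (x * (x * x + a * x + b)))"
  proof (intro sum.cong refl)
    fix x assume x: "x \<in> K"
    have "(c * x) * ((c * x) * (c * x) + c * a * (c * x) + c * c * b)
        = (c * c) * (c * (x * (x * x + a * x + b)))"
      by (simp add: algebra_simps)
    also have "eta \<dots> = eta (c * (x * (x * x + a * x + b)))"
      using c x ab by (intro eta_mult_square) auto
    also have "\<dots> = eta c * eta (x * (x * x + a * x + b))"
      using c x ab by (intro eta_mult) auto
    finally show "eta ((c * x) * ((c * x) * (c * x) + c * a * (c * x) + c * c * b))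
        = eta c * eta (x * (x * x + a * x + b))" .
  qed
  finally show ?thesis by (simp add: cubic_sum_def sum_distrib_left)
qed

text \<open>
  For \<open>x \<noteq> y\<close> the pair of values \<open>(x^2 + a x + b, y^2 + a y + b)\<close> runs through \<open>K \<times> K\<close> exactly
  once as \<open>(a, b)\<close> does, so the double sum is a product of two complete sums of \<open>eta\<close>.
\<close>

lemma sum_eta_pair:
  assumes x: "x \<in> K" and y: "y \<in> K" and ne: "x \<noteq> y"
  shows "(\<Sum>a\<in>K. \<Sum>b\<in>K. eta (x * x + a * x + b) * eta (y * y + a * y + b)) = 0"
proof -
  have "(\<Sum>a\<in>K. \<Sum>b\<in>K. eta (x * x + a * x + b) * eta (y * y + a * y + b))
      = (\<Sum>a\<in>K. \<Sum>b\<in>K. eta b * eta ((y - x) * a + (y * y - x * x + b)))"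
  proof (rule sum.cong[OF refl])
    fix a assume a: "a \<in> K"
    have shift: "- (x * x + a * x) \<in> K" using x a by auto
    have "(\<Sum>b\<in>K. eta (x * x + a * x + b) * eta (y * y + a * y + b))
        = (\<Sum>b\<in>K. eta (x * x + a * x + (b + - (x * x + a * x))) * eta (y * y + a * y + (b + - (x * x + a * x))))"
      by (rule sum.reindex_bij_betw[OF bij_add[OF shift], symmetric])
    also have "\<dots> = (\<Sum>b\<in>K. eta b * eta ((y - x) * a + (y * y - x * x + b)))"
      by (intro sum.cong refl arg_cong2[of _ _ _ _ "(*)"] arg_cong[of _ _ eta]) (simp_all add: algebra_simps)
    finally show "(\<Sum>b\<in>K. eta (x * x + a * x + b) * eta (y * y + a * y + b))
        = (\<Sum>b\<in>K. eta b * eta ((y - x) * a + (y * y - x * x + b)))" .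
  qed
  also have "\<dots> = (\<Sum>b\<in>K. eta b * (\<Sum>a\<in>K. eta ((y - x) * a + (y * y - x * x + b))))"
    by (subst sum.swap) (simp add: sum_distrib_left)
  also have "\<dots> = 0"
    using x y ne by (intro sum.neutral ballI) (subst sum_eta_affine, auto)
  finally show ?thesis .
qed

text \<open>
  Only the diagonal of the squared sum survives. On average over \<open>(a, b)\<close> the cubic sum thus has
  the size that the Hasse bound gives for each of them; the average is enough for the sixth
  moment.
\<close>

lemma sum_cubic_sum_sq: "(\<Sum>a\<in>K. \<Sum>b\<in>K. (cubic_sum a b)\<^sup>2) \<le> real q ^ 3"
proof -
  have "(\<Sum>a\<in>K. \<Sum>b\<in>K. (cubic_sum a b)\<^sup>2)
      = (\<Sum>a\<in>K. \<Sum>b\<in>K. \<Sum>x\<in>K. \<Sum>y\<in>K. (eta x * eta y) * (eta (x * x + a * x + b) * eta (y * y + a * y + b)))"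
    unfolding cubic_sum_def power2_eq_square sum_product
    by (intro sum.cong refl) (simp add: eta_mult mult_ac)
  also have "\<dots> = (\<Sum>a\<in>K. \<Sum>x\<in>K. \<Sum>b\<in>K. \<Sum>y\<in>K. (eta x * eta y) * (eta (x * x + a * x + b) * eta (y * y + a * y + b)))"
    by (intro sum.cong refl sum.swap)
  also have "\<dots> = (\<Sum>x\<in>K. \<Sum>a\<in>K. \<Sum>y\<in>K. \<Sum>b\<in>K. (eta x * eta y) * (eta (x * x + a * x + b) * eta (y * y + a * y + b)))"
    by (subst sum.swap) (intro sum.cong refl sum.swap)
  also have "\<dots> = (\<Sum>x\<in>K. \<Sum>y\<in>K. \<Sum>a\<in>K. \<Sum>b\<in>K. (eta x * eta y) * (eta (x * x + a * x + b) * eta (y * y + a * y + b)))"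
    by (intro sum.cong refl sum.swap)
  also have "\<dots> = (\<Sum>x\<in>K. \<Sum>y\<in>K. (eta x * eta y) * (\<Sum>a\<in>K. \<Sum>b\<in>K. eta (x * x + a * x + b) * eta (y * y + a * y + b)))"
    by (simp add: sum_distrib_left)
  also have "\<dots> \<le> (\<Sum>x\<in>K. \<Sum>y\<in>K. if y = x then (real q)\<^sup>2 else 0)"
  proof (intro sum_mono)
    fix x y assume xy: "x \<in> K" "y \<in> K"
    show "(eta x * eta y) * (\<Sum>a\<in>K. \<Sum>b\<in>K. eta (x * x + a * x + b) * eta (y * y + a * y + b))
        \<le> (if y = x then (real q)\<^sup>2 else 0)"
    proof (cases "y = x")
      case True
      have "\<bar>(eta x * eta y) * (\<Sum>a\<in>K. \<Sum>b\<in>K. eta (x * x + a * x + b) * eta (y * y + a * y + b))\<bar>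
          \<le> 1 * (\<Sum>a\<in>K. \<Sum>b\<in>K. 1)"
        unfolding abs_mult
        by (intro mult_mono order_trans[OF sum_abs] sum_mono)
           (auto simp: eta_bounds abs_mult intro!: mult_le_one sum_nonneg)
      thus ?thesis using True by (simp add: q_def power2_eq_square)
    next
      case False
      thus ?thesis using sum_eta_pair[OF xy] by auto
    qed
  qed
  also have "\<dots> = real q ^ 3" by (simp add: q_def power2_eq_square power3_eq_cube)
  finally show ?thesis .
qed

text \<open>
  The number of ways in which the frequency \<open>(u, v)\<close> arises when the Kloosterman sum is cubed.
\<close>

definition triple_count :: "'r \<Rightarrow> 'r \<Rightarrow> nat" where
  "triple_count u v = card {(x, y, z) \<in> (K - {0}) \<times> (K - {0}) \<times> (K - {0}).
     x + y + z = u \<and> kinv x + kinv y + kinv z = v}"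

lemma triple_count_eq: "triple_count u v = (\<Sum>x\<in>K - {0}. pair_count (u - x) (v - kinv x))"
proof -
  have "{(x, y, z) \<in> (K - {0}) \<times> (K - {0}) \<times> (K - {0}). x + y + z = u \<and> kinv x + kinv y + kinv z = v}
      = Sigma (K - {0}) (\<lambda>x. {(y, z) \<in> (K - {0}) \<times> (K - {0}). y + z = u - x \<and> kinv y + kinv z = v - kinv x})"
    by (auto simp: eq_diff_eq add_ac)
  moreover have "finite {(y, z) \<in> (K - {0}) \<times> (K - {0}). y + z = u - x \<and> kinv y + kinv z = v - kinv x}" for x
    by (rule finite_subset[of _ "K \<times> K"]) auto
  ultimately show ?thesis unfolding triple_count_def pair_count_def by (simp add: card_SigmaI)
qed

lemma triple_count_le:
  assumes u: "u \<in> K" "v \<in> K"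
  shows "real (triple_count u v) \<le> 3 * real q"
proof -
  have "real (triple_count u v) = (\<Sum>x\<in>K - {0}. real (pair_count (u - x) (v - kinv x)))"
    by (simp add: triple_count_eq)
  also have "\<dots> \<le> (\<Sum>x\<in>K - {0}. 2 + (if x = u then real q else 0))"
  proof (intro sum_mono)
    fix x assume x: "x \<in> K - {0}"
    show "real (pair_count (u - x) (v - kinv x)) \<le> 2 + (if x = u then real q else 0)"
    proof (cases "(u - x, v - kinv x) = (0, 0)")
      case True
      thus ?thesis using pair_count_zero by auto
    next
      case False
      hence "pair_count (u - x) (v - kinv x) \<le> 2" using x u by (intro pair_count_le) auto
      thus ?thesis by auto
    qed
  qed
  also have "\<dots> \<le> (\<Sum>x\<in>K. 2 + (if x = u then real q else 0))" by (intro sum_mono2) auto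
  also have "\<dots> = 3 * real q" using u by (simp add: sum.distrib q_def)
  finally show ?thesis .
qed

section \<open>Triples with given sum and given sum of inverses\<close>

text \<open>
  With one entry \<open>x\<close> of the triple fixed, the number of completions depends on \<open>W (W - 4)\<close> with
  \<open>W = (u - x) (v - 1/x)\<close>. Modulo squares this is a quartic in \<open>x\<close> that vanishes at \<open>u\<close> and at
  \<open>1 / v\<close>. The Moebius transformation to \<open>X\<close> sends the first zero to infinity and the second one
  to \<open>0\<close>, which leaves a cubic in \<open>X\<close> with root \<open>0\<close>.
\<close>

lemma eta_moebius:
  assumes u: "u \<in> K" "u \<noteq> 0" and v: "v \<in> K" "v \<noteq> 0" and x: "x \<in> K" "x \<noteq> 0" "x \<noteq> u"
    and ne: "u * v \<noteq> e"
  defines "W \<equiv> (u - x) * (v - kinv x)" and "n \<equiv> u * v"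
    and "X \<equiv> (u * v * x - u) * kinv (x - u)"
  shows "eta (W * (W - 4 * e)) = eta (X * (4 * (X * X) + (n * n - 6 * n - 3 * e) * X + 4 * n))"
proof -
  have K [simp]: "W \<in> K" "n \<in> K" "X \<in> K" "x - u \<in> K" using u v x by (simp_all add: W_def n_def X_def)
  have xu: "x - u \<noteq> 0" using x by simp
  have X: "(x - u) * X = n * x - u" using xu u v x by (simp add: X_def n_def)
  have Xn: "(x - u) * (X - n) = u * (n - e)"
  proof -
    have "(x - u) * (X - n) = (x - u) * X - (x - u) * n" by (rule right_diff_distrib)
    also have "\<dots> = u * n - u" unfolding X by (simp add: algebra_simps)
    finally show ?thesis using u by (simp add: right_diff_distrib)
  qed
  hence Xn0: "X - n \<noteq> 0"
    using u ne mult_eq_0_K[of u "n - e"] by (auto simp: n_def)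
  have Xn': "x * (X - n) = u * (X - e)"
  proof -
    have "x * (X - n) = (x - u) * (X - n) + u * (X - n)" by (simp add: algebra_simps)
    also have "\<dots> = u * (X - e)" unfolding Xn by (simp add: algebra_simps)
    finally show ?thesis .
  qed
  have "W * x = (u - x) * (v * x - x * kinv x)" by (simp add: W_def algebra_simps)
  hence "W * x = (u - x) * (v * x - e)" using x by simp
  hence "W * (x * u) = (u - x) * ((v * x - e) * u)" by (metis mult.assoc)
  also have "(v * x - e) * u = n * x - u" using u by (simp add: n_def algebra_simps)
  finally have Wx: "W * (x * u) = - ((x - u) * (x - u) * X)"
    unfolding X[symmetric] by (simp add: algebra_simps)
  have W4: "(W - 4 * e) * (x * u) = - ((x - u) * (x - u) * X + 4 * (x * u))"
    using Wx x u by (simp add: left_diff_distrib mult.assoc)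
  have xu0: "x * u \<noteq> 0" using x u by (simp add: mult_eq_0_K)
  define T where "T = (x - u) * (x - u) * X + 4 * (x * u)"
  have TK [simp]: "T \<in> K" using u x by (simp add: T_def)
  have "eta (W * (W - 4 * e)) = eta ((x * u) * (x * u) * (W * (W - 4 * e)))"
    using x u xu0 by (intro eta_mult_square[symmetric]) auto
  also have "(x * u) * (x * u) * (W * (W - 4 * e)) = (W * (x * u)) * ((W - 4 * e) * (x * u))"
    by (simp only: mult_ac)
  also have "\<dots> = (x - u) * (x - u) * (X * T)" unfolding Wx W4[folded T_def] by (simp add: mult_ac)
  also have "eta \<dots> = eta (X * T)" using xu by (intro eta_mult_square) auto
  also have "\<dots> = eta ((X - n) * (X - n) * (X * T))" using Xn0 by (intro eta_mult_square[symmetric]) auto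
  also have "(X - n) * (X - n) * (X * T)
      = X * (((x - u) * (X - n)) * ((x - u) * (X - n)) * X + 4 * u * (X - n) * (x * (X - n)))"
    unfolding T_def by (simp add: algebra_simps)
  also have "\<dots> = X * ((u * (n - e)) * (u * (n - e)) * X + 4 * u * (X - n) * (u * (X - e)))"
    unfolding Xn Xn' ..
  also have "\<dots> = u * u * (X * ((n - e) * (n - e) * X + 4 * ((X - n) * (X - e))))"
    by (simp add: algebra_simps)
  also have "(n - e) * (n - e) * X + 4 * ((X - n) * (X - e)) = 4 * (X * X) + (n * n - 6 * n - 3 * e) * X + 4 * n"
    by (simp add: algebra_simps)
  also have "eta (u * u * (X * (4 * (X * X) + (n * n - 6 * n - 3 * e) * X + 4 * n)))
      = eta (X * (4 * (X * X) + (n * n - 6 * n - 3 * e) * X + 4 * n))"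
    using u by (intro eta_mult_square) auto
  finally show ?thesis .
qed

lemma mult_kinv_cancel: "x \<in> K \<Longrightarrow> x \<noteq> 0 \<Longrightarrow> y \<in> K \<Longrightarrow> x * y * kinv x = y"
  by (simp add: mult.assoc)

text \<open>
  The values \<open>n\<close> and \<open>e\<close> that are missed are those at infinity and at \<open>0\<close>; the determinant
  \<open>u (1 - n)\<close> is nonzero.
\<close>

lemma bij_moebius:
  assumes u: "u \<in> K" "u \<noteq> 0" and v: "v \<in> K" "v \<noteq> 0" and ne: "u * v \<noteq> e"
  shows "bij_betw (\<lambda>x. (u * v * x - u) * kinv (x - u)) (K - {0, u}) (K - {u * v, e})"
proof (rule bij_betwI[where g="\<lambda>X. u * (X - e) * kinv (X - u * v)"])
  define n where "n = u * v"
  have nK [simp]: "n \<in> K" using u by (simp add: n_def)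
  have key: "(x - u) * X = n * x - u \<longleftrightarrow> (X - n) * x = u * (X - e)" if "x \<in> K" "X \<in> K" for x X
    using u by (auto simp: algebra_simps)
  have ne': "u * n \<noteq> u" "n \<noteq> e" using ne u mult_left_cancel_K[of u n e] by (auto simp: n_def)
  have fwd: "(x - u) * ((u * v * x - u) * kinv (x - u)) = n * x - u" if "x \<in> K - {0, u}" for x
    using that u by (simp add: n_def)
  have bwd: "(X - n) * (u * (X - e) * kinv (X - u * v)) = u * (X - e)" if "X \<in> K - {u * v, e}" for X
    using that u by (simp add: n_def)
  show "(\<lambda>x. (u * v * x - u) * kinv (x - u)) \<in> K - {0, u} \<rightarrow> K - {u * v, e}"
  proof
    fix x assume x: "x \<in> K - {0, u}"
    let ?X = "(u * v * x - u) * kinv (x - u)"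
    have XK: "?X \<in> K" using x u by simp
    have 1: "(?X - n) * x = u * (?X - e)" using key[of x ?X] fwd[OF x] x XK by blast
    have "?X \<noteq> n"
    proof
      assume "?X = n"
      hence "u * (n - e) = 0" using 1 by simp
      thus False using ne' u mult_eq_0_K[of u "n - e"] by auto
    qed
    moreover have "?X \<noteq> e"
    proof
      assume "?X = e"
      hence "(e - n) * x = 0" using 1 by simp
      thus False using ne' x mult_eq_0_K[of "e - n" x] by auto
    qed
    ultimately show "?X \<in> K - {u * v, e}" using XK by (simp add: n_def)
  qed
  show "(\<lambda>X. u * (X - e) * kinv (X - u * v)) \<in> K - {u * v, e} \<rightarrow> K - {0, u}"
  proof
    fix X assume X: "X \<in> K - {u * v, e}"
    let ?x = "u * (X - e) * kinv (X - u * v)"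
    have xK: "?x \<in> K" using X u by simp
    have 1: "(?x - u) * X = n * ?x - u" using key[of ?x X] bwd[OF X] X xK by blast
    have "?x \<noteq> 0" using X u by (auto simp: mult_eq_0_K)
    moreover have "?x \<noteq> u"
    proof
      assume "?x = u"
      hence "n * u = u" using 1 by simp
      thus False using ne' by (simp add: mult.commute)
    qed
    ultimately show "?x \<in> K - {0, u}" using xK by simp
  qed
  fix x assume x: "x \<in> K - {0, u}"
  let ?X = "(u * v * x - u) * kinv (x - u)"
  have XK: "?X \<in> K" using x u by simp
  have 1: "(?X - n) * x = u * (?X - e)" using key[of x ?X] fwd[OF x] x XK by blast
  have "?X - n \<noteq> 0"
  proof
    assume "?X - n = 0"
    hence "u * (n - e) = 0" using 1 by simp
    thus False using ne' u mult_eq_0_K[of u "n - e"] by auto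
  qed
  hence "(?X - n) * x * kinv (?X - n) = x" using XK x by (intro mult_kinv_cancel) simp_all
  thus "u * (?X - e) * kinv (?X - u * v) = x" unfolding 1 unfolding n_def .
next
  define n where "n = u * v"
  have nK [simp]: "n \<in> K" using u by (simp add: n_def)
  fix X assume X: "X \<in> K - {u * v, e}"
  let ?x = "u * (X - e) * kinv (X - u * v)"
  have xK: "?x \<in> K" using X u by simp
  have "(X - n) * ?x = u * (X - e)" using X u by (simp add: n_def)
  hence 1: "(?x - u) * X = n * ?x - u" using u X by (auto simp: algebra_simps)
  have "?x - u \<noteq> 0"
  proof
    assume "?x - u = 0"
    hence "n * u - u = 0" using 1 by simp
    hence "u * (n - e) = 0" using u by (simp add: algebra_simps)
    thus False using ne u mult_eq_0_K[of u "n - e"] by (auto simp: n_def)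
  qed
  hence "(?x - u) * X * kinv (?x - u) = X" using xK X u by (intro mult_kinv_cancel) simp_all
  thus "(u * v * ?x - u) * kinv (?x - u) = X" unfolding 1 unfolding n_def .
qed

text \<open>
  Substituting \<open>X / 4\<close> makes the polynomial monic, up to a square factor.
\<close>

lemma sum_eta_cubic:
  assumes "A \<in> K" "n \<in> K"
  shows "(\<Sum>X\<in>K. eta (X * (4 * (X * X) + A * X + 4 * n))) = cubic_sum A (16 * n)"
proof -
  have 4: "4 * e \<in> K" "4 * e \<noteq> 0" using four_mult_eq_0[of e] by auto
  have "cubic_sum A (16 * n) = (\<Sum>X\<in>K. eta ((4 * e * X) * ((4 * e * X) * (4 * e * X) + A * (4 * e * X) + 16 * n)))"
    unfolding cubic_sum_def by (rule sum.reindex_bij_betw[OF bij_mult[OF 4], symmetric])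
  also have "\<dots> = (\<Sum>X\<in>K. eta (X * (4 * (X * X) + A * X + 4 * n)))"
  proof (intro sum.cong refl)
    fix X assume X: "X \<in> K"
    have "(4 * e * X) * ((4 * e * X) * (4 * e * X) + A * (4 * e * X) + 16 * n)
        = 4 * (4 * (X * (4 * (X * X) + A * X + 4 * n)))"
      using X by (simp add: mult.assoc[of 4 e X] algebra_simps)
    hence "eta ((4 * e * X) * ((4 * e * X) * (4 * e * X) + A * (4 * e * X) + 16 * n))
        = eta (4 * (4 * (X * (4 * (X * X) + A * X + 4 * n))))" by (rule arg_cong)
    also have "\<dots> = eta (4 * (X * (4 * (X * X) + A * X + 4 * n)))" using X by (intro eta_4_mult) auto
    also have "\<dots> = eta (X * (4 * (X * X) + A * X + 4 * n))" using X by (intro eta_4_mult) auto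
    finally show "eta ((4 * e * X) * ((4 * e * X) * (4 * e * X) + A * (4 * e * X) + 16 * n))
        = eta (X * (4 * (X * X) + A * X + 4 * n))" .
  qed
  finally show ?thesis ..
qed

text \<open>
  Sum the number of pairs \<open>(y, z)\<close> over \<open>x\<close>. The main term is \<open>q - 3\<close>, from the \<open>x\<close> for which
  neither the sum nor the inverse sum of the pair vanishes; the fluctuation is a cubic sum with
  the two values \<open>X = n\<close> and \<open>X = e\<close> left out.
\<close>

lemma triple_count_generic:
  assumes u: "u \<in> K" "u \<noteq> 0" and v: "v \<in> K" "v \<noteq> 0" and ne: "u * v \<noteq> e"
  defines "n \<equiv> u * v"
  shows "\<bar>real (triple_count u v) - real q\<bar> \<le> 5 + \<bar>cubic_sum (n * n - 6 * n - 3 * e) (16 * n)\<bar>"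
proof -
  define A where "A = n * n - 6 * n - 3 * e"
  define W where "W x = (u - x) * (v - kinv x)" for x
  define P where "P X = eta (X * (4 * (X * X) + A * X + 4 * n))" for X
  have K [simp]: "n \<in> K" "A \<in> K" using u by (simp_all add: n_def A_def)
  have uv: "u \<noteq> kinv v" using ne v by auto
  have count: "real (pair_count (u - x) (v - kinv x)) = (if x \<in> {u, kinv v} then 0 else 1) + eta (W x * (W x - 4 * e))"
    if x: "x \<in> K - {0}" for x
  proof (cases "x \<in> {u, kinv v}")
    case True
    have "v - kinv x = 0 \<longleftrightarrow> x = kinv v" using x v kinv_kinv[of x] kinv_kinv[of v] by auto
    hence "(u - x = 0) \<noteq> (v - kinv x = 0)" using True uv by auto
    moreover from this have "W x = 0" by (auto simp: W_def)
    ultimately show ?thesis using True pair_count_degenerate by simp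
  next
    case False
    hence "v - kinv x \<noteq> 0" using x kinv_kinv[of x] by auto
    thus ?thesis using False x u v unfolding W_def by (subst pair_count_eta) auto
  qed
  have "real (triple_count u v) = (\<Sum>x\<in>K - {0}. (if x \<in> {u, kinv v} then 0 else 1) + eta (W x * (W x - 4 * e)))"
    unfolding triple_count_eq of_nat_sum by (intro sum.cong refl count)
  also have "\<dots> = (\<Sum>x\<in>K - {0}. if x \<in> {u, kinv v} then 0 else 1) + (\<Sum>x\<in>K - {0}. eta (W x * (W x - 4 * e)))"
    by (rule sum.distrib)
  also have "(\<Sum>x\<in>K - {0}. if x \<in> {u, kinv v} then 0 else 1) = (\<Sum>x\<in>K - {0, u, kinv v}. (1::real))"
    by (rule sum.mono_neutral_cong_right) auto
  also have "\<dots> = real q - 3"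
  proof -
    have "card {0, u, kinv v} = 3" using u v uv by auto
    hence "card (K - {0, u, kinv v}) = q - 3"
      using u v by (subst card_Diff_subset) (auto simp: q_def)
    thus ?thesis using q_ge_3 by (simp add: of_nat_diff)
  qed
  also have "(\<Sum>x\<in>K - {0}. eta (W x * (W x - 4 * e))) = (\<Sum>x\<in>K - {0, u}. eta (W x * (W x - 4 * e)))"
    by (rule sum.mono_neutral_right) (auto simp: W_def)
  also have "\<dots> = (\<Sum>x\<in>K - {0, u}. P ((u * v * x - u) * kinv (x - u)))"
    using u v ne unfolding P_def W_def A_def n_def by (intro sum.cong refl eta_moebius) auto
  also have "\<dots> = (\<Sum>X\<in>K - {n, e}. P X)"
    unfolding n_def by (rule sum.reindex_bij_betw[OF bij_moebius[OF u v ne]])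
  also have "\<dots> = (\<Sum>X\<in>K. P X) - (\<Sum>X\<in>{n, e}. P X)"
    by (rule sum_diff) auto
  also have "(\<Sum>X\<in>K. P X) = cubic_sum A (16 * n)" unfolding P_def by (rule sum_eta_cubic) auto
  finally have "real (triple_count u v) - real q = cubic_sum A (16 * n) - 3 - (\<Sum>X\<in>{n, e}. P X)" by simp
  moreover have "\<bar>\<Sum>X\<in>{n, e}. P X\<bar> \<le> 2"
  proof -
    have "\<bar>\<Sum>X\<in>{n, e}. P X\<bar> \<le> (\<Sum>X\<in>{n, e}. 1)"
      by (intro order_trans[OF sum_abs] sum_mono) (simp add: P_def eta_bounds)
    also have "\<dots> \<le> 2" by (simp add: card_insert_if)
    finally show ?thesis .
  qed
  ultimately show ?thesis unfolding A_def by linarith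
qed

text \<open>
  The curve parameters attached to \<open>(u, v)\<close> are rescaled by \<open>u\<close> so that they determine \<open>(u, v)\<close>
  up to four choices: \<open>1 / u\<close> is a root of a quartic with coefficients in \<open>a\<close> and \<open>b\<close>, and \<open>v\<close>
  is then determined by \<open>b\<close>. Without the rescaling the parameters would depend on \<open>u v\<close> only.
\<close>

lemma card_cubic_parameters:
  assumes a: "a \<in> K" and b: "b \<in> K"
  shows "card {z \<in> (K - {0}) \<times> (K - {0}).
    (fst z * ((fst z * snd z) * (fst z * snd z) - 6 * (fst z * snd z) - 3 * e),
     fst z * fst z * (16 * (fst z * snd z))) = (a, b)} \<le> 4" (is "card ?Z \<le> 4")
proof (cases "b = 0")
  case True
  have "fst z * fst z * (16 * (fst z * snd z)) \<noteq> 0" if "z \<in> (K - {0}) \<times> (K - {0})" for z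
  proof -
    have "fst z * snd z \<noteq> 0" "fst z * fst z \<noteq> 0" using that by (auto simp: mult_eq_0_K)
    moreover have "16 * (fst z * snd z) = 4 * (4 * (fst z * snd z))" by simp
    ultimately show ?thesis
      using that four_mult_eq_0[of "fst z * snd z"] four_mult_eq_0[of "4 * (fst z * snd z)"]
        mult_eq_0_K[of "fst z * fst z" "16 * (fst z * snd z)"] by (auto simp: mult_eq_0_K)
  qed
  hence "?Z = {}" using True by auto
  thus ?thesis by (simp only: card.empty)
next
  case False
  \<comment> \<open>The quartic satisfied by \<open>w = 1 / u\<close>: with \<open>n = b w^2 / 16\<close>, the relation
    \<open>n^2 - 6 n - 3 = w a\<close>, multiplied by 256.\<close>
  define c where "c i = [- 768 * e, - 256 * a, - 96 * b, 0, b * b] ! i" for i :: nat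
  let ?R = "{w \<in> K. (\<Sum>i\<le>4. c i * w ^ i) = 0}"
  have c: "\<forall>i\<le>4. c i \<in> K" "c 4 \<noteq> 0"
    using a b False by (auto simp: c_def le_Suc_eq numeral_eq_Suc mult_eq_0_K)
  have eval: "(\<Sum>i\<le>4. c i * w ^ i) = b * b * w ^ 4 - 96 * b * w ^ 2 - 256 * a * w - 768 * e" for w
    by (simp add: c_def eval_nat_numeral algebra_simps)
  have rel: "kinv (fst z) \<in> ?R \<and> snd z = kinv (16 * e) * b * kinv (fst z) * kinv (fst z) * kinv (fst z)"
    if z: "z \<in> ?Z" for z
  proof -
    define u v w where "u = fst z" and "v = snd z" and "w = kinv (fst z)"
    have K: "u \<in> K" "u \<noteq> 0" "v \<in> K" "v \<noteq> 0" "w \<in> K" using z by (auto simp: u_def v_def w_def)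
    have wu: "w * u = e" using K by (simp add: w_def u_def)
    define n where "n = u * v"
    have nK: "n \<in> K" using K by (simp add: n_def)
    have a: "a = u * (n * n - 6 * n - 3 * e)" and b: "b = u * u * (16 * n)"
      using z by (auto simp: u_def v_def n_def)
    have wa: "w * a = n * n - 6 * n - 3 * e"
      unfolding a using wu K nK by (simp flip: mult.assoc)
    have wb: "w * (w * b) = 16 * n"
    proof -
      have "w * (w * b) = (w * u) * ((w * u) * (16 * n))" unfolding b by (simp only: mult_ac)
      thus ?thesis using wu nK by simp
    qed
    have "b * b * w ^ 4 - 96 * b * w ^ 2 - 256 * a * w - 768 * e
       = (w * (w * b)) * (w * (w * b)) - 96 * (w * (w * b)) - 256 * (w * a) - 768 * e"
      by (simp add: eval_nat_numeral algebra_simps)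
    also have "\<dots> = 0" unfolding wa wb by (simp add: algebra_simps)
    finally have 1: "w \<in> ?R" using eval K by simp
    have 16: "16 * e \<noteq> 0"
      using four_mult_eq_0[of e] four_mult_eq_0[of "4 * e"] by (simp flip: mult.assoc)
    have "b * w * w * w = (16 * e) * v"
    proof -
      have "b * w * w * w = w * (w * (w * b))" by (simp only: mult_ac)
      also have "\<dots> = 16 * ((w * u) * v)" unfolding wb n_def by (simp add: mult_ac)
      finally show ?thesis using wu K by (simp add: mult.assoc)
    qed
    hence "kinv (16 * e) * (b * w * w * w) = v" using K 16 by simp
    hence "v = kinv (16 * e) * b * w * w * w" by (simp add: mult.assoc)
    with 1 show ?thesis by (simp add: u_def v_def w_def)
  qed
  have "card ?Z \<le> card ?R"
  proof (rule card_inj_on_le[of "\<lambda>z. kinv (fst z)"])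
    show "inj_on (\<lambda>z. kinv (fst z)) ?Z"
    proof (rule inj_onI)
      fix z z' assume z: "z \<in> ?Z" "z' \<in> ?Z" and eq: "kinv (fst z) = kinv (fst z')"
      have "fst z = kinv (kinv (fst z))" "fst z' = kinv (kinv (fst z'))" using z by auto
      hence "fst z = fst z'" using eq by simp
      moreover have "snd z = snd z'" using rel[OF z(1)] rel[OF z(2)] eq by simp
      ultimately show "z = z'" by (rule prod_eqI)
    qed
    show "(\<lambda>z. kinv (fst z)) ` ?Z \<subseteq> ?R" using rel by blast
  qed auto
  also have "\<dots> \<le> 4" using c by (rule card_roots)
  finally show ?thesis .
qed

end

section \<open>The sixth moment of Kloosterman sums\<close>

context finite_field_ideal begin

text \<open>
  Subtracting the constant \<open>q\<close> from the multiplicities does not change the transform at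
  \<open>(a, b) \<noteq> (0, 0)\<close>.
\<close>

lemma kloosterman_cube:
  assumes ab: "a \<in> K" "b \<in> K" "(a, b) \<noteq> (0, 0)"
  shows "kloosterman (\<lambda>_. 1) a b ^ 3
    = (\<Sum>u\<in>K. \<Sum>v\<in>K. of_real (real (triple_count u v) - real q) * chi (a * u + b * v))"
proof -
  let ?X = "(K - {0}) \<times> (K - {0}) \<times> (K - {0})"
  define p where "p z = (case z of (x, y, w) \<Rightarrow> x + y + w)" for z :: "'r \<times> 'r \<times> 'r"
  define r where "r z = (case z of (x, y, w) \<Rightarrow> kinv x + kinv y + kinv w)" for z
  have "kloosterman (\<lambda>_. 1) a b ^ 3 = (\<Sum>x\<in>K - {0}. \<Sum>y\<in>K - {0}. \<Sum>w\<in>K - {0}.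
      chi (a * x + b * kinv x) * chi (a * y + b * kinv y) * chi (a * w + b * kinv w))"
    unfolding power3_eq_cube kloosterman_def
    by (simp add: sum_product) (simp add: sum_distrib_left sum_distrib_right mult_ac)
  also have "\<dots> = (\<Sum>z\<in>?X. 1 * chi (a * p z + b * r z))"
    unfolding sum.cartesian_product
    by (rule sum.cong) (auto simp: p_def r_def chi_add distrib_left)
  also have "\<dots> = (\<Sum>u\<in>K. \<Sum>v\<in>K. (\<Sum>z\<in>{z \<in> ?X. p z = u \<and> r z = v}. 1) * chi (a * u + b * v))"
    by (rule sum_chi_group) (auto simp: p_def r_def)
  also have "\<dots> = (\<Sum>u\<in>K. \<Sum>v\<in>K. of_nat (triple_count u v) * chi (a * u + b * v))"
  proof -
    have "{z \<in> ?X. p z = u \<and> r z = v} = {(x, y, z) \<in> ?X. x + y + z = u \<and> kinv x + kinv y + kinv z = v}" for u v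
      by (auto simp: p_def r_def)
    thus ?thesis unfolding triple_count_def by simp
  qed
  also have "\<dots> = (\<Sum>u\<in>K. \<Sum>v\<in>K. of_real (real (triple_count u v) - real q) * chi (a * u + b * v))
      + of_nat q * (\<Sum>u\<in>K. \<Sum>v\<in>K. chi (a * u + b * v))"
    by (simp add: sum_distrib_left left_diff_distrib flip: sum.distrib)
  also have "(\<Sum>u\<in>K. \<Sum>v\<in>K. chi (a * u + b * v)) = (\<Sum>u\<in>K. chi (u * a)) * (\<Sum>v\<in>K. chi (v * b))"
    by (simp add: sum_product chi_add mult.commute)
  also have "\<dots> = 0" using ab by (simp add: sum_chi_mult)
  finally show ?thesis by simp
qed

text \<open>
  On the curves \<open>u = 0\<close>, \<open>v = 0\<close> and \<open>u v = 1\<close>, with about \<open>3 q\<close> points, the trivial bound \<open>2 q\<close>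
  is enough. Elsewhere the deviation is a cubic sum, and the mean square over curve parameters
  applies because at most four pairs \<open>(u, v)\<close> share a curve.
\<close>

lemma sum_triple_count:
  "(\<Sum>u\<in>K. \<Sum>v\<in>K. (real (triple_count u v) - real q)\<^sup>2) \<le> 70 * real q ^ 3"
proof -
  define \<phi> where "\<phi> z = (fst z * ((fst z * snd z) * (fst z * snd z) - 6 * (fst z * snd z) - 3 * e),
     fst z * fst z * (16 * (fst z * snd z)))" for z :: "'r \<times> 'r"
  define S where "S z = (cubic_sum (fst z) (snd z))\<^sup>2" for z
  \<comment> \<open>\<open>I\<close> counts the exceptional curves through \<open>(u, v)\<close>, and \<open>J\<close> bounds the squared
    deviation at generic points.\<close>
  define I where "I u v = (if u = 0 then 1 else 0) + (if v = 0 then 1 else 0) + (if v = kinv u then 1 else 0 :: real)"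
    for u v :: 'r
  define J where "J u v = (if u \<noteq> 0 \<and> v \<noteq> 0 then 50 + 2 * S (\<phi> (u, v)) else 0)" for u v
  have I: "I u v \<ge> 0" for u v by (simp add: I_def)
  have J: "J u v \<ge> 0" for u v by (simp add: J_def S_def)
  have bound: "(real (triple_count u v) - real q)\<^sup>2 \<le> 4 * (real q)\<^sup>2 * I u v + J u v"
    if uv: "u \<in> K" "v \<in> K" for u v
  proof (cases "u = 0 \<or> v = 0 \<or> v = kinv u")
    case True
    hence "I u v \<ge> 1" by (auto simp: I_def)
    have "\<bar>real (triple_count u v) - real q\<bar> \<le> 2 * real q" using triple_count_le[OF uv] by simp
    hence "(real (triple_count u v) - real q)\<^sup>2 \<le> (2 * real q)\<^sup>2"
      using power_mono[of "\<bar>real (triple_count u v) - real q\<bar>" "2 * real q" 2] by simp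
    also have "\<dots> \<le> 4 * (real q)\<^sup>2 * I u v"
      using \<open>I u v \<ge> 1\<close> by (simp add: power_mult_distrib mult_le_cancel_left1)
    finally show ?thesis using J[of u v] by linarith
  next
    case False
    define n where "n = u * v"
    have nK: "n \<in> K" using uv by (simp add: n_def)
    have "u * v \<noteq> e" using False kinv_unique[of u v] uv by auto
    hence "\<bar>real (triple_count u v) - real q\<bar> \<le> 5 + \<bar>cubic_sum (n * n - 6 * n - 3 * e) (16 * n)\<bar>"
      using triple_count_generic[of u v] uv False by (simp add: n_def)
    hence "(real (triple_count u v) - real q)\<^sup>2 \<le> (5 + \<bar>cubic_sum (n * n - 6 * n - 3 * e) (16 * n)\<bar>)\<^sup>2"
      using power_mono[of "\<bar>real (triple_count u v) - real q\<bar>" _ 2] by simp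
    also have "\<dots> \<le> 50 + 2 * (cubic_sum (n * n - 6 * n - 3 * e) (16 * n))\<^sup>2"
      using zero_le_power2[of "5 - \<bar>cubic_sum (n * n - 6 * n - 3 * e) (16 * n)\<bar>"]
      by (simp add: power2_sum power2_diff)
    also have "(cubic_sum (n * n - 6 * n - 3 * e) (16 * n))\<^sup>2 = S (\<phi> (u, v))"
      using uv False cubic_sum_scale[of u "n * n - 6 * n - 3 * e" "16 * n"] eta_sq[of u] nK
      by (simp add: S_def \<phi>_def n_def power_mult_distrib) (simp add: power2_eq_square)
    also have "50 + 2 * S (\<phi> (u, v)) = J u v" using False by (simp add: J_def)
    finally show ?thesis using I[of u v] by (simp add: add_increasing)
  qed
  have sumI: "(\<Sum>u\<in>K. \<Sum>v\<in>K. I u v) = 3 * real q"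
  proof -
    have "(\<Sum>v\<in>K. I u v) = (if u = 0 then real q else 0) + 2" if "u \<in> K" for u
      using that unfolding I_def by (simp add: sum.distrib q_def)
    hence "(\<Sum>u\<in>K. \<Sum>v\<in>K. I u v) = (\<Sum>u\<in>K. (if u = 0 then real q else 0) + 2)" by (rule sum.cong[OF refl])
    thus ?thesis by (simp add: sum.distrib q_def)
  qed
  have sumJ: "(\<Sum>u\<in>K. \<Sum>v\<in>K. J u v) \<le> 50 * (real q)\<^sup>2 + 8 * real q ^ 3"
  proof -
    have "(\<Sum>u\<in>K. \<Sum>v\<in>K. J u v) = (\<Sum>z\<in>K \<times> K. J (fst z) (snd z))"
      by (simp add: sum.cartesian_product case_prod_beta)
    also have "\<dots> = (\<Sum>z\<in>(K - {0}) \<times> (K - {0}). 50 + 2 * S (\<phi> z))"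
      by (rule sum.mono_neutral_cong_right) (auto simp: J_def)
    also have "\<dots> = 50 * real ((q - 1) * (q - 1)) + 2 * (\<Sum>z\<in>(K - {0}) \<times> (K - {0}). S (\<phi> z))"
      by (simp add: sum.distrib sum_distrib_left card_cartesian_product q_def)
    also have "(\<Sum>z\<in>(K - {0}) \<times> (K - {0}). S (\<phi> z)) \<le> real 4 * (\<Sum>z\<in>K \<times> K. S z)"
    proof (rule sum_comp_le)
      fix y assume "y \<in> K \<times> K"
      thus "card {x \<in> (K - {0}) \<times> (K - {0}). \<phi> x = y} \<le> 4"
        using card_cubic_parameters[of "fst y" "snd y"] unfolding \<phi>_def by auto
    qed (auto simp: \<phi>_def S_def)
    also have "(\<Sum>z\<in>K \<times> K. S z) \<le> real q ^ 3"
      using sum_cubic_sum_sq by (simp add: S_def sum.cartesian_product case_prod_beta)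
    also have "real ((q - 1) * (q - 1)) \<le> (real q)\<^sup>2"
      unfolding power2_eq_square of_nat_mult by (intro mult_mono) auto
    finally show ?thesis by simp
  qed
  have "(\<Sum>u\<in>K. \<Sum>v\<in>K. (real (triple_count u v) - real q)\<^sup>2) \<le> (\<Sum>u\<in>K. \<Sum>v\<in>K. 4 * (real q)\<^sup>2 * I u v + J u v)"
    by (intro sum_mono bound)
  also have "\<dots> = 4 * (real q)\<^sup>2 * (\<Sum>u\<in>K. \<Sum>v\<in>K. I u v) + (\<Sum>u\<in>K. \<Sum>v\<in>K. J u v)"
    by (simp add: sum.distrib sum_distrib_left)
  also have "\<dots> \<le> 4 * (real q)\<^sup>2 * (3 * real q) + (50 * (real q)\<^sup>2 + 8 * real q ^ 3)"
    unfolding sumI using sumJ by linarith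
  also have "\<dots> \<le> 70 * real q ^ 3"
  proof -
    have "(real q)\<^sup>2 * 1 \<le> (real q)\<^sup>2 * real q" using q_ge_3 by (intro mult_left_mono) auto
    thus ?thesis by (simp add: power2_eq_square power3_eq_cube)
  qed
  finally show ?thesis .
qed

text \<open>
  The same argument as for the fourth moment, applied to the cube of the sum. It is confined to
  the trivial character, since it depends on counting triples and not only on bounding their
  number.
\<close>

lemma kloosterman_bound_6:
  assumes ab: "a \<in> K" "b \<in> K" "(a, b) \<noteq> (0, 0)"
  shows "cmod (kloosterman (\<lambda>_. 1) a b) ^ 6 \<le> 140 * real q ^ 4"
proof -
  let ?k = "kloosterman (\<lambda>_. 1)"
  have "(\<Sum>(a,b)\<in>K \<times> K - {(0,0)}. cmod (?k a b) ^ 6)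
      = (\<Sum>z\<in>K \<times> K - {(0,0)}. (cmod (\<Sum>u\<in>K. \<Sum>v\<in>K. of_real (real (triple_count u v) - real q) * chi (fst z * u + snd z * v)))\<^sup>2)"
  proof (rule sum.cong[OF refl])
    fix z assume z: "z \<in> K \<times> K - {(0,0)}"
    have "cmod (?k (fst z) (snd z)) ^ 6 = (cmod (?k (fst z) (snd z) ^ 3))\<^sup>2"
      by (simp add: norm_power flip: power_mult)
    also have "?k (fst z) (snd z) ^ 3 =
        (\<Sum>u\<in>K. \<Sum>v\<in>K. of_real (real (triple_count u v) - real q) * chi (fst z * u + snd z * v))"
      using z by (intro kloosterman_cube) auto
    finally show "(case z of (a, b) \<Rightarrow> cmod (?k a b) ^ 6) = (cmod (\<Sum>u\<in>K. \<Sum>v\<in>K.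
        of_real (real (triple_count u v) - real q) * chi (fst z * u + snd z * v)))\<^sup>2"
      by (simp only: case_prod_beta)
  qed
  also have "\<dots> \<le> (\<Sum>z\<in>K \<times> K. (cmod (\<Sum>u\<in>K. \<Sum>v\<in>K. of_real (real (triple_count u v) - real q) * chi (fst z * u + snd z * v)))\<^sup>2)"
    by (intro sum_mono2) auto
  also have "\<dots> = (\<Sum>a\<in>K. \<Sum>b\<in>K. (cmod (\<Sum>u\<in>K. \<Sum>v\<in>K. of_real (real (triple_count u v) - real q) * chi (a * u + b * v)))\<^sup>2)"
    by (simp add: sum.cartesian_product case_prod_beta)
  also have "\<dots> = (real q)\<^sup>2 * (\<Sum>u\<in>K. \<Sum>v\<in>K. (cmod (of_real (real (triple_count u v) - real q)))\<^sup>2)"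
    by (rule parseval_K2)
  also have "\<dots> = (real q)\<^sup>2 * (\<Sum>u\<in>K. \<Sum>v\<in>K. (real (triple_count u v) - real q)\<^sup>2)"
    by (simp only: norm_of_real power2_abs)
  also have "\<dots> \<le> (real q)\<^sup>2 * (70 * real q ^ 3)"
    by (intro mult_left_mono sum_triple_count) auto
  finally have "real (q - 1) * cmod (?k a b) ^ 6 \<le> 70 * real q ^ 5"
    using kloosterman_orbit[OF unit_character_1 ab, of 6] by (simp add: eval_nat_numeral)
  moreover have "real q / 2 * cmod (?k a b) ^ 6 \<le> real (q - 1) * cmod (?k a b) ^ 6"
    using q_ge_3 by (intro mult_right_mono) (auto simp: of_nat_diff)
  ultimately have "real q * cmod (?k a b) ^ 6 \<le> 140 * real q ^ 5" by linarith
  also have "140 * real q ^ 5 = real q * (140 * real q ^ 4)" by (simp add: eval_nat_numeral)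
  finally have "real q * cmod (?k a b) ^ 6 \<le> real q * (140 * real q ^ 4)" .
  thus ?thesis by (simp only: mult_le_cancel_left_pos q_pos)
qed

end

section \<open>The standard quadratic space\<close>

locale quadratic_space = finite_field_ideal K e for K :: "'r::comm_ring_1 set" and e +
  fixes d :: nat
begin

text \<open>
  Vectors vanish outside of \<open>{1..d}\<close>, so that the pointwise operations on functions preserve
  \<open>V\<close>.
\<close>

definition V :: "(nat \<Rightarrow> 'r) set" where
  "V = {x. (\<forall>i. x i \<in> K) \<and> (\<forall>i. i \<notin> {1..d} \<longrightarrow> x i = 0)}"

definition dot :: "(nat \<Rightarrow> 'r) \<Rightarrow> (nat \<Rightarrow> 'r) \<Rightarrow> 'r" where
  "dot x y = (\<Sum>i\<in>{1..d}. x i * y i)"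

abbreviation nrm :: "(nat \<Rightarrow> 'r) \<Rightarrow> 'r" where
  "nrm x \<equiv> dot x x"

definition smul :: "'r \<Rightarrow> (nat \<Rightarrow> 'r) \<Rightarrow> (nat \<Rightarrow> 'r)" where
  "smul c x = (\<lambda>i. c * x i)"

definition lincomb :: "'i set \<Rightarrow> ('i \<Rightarrow> 'r) \<Rightarrow> ('i \<Rightarrow> nat \<Rightarrow> 'r) \<Rightarrow> (nat \<Rightarrow> 'r)" where
  "lincomb I c v = (\<lambda>j. \<Sum>i\<in>I. c i * v i j)"

lemma V_nth: "x \<in> V \<Longrightarrow> x i \<in> K"
  by (simp add: V_def)

lemma zero_V [simp]: "0 \<in> V" and add_V [simp]: "x \<in> V \<Longrightarrow> y \<in> V \<Longrightarrow> x + y \<in> V"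
  and minus_V [simp]: "x \<in> V \<Longrightarrow> - x \<in> V" and diff_V [simp]: "x \<in> V \<Longrightarrow> y \<in> V \<Longrightarrow> x - y \<in> V"
  and smul_V [simp]: "x \<in> V \<Longrightarrow> smul c x \<in> V"
  by (auto simp: V_def smul_def)

lemma lincomb_V [simp]: "(\<And>i. i \<in> I \<Longrightarrow> v i \<in> V) \<Longrightarrow> lincomb I c v \<in> V"
  by (auto simp: V_def lincomb_def)

lemma V_eqI: "x \<in> V \<Longrightarrow> y \<in> V \<Longrightarrow> (\<And>i. i \<in> {1..d} \<Longrightarrow> x i = y i) \<Longrightarrow> x = y"
proof (rule ext)
  fix i assume "x \<in> V" "y \<in> V" "\<And>i. i \<in> {1..d} \<Longrightarrow> x i = y i"
  thus "x i = y i" by (cases "i \<in> {1..d}") (simp, simp add: V_def)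
qed

lemma dot_K [simp]: "x \<in> V \<Longrightarrow> dot x y \<in> K" "y \<in> V \<Longrightarrow> dot x y \<in> K"
  by (auto simp: dot_def V_nth)

lemma dot_commute: "dot x y = dot y x"
  by (simp add: dot_def mult.commute)

lemma dot_add_left: "dot (x + y) z = dot x z + dot y z"
  and dot_add_right: "dot z (x + y) = dot z x + dot z y"
  and dot_diff_left: "dot (x - y) z = dot x z - dot y z"
  and dot_diff_right: "dot z (x - y) = dot z x - dot z y"
  and dot_minus_left: "dot (- x) z = - dot x z"
  and dot_minus_right: "dot z (- x) = - dot z x"
  and dot_smul_left: "dot (smul c x) z = c * dot x z"
  and dot_smul_right: "dot z (smul c x) = c * dot z x"
  and dot_zero_left [simp]: "dot 0 z = 0"
  and dot_zero_right [simp]: "dot z 0 = 0"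
  by (simp_all add: dot_def algebra_simps sum.distrib sum_subtractf sum_negf smul_def sum_distrib_left)

lemmas dot_linear = dot_add_left dot_add_right dot_diff_left dot_diff_right dot_minus_left dot_minus_right
  dot_smul_left dot_smul_right

lemma dot_lincomb_left: "dot (lincomb I c v) z = (\<Sum>i\<in>I. c i * dot (v i) z)"
  unfolding dot_def lincomb_def sum_distrib_left sum_distrib_right by (subst sum.swap) (simp add: mult.assoc)

lemma dot_lincomb_right: "dot z (lincomb I c v) = (\<Sum>i\<in>I. c i * dot z (v i))"
  using dot_lincomb_left by (simp add: dot_commute)

lemma nrm_diff: "nrm (x - y) = nrm x + nrm y - 2 * dot x y"
  using dot_commute[of y x] by (simp add: dot_linear algebra_simps)

lemma nrm_diff_commute: "nrm (x - y) = nrm (y - x)"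
  by (simp add: dot_linear)

lemma bij_V_PiE: "bij_betw (\<lambda>x. restrict x {1..d}) V ({1..d} \<rightarrow>\<^sub>E K)"
proof (rule bij_betwI[where g="\<lambda>x i. if i \<in> {1..d} then x i else 0"])
  show "(\<lambda>x. restrict x {1..d}) \<in> V \<rightarrow> {1..d} \<rightarrow>\<^sub>E K" by (auto simp: V_def)
  show "(\<lambda>x i. if i \<in> {1..d} then x i else 0) \<in> ({1..d} \<rightarrow>\<^sub>E K) \<rightarrow> V" by (auto simp: V_def)
  fix x assume "x \<in> V"
  thus "(\<lambda>i. if i \<in> {1..d} then restrict x {1..d} i else 0) = x" by (auto simp: V_def fun_eq_iff)
next
  fix x assume "x \<in> {1..d} \<rightarrow>\<^sub>E K"
  thus "restrict (\<lambda>i. if i \<in> {1..d} then x i else 0) {1..d} = x"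
    by (auto simp: fun_eq_iff PiE_def extensional_def)
qed

lemma finite_V [simp]: "finite V"
  using bij_betw_finite[OF bij_V_PiE] by (simp add: finite_PiE)

lemma card_V: "card V = q ^ d"
  using bij_betw_same_card[OF bij_V_PiE] by (simp add: card_PiE q_def)

lemma sum_prod_V:
  fixes f :: "nat \<Rightarrow> 'r \<Rightarrow> 'b::comm_semiring_1"
  shows "(\<Sum>x\<in>V. \<Prod>i\<in>{1..d}. f i (x i)) = (\<Prod>i\<in>{1..d}. \<Sum>t\<in>K. f i t)"
proof -
  have "(\<Sum>x\<in>V. \<Prod>i\<in>{1..d}. f i (x i)) = (\<Sum>x\<in>V. \<Prod>i\<in>{1..d}. f i (restrict x {1..d} i))"
    by (intro sum.cong refl prod.cong) auto
  also have "\<dots> = (\<Sum>x\<in>{1..d} \<rightarrow>\<^sub>E K. \<Prod>i\<in>{1..d}. f i (x i))"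
    by (rule sum.reindex_bij_betw[OF bij_V_PiE])
  finally show ?thesis by (subst prod_sum_PiE) auto
qed

lemma bij_add_V: "a \<in> V \<Longrightarrow> bij_betw (\<lambda>x. x + a) V V"
  by (rule bij_betwI[where g="\<lambda>x. x - a"]) auto

lemma smul_smul [simp]: "smul a (smul b x) = smul (a * b) x"
  by (simp add: smul_def mult.assoc)

lemma smul_e [simp]: "x \<in> V \<Longrightarrow> smul e x = x"
  by (simp add: smul_def V_nth)

lemma smul_0 [simp]: "smul c 0 = 0" "smul 0 x = 0"
  by (simp_all add: smul_def fun_eq_iff)

lemma smul_add: "smul c (x + y) = smul c x + smul c y" "smul c (x - y) = smul c x - smul c y"
  "smul (a + b) x = smul a x + smul b x" "smul (a - b) x = smul a x - smul b x"
  by (simp_all add: smul_def fun_eq_iff algebra_simps)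

lemma bij_smul_V: "c \<in> K \<Longrightarrow> c \<noteq> 0 \<Longrightarrow> bij_betw (smul c) V V"
  by (rule bij_betwI[where g="smul (kinv c)"]) auto

lemma sum_chi_dot: "y \<in> V \<Longrightarrow> (\<Sum>x\<in>V. chi (dot x y)) = (if y = 0 then of_nat q ^ d else 0)"
proof -
  assume y: "y \<in> V"
  have "(\<Sum>x\<in>V. chi (dot x y)) = (\<Prod>i\<in>{1..d}. \<Sum>t\<in>K. chi (t * y i))"
    using sum_prod_V[of "\<lambda>i t. chi (t * y i)"] by (simp add: dot_def chi_sum)
  also have "\<dots> = (\<Prod>i\<in>{1..d}. if y i = 0 then of_nat q else 0)"
    using y by (intro prod.cong refl sum_chi_mult V_nth)
  also have "\<dots> = (if y = 0 then of_nat q ^ d else 0)"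
  proof (cases "y = 0")
    case False
    then obtain i where "i \<in> {1..d}" "y i \<noteq> 0" using V_eqI[OF y zero_V] by auto
    thus ?thesis using False by (auto intro!: prod_zero)
  qed simp
  finally show ?thesis .
qed

text \<open>
  Parseval for exponential sums whose frequencies may coincide; the right-hand side counts
  coincidences.
\<close>

lemma sum_chi_dot_sq:
  assumes "finite Z" "\<And>z. z \<in> Z \<Longrightarrow> \<phi> z \<in> V"
  shows "of_real (\<Sum>x\<in>V. (cmod (\<Sum>z\<in>Z. a z * chi (dot x (\<phi> z))))\<^sup>2)
    = of_nat q ^ d * (\<Sum>z\<in>Z. \<Sum>z'\<in>{z' \<in> Z. \<phi> z' = \<phi> z}. a z * cnj (a z'))"
proof -
  have "of_real (\<Sum>x\<in>V. (cmod (\<Sum>z\<in>Z. a z * chi (dot x (\<phi> z))))\<^sup>2)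
      = (\<Sum>x\<in>V. \<Sum>z\<in>Z. \<Sum>z'\<in>Z. a z * cnj (a z') * chi (dot x (\<phi> z - \<phi> z')))"
    unfolding of_real_sum norm_sum_sq
    by (intro sum.cong refl) (simp add: dot_diff_right chi_diff)
  also have "\<dots> = (\<Sum>z\<in>Z. \<Sum>z'\<in>Z. \<Sum>x\<in>V. a z * cnj (a z') * chi (dot x (\<phi> z - \<phi> z')))"
    by (subst sum.swap) (intro sum.cong refl sum.swap)
  also have "\<dots> = (\<Sum>z\<in>Z. \<Sum>z'\<in>Z. if \<phi> z' = \<phi> z then of_nat q ^ d * (a z * cnj (a z')) else 0)"
  proof (intro sum.cong refl)
    fix z z' assume "z \<in> Z" "z' \<in> Z"
    hence "(\<Sum>x\<in>V. chi (dot x (\<phi> z - \<phi> z'))) = (if \<phi> z - \<phi> z' = 0 then of_nat q ^ d else 0)"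
      using assms by (intro sum_chi_dot) auto
    thus "(\<Sum>x\<in>V. a z * cnj (a z') * chi (dot x (\<phi> z - \<phi> z')))
        = (if \<phi> z' = \<phi> z then of_nat q ^ d * (a z * cnj (a z')) else 0)"
      by (auto simp flip: sum_distrib_left)
  qed
  also have "\<dots> = of_nat q ^ d * (\<Sum>z\<in>Z. \<Sum>z'\<in>{z' \<in> Z. \<phi> z' = \<phi> z}. a z * cnj (a z'))"
    using assms(1) by (simp add: sum_distrib_left sum.If_cases Int_def)
  finally show ?thesis .
qed

lemma parseval_V:
  assumes "P \<subseteq> V"
  shows "(\<Sum>x\<in>V. (cmod (\<Sum>y\<in>P. f y * chi (dot x y)))\<^sup>2) = real q ^ d * (\<Sum>y\<in>P. (cmod (f y))\<^sup>2)"
proof -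
  have fin: "finite P" using assms finite_V by (rule finite_subset)
  have "of_real (\<Sum>x\<in>V. (cmod (\<Sum>y\<in>P. f y * chi (dot x y)))\<^sup>2)
      = of_nat q ^ d * (\<Sum>y\<in>P. \<Sum>z'\<in>{z' \<in> P. z' = y}. f y * cnj (f z'))"
    using sum_chi_dot_sq[OF fin, of "\<lambda>y. y" f] assms by auto
  also have "(\<Sum>y\<in>P. \<Sum>z'\<in>{z' \<in> P. z' = y}. f y * cnj (f z')) = (\<Sum>y\<in>P. f y * cnj (f y))"
  proof (rule sum.cong[OF refl])
    fix y assume "y \<in> P"
    hence "{z' \<in> P. z' = y} = {y}" by auto
    thus "(\<Sum>z'\<in>{z' \<in> P. z' = y}. f y * cnj (f z')) = f y * cnj (f y)" by simp
  qed
  also have "(\<Sum>y\<in>P. f y * cnj (f y)) = of_real (\<Sum>y\<in>P. (cmod (f y))\<^sup>2)"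
    by (simp only: complex_norm_square of_real_sum)
  also have "of_nat q ^ d * of_real (\<Sum>y\<in>P. (cmod (f y))\<^sup>2) = (of_real (real q ^ d * (\<Sum>y\<in>P. (cmod (f y))\<^sup>2)) :: complex)"
    by simp
  finally show ?thesis by (simp only: of_real_eq_iff)
qed

section \<open>Pairs of points at a given distance\<close>

lemma q_times_indicator:
  assumes "t \<in> K" "finite Z" "\<And>z. z \<in> Z \<Longrightarrow> F z \<in> K"
  shows "of_nat (q * card {z \<in> Z. F z = t}) = (\<Sum>z\<in>Z. \<Sum>s\<in>K. chi (s * (F z - t)))"
proof -
  have "(\<Sum>z\<in>Z. \<Sum>s\<in>K. chi (s * (F z - t))) = (\<Sum>z\<in>Z. if F z = t then of_nat q else 0)"
  proof (rule sum.cong[OF refl])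
    fix z assume "z \<in> Z"
    hence "(\<Sum>s\<in>K. chi (s * (F z - t))) = (if F z - t = 0 then of_nat q else 0)"
      using assms by (intro sum_chi_mult) auto
    thus "(\<Sum>s\<in>K. chi (s * (F z - t))) = (if F z = t then of_nat q else 0)" by simp
  qed
  also have "\<dots> = of_nat (q * card {z \<in> Z. F z = t})"
    using \<open>finite Z\<close> by (simp add: sum.If_cases Int_def mult.commute)
  finally show ?thesis by simp
qed

lemma q_times_card:
  assumes "t \<in> K" "finite Z" "\<And>z. z \<in> Z \<Longrightarrow> F z \<in> K"
  shows "of_real (real q * real (card {z \<in> Z. F z = t}) - real (card Z))
    = (\<Sum>s\<in>K - {0}. chi (- (s * t)) * (\<Sum>z\<in>Z. chi (s * F z)))"
proof -
  have "of_nat (q * card {z \<in> Z. F z = t}) = (\<Sum>s\<in>K. \<Sum>z\<in>Z. chi (s * (F z - t)))"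
    using q_times_indicator[OF assms] by (simp only: sum.swap[of _ K])
  also have "\<dots> = (\<Sum>s\<in>K. chi (- (s * t)) * (\<Sum>z\<in>Z. chi (s * F z)))"
    unfolding sum_distrib_left
    by (intro sum.cong refl) (simp add: right_diff_distrib flip: chi_add)
  also have "\<dots> = of_nat (card Z) + (\<Sum>s\<in>K - {0}. chi (- (s * t)) * (\<Sum>z\<in>Z. chi (s * F z)))"
    by (subst sum.remove[of K 0]) auto
  finally show ?thesis by simp
qed

lemma gauss_power: "(\<Sum>x\<in>V. chi (s * nrm x)) = gauss s ^ d"
  using sum_prod_V[of "\<lambda>i t. chi (s * (t * t))"] by (simp add: dot_def chi_sum gauss_def sum_distrib_left)

lemma gauss_shift:
  assumes s: "s \<in> K" "s \<noteq> 0" and u: "u \<in> K"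
  shows "(\<Sum>x\<in>K. chi (- (kinv s) * (x * x) + 2 * (x * u))) = chi (s * (u * u)) * gauss (- kinv s)"
proof -
  have su: "s * u \<in> K" using s by simp
  have "(\<Sum>x\<in>K. chi (- (kinv s) * (x * x) + 2 * (x * u)))
      = (\<Sum>x\<in>K. chi (- (kinv s) * ((x + s * u) * (x + s * u)) + 2 * ((x + s * u) * u)))"
    by (rule sum.reindex_bij_betw[OF bij_add[OF su], symmetric])
  also have "\<dots> = (\<Sum>x\<in>K. chi (s * (u * u)) * chi (- kinv s * (x * x)))"
  proof (rule sum.cong[OF refl])
    fix x assume x: "x \<in> K"
    have 1: "kinv s * (s * u) = u" using s u by simp
    have "kinv s * ((x + s * u) * (x + s * u))
        = kinv s * (x * x) + 2 * (x * (kinv s * (s * u))) + (kinv s * (s * u)) * (s * u)"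
      by (simp add: algebra_simps)
    hence "- (kinv s) * ((x + s * u) * (x + s * u)) + 2 * ((x + s * u) * u)
        = s * (u * u) + (- kinv s * (x * x))"
      unfolding 1 by (simp add: algebra_simps)
    thus "chi (- (kinv s) * ((x + s * u) * (x + s * u)) + 2 * ((x + s * u) * u))
        = chi (s * (u * u)) * chi (- kinv s * (x * x))" by (simp only: chi_add)
  qed
  finally show ?thesis by (simp add: gauss_def sum_distrib_left)
qed

text \<open>
  The function \<open>chi (s nrm u)\<close> is, up to Gauss sums, its own Fourier transform, with \<open>s\<close>
  replaced by \<open>- 1 / s\<close>. This is completion of the square in each coordinate.
\<close>

lemma chi_nrm_expand:
  assumes s: "s \<in> K" "s \<noteq> 0" and u: "u \<in> V"
  shows "(\<Sum>\<xi>\<in>V. chi (- (nrm \<xi> * kinv s)) * chi (dot (2 * \<xi>) u)) = chi (s * nrm u) * gauss (- kinv s) ^ d"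
proof -
  have arg: "- (nrm \<xi> * kinv s) + dot (2 * \<xi>) u = (\<Sum>i\<in>{1..d}. - (kinv s) * (\<xi> i * \<xi> i) + 2 * (\<xi> i * u i))" for \<xi>
    by (simp add: dot_def sum_subtractf sum_distrib_left sum_distrib_right mult_ac)
  have "(\<Sum>\<xi>\<in>V. chi (- (nrm \<xi> * kinv s)) * chi (dot (2 * \<xi>) u))
      = (\<Sum>\<xi>\<in>V. \<Prod>i\<in>{1..d}. chi (- (kinv s) * (\<xi> i * \<xi> i) + 2 * (\<xi> i * u i)))"
    by (simp only: chi_add[symmetric] arg chi_sum)
  also have "\<dots> = (\<Prod>i\<in>{1..d}. chi (s * (u i * u i)) * gauss (- kinv s))"
    unfolding sum_prod_V[of "\<lambda>i t. chi (- (kinv s) * (t * t) + 2 * (t * u i))"]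
    using s u by (intro prod.cong refl gauss_shift) (auto simp: V_nth)
  also have "\<dots> = chi (s * nrm u) * gauss (- kinv s) ^ d"
    by (simp add: prod.distrib dot_def sum_distrib_left chi_sum)
  finally show ?thesis .
qed

lemma bij_double_V: "bij_betw (\<lambda>x. 2 * x) V V"
proof -
  have "2 * e \<noteq> 0" using two_mult_eq_0[of e] by simp
  hence "bij_betw (smul (2 * e)) V V" by (intro bij_smul_V) auto
  moreover have "smul (2 * e) x = 2 * x" if "x \<in> V" for x
    using that by (simp add: smul_def fun_eq_iff mult.assoc V_nth)
  ultimately show ?thesis by (subst bij_betw_cong[where g="smul (2 * e)"]) auto
qed

lemma sum_norm_mult_le:
  fixes f g :: "'i \<Rightarrow> complex"
  shows "(\<Sum>x\<in>A. cmod (f x) * cmod (g x)) \<le> sqrt (\<Sum>x\<in>A. (cmod (f x))\<^sup>2) * sqrt (\<Sum>x\<in>A. (cmod (g x))\<^sup>2)"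
proof -
  have "(\<Sum>x\<in>A. cmod (f x) * cmod (g x))\<^sup>2 \<le> (\<Sum>x\<in>A. (cmod (f x))\<^sup>2) * (\<Sum>x\<in>A. (cmod (g x))\<^sup>2)"
    by (rule Cauchy_Schwarz_ineq_sum)
  hence "sqrt ((\<Sum>x\<in>A. cmod (f x) * cmod (g x))\<^sup>2) \<le> sqrt ((\<Sum>x\<in>A. (cmod (f x))\<^sup>2) * (\<Sum>x\<in>A. (cmod (g x))\<^sup>2))"
    by (rule real_sqrt_le_mono)
  moreover have "(\<Sum>x\<in>A. cmod (f x) * cmod (g x)) \<ge> 0" by (intro sum_nonneg) auto
  ultimately show ?thesis by (simp add: real_sqrt_mult)
qed

text \<open>
  Detect the condition \<open>nrm (x - y) = t\<close> by characters with parameter \<open>s\<close>, and expand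
  \<open>chi (s nrm (x - y))\<close> in Fourier modes, which separates \<open>x\<close> from \<open>y\<close>. The sum over \<open>s\<close> that
  multiplies the mode \<open>\<xi>\<close> is a Kloosterman sum, twisted by \<open>eta\<close> when \<open>d\<close> is odd. Cauchy-Schwarz
  and Parseval take care of the sum over \<open>\<xi>\<close>.
\<close>

lemma distance_pairs:
  assumes P: "P \<subseteq> V" and Q: "Q \<subseteq> V" and t: "t \<in> K"
    and \<kappa>: "\<And>b. b \<in> K \<Longrightarrow> cmod (kloosterman (\<lambda>x. of_real (eta x) ^ d) (- t) b) \<le> \<kappa>"
  shows "\<bar>real q * real (card {z \<in> P \<times> Q. nrm (fst z - snd z) = t}) - real (card P) * real (card Q)\<bar>
    \<le> sqrt (real q) ^ d * \<kappa> * sqrt (real (card P) * real (card Q))"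
proof -
  define \<epsilon> where "\<epsilon> = (\<lambda>x. complex_of_real (eta x) ^ d)"
  define p where "p \<xi> = (\<Sum>x\<in>P. chi (dot \<xi> x))" for \<xi>
  define r where "r \<xi> = (\<Sum>x\<in>Q. chi (dot \<xi> x))" for \<xi>
  define G where "G = gauss (- e)"
  have e_neg: "- e \<in> K" "- e \<noteq> 0" by auto
  have fin: "finite P" "finite Q" using P Q finite_V by (auto intro: finite_subset)
  have normG: "cmod G = sqrt (real q)"
    using norm_gauss[OF e_neg] by (simp add: G_def real_sqrt_unique)
  hence G0: "G \<noteq> 0" by auto
  have G: "gauss (- kinv s) ^ d = \<epsilon> s * G ^ d" if "s \<in> K" "s \<noteq> 0" for s
  proof -
    have "- kinv s = - e * kinv s" using that by simp
    hence "eta (- kinv s) = eta (- e) * eta s" using that eta_mult[of "- e" "kinv s"] eta_kinv[of s] by simp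
    moreover have "gauss (- kinv s) = of_real (eta (- kinv s)) * gauss e"
      using that by (intro gauss_eta) auto
    moreover have "G = of_real (eta (- e)) * gauss e" unfolding G_def using e_neg by (rule gauss_eta)
    ultimately show ?thesis by (simp add: \<epsilon>_def power_mult_distrib mult_ac)
  qed
  have eps_sq: "\<epsilon> s * \<epsilon> s = 1" if "s \<noteq> 0" for s
    using eta_sq[OF that] unfolding \<epsilon>_def by (simp flip: power_mult_distrib of_real_mult)
  have expand: "G ^ d * (\<Sum>z\<in>P \<times> Q. chi (s * nrm (fst z - snd z)))
      = (\<Sum>\<xi>\<in>V. p (2 * \<xi>) * cnj (r (2 * \<xi>)) * (\<epsilon> s * chi (- (nrm \<xi> * kinv s))))"
    if s: "s \<in> K" "s \<noteq> 0" for s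
  proof -
    have "G ^ d * (\<Sum>z\<in>P \<times> Q. chi (s * nrm (fst z - snd z)))
       = \<epsilon> s * (\<Sum>z\<in>P \<times> Q. chi (s * nrm (fst z - snd z)) * gauss (- kinv s) ^ d)"
      unfolding G[OF s] using eps_sq[OF s(2)]
      by (simp add: sum_distrib_left sum_distrib_right mult_ac) (simp flip: mult.assoc)
    also have "(\<Sum>z\<in>P \<times> Q. chi (s * nrm (fst z - snd z)) * gauss (- kinv s) ^ d)
       = (\<Sum>z\<in>P \<times> Q. \<Sum>\<xi>\<in>V. chi (- (nrm \<xi> * kinv s)) * chi (dot (2 * \<xi>) (fst z - snd z)))"
      using subsetD[OF P] subsetD[OF Q] by (intro sum.cong refl chi_nrm_expand[OF s, symmetric]) auto
    also have "\<dots> = (\<Sum>\<xi>\<in>V. \<Sum>z\<in>P \<times> Q. chi (- (nrm \<xi> * kinv s)) * chi (dot (2 * \<xi>) (fst z - snd z)))"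
      by (rule sum.swap)
    also have "\<dots> = (\<Sum>\<xi>\<in>V. chi (- (nrm \<xi> * kinv s)) * (p (2 * \<xi>) * cnj (r (2 * \<xi>))))"
    proof (rule sum.cong[OF refl])
      fix \<xi>
      have "p (2 * \<xi>) * cnj (r (2 * \<xi>)) = (\<Sum>z\<in>P \<times> Q. chi (dot (2 * \<xi>) (fst z)) * cnj (chi (dot (2 * \<xi>) (snd z))))"
        unfolding p_def r_def cnj_sum sum_product sum.cartesian_product by (rule sum.cong) auto
      thus "(\<Sum>z\<in>P \<times> Q. chi (- (nrm \<xi> * kinv s)) * chi (dot (2 * \<xi>) (fst z - snd z)))
          = chi (- (nrm \<xi> * kinv s)) * (p (2 * \<xi>) * cnj (r (2 * \<xi>)))"
        by (simp only: dot_diff_right chi_diff sum_distrib_left)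
    qed
    also have "\<epsilon> s * (\<Sum>\<xi>\<in>V. chi (- (nrm \<xi> * kinv s)) * (p (2 * \<xi>) * cnj (r (2 * \<xi>))))
        = (\<Sum>\<xi>\<in>V. p (2 * \<xi>) * cnj (r (2 * \<xi>)) * (\<epsilon> s * chi (- (nrm \<xi> * kinv s))))"
      unfolding sum_distrib_left by (intro sum.cong refl) (simp only: mult_ac)
    finally show ?thesis .
  qed
  have "G ^ d * of_real (real q * real (card {z \<in> P \<times> Q. nrm (fst z - snd z) = t}) - real (card (P \<times> Q)))
      = (\<Sum>s\<in>K - {0}. chi (- (s * t)) * (G ^ d * (\<Sum>z\<in>P \<times> Q. chi (s * nrm (fst z - snd z)))))"
  proof -
    have "of_real (real q * real (card {z \<in> P \<times> Q. nrm (fst z - snd z) = t}) - real (card (P \<times> Q)))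
        = (\<Sum>s\<in>K - {0}. chi (- (s * t)) * (\<Sum>z\<in>P \<times> Q. chi (s * nrm (fst z - snd z))))"
      using fin t subsetD[OF P] subsetD[OF Q] by (intro q_times_card) auto
    thus ?thesis unfolding sum_distrib_left by (simp only: sum_distrib_left mult_ac)
  qed
  also have "\<dots> = (\<Sum>s\<in>K - {0}. \<Sum>\<xi>\<in>V. p (2 * \<xi>) * cnj (r (2 * \<xi>)) * (\<epsilon> s * chi (- t * s + (- nrm \<xi>) * kinv s)))"
  proof (rule sum.cong[OF refl])
    fix s assume s: "s \<in> K - {0}"
    have "chi (- (s * t)) * (p (2 * \<xi>) * cnj (r (2 * \<xi>)) * (\<epsilon> s * chi (- (nrm \<xi> * kinv s))))
        = p (2 * \<xi>) * cnj (r (2 * \<xi>)) * (\<epsilon> s * chi (- t * s + (- nrm \<xi>) * kinv s))" for \<xi>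
    proof -
      have "chi (- t * s + (- nrm \<xi>) * kinv s) = chi (- (s * t)) * chi (- (nrm \<xi> * kinv s))"
        by (simp only: chi_add minus_mult_left[symmetric] mult.commute[of t s])
      thus ?thesis by (simp only: mult_ac)
    qed
    thus "chi (- (s * t)) * (G ^ d * (\<Sum>z\<in>P \<times> Q. chi (s * nrm (fst z - snd z))))
        = (\<Sum>\<xi>\<in>V. p (2 * \<xi>) * cnj (r (2 * \<xi>)) * (\<epsilon> s * chi (- t * s + (- nrm \<xi>) * kinv s)))"
      using s by (subst expand) (auto simp only: sum_distrib_left)
  qed
  also have "\<dots> = (\<Sum>\<xi>\<in>V. p (2 * \<xi>) * cnj (r (2 * \<xi>)) * kloosterman \<epsilon> (- t) (- nrm \<xi>))"
    by (subst sum.swap) (simp add: kloosterman_def sum_distrib_left)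
  finally have "G ^ d * of_real (real q * real (card {z \<in> P \<times> Q. nrm (fst z - snd z) = t}) - real (card (P \<times> Q)))
      = (\<Sum>\<xi>\<in>V. p (2 * \<xi>) * cnj (r (2 * \<xi>)) * kloosterman \<epsilon> (- t) (- nrm \<xi>))" .
  from arg_cong[OF this, of cmod]
  have "cmod G ^ d * \<bar>real q * real (card {z \<in> P \<times> Q. nrm (fst z - snd z) = t}) - real (card (P \<times> Q))\<bar>
      = cmod (\<Sum>\<xi>\<in>V. p (2 * \<xi>) * cnj (r (2 * \<xi>)) * kloosterman \<epsilon> (- t) (- nrm \<xi>))"
    by (simp only: norm_mult norm_power norm_of_real)
  also have "\<dots> \<le> (\<Sum>\<xi>\<in>V. cmod (p (2 * \<xi>)) * cmod (r (2 * \<xi>)) * \<kappa>)"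
    using \<kappa> unfolding \<epsilon>_def[symmetric]
    by (intro order_trans[OF norm_sum] sum_mono) (auto simp: norm_mult intro!: mult_left_mono)
  also have "\<dots> = (\<Sum>\<xi>\<in>V. cmod (p \<xi>) * cmod (r \<xi>) * \<kappa>)"
    using sum.reindex_bij_betw[OF bij_double_V, of "\<lambda>\<xi>. cmod (p \<xi>) * cmod (r \<xi>) * \<kappa>"] .
  also have "\<dots> = (\<Sum>\<xi>\<in>V. cmod (p \<xi>) * cmod (r \<xi>)) * \<kappa>" by (simp add: sum_distrib_right)
  also have "\<dots> \<le> (sqrt (\<Sum>\<xi>\<in>V. (cmod (p \<xi>))\<^sup>2) * sqrt (\<Sum>\<xi>\<in>V. (cmod (r \<xi>))\<^sup>2)) * \<kappa>"
    using order_trans[OF norm_ge_zero \<kappa>[OF zero_K]] by (intro mult_right_mono sum_norm_mult_le)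
  also have "(\<Sum>\<xi>\<in>V. (cmod (p \<xi>))\<^sup>2) = real q ^ d * real (card P)"
    using parseval_V[OF P, of "\<lambda>_. 1"] by (simp add: p_def)
  also have "(\<Sum>\<xi>\<in>V. (cmod (r \<xi>))\<^sup>2) = real q ^ d * real (card Q)"
    using parseval_V[OF Q, of "\<lambda>_. 1"] by (simp add: r_def)
  also have "sqrt (real q ^ d * real (card P)) * sqrt (real q ^ d * real (card Q)) * \<kappa>
      = sqrt (real q) ^ d * (sqrt (real q) ^ d * \<kappa> * sqrt (real (card P) * real (card Q)))"
    by (simp add: real_sqrt_mult real_sqrt_power)
  finally have "sqrt (real q) ^ d * \<bar>real q * real (card {z \<in> P \<times> Q. nrm (fst z - snd z) = t}) - real (card (P \<times> Q))\<bar>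
      \<le> sqrt (real q) ^ d * (sqrt (real q) ^ d * \<kappa> * sqrt (real (card P) * real (card Q)))"
    unfolding normG .
  thus ?thesis by (subst (asm) mult_le_cancel_left_pos) (auto simp: card_cartesian_product)
qed

lemma card_sphere:
  assumes t: "t \<in> K"
  shows "\<bar>real q * real (card {x \<in> V. nrm x = t}) - real q ^ d\<bar>
    \<le> sqrt (real q) ^ d * cmod (kloosterman (\<lambda>x. of_real (eta x) ^ d) (- t) 0)"
proof -
  have "of_real (real q * real (card {x \<in> V. nrm x = t}) - real (card V))
      = (\<Sum>s\<in>K - {0}. chi (- (s * t)) * gauss s ^ d)"
    using t by (subst q_times_card) (auto simp: gauss_power)
  also have "\<dots> = (\<Sum>s\<in>K - {0}. gauss e ^ d * (of_real (eta s) ^ d * chi (- t * s + 0 * kinv s)))"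
  proof (rule sum.cong[OF refl])
    fix s assume "s \<in> K - {0}"
    hence "gauss s = of_real (eta s) * gauss e" by (intro gauss_eta) auto
    thus "chi (- (s * t)) * gauss s ^ d = gauss e ^ d * (of_real (eta s) ^ d * chi (- t * s + 0 * kinv s))"
      by (simp add: power_mult_distrib mult_ac)
  qed
  also have "\<dots> = gauss e ^ d * kloosterman (\<lambda>x. of_real (eta x) ^ d) (- t) 0"
    by (simp add: kloosterman_def sum_distrib_left)
  finally have "of_real (real q * real (card {x \<in> V. nrm x = t}) - real (card V))
      = gauss e ^ d * kloosterman (\<lambda>x. of_real (eta x) ^ d) (- t) 0" .
  from arg_cong[OF this, of cmod]
  have "\<bar>real q * real (card {x \<in> V. nrm x = t}) - real (card V)\<bar>
      = cmod (gauss e) ^ d * cmod (kloosterman (\<lambda>x. of_real (eta x) ^ d) (- t) 0)"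
    by (simp only: norm_mult norm_power norm_of_real)
  moreover have "cmod (gauss e) = sqrt (real q)" using norm_gauss[of e] by (simp add: real_sqrt_unique)
  ultimately show ?thesis by (simp add: card_V)
qed

end

section \<open>Pairs of points with a given dot product\<close>

context quadratic_space begin

text \<open>
  Here the prescribed quantity is a dot product, and \<open>Q\<close> lies on a sphere. By Cauchy-Schwarz in
  \<open>x\<close> and Parseval, the error is controlled by the number of coincidences \<open>c y = c' y'\<close> with
  \<open>c, c' \<noteq> 0\<close> and \<open>y, y' \<in> Q\<close>. As \<open>y\<close> and \<open>y'\<close> have the same nonzero norm, \<open>c' = c\<close> or
  \<open>c' = - c\<close>, so every element takes part in at most two. For arbitrary \<open>Q\<close> a whole line of
  multiples could occur.
\<close>

lemma dot_pairs:
  assumes P: "P \<subseteq> V" and Q: "Q \<subseteq> V" and s: "s \<in> K" and b: "b \<noteq> 0" and Qb: "\<And>y. y \<in> Q \<Longrightarrow> nrm y = b"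
  shows "\<bar>real q * real (card {z \<in> P \<times> Q. dot (fst z) (snd z) = s}) - real (card P) * real (card Q)\<bar>
    \<le> sqrt 2 * sqrt (real q) ^ (d + 1) * sqrt (real (card P) * real (card Q))"
proof -
  have fin: "finite P" "finite Q" using P Q finite_V by (auto intro: finite_subset)
  define Z where "Z = (K - {0}) \<times> Q"
  define a where "a z = chi (- (fst z * s))" for z :: "'r \<times> (nat \<Rightarrow> 'r)"
  define \<phi> where "\<phi> z = smul (fst z) (snd z)" for z :: "'r \<times> (nat \<Rightarrow> 'r)"
  define g where "g x = (\<Sum>z\<in>Z. a z * chi (dot x (\<phi> z)))" for x
  have finZ: "finite Z" using fin by (simp add: Z_def)
  have \<phi>V: "\<phi> z \<in> V" if "z \<in> Z" for z using that Q by (auto simp: Z_def \<phi>_def)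
  have "of_real (real q * real (card {z \<in> P \<times> Q. dot (fst z) (snd z) = s}) - real (card (P \<times> Q)))
      = (\<Sum>c\<in>K - {0}. chi (- (c * s)) * (\<Sum>z\<in>P \<times> Q. chi (c * dot (fst z) (snd z))))"
    using s P Q fin by (intro q_times_card) auto
  also have "\<dots> = (\<Sum>c\<in>K - {0}. \<Sum>x\<in>P. \<Sum>y\<in>Q. chi (- (c * s)) * chi (c * dot x y))"
    by (simp add: sum.cartesian_product sum_distrib_left case_prod_beta)
  also have "\<dots> = (\<Sum>x\<in>P. \<Sum>c\<in>K - {0}. \<Sum>y\<in>Q. chi (- (c * s)) * chi (c * dot x y))"
    by (rule sum.swap)
  also have "\<dots> = (\<Sum>x\<in>P. g x)"
    by (simp add: g_def Z_def a_def \<phi>_def sum.cartesian_product case_prod_beta dot_smul_right)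
  finally have eq: "of_real (real q * real (card {z \<in> P \<times> Q. dot (fst z) (snd z) = s}) - real (card (P \<times> Q)))
      = (\<Sum>x\<in>P. g x)" .
  have "\<bar>real q * real (card {z \<in> P \<times> Q. dot (fst z) (snd z) = s}) - real (card (P \<times> Q))\<bar> = cmod (\<Sum>x\<in>P. g x)"
    unfolding eq[symmetric] by (rule norm_of_real[symmetric])
  also have "\<dots> \<le> (\<Sum>x\<in>P. cmod 1 * cmod (g x))" by (simp add: norm_sum)
  also have "\<dots> \<le> sqrt (\<Sum>x\<in>P. (cmod 1)\<^sup>2) * sqrt (\<Sum>x\<in>P. (cmod (g x))\<^sup>2)" by (rule sum_norm_mult_le)
  also have "\<dots> \<le> sqrt (real (card P)) * sqrt (2 * real q ^ (d + 1) * real (card Q))"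
  proof (intro mult_mono real_sqrt_le_mono)
    have "(\<Sum>x\<in>P. (cmod (g x))\<^sup>2) \<le> (\<Sum>x\<in>V. (cmod (g x))\<^sup>2)" using P by (intro sum_mono2) auto
    also have "\<dots> \<le> real q ^ d * cmod (\<Sum>z\<in>Z. \<Sum>z'\<in>{z' \<in> Z. \<phi> z' = \<phi> z}. a z * cnj (a z'))"
    proof -
      have "of_real (\<Sum>x\<in>V. (cmod (g x))\<^sup>2) = of_nat q ^ d * (\<Sum>z\<in>Z. \<Sum>z'\<in>{z' \<in> Z. \<phi> z' = \<phi> z}. a z * cnj (a z'))"
        unfolding g_def by (rule sum_chi_dot_sq[OF finZ \<phi>V])
      from arg_cong[OF this, of cmod] show ?thesis
        by (simp only: norm_of_real norm_mult norm_power norm_of_nat)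
    qed
    also have "\<dots> \<le> real q ^ d * (\<Sum>z\<in>Z. 2)"
    proof (rule mult_left_mono[OF order_trans[OF norm_sum sum_mono]])
      fix z assume z: "z \<in> Z"
      \<comment> \<open>Comparing norms gives \<open>c' = c\<close> or \<open>c' = - c\<close>, and then \<open>y'\<close> is determined.\<close>
      have sub: "{z' \<in> Z. \<phi> z' = \<phi> z} \<subseteq> (\<lambda>\<sigma>. (\<sigma> * fst z, smul \<sigma> (snd z))) ` {e, - e}"
      proof
        fix z' assume "z' \<in> {z' \<in> Z. \<phi> z' = \<phi> z}"
        hence z': "z' \<in> Z" "\<phi> z' = \<phi> z" by auto
        obtain c y c' y' where zz: "z = (c, y)" "z' = (c', y')" by (metis surj_pair)
        have K: "c \<in> K" "c' \<in> K" "c \<noteq> 0" "c' \<noteq> 0" "y \<in> V" "y' \<in> V" "nrm y = b" "nrm y' = b"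
          using z z' zz Q Qb by (auto simp: Z_def)
        have bK: "b \<in> K" using K(5,7) dot_K(1) by blast
        have eq: "smul c' y' = smul c y" using z' zz by (simp add: \<phi>_def)
        have "nrm (smul c' y') = nrm (smul c y)" unfolding eq ..
        hence "b * (c' * c') = b * (c * c)" using K by (simp add: dot_linear mult_ac)
        hence "c' * c' = c * c" using mult_left_cancel_K[of b "c' * c'" "c * c"] b bK K by simp
        hence cc: "c' = c \<or> c' = - c" using square_eq_iff_K K by blast
        have y': "y' = smul (kinv c') (smul c y)"
        proof -
          have "y' = smul (kinv c') (smul c' y')" using K by simp
          thus ?thesis unfolding eq .
        qed
        show "z' \<in> (\<lambda>\<sigma>. (\<sigma> * fst z, smul \<sigma> (snd z))) ` {e, - e}"
        proof (cases "c' = c")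
          case True
          thus ?thesis using y' K zz by auto
        next
          case False
          hence "c' = - c" using cc by simp
          moreover from this have "kinv c' * c = - e" using K by (simp add: kinv_minus)
          ultimately show ?thesis using y' K zz by auto
        qed
      qed
      have "card {z' \<in> Z. \<phi> z' = \<phi> z} \<le> card ((\<lambda>\<sigma>. (\<sigma> * fst z, smul \<sigma> (snd z))) ` {e, - e})"
        by (intro card_mono sub) auto
      also have "\<dots> \<le> card {e, - e}" by (intro card_image_le) auto
      also have "\<dots> \<le> 2" by (simp add: card_insert_if)
      finally have card2: "real (card {z' \<in> Z. \<phi> z' = \<phi> z}) \<le> 2" by simp
      have "cmod (\<Sum>z'\<in>{z' \<in> Z. \<phi> z' = \<phi> z}. a z * cnj (a z')) \<le> (\<Sum>z'\<in>{z' \<in> Z. \<phi> z' = \<phi> z}. 1)"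
        by (rule sum_norm_le) (simp add: norm_mult a_def)
      thus "cmod (\<Sum>z'\<in>{z' \<in> Z. \<phi> z' = \<phi> z}. a z * cnj (a z')) \<le> 2" using card2 by simp
    qed auto
    also have "\<dots> = real q ^ d * (2 * (real (q - 1) * real (card Q)))"
      by (simp add: Z_def card_cartesian_product card_units)
    also have "\<dots> \<le> real q ^ d * (2 * (real q * real (card Q)))"
      by (intro mult_left_mono mult_right_mono) auto
    finally show "(\<Sum>x\<in>P. (cmod (g x))\<^sup>2) \<le> 2 * real q ^ (d + 1) * real (card Q)" by (simp add: mult_ac)
  qed (auto intro!: sum_nonneg)
  also have "\<dots> = sqrt 2 * sqrt (real q) ^ (d + 1) * sqrt (real (card P) * real (card Q))"
    by (simp add: real_sqrt_mult real_sqrt_power mult_ac)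
  finally show ?thesis by (simp add: card_cartesian_product)
qed

section \<open>Orthogonality and linear independence\<close>

text \<open>
  By Parseval: the exponential sum over \<open>W\<close> takes its maximal value \<open>|W|\<close> at every point of
  \<open>W'\<close>.
\<close>

lemma orthogonal_sets:
  assumes W: "W \<subseteq> V" and W': "W' \<subseteq> V" and orth: "\<And>x y. x \<in> W' \<Longrightarrow> y \<in> W \<Longrightarrow> dot x y = 0"
  shows "card W * card W' \<le> q ^ d"
proof (cases "W = {}")
  case False
  have finW: "finite W" "finite W'" using W W' finite_V by (auto intro: finite_subset)
  have "real (card W') * (real (card W))\<^sup>2 = (\<Sum>x\<in>W'. (cmod (\<Sum>y\<in>W. 1 * chi (dot x y)))\<^sup>2)"
    using orth by simp
  also have "\<dots> \<le> (\<Sum>x\<in>V. (cmod (\<Sum>y\<in>W. 1 * chi (dot x y)))\<^sup>2)" using W' by (intro sum_mono2) auto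
  also have "\<dots> = real q ^ d * real (card W)" using parseval_V[OF W, of "\<lambda>_. 1"] by simp
  finally have "real (card W * card W') * real (card W) \<le> real (q ^ d) * real (card W)"
    by (simp add: power2_eq_square mult_ac)
  moreover have "real (card W) > 0" using False finW by (simp add: card_gt_0_iff)
  ultimately have "real (card W * card W') \<le> real (q ^ d)" by (simp only: mult_le_cancel_right_pos)
  thus ?thesis by linarith
qed auto

text \<open>
  A totally isotropic set is orthogonal to itself, and also to the \<open>q\<close> translates of itself
  along \<open>v\<close>. The vector \<open>v\<close> thus improves the bound \<open>q^(d/2)\<close> for totally isotropic sets by the
  factor \<open>sqrt q\<close>.
\<close>

lemma isotropic_card:
  assumes W: "W \<subseteq> V" and iso: "\<And>x y. x \<in> W \<Longrightarrow> y \<in> W \<Longrightarrow> dot x y = 0"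
    and v: "v \<in> V" "nrm v \<noteq> 0" and perp: "\<And>x. x \<in> W \<Longrightarrow> dot x v = 0"
  shows "q * (card W)\<^sup>2 \<le> q ^ d"
proof -
  let ?f = "\<lambda>(c, x). x + smul c v"
  have "inj_on ?f (K \<times> W)"
  proof (rule inj_onI, clarify)
    fix c x c' x' assume *: "c \<in> K" "c' \<in> K" "x \<in> W" "x' \<in> W" and eq: "x + smul c v = x' + smul c' v"
    have "dot (x + smul c v) v = dot (x' + smul c' v) v" using eq by simp
    hence "nrm v * c = nrm v * c'" using perp * by (simp add: dot_linear mult.commute)
    hence "c = c'" using mult_left_cancel_K[of "nrm v" c c'] v * by simp
    thus "c = c' \<and> x = x'" using eq by simp
  qed
  hence "card (?f ` (K \<times> W)) = q * card W" by (simp add: card_image card_cartesian_product q_def)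
  moreover have "card W * card (?f ` (K \<times> W)) \<le> q ^ d"
  proof (rule orthogonal_sets[OF W])
    show "?f ` (K \<times> W) \<subseteq> V" using W v by auto
    fix x y assume "x \<in> ?f ` (K \<times> W)" "y \<in> W"
    thus "dot x y = 0" using iso perp by (auto simp: dot_linear dot_commute[of v y])
  qed
  ultimately show ?thesis by (simp add: power2_eq_square mult_ac)
qed

definition independent :: "'i set \<Rightarrow> ('i \<Rightarrow> nat \<Rightarrow> 'r) \<Rightarrow> bool" where
  "independent I v \<longleftrightarrow> finite I \<and> (\<forall>i\<in>I. v i \<in> V) \<and> (\<forall>c. (\<forall>i\<in>I. c i \<in> K) \<longrightarrow> lincomb I c v = 0 \<longrightarrow> (\<forall>i\<in>I. c i = 0))"

lemma independentD: "independent I v \<Longrightarrow> (\<And>i. i \<in> I \<Longrightarrow> c i \<in> K) \<Longrightarrow> lincomb I c v = 0 \<Longrightarrow> i \<in> I \<Longrightarrow> c i = 0"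
  unfolding independent_def by blast

lemma independent_subset: "independent I v \<Longrightarrow> J \<subseteq> I \<Longrightarrow> independent J v"
proof -
  assume ind: "independent I v" and J: "J \<subseteq> I"
  have fin: "finite I" "finite J" using ind J by (auto simp: independent_def intro: finite_subset)
  show ?thesis unfolding independent_def
  proof (intro conjI allI impI ballI)
    fix c i assume c: "\<forall>i\<in>J. c i \<in> K" and 0: "lincomb J c v = 0" and i: "i \<in> J"
    define c' where "c' i = (if i \<in> J then c i else 0)" for i
    have "lincomb I c' v = lincomb J c v"
      unfolding lincomb_def c'_def using fin J
      by (intro ext sum.mono_neutral_cong_right) auto
    hence c'0: "lincomb I c' v = 0" using 0 by simp
    have c'K: "c' j \<in> K" for j using c by (simp add: c'_def)
    have "c' i = 0" by (rule independentD[OF ind c'K c'0 subsetD[OF J i]])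
    thus "c i = 0" using i by (simp add: c'_def)
  qed (use fin ind J in \<open>auto simp: independent_def\<close>)
qed

text \<open>
  Detect each equation by characters and sum over \<open>x\<close> first: by independence, only the zero
  coefficient vector contributes.
\<close>

lemma card_linear_system:
  assumes ind: "independent I v" and s: "\<And>i. i \<in> I \<Longrightarrow> s i \<in> K"
  shows "q ^ card I * card {x \<in> V. \<forall>i\<in>I. dot x (v i) = s i} = q ^ d"
proof -
  have I: "finite I" "\<And>i. i \<in> I \<Longrightarrow> v i \<in> V" using ind by (auto simp: independent_def)
  have "(of_nat (q ^ card I * card {x \<in> V. \<forall>i\<in>I. dot x (v i) = s i}) :: complex)
      = (\<Sum>x\<in>V. \<Prod>i\<in>I. if dot x (v i) = s i then of_nat q else 0)"
  proof -
    have "(\<Prod>i\<in>I. if dot x (v i) = s i then of_nat q else 0)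
        = (if \<forall>i\<in>I. dot x (v i) = s i then of_nat q ^ card I else (0::complex))" for x
      using I by (auto intro!: prod_zero)
    thus ?thesis by (simp add: sum.If_cases Int_def mult.commute)
  qed
  also have "\<dots> = (\<Sum>x\<in>V. \<Prod>i\<in>I. \<Sum>c\<in>K. chi (c * (dot x (v i) - s i)))"
    using I s by (intro sum.cong prod.cong refl) (simp add: sum_chi_mult)
  also have "\<dots> = (\<Sum>x\<in>V. \<Sum>c\<in>I \<rightarrow>\<^sub>E K. \<Prod>i\<in>I. chi (c i * (dot x (v i) - s i)))"
    using I by (simp add: prod_sum_PiE)
  also have "\<dots> = (\<Sum>c\<in>I \<rightarrow>\<^sub>E K. \<Sum>x\<in>V. chi (- (\<Sum>i\<in>I. c i * s i)) * chi (dot x (lincomb I c v)))"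
    by (subst sum.swap) (intro sum.cong refl,
      simp add: dot_lincomb_right right_diff_distrib sum_subtractf flip: chi_add chi_sum)
  also have "\<dots> = (\<Sum>c\<in>I \<rightarrow>\<^sub>E K. if c = (\<lambda>i\<in>I. 0) then of_nat q ^ d else 0)"
  proof (rule sum.cong[OF refl])
    fix c assume c: "c \<in> I \<rightarrow>\<^sub>E K"
    have "lincomb I c v = 0 \<longleftrightarrow> c = (\<lambda>i\<in>I. 0)"
    proof
      assume "lincomb I c v = 0"
      hence "c i = 0" if "i \<in> I" for i using that c by (intro independentD[OF ind]) auto
      thus "c = (\<lambda>i\<in>I. 0)" using c by (auto simp: PiE_def extensional_def fun_eq_iff)
    next
      assume "c = (\<lambda>i\<in>I. 0)"
      thus "lincomb I c v = 0" by (simp add: lincomb_def fun_eq_iff)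
    qed
    moreover have "(\<Sum>x\<in>V. chi (dot x (lincomb I c v))) = (if lincomb I c v = 0 then of_nat q ^ d else 0)"
      using I by (intro sum_chi_dot) auto
    ultimately show "(\<Sum>x\<in>V. chi (- (\<Sum>i\<in>I. c i * s i)) * chi (dot x (lincomb I c v)))
        = (if c = (\<lambda>i\<in>I. 0) then of_nat q ^ d else 0)"
      by (auto simp flip: sum_distrib_left)
  qed
  also have "\<dots> = of_nat (q ^ d)" using I by (simp add: sum.delta finite_PiE restrict_PiE_iff)
  finally show ?thesis by (simp only: of_nat_eq_iff)
qed

section \<open>Quadrics on a subspace\<close>

lemma card_quadratic_roots:
  assumes "a \<in> K" "b \<in> K" "c \<in> K" "a \<noteq> 0"
  shows "card {x \<in> K. a * (x * x) + b * x + c = 0} \<le> 2"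
proof -
  define f where "f i = [c, b, a] ! i" for i :: nat
  have eq: "(\<Sum>i\<le>2. f i * x ^ i) = a * (x * x) + b * x + c" for x
    by (simp add: f_def eval_nat_numeral algebra_simps)
  have "\<forall>i\<le>2. f i \<in> K" "f 2 \<noteq> 0" using assms by (auto simp: f_def le_Suc_eq numeral_eq_Suc)
  from card_roots[OF this] show ?thesis unfolding eq .
qed

text \<open>
  Each line in direction \<open>h\<close> meets the quadric in at most two points, since the norm is a
  quadratic polynomial with leading coefficient \<open>nrm h\<close> along it.
\<close>

lemma card_quadric:
  assumes W: "W \<subseteq> V" and closed: "\<And>x c. x \<in> W \<Longrightarrow> c \<in> K \<Longrightarrow> x + smul c h \<in> W"
    and h: "h \<in> V" "nrm h \<noteq> 0" and u: "u \<in> V" and t: "t \<in> K"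
  shows "q * card {x \<in> W. nrm (u + x) = t} \<le> 2 * card W"
proof -
  have finW: "finite W" using W finite_V by (rule finite_subset)
  have shift: "bij_betw (\<lambda>x. x + smul c h) W W" if "c \<in> K" for c
  proof (rule bij_betwI[where g="\<lambda>x. x + smul (- c) h"])
    have "smul (- c) h = - smul c h" by (simp add: smul_def fun_eq_iff)
    thus "x + smul c h + smul (- c) h = x" "x + smul (- c) h + smul c h = x" for x by simp_all
  qed (use that closed in auto)
  have "q * card {x \<in> W. nrm (u + x) = t} = (\<Sum>c\<in>K. \<Sum>x\<in>W. if nrm (u + x) = t then 1 else 0)"
    using finW by (simp add: q_def sum.If_cases Int_def)
  also have "\<dots> = (\<Sum>c\<in>K. \<Sum>x\<in>W. if nrm (u + (x + smul c h)) = t then 1 else 0)"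
    by (rule sum.cong[OF refl], rule sum.reindex_bij_betw[OF shift, symmetric])
  also have "\<dots> = (\<Sum>x\<in>W. \<Sum>c\<in>K. if nrm (u + (x + smul c h)) = t then 1 else 0)" by (rule sum.swap)
  also have "\<dots> \<le> (\<Sum>x\<in>W. 2)"
  proof (rule sum_mono)
    fix x assume x: "x \<in> W"
    hence xV: "x \<in> V" using W by blast
    have "(\<Sum>c\<in>K. if nrm (u + (x + smul c h)) = t then 1 else 0) = card {c \<in> K. nrm (u + (x + smul c h)) = t}"
      by (simp add: sum.If_cases Int_def)
    also have "{c \<in> K. nrm (u + (x + smul c h)) = t}
        = {c \<in> K. nrm h * (c * c) + (2 * dot (u + x) h) * c + (nrm (u + x) - t) = 0}"
    proof (rule Collect_cong, rule conj_cong[OF refl])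
      fix c
      have "nrm (u + (x + smul c h)) - t = nrm h * (c * c) + (2 * dot (u + x) h) * c + (nrm (u + x) - t)"
        using dot_commute[of h u] dot_commute[of h x] by (simp add: dot_linear algebra_simps)
      thus "nrm (u + (x + smul c h)) = t \<longleftrightarrow> nrm h * (c * c) + (2 * dot (u + x) h) * c + (nrm (u + x) - t) = 0"
        by (metis eq_iff_diff_eq_0)
    qed
    also have "card \<dots> \<le> 2" using h u xV t by (intro card_quadratic_roots) auto
    finally show "(\<Sum>c\<in>K. if nrm (u + (x + smul c h)) = t then 1 else 0) \<le> (2::nat)" .
  qed
  finally show ?thesis by simp
qed

text \<open>
  By polarization a subspace of isotropic vectors is totally isotropic, hence small.
\<close>

lemma exists_anisotropic:
  assumes W: "W \<subseteq> V" and add: "\<And>x y. x \<in> W \<Longrightarrow> y \<in> W \<Longrightarrow> x + y \<in> W"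
    and big: "q ^ d < (card W)\<^sup>2"
  shows "\<exists>h\<in>W. nrm h \<noteq> 0"
proof (rule ccontr)
  assume "\<not> ?thesis"
  hence iso: "nrm h = 0" if "h \<in> W" for h using that by blast
  have "dot x y = 0" if "x \<in> W" "y \<in> W" for x y
  proof -
    have "2 * dot x y = nrm (x + y) - nrm x - nrm y"
      using dot_commute[of y x] by (simp add: dot_linear algebra_simps)
    hence "2 * dot x y = 0" using that iso add by simp
    thus ?thesis using two_mult_eq_0[of "dot x y"] that W by auto
  qed
  hence "card W * card W \<le> q ^ d" by (intro orthogonal_sets W)
  thus False using big by (simp add: power2_eq_square)
qed

end

section \<open>Isometries and the theorem of Witt\<close>

text \<open>
  Vector identities are proved at the level of vectors; evaluating them pointwise would hide \<open>+\<close>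
  and \<open>-\<close> on \<open>V\<close>.
\<close>

declare zero_fun_apply [simp del] plus_fun_apply [simp del] minus_apply [simp del] uminus_apply [simp del]

context quadratic_space begin

text \<open>
  Isometries are extensional on \<open>V\<close>, so that each is determined by its values there and their
  number is finite.
\<close>

definition isometries :: "((nat \<Rightarrow> 'r) \<Rightarrow> (nat \<Rightarrow> 'r)) set" where
  "isometries = {\<theta> \<in> V \<rightarrow>\<^sub>E V. (\<forall>x\<in>V. \<forall>y\<in>V. \<theta> (x + y) = \<theta> x + \<theta> y)
     \<and> (\<forall>c\<in>K. \<forall>x\<in>V. \<theta> (smul c x) = smul c (\<theta> x)) \<and> (\<forall>x\<in>V. \<forall>y\<in>V. dot (\<theta> x) (\<theta> y) = dot x y)}"

lemma finite_isometries [simp]: "finite isometries"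
  by (rule finite_subset[of _ "V \<rightarrow>\<^sub>E V"]) (auto simp: isometries_def intro: finite_PiE)

lemma isometry_V: "\<theta> \<in> isometries \<Longrightarrow> x \<in> V \<Longrightarrow> \<theta> x \<in> V"
  and isometry_add: "\<theta> \<in> isometries \<Longrightarrow> x \<in> V \<Longrightarrow> y \<in> V \<Longrightarrow> \<theta> (x + y) = \<theta> x + \<theta> y"
  and isometry_smul: "\<theta> \<in> isometries \<Longrightarrow> c \<in> K \<Longrightarrow> x \<in> V \<Longrightarrow> \<theta> (smul c x) = smul c (\<theta> x)"
  and isometry_dot: "\<theta> \<in> isometries \<Longrightarrow> x \<in> V \<Longrightarrow> y \<in> V \<Longrightarrow> dot (\<theta> x) (\<theta> y) = dot x y"
  by (auto simp: isometries_def)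

lemma isometry_zero: "\<theta> \<in> isometries \<Longrightarrow> \<theta> 0 = 0"
  using isometry_smul[of \<theta> 0 0] by simp

lemma isometry_diff: "\<theta> \<in> isometries \<Longrightarrow> x \<in> V \<Longrightarrow> y \<in> V \<Longrightarrow> \<theta> (x - y) = \<theta> x - \<theta> y"
  using isometry_add[of \<theta> "x - y" y] by simp

lemmas isometry_simps = isometry_V isometry_dot isometry_zero isometry_add isometry_smul isometry_diff

lemma lincomb_insert: "finite I \<Longrightarrow> i \<notin> I \<Longrightarrow> lincomb (insert i I) c v = smul (c i) (v i) + lincomb I c v"
  by (simp add: lincomb_def smul_def plus_fun_def)

lemma isometry_lincomb:
  assumes \<theta>: "\<theta> \<in> isometries" and "finite I" "\<forall>i\<in>I. c i \<in> K \<and> v i \<in> V"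
  shows "\<theta> (lincomb I c v) = lincomb I c (\<lambda>i. \<theta> (v i))"
  using assms(2,3)
proof (induction I rule: finite_induct)
  case empty
  have "lincomb {} c v = 0" "lincomb {} c (\<lambda>i. \<theta> (v i)) = 0" by (simp_all add: lincomb_def zero_fun_def)
  thus ?case using \<theta> by (simp add: isometry_simps[OF \<theta>])
next
  case (insert i I)
  thus ?case using \<theta> by (simp add: lincomb_insert isometry_simps[OF \<theta>])
qed

lemma dot_nondegenerate: "x \<in> V \<Longrightarrow> (\<And>y. y \<in> V \<Longrightarrow> dot x y = 0) \<Longrightarrow> x = 0"
proof (rule ccontr)
  assume x: "x \<in> V" and 0: "\<And>y. y \<in> V \<Longrightarrow> dot x y = 0" and "x \<noteq> 0"
  hence "(\<Sum>y\<in>V. chi (dot y x)) = 0" by (simp add: sum_chi_dot)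
  moreover have "(\<Sum>y\<in>V. chi (dot y x)) = of_nat (card V)" using 0 by (simp add: dot_commute[of _ x])
  ultimately show False by (simp add: card_V)
qed

lemma inj_on_isometry: "\<theta> \<in> isometries \<Longrightarrow> inj_on \<theta> V"
proof (rule inj_onI)
  fix x y assume \<theta>: "\<theta> \<in> isometries" and xy: "x \<in> V" "y \<in> V" and eq: "\<theta> x = \<theta> y"
  have "x - y = 0"
  proof (rule dot_nondegenerate)
    fix z assume z: "z \<in> V"
    have "dot (x - y) z = dot (\<theta> (x - y)) (\<theta> z)" using isometry_dot[OF \<theta>] xy z by simp
    also have "\<theta> (x - y) = 0" using isometry_diff[OF \<theta>] xy eq by simp
    finally show "dot (x - y) z = 0" by simp
  qed (use xy in simp)
  thus "x = y" by simp
qed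

lemma bij_isometry: "\<theta> \<in> isometries \<Longrightarrow> bij_betw \<theta> V V"
  using inj_on_isometry[of \<theta>] isometry_V[of \<theta>]
  by (metis bij_betw_def endo_inj_surj finite_V image_subsetI)

lemma isometry_comp: "\<theta> \<in> isometries \<Longrightarrow> \<rho> \<in> isometries \<Longrightarrow> compose V \<theta> \<rho> \<in> isometries"
proof -
  assume \<theta>: "\<theta> \<in> isometries" and \<rho>: "\<rho> \<in> isometries"
  show ?thesis
    unfolding isometries_def
    by (auto simp: compose_def isometry_simps[OF \<theta>] isometry_simps[OF \<rho>])
qed

lemma isometry_id: "restrict (\<lambda>x. x) V \<in> isometries"
  by (auto simp: isometries_def)

lemma isometry_inverse:
  assumes \<theta>: "\<theta> \<in> isometries"
  obtains \<rho> where "\<rho> \<in> isometries" "\<And>x. x \<in> V \<Longrightarrow> \<rho> (\<theta> x) = x" "\<And>x. x \<in> V \<Longrightarrow> \<theta> (\<rho> x) = x"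
proof -
  define \<rho> where "\<rho> = restrict (inv_into V \<theta>) V"
  have 1: "\<rho> (\<theta> x) = x" if "x \<in> V" for x
    using that inj_on_isometry[OF \<theta>] by (simp add: \<rho>_def inv_into_f_f isometry_V[OF \<theta>])
  have 2: "\<theta> (\<rho> x) = x" if "x \<in> V" for x
    using that bij_betw_inv_into_right[OF bij_isometry[OF \<theta>]] by (simp add: \<rho>_def)
  have \<rho>V: "\<rho> x \<in> V" if "x \<in> V" for x
    using that bij_betwE[OF bij_betw_inv_into[OF bij_isometry[OF \<theta>]]] by (simp add: \<rho>_def)
  have "\<rho> \<in> isometries"
    unfolding isometries_def
  proof (intro CollectI conjI ballI)
    show "\<rho> \<in> V \<rightarrow>\<^sub>E V" using \<rho>V by (auto simp: \<rho>_def)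
    fix x y assume xy: "x \<in> V" "y \<in> V"
    have "\<rho> (x + y) = \<rho> (\<theta> (\<rho> x + \<rho> y))" using xy \<rho>V 2 by (simp add: isometry_simps[OF \<theta>])
    thus "\<rho> (x + y) = \<rho> x + \<rho> y" using 1 xy \<rho>V by simp
    have "dot (\<rho> x) (\<rho> y) = dot (\<theta> (\<rho> x)) (\<theta> (\<rho> y))" using xy \<rho>V by (simp add: isometry_simps[OF \<theta>])
    thus "dot (\<rho> x) (\<rho> y) = dot x y" using 2 xy by simp
  next
    fix c x assume cx: "c \<in> K" "x \<in> V"
    have "\<rho> (smul c x) = \<rho> (\<theta> (smul c (\<rho> x)))" using cx \<rho>V 2 by (simp add: isometry_simps[OF \<theta>])
    thus "\<rho> (smul c x) = smul c (\<rho> x)" using 1 cx \<rho>V by simp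
  qed
  thus thesis using that 1 2 by blast
qed

definition reflection :: "(nat \<Rightarrow> 'r) \<Rightarrow> (nat \<Rightarrow> 'r) \<Rightarrow> (nat \<Rightarrow> 'r)" where
  "reflection r = (\<lambda>x\<in>V. x - smul (2 * dot x r * kinv (nrm r)) r)"

lemma reflection_isometry:
  assumes r: "r \<in> V" "nrm r \<noteq> 0"
  shows "reflection r \<in> isometries"
  unfolding isometries_def
proof (intro CollectI conjI ballI)
  show "reflection r \<in> V \<rightarrow>\<^sub>E V" using r by (auto simp: reflection_def)
  fix x y assume xy: "x \<in> V" "y \<in> V"
  show "reflection r (x + y) = reflection r x + reflection r y"
    using xy by (simp add: reflection_def dot_linear distrib_left distrib_right smul_add)
  let ?n = "nrm r" and ?i = "kinv (nrm r)"
  have n: "?n * ?i = e" using r by simp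
  have "dot (x - smul (2 * dot x r * ?i) r) (y - smul (2 * dot y r * ?i) r)
      = dot x y - 4 * (dot x r * dot y r * ?i) + 4 * (dot x r * dot y r * ?i * (?n * ?i))"
    using dot_commute[of r y] by (simp add: dot_linear algebra_simps)
  also have "\<dots> = dot x y" unfolding n using r xy by simp
  finally show "dot (reflection r x) (reflection r y) = dot x y" using xy by (simp add: reflection_def)
next
  fix c x assume "c \<in> K" "x \<in> V"
  thus "reflection r (smul c x) = smul c (reflection r x)"
    by (simp add: reflection_def dot_linear smul_add mult_ac)
qed

lemma reflection_fixes: "x \<in> V \<Longrightarrow> dot x r = 0 \<Longrightarrow> reflection r x = x"
  by (simp add: reflection_def)

lemma reflection_swaps:
  assumes "a \<in> V" "b \<in> V" "nrm a = nrm b" "nrm (a - b) \<noteq> 0"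
  shows "reflection (a - b) a = b"
proof -
  have "2 * dot a (a - b) = nrm (a - b)"
    using assms(3) dot_commute[of b a] by (simp add: dot_linear algebra_simps)
  thus ?thesis using assms by (simp add: reflection_def)
qed

lemma independent_nonmember:
  assumes "independent (insert i I) (v(i := a))" "i \<notin> I"
  shows "q ^ Suc (card I) * card {x \<in> V. (\<forall>j\<in>I. dot x (v j) = 0) \<and> dot x a = 0} = q ^ d"
proof -
  have "finite I" using assms by (auto simp: independent_def)
  have "{x \<in> V. \<forall>j\<in>insert i I. dot x ((v(i := a)) j) = 0} = {x \<in> V. (\<forall>j\<in>I. dot x (v j) = 0) \<and> dot x a = 0}"
    using assms(2) by auto
  with card_linear_system[OF assms(1), of "\<lambda>_. 0"] show ?thesis using assms(2) \<open>finite I\<close> by simp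
qed

text \<open>
  The orthogonal complement of fewer than \<open>d / 2\<close> vectors is too large to be totally isotropic.
\<close>

lemma perp_large:
  assumes ind: "independent I v" and small: "2 * card I < d"
  shows "q ^ d < (card {x \<in> V. \<forall>j\<in>I. dot x (v j) = 0})\<^sup>2"
proof -
  let ?W = "{x \<in> V. \<forall>j\<in>I. dot x (v j) = 0}"
  have W: "q ^ card I * card ?W = q ^ d" using card_linear_system[OF ind, of "\<lambda>_. 0"] by simp
  also have "\<dots> = q ^ card I * q ^ (d - card I)" using small by (simp flip: power_add)
  finally have "card ?W = q ^ (d - card I)" by simp
  hence "(card ?W)\<^sup>2 = q ^ (2 * (d - card I))" by (simp flip: power_mult add: mult.commute)
  moreover have "q ^ d < q ^ (2 * (d - card I))" using q_ge_3 small by (intro power_strict_increasing) auto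
  ultimately show ?thesis by simp
qed

text \<open>
  If \<open>a - b\<close> is not isotropic, the reflection along it does the job. Otherwise reflect along
  some \<open>r\<close> first, orthogonal to all \<open>w j\<close> but neither to \<open>a\<close> nor to \<open>b\<close>: the image of \<open>a\<close> has a
  nonisotropic difference from \<open>b\<close>. Such an \<open>r\<close> exists by counting. In the orthogonal complement
  of the \<open>w j\<close>, a fraction of at most \<open>2 / q\<close> of the vectors is isotropic, and a fraction of
  \<open>1 / q\<close> each is orthogonal to \<open>a\<close> and to \<open>b\<close>; this is where \<open>q \<ge> 5\<close> enters.
\<close>

lemma witt_step:
  assumes q5: "q \<ge> 5" and i: "i \<notin> I" and small: "2 * Suc (card I) \<le> d"
    and a: "independent (insert i I) (w(i := a))" and b: "independent (insert i I) (w(i := b))"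
    and prod: "\<And>j. j \<in> I \<Longrightarrow> dot a (w j) = dot b (w j)" and nrm: "nrm a = nrm b"
  shows "\<exists>\<rho>\<in>isometries. (\<forall>j\<in>I. \<rho> (w j) = w j) \<and> \<rho> a = b"
proof -
  have I: "finite I" using a by (auto simp: independent_def)
  have V: "a \<in> V" "b \<in> V" using a b by (auto simp: independent_def)
  have wV: "w j \<in> V" if "j \<in> I" for j
  proof -
    have "(w(i := a)) j \<in> V" using a that unfolding independent_def by blast
    moreover have "j \<noteq> i" using that i by blast
    ultimately show ?thesis by simp
  qed
  show ?thesis
  proof (cases "nrm (a - b) = 0")
    case False
    have "reflection (a - b) \<in> isometries" using V False by (intro reflection_isometry) auto
    moreover have "reflection (a - b) (w j) = w j" if "j \<in> I" for j
      using wV[OF that] prod[OF that] by (intro reflection_fixes) (simp_all add: dot_diff_right dot_commute[of "w j"])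
    ultimately show ?thesis using reflection_swaps[OF V nrm False] by blast
  next
    case True
    define W where "W = {x \<in> V. \<forall>j\<in>I. dot x (w j) = 0}"
    have WV: "W \<subseteq> V" and finW: "finite W" by (auto simp: W_def)
    have ind: "independent I w"
    proof -
      have "independent I (w(i := a))" using independent_subset[OF a, of I] by blast
      moreover have "lincomb I c (w(i := a)) = lincomb I c w" for c
        unfolding lincomb_def using i by (intro ext sum.cong) auto
      ultimately show ?thesis using wV unfolding independent_def by auto
    qed
    have Wcard: "q ^ card I * card W = q ^ d" unfolding W_def using card_linear_system[OF ind, of "\<lambda>_. 0"] by simp
    have "\<exists>h\<in>W. nrm h \<noteq> 0"
    proof (rule exists_anisotropic[OF WV])
      show "q ^ d < (card W)\<^sup>2" unfolding W_def using perp_large[OF ind] small by simp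
    qed (auto simp: W_def dot_linear)
    then obtain h where h: "h \<in> W" "nrm h \<noteq> 0" by blast
    have "q * card {x \<in> W. nrm (0 + x) = 0} \<le> 2 * card W"
      by (rule card_quadric[OF WV _ _ h(2)]) (use h in \<open>auto simp: W_def dot_linear\<close>)
    hence iso: "q * card {x \<in> W. nrm x = 0} \<le> 2 * card W" by simp
    have hyp: "q * card {x \<in> W. dot x c = 0} = card W" if "independent (insert i I) (w(i := c))" for c
    proof -
      have "{x \<in> W. dot x c = 0} = {x \<in> V. (\<forall>j\<in>I. dot x (w j) = 0) \<and> dot x c = 0}" by (auto simp: W_def)
      hence "q ^ card I * (q * card {x \<in> W. dot x c = 0}) = q ^ card I * card W"
        using independent_nonmember[OF that i] Wcard by (simp add: mult_ac)
      thus ?thesis by simp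
    qed
    have "\<exists>r\<in>W. nrm r \<noteq> 0 \<and> dot r a \<noteq> 0 \<and> dot r b \<noteq> 0"
    proof (rule ccontr)
      assume "\<not> ?thesis"
      hence "W \<subseteq> {x \<in> W. nrm x = 0} \<union> ({x \<in> W. dot x a = 0} \<union> {x \<in> W. dot x b = 0})" by blast
      hence "card W \<le> card ({x \<in> W. nrm x = 0} \<union> ({x \<in> W. dot x a = 0} \<union> {x \<in> W. dot x b = 0}))"
        using finW by (intro card_mono) auto
      also have "\<dots> \<le> card {x \<in> W. nrm x = 0} + (card {x \<in> W. dot x a = 0} + card {x \<in> W. dot x b = 0})"
        by (intro order_trans[OF card_Un_le] add_left_mono card_Un_le)
      finally have "q * card W \<le> q * (card {x \<in> W. nrm x = 0} + (card {x \<in> W. dot x a = 0} + card {x \<in> W. dot x b = 0}))"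
        by (rule mult_le_mono2)
      also have "\<dots> \<le> 4 * card W" using iso hyp[OF a] hyp[OF b] by (simp add: distrib_left)
      finally have "card W = 0" using q5 by (cases "card W = 0") auto
      moreover have "card W \<noteq> 0" using Wcard by (intro notI) simp
      ultimately show False by simp
    qed
    then obtain r where r: "r \<in> W" "nrm r \<noteq> 0" "dot r a \<noteq> 0" "dot r b \<noteq> 0" by blast
    have rV: "r \<in> V" using r WV by blast
    have refl_r: "reflection r \<in> isometries" using rV r by (intro reflection_isometry)
    define z where "z = reflection r a"
    define l where "l = 2 * dot a r * kinv (nrm r)"
    have z: "z = a - smul l r" "z \<in> V" using V rV by (simp_all add: z_def reflection_def l_def)
    have zn: "nrm z = nrm b" using isometry_dot[OF refl_r] V nrm by (simp add: z_def)
    have ln: "l * nrm r = 2 * dot a r"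
      using rV r V by (simp add: l_def mult.assoc)
    have zb: "z - b = (a - b) - smul l r" using z by (simp add: algebra_simps)
    have "nrm (z - b) = nrm (a - b) - 2 * l * (dot a r - dot b r) + l * (l * nrm r)"
      unfolding zb using dot_commute[of r a] dot_commute[of r b] dot_commute[of b a]
      by (simp add: dot_linear algebra_simps)
    also have "\<dots> = 2 * (l * dot b r)" unfolding True ln by (simp add: algebra_simps)
    also have "\<dots> = 2 * (2 * (dot a r * kinv (nrm r) * dot b r))" by (simp add: l_def algebra_simps)
    finally have nz: "nrm (z - b) = 2 * (2 * (dot a r * kinv (nrm r) * dot b r))" .
    have zbn: "nrm (z - b) \<noteq> 0"
    proof -
      have "dot a r \<noteq> 0" "dot b r \<noteq> 0" using r(3,4) by (simp_all only: dot_commute[of a r] dot_commute[of b r] not_False_eq_True)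
      hence "dot a r * kinv (nrm r) * dot b r \<noteq> 0" using rV V r(2) by (simp add: mult_eq_0_K)
      thus ?thesis unfolding nz
        using two_mult_eq_0[of "dot a r * kinv (nrm r) * dot b r"]
          two_mult_eq_0[of "2 * (dot a r * kinv (nrm r) * dot b r)"] rV V by simp
    qed
    have refl_zb: "reflection (z - b) \<in> isometries" using z V zbn by (intro reflection_isometry) auto
    have rw: "dot r (w j) = 0" if "j \<in> I" for j using r that by (auto simp: W_def)
    have fix_r: "reflection r (w j) = w j" if "j \<in> I" for j
      using rw[OF that] wV[OF that] by (intro reflection_fixes) (simp_all add: dot_commute[of "w j"])
    have fix_zb: "reflection (z - b) (w j) = w j" if "j \<in> I" for j
      unfolding zb using rw[OF that] prod[OF that] wV[OF that]
      by (intro reflection_fixes) (simp_all add: dot_linear dot_commute[of "w j"])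
    have "compose V (reflection (z - b)) (reflection r) \<in> isometries"
      by (rule isometry_comp[OF refl_zb refl_r])
    moreover have "compose V (reflection (z - b)) (reflection r) a = b"
      using V reflection_swaps[OF z(2) V(2) zn zbn] by (simp add: compose_def z_def)
    moreover have "compose V (reflection (z - b)) (reflection r) (w j) = w j" if "j \<in> I" for j
      using wV[OF that] fix_r[OF that] fix_zb[OF that] by (simp add: compose_def)
    ultimately show ?thesis by blast
  qed
qed

lemma independent_cong: "(\<And>i. i \<in> I \<Longrightarrow> v i = w i) \<Longrightarrow> independent I v \<longleftrightarrow> independent I w"
proof -
  assume "\<And>i. i \<in> I \<Longrightarrow> v i = w i"
  moreover from this have "lincomb I c v = lincomb I c w" for c
    unfolding lincomb_def by (intro ext sum.cong) auto
  ultimately show ?thesis unfolding independent_def by auto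
qed

lemma independent_isometry:
  assumes "\<theta> \<in> isometries" "independent I v"
  shows "independent I (\<lambda>i. \<theta> (v i))"
  unfolding independent_def
proof (intro conjI ballI allI impI)
  have I: "finite I" "\<forall>i\<in>I. v i \<in> V" using assms by (auto simp: independent_def)
  show "finite I" "\<And>i. i \<in> I \<Longrightarrow> \<theta> (v i) \<in> V" using I isometry_V[OF assms(1)] by auto
  fix c i assume c: "\<forall>i\<in>I. c i \<in> K" and 0: "lincomb I c (\<lambda>i. \<theta> (v i)) = 0" and i: "i \<in> I"
  have "\<theta> (lincomb I c v) = \<theta> 0"
    using isometry_lincomb[OF assms(1) I(1), of c v] c I 0 isometry_zero[OF assms(1)] by simp
  moreover have "lincomb I c v \<in> V" using I by simp
  ultimately have "lincomb I c v = 0" using inj_onD[OF inj_on_isometry[OF assms(1)]] zero_V by blast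
  thus "c i = 0" using c i by (intro independentD[OF assms(2)]) auto
qed

text \<open>
  The bound on the number of vectors keeps each step within the range where the complement
  contains a vector of nonzero norm; this makes two reflections per vector suffice, without a
  treatment of degenerate subspaces.
\<close>

theorem witt:
  assumes q5: "q \<ge> 5" and "independent I v" "independent I w" and "2 * card I \<le> d"
    and "\<And>i j. i \<in> I \<Longrightarrow> j \<in> I \<Longrightarrow> dot (v i) (v j) = dot (w i) (w j)"
  shows "\<exists>\<theta>\<in>isometries. \<forall>i\<in>I. \<theta> (v i) = w i"
proof -
  have "finite I" using assms(2) by (simp add: independent_def)
  thus ?thesis using assms(2-5)
  proof (induction I rule: finite_induct)
    case empty
    thus ?case using isometry_id by blast
  next
    case (insert i I)
    have "independent I v" "independent I w"
      using insert.prems(1,2) by (auto intro: independent_subset)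
    then obtain \<theta> where \<theta>: "\<theta> \<in> isometries" "\<forall>j\<in>I. \<theta> (v j) = w j"
      using insert.IH insert.prems insert.hyps by auto
    have vV: "v j \<in> V" if "j \<in> insert i I" for j using insert.prems(1) that unfolding independent_def by blast
    have "\<exists>\<rho>\<in>isometries. (\<forall>j\<in>I. \<rho> (w j) = w j) \<and> \<rho> (\<theta> (v i)) = w i"
    proof (rule witt_step[OF q5 insert.hyps(2)])
      show "2 * Suc (card I) \<le> d" using insert.prems(3) insert.hyps by simp
      have "independent (insert i I) (\<lambda>j. \<theta> (v j))" by (rule independent_isometry[OF \<theta>(1) insert.prems(1)])
      thus "independent (insert i I) (w(i := \<theta> (v i)))"
        using \<theta>(2) insert.hyps by (subst independent_cong[of _ _ "\<lambda>j. \<theta> (v j)"]) auto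
      show "independent (insert i I) (w(i := w i))" using insert.prems(2) by simp
      show "nrm (\<theta> (v i)) = nrm (w i)" using isometry_dot[OF \<theta>(1)] vV insert.prems(4) by simp
      fix j assume j: "j \<in> I"
      have "dot (\<theta> (v i)) (\<theta> (v j)) = dot (v i) (v j)" using vV j by (intro isometry_dot[OF \<theta>(1)]) auto
      also have "\<dots> = dot (w i) (w j)" using insert.prems(4) j by simp
      finally show "dot (\<theta> (v i)) (w j) = dot (w i) (w j)" using \<theta>(2) j by simp
    qed
    then obtain \<rho> where \<rho>: "\<rho> \<in> isometries" "\<forall>j\<in>I. \<rho> (w j) = w j" "\<rho> (\<theta> (v i)) = w i" by blast
    have "\<forall>j\<in>insert i I. compose V \<rho> \<theta> (v j) = w j" using \<rho> \<theta> vV by (auto simp: compose_def)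
    thus ?case using isometry_comp[OF \<rho>(1) \<theta>(1)] by blast
  qed
qed

lemma isometry_transitive:
  assumes q5: "q \<ge> 5" and d: "d \<ge> 2" and "x \<in> V" "y \<in> V" "x \<noteq> 0" "y \<noteq> 0" "nrm x = nrm y"
  shows "\<exists>\<theta>\<in>isometries. \<theta> x = y"
proof -
  have single: "independent {0::nat} (\<lambda>_. z)" if z: "z \<in> V" "z \<noteq> 0" for z
    unfolding independent_def
  proof (intro conjI allI impI ballI)
    fix c and i :: nat assume c: "\<forall>i\<in>{0::nat}. c i \<in> K" and 0: "lincomb {0::nat} c (\<lambda>_. z) = 0" and i: "i \<in> {0}"
    obtain j where "z j \<noteq> 0" using z by (auto simp: fun_eq_iff zero_fun_apply)
    moreover have "c 0 * z j = 0" using fun_cong[OF 0, of j] by (simp add: lincomb_def zero_fun_apply)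
    ultimately show "c i = 0" using c i z mult_eq_0_K[of "c 0" "z j"] by (auto simp: V_nth)
  qed (use z in auto)
  have "\<exists>\<theta>\<in>isometries. \<forall>i\<in>{0::nat}. \<theta> x = y"
    by (rule witt[OF q5 single single]) (use assms in auto)
  thus ?thesis by simp
qed

end

section \<open>Sizes of spheres\<close>

context quadratic_space begin

lemma nonzero_norm_sphere_large:
  assumes q: "q \<ge> 160" and d: "d \<ge> 2" and t: "t \<in> K" "t \<noteq> 0"
  shows "real q ^ d \<le> 2 * real q * real (card {x \<in> V. nrm x = t})"
proof -
  let ?k = "cmod (kloosterman (\<lambda>x. of_real (eta x) ^ d) (- t) 0)"
  have "?k ^ 4 \<le> 10 * real q ^ 3"
    using t by (intro kloosterman_bound_4[OF unit_character_eta_power]) auto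
  also have "\<dots> \<le> (real q / 2) ^ 4"
  proof -
    have "160 * real q ^ 3 \<le> real q * real q ^ 3" using q by (intro mult_right_mono) auto
    thus ?thesis by (simp add: power_divide eval_nat_numeral)
  qed
  finally have k: "?k \<le> real q / 2" by (rule power_le_imp_le_base[where n=3, simplified]) auto
  have "real q = sqrt (real q) ^ 2" by simp
  also have "\<dots> \<le> sqrt (real q) ^ d" using q d by (intro power_increasing) auto
  finally have "sqrt (real q) ^ d * ?k \<le> sqrt (real q) ^ d * (sqrt (real q) ^ d / 2)"
    using k by (intro mult_left_mono) auto
  also have "\<dots> = real q ^ d / 2" by (simp flip: power_mult_distrib)
  finally show ?thesis using card_sphere[OF t(1)] by linarith
qed

text \<open>
  For \<open>d = 2\<close> the cone can consist of \<open>0\<close> alone, which the given vector \<open>x\<close> excludes; its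
  multiples are then enough. For \<open>d \<ge> 3\<close> the trivial bound in the sphere count suffices.
\<close>

lemma isotropic_cone_large:
  assumes q: "q \<ge> 160" and d: "d \<ge> 2" and x: "x \<in> V" "x \<noteq> 0" "nrm x = 0"
  shows "real q ^ d \<le> 2 * real q * real (card {y \<in> V. y \<noteq> 0 \<and> nrm y = 0})"
proof (cases "d = 2")
  case True
  obtain i where i: "x i \<noteq> 0" using x(2) by (auto simp: fun_eq_iff zero_fun_apply)
  have "inj_on (\<lambda>c. smul c x) (K - {0})"
  proof (rule inj_onI)
    fix c c' assume "c \<in> K - {0}" "c' \<in> K - {0}" "smul c x = smul c' x"
    hence "x i * c = x i * c'" "c \<in> K" "c' \<in> K" by (auto simp: smul_def mult.commute dest: fun_cong[of _ _ i])
    thus "c = c'" using mult_left_cancel_K[of "x i" c c'] i x by (simp add: V_nth)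
  qed
  hence "q - 1 = card ((\<lambda>c. smul c x) ` (K - {0}))" by (simp add: card_image card_units)
  also have "\<dots> \<le> card {y \<in> V. y \<noteq> 0 \<and> nrm y = 0}"
  proof (intro card_mono subsetI)
    fix y assume "y \<in> (\<lambda>c. smul c x) ` (K - {0})"
    then obtain c where c: "c \<in> K" "c \<noteq> 0" "y = smul c x" by auto
    have "c * x i \<noteq> 0" using c i x mult_eq_0_K[of c "x i"] by (simp add: V_nth)
    hence "y \<noteq> 0" using c(3) by (auto simp: smul_def zero_fun_def dest: fun_cong[of _ _ i])
    thus "y \<in> {y \<in> V. y \<noteq> 0 \<and> nrm y = 0}" using c x by (simp add: dot_linear)
  qed auto
  finally have "real q \<le> 2 * real (card {y \<in> V. y \<noteq> 0 \<and> nrm y = 0})" using q by linarith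
  hence "real q * real q \<le> real q * (2 * real (card {y \<in> V. y \<noteq> 0 \<and> nrm y = 0}))"
    by (intro mult_left_mono) auto
  thus ?thesis using True by (simp add: power2_eq_square)
next
  case False
  let ?k = "cmod (kloosterman (\<lambda>x. of_real (eta x) ^ d) (- 0) 0)"
  have "?k \<le> (\<Sum>x\<in>K - {0}. 1)"
    unfolding kloosterman_def
    by (rule sum_norm_le) (auto simp: norm_mult norm_power eta_def)
  hence k: "?k \<le> real q" using card_units by (simp add: q_def)
  have sq: "4 \<le> sqrt (real q)"
  proof -
    have "sqrt 16 \<le> sqrt (real q)" using q by (intro real_sqrt_le_mono) auto
    thus ?thesis using real_sqrt_unique[of 4 16] by simp
  qed
  have "4 * real q \<le> sqrt (real q) * sqrt (real q) ^ 2" using sq by (simp add: mult_right_mono)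
  also have "\<dots> = sqrt (real q) ^ 3" by (simp add: eval_nat_numeral)
  also have "\<dots> \<le> sqrt (real q) ^ d" using sq q d False by (intro power_increasing) auto
  finally have "sqrt (real q) ^ d * (4 * real q) \<le> sqrt (real q) ^ d * sqrt (real q) ^ d"
    by (intro mult_left_mono) auto
  hence "sqrt (real q) ^ d * real q \<le> real q ^ d / 4" by (simp flip: power_mult_distrib)
  moreover have "sqrt (real q) ^ d * ?k \<le> sqrt (real q) ^ d * real q" using k by (intro mult_left_mono) auto
  moreover have "\<bar>real q * real (card {x \<in> V. nrm x = 0}) - real q ^ d\<bar> \<le> sqrt (real q) ^ d * ?k"
    using card_sphere[of 0] by simp
  ultimately have 1: "3 / 4 * real q ^ d \<le> real q * real (card {x \<in> V. nrm x = 0})" by linarith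
  have "{x \<in> V. nrm x = 0} = insert 0 {y \<in> V. y \<noteq> 0 \<and> nrm y = 0}" by auto
  hence "card {x \<in> V. nrm x = 0} = Suc (card {y \<in> V. y \<noteq> 0 \<and> nrm y = 0})" by simp
  hence 2: "3 / 4 * real q ^ d \<le> real q * real (card {y \<in> V. y \<noteq> 0 \<and> nrm y = 0}) + real q"
    using 1 by (simp add: distrib_left)
  have "4 * real q ^ 1 \<le> real q * real q ^ 1" using q by (intro mult_right_mono) auto
  also have "\<dots> = real q ^ 2" by (simp add: power2_eq_square)
  also have "\<dots> \<le> real q ^ d" using q d by (intro power_increasing) auto
  finally have "real q \<le> real q ^ d / 4" by simp
  with 2 show ?thesis by linarith
qed

lemma sphere_large:
  assumes "q \<ge> 160" "d \<ge> 2" "x \<in> V" "x \<noteq> 0"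
  shows "real q ^ d \<le> 2 * real q * real (card {y \<in> V. y \<noteq> 0 \<and> nrm y = nrm x})"
proof (cases "nrm x = 0")
  case True
  thus ?thesis using isotropic_cone_large[of x] assms by simp
next
  case False
  have "{y \<in> V. y \<noteq> 0 \<and> nrm y = nrm x} = {y \<in> V. nrm y = nrm x}" using False by auto
  thus ?thesis using nonzero_norm_sphere_large[of "nrm x"] assms False by simp
qed

section \<open>Rigid motions mix point sets\<close>

lemma card_stabilizer_coset_le:
  assumes \<rho>: "\<rho> \<in> isometries" and x: "x \<in> V"
  shows "card {\<theta> \<in> isometries. \<theta> x = y} \<le> card {\<theta> \<in> isometries. \<theta> x = \<rho> y}"
proof (rule card_inj_on_le[of "compose V \<rho>"])
  show "inj_on (compose V \<rho>) {\<theta> \<in> isometries. \<theta> x = y}"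
  proof (rule inj_onI)
    fix \<theta> \<theta>' assume \<theta>: "\<theta> \<in> {\<theta> \<in> isometries. \<theta> x = y}" "\<theta>' \<in> {\<theta> \<in> isometries. \<theta> x = y}"
      and eq: "compose V \<rho> \<theta> = compose V \<rho> \<theta>'"
    have PiE: "\<theta> \<in> V \<rightarrow>\<^sub>E V" "\<theta>' \<in> V \<rightarrow>\<^sub>E V" using \<theta> by (auto simp: isometries_def)
    show "\<theta> = \<theta>'"
    proof (rule PiE_ext[OF PiE])
      fix v assume v: "v \<in> V"
      have "\<rho> (\<theta> v) = \<rho> (\<theta>' v)" using fun_cong[OF eq, of v] v by (simp add: compose_def)
      thus "\<theta> v = \<theta>' v" using inj_onD[OF inj_on_isometry[OF \<rho>]] PiE v by blast
    qed
  qed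
  show "compose V \<rho> ` {\<theta> \<in> isometries. \<theta> x = y} \<subseteq> {\<theta> \<in> isometries. \<theta> x = \<rho> y}"
    using isometry_comp[OF \<rho>] x by (auto simp: compose_def)
qed auto

text \<open>
  The images \<open>\<theta> x\<close> are equidistributed on the orbit of \<open>x\<close>, which consists of all nonzero
  vectors of the same norm, at least \<open>q^(d-1) / 2\<close> of them.
\<close>

lemma isometry_average:
  assumes q: "q \<ge> 160" and d: "d \<ge> 2" and x: "x \<in> V" "x \<noteq> 0" and \<phi>: "\<And>y. y \<in> V \<Longrightarrow> \<phi> y \<ge> (0::real)"
  shows "real q ^ d * (\<Sum>\<theta>\<in>isometries. \<phi> (\<theta> x)) \<le> 2 * real q * real (card isometries) * (\<Sum>y\<in>V. \<phi> y)"
proof -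
  define Orb where "Orb = {y \<in> V. y \<noteq> 0 \<and> nrm y = nrm x}"
  define N where "N y = card {\<theta> \<in> isometries. \<theta> x = y}" for y
  have q5: "q \<ge> 5" using q by simp
  have fin: "finite Orb" and OV: "Orb \<subseteq> V" by (auto simp: Orb_def)
  have img: "(\<lambda>\<theta>. \<theta> x) ` isometries \<subseteq> Orb"
  proof (rule image_subsetI)
    fix \<theta> assume \<theta>: "\<theta> \<in> isometries"
    have "\<theta> x \<noteq> 0"
    proof
      assume "\<theta> x = 0"
      hence "\<theta> x = \<theta> 0" using isometry_zero[OF \<theta>] by simp
      thus False using inj_onD[OF inj_on_isometry[OF \<theta>], of x 0] x by simp
    qed
    thus "\<theta> x \<in> Orb" using isometry_V[OF \<theta>] isometry_dot[OF \<theta>] x by (simp add: Orb_def)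
  qed
  have Nle: "N y \<le> N y'" if y: "y \<in> Orb" "y' \<in> Orb" for y y'
  proof -
    obtain \<rho> where "\<rho> \<in> isometries" "\<rho> y = y'"
      using isometry_transitive[OF q5 d, of y y'] y by (auto simp: Orb_def)
    thus ?thesis unfolding N_def using card_stabilizer_coset_le x by blast
  qed
  have xO: "x \<in> Orb" using x by (simp add: Orb_def)
  have N: "N y = N x" if "y \<in> Orb" for y using Nle xO that by (meson le_antisym)
  have group: "(\<Sum>\<theta>\<in>isometries. f (\<theta> x)) = real (N x) * (\<Sum>y\<in>Orb. f y)" for f :: "_ \<Rightarrow> real"
  proof -
    have "(\<Sum>\<theta>\<in>isometries. f (\<theta> x)) = (\<Sum>y\<in>Orb. \<Sum>\<theta>\<in>{\<theta> \<in> isometries. \<theta> x = y}. f (\<theta> x))"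
      by (rule sum.group[symmetric]) (use fin img in auto)
    also have "\<dots> = (\<Sum>y\<in>Orb. real (N x) * f y)"
    proof (rule sum.cong[OF refl])
      fix y assume y: "y \<in> Orb"
      have "(\<Sum>\<theta>\<in>{\<theta> \<in> isometries. \<theta> x = y}. f (\<theta> x)) = (\<Sum>\<theta>\<in>{\<theta> \<in> isometries. \<theta> x = y}. f y)"
        by (rule sum.cong) auto
      thus "(\<Sum>\<theta>\<in>{\<theta> \<in> isometries. \<theta> x = y}. f (\<theta> x)) = real (N x) * f y"
        using N[OF y] by (simp add: N_def)
    qed
    finally show ?thesis by (simp add: sum_distrib_left)
  qed
  have total: "real (card isometries) = real (N x) * real (card Orb)" using group[of "\<lambda>_. 1"] by simp
  have "real q ^ d * (\<Sum>\<theta>\<in>isometries. \<phi> (\<theta> x)) = real q ^ d * (real (N x) * (\<Sum>y\<in>Orb. \<phi> y))"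
    by (simp only: group)
  also have "\<dots> \<le> (2 * real q * real (card Orb)) * (real (N x) * (\<Sum>y\<in>Orb. \<phi> y))"
    using sphere_large[OF q d x] \<phi> OV unfolding Orb_def
    by (intro mult_right_mono mult_nonneg_nonneg sum_nonneg) auto
  also have "\<dots> = 2 * real q * real (card isometries) * (\<Sum>y\<in>Orb. \<phi> y)" by (simp add: total mult_ac)
  also have "\<dots> \<le> 2 * real q * real (card isometries) * (\<Sum>y\<in>V. \<phi> y)"
    using \<phi> OV by (intro mult_left_mono sum_mono2) auto
  finally show ?thesis .
qed

text \<open>
  For a fixed isometry the sum over translations is, by Parseval, a correlation of the two
  squared Fourier transforms. Averaging over isometries replaces the first one by its mean over
  an orbit. The zero frequency, which is a fixed point, contributes nothing because \<open>f\<close> has mean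
  zero.
\<close>

lemma rigid_motion_correlation:
  fixes f F :: "(nat \<Rightarrow> 'r) \<Rightarrow> real"
  assumes q: "q \<ge> 160" and d: "d \<ge> 2" and mean: "(\<Sum>a\<in>V. f a) = 0"
  shows "(\<Sum>\<theta>\<in>isometries. \<Sum>z\<in>V. (\<Sum>a\<in>V. f (\<theta> a + z) * F a)\<^sup>2)
    \<le> 2 * real q * real (card isometries) * (\<Sum>a\<in>V. (f a)\<^sup>2) * (\<Sum>a\<in>V. (F a)\<^sup>2)"
proof -
  define fh where "fh \<xi> = (\<Sum>a\<in>V. of_real (f a) * chi (dot \<xi> a))" for \<xi>
  define Fh where "Fh \<xi> = (\<Sum>a\<in>V. of_real (F a) * chi (dot \<xi> a))" for \<xi>
  have fh2: "(\<Sum>\<xi>\<in>V. (cmod (fh \<xi>))\<^sup>2) = real q ^ d * (\<Sum>a\<in>V. (f a)\<^sup>2)"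
    unfolding fh_def by (subst parseval_V) auto
  have Fh2: "(\<Sum>\<xi>\<in>V. (cmod (Fh \<xi>))\<^sup>2) = real q ^ d * (\<Sum>a\<in>V. (F a)\<^sup>2)"
    unfolding Fh_def by (subst parseval_V) auto
  have fh0: "fh 0 = 0" using mean by (simp add: fh_def flip: of_real_sum)
  have fixed: "real q ^ d * (\<Sum>z\<in>V. (\<Sum>a\<in>V. f (\<theta> a + z) * F a)\<^sup>2) = (\<Sum>\<xi>\<in>V. (cmod (fh (\<theta> \<xi>)))\<^sup>2 * (cmod (Fh \<xi>))\<^sup>2)"
    if \<theta>: "\<theta> \<in> isometries" for \<theta>
  proof -
    have transform: "(\<Sum>z\<in>V. of_real (\<Sum>a\<in>V. f (\<theta> a + z) * F a) * chi (dot (\<theta> \<xi>) z)) = fh (\<theta> \<xi>) * cnj (Fh \<xi>)"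
      if \<xi>: "\<xi> \<in> V" for \<xi>
    proof -
      have "(\<Sum>z\<in>V. of_real (\<Sum>a\<in>V. f (\<theta> a + z) * F a) * chi (dot (\<theta> \<xi>) z))
          = (\<Sum>a\<in>V. \<Sum>z\<in>V. of_real (F a) * (of_real (f (z + \<theta> a)) * chi (dot (\<theta> \<xi>) z)))"
        unfolding of_real_sum sum_distrib_right by (subst sum.swap) (simp add: mult_ac add.commute)
      also have "\<dots> = (\<Sum>a\<in>V. of_real (F a) * (fh (\<theta> \<xi>) * cnj (chi (dot \<xi> a))))"
      proof (rule sum.cong[OF refl])
        fix a assume a: "a \<in> V"
        have dot: "dot (\<theta> \<xi>) z = dot (\<theta> \<xi>) (z + \<theta> a) - dot \<xi> a" for z
          using isometry_dot[OF \<theta> \<xi> a] by (simp add: dot_linear)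
        have "(\<Sum>z\<in>V. of_real (f (z + \<theta> a)) * chi (dot (\<theta> \<xi>) z))
            = (\<Sum>z\<in>V. of_real (f (z + \<theta> a)) * chi (dot (\<theta> \<xi>) (z + \<theta> a)) * cnj (chi (dot \<xi> a)))"
          by (intro sum.cong refl) (subst dot, simp add: chi_diff)
        also have "\<dots> = (\<Sum>z\<in>V. of_real (f z) * chi (dot (\<theta> \<xi>) z) * cnj (chi (dot \<xi> a)))"
          by (rule sum.reindex_bij_betw[OF bij_add_V[OF isometry_V[OF \<theta> a]]])
        also have "\<dots> = fh (\<theta> \<xi>) * cnj (chi (dot \<xi> a))" by (simp add: fh_def sum_distrib_right)
        finally show "(\<Sum>z\<in>V. of_real (F a) * (of_real (f (z + \<theta> a)) * chi (dot (\<theta> \<xi>) z)))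
            = of_real (F a) * (fh (\<theta> \<xi>) * cnj (chi (dot \<xi> a)))"
          by (simp flip: sum_distrib_left)
      qed
      also have "\<dots> = fh (\<theta> \<xi>) * cnj (Fh \<xi>)"
        unfolding Fh_def cnj_sum sum_distrib_left by (intro sum.cong refl) (simp add: mult_ac)
      finally show ?thesis .
    qed
    have "real q ^ d * (\<Sum>z\<in>V. (\<Sum>a\<in>V. f (\<theta> a + z) * F a)\<^sup>2)
        = (\<Sum>\<xi>\<in>V. (cmod (\<Sum>z\<in>V. of_real (\<Sum>a\<in>V. f (\<theta> a + z) * F a) * chi (dot \<xi> z)))\<^sup>2)"
      by (subst parseval_V[OF subset_refl]) (simp only: norm_of_real power2_abs)
    also have "\<dots> = (\<Sum>\<xi>\<in>V. (cmod (\<Sum>z\<in>V. of_real (\<Sum>a\<in>V. f (\<theta> a + z) * F a) * chi (dot (\<theta> \<xi>) z)))\<^sup>2)"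
      by (rule sum.reindex_bij_betw[OF bij_isometry[OF \<theta>], symmetric])
    also have "\<dots> = (\<Sum>\<xi>\<in>V. (cmod (fh (\<theta> \<xi>)))\<^sup>2 * (cmod (Fh \<xi>))\<^sup>2)"
      by (intro sum.cong refl) (simp only: transform norm_mult complex_mod_cnj power_mult_distrib)
    finally show ?thesis .
  qed
  have "real q ^ d * (\<Sum>\<theta>\<in>isometries. \<Sum>z\<in>V. (\<Sum>a\<in>V. f (\<theta> a + z) * F a)\<^sup>2)
      = (\<Sum>\<theta>\<in>isometries. \<Sum>\<xi>\<in>V. (cmod (fh (\<theta> \<xi>)))\<^sup>2 * (cmod (Fh \<xi>))\<^sup>2)"
    unfolding sum_distrib_left[of "real q ^ d" _ isometries] by (intro sum.cong refl fixed)
  also have "\<dots> = (\<Sum>\<xi>\<in>V. (\<Sum>\<theta>\<in>isometries. (cmod (fh (\<theta> \<xi>)))\<^sup>2) * (cmod (Fh \<xi>))\<^sup>2)"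
    by (subst sum.swap) (simp only: sum_distrib_right)
  also have "\<dots> \<le> (\<Sum>\<xi>\<in>V. (2 * real q * real (card isometries) * (\<Sum>a\<in>V. (f a)\<^sup>2)) * (cmod (Fh \<xi>))\<^sup>2)"
  proof (intro sum_mono mult_right_mono)
    fix \<xi> assume \<xi>: "\<xi> \<in> V"
    show "(\<Sum>\<theta>\<in>isometries. (cmod (fh (\<theta> \<xi>)))\<^sup>2) \<le> 2 * real q * real (card isometries) * (\<Sum>a\<in>V. (f a)\<^sup>2)"
    proof (cases "\<xi> = 0")
      case True
      have "(\<Sum>\<theta>\<in>isometries. (cmod (fh (\<theta> \<xi>)))\<^sup>2) = 0"
        using True fh0 isometry_zero by (intro sum.neutral) auto
      also have "\<dots> \<le> 2 * real q * real (card isometries) * (\<Sum>a\<in>V. (f a)\<^sup>2)"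
        by (intro mult_nonneg_nonneg sum_nonneg) auto
      finally show ?thesis .
    next
      case False
      have "real q ^ d * (\<Sum>\<theta>\<in>isometries. (cmod (fh (\<theta> \<xi>)))\<^sup>2)
          \<le> 2 * real q * real (card isometries) * (\<Sum>y\<in>V. (cmod (fh y))\<^sup>2)"
        by (rule isometry_average[OF q d \<xi> False]) simp
      also have "\<dots> = real q ^ d * (2 * real q * real (card isometries) * (\<Sum>a\<in>V. (f a)\<^sup>2))"
        unfolding fh2 by (simp only: mult_ac)
      finally show ?thesis by (subst (asm) mult_le_cancel_left_pos) auto
    qed
  qed auto
  also have "\<dots> = (2 * real q * real (card isometries) * (\<Sum>a\<in>V. (f a)\<^sup>2)) * (real q ^ d * (\<Sum>a\<in>V. (F a)\<^sup>2))"
    by (simp only: sum_distrib_left[symmetric] Fh2)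
  also have "\<dots> = real q ^ d * (2 * real q * real (card isometries) * (\<Sum>a\<in>V. (f a)\<^sup>2) * (\<Sum>a\<in>V. (F a)\<^sup>2))"
    by (simp only: mult_ac)
  finally show ?thesis by (subst (asm) mult_le_cancel_left_pos) auto
qed

text \<open>
  With \<open>f\<close> the indicator of \<open>A\<close> minus its density \<open>\<alpha>\<close>, let \<open>F\<close> be the sum of the functions
  \<open>f (g a)\<close> over \<open>g \<in> T\<close>. On the points that no motion of \<open>T\<close> sends to \<open>A\<close>, \<open>F\<close> equals
  \<open>- \<alpha> |T|\<close>, so these points are few if \<open>F\<close> has small square sum \<open>E\<close>. That sum is itself a sum
  of correlations of \<open>F\<close> with the functions \<open>f (g a)\<close>, and the correlation bound gives an
  inequality for \<open>E^2\<close> in terms of \<open>E\<close>.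
\<close>

theorem rigid_motion_mixing:
  assumes q: "q \<ge> 160" and d: "d \<ge> 2" and T: "T \<subseteq> isometries \<times> V" and A: "A \<subseteq> V"
  shows "real (card T) * real (card A) * real (card {w \<in> V. \<forall>g\<in>T. fst g w + snd g \<notin> A})
    \<le> 2 * real q * real (card isometries) * (real q ^ d)\<^sup>2"
proof -
  define \<alpha> where "\<alpha> = real (card A) / real q ^ d"
  define \<iota> where "\<iota> a = (if a \<in> A then 1 else 0 :: real)" for a :: "nat \<Rightarrow> 'r"
  define f where "f a = \<iota> a - \<alpha>" for a :: "nat \<Rightarrow> 'r"
  define F where "F a = (\<Sum>g\<in>T. f (fst g a + snd g))" for a
  define B where "B = {w \<in> V. \<forall>g\<in>T. fst g w + snd g \<notin> A}"
  have finT: "finite T" using T by (rule finite_subset) auto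
  have sumA: "(\<Sum>a\<in>V. \<iota> a) = real (card A)"
    using A by (simp add: \<iota>_def sum.If_cases Int_absorb1)
  have mean: "(\<Sum>a\<in>V. f a) = 0"
    unfolding f_def sum_subtractf sumA by (simp add: \<alpha>_def card_V)
  have var: "(\<Sum>a\<in>V. (f a)\<^sup>2) \<le> real (card A)"
  proof -
    have "(f a)\<^sup>2 = \<iota> a - 2 * \<alpha> * \<iota> a + \<alpha>\<^sup>2" for a
      by (simp add: f_def \<iota>_def power2_diff)
    hence "(\<Sum>a\<in>V. (f a)\<^sup>2) = real (card A) - 2 * \<alpha> * real (card A) + real q ^ d * \<alpha>\<^sup>2"
      by (simp add: sum.distrib sum_subtractf sumA card_V flip: sum_distrib_left)
    also have "real q ^ d * \<alpha>\<^sup>2 = \<alpha> * real (card A)" by (simp add: \<alpha>_def power2_eq_square)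
    finally have "(\<Sum>a\<in>V. (f a)\<^sup>2) = real (card A) - \<alpha> * real (card A)" by simp
    moreover have "\<alpha> * real (card A) \<ge> 0" by (simp add: \<alpha>_def)
    ultimately show ?thesis by linarith
  qed
  define E where "E = (\<Sum>a\<in>V. (F a)\<^sup>2)"
  have E0: "E \<ge> 0" unfolding E_def by (intro sum_nonneg) auto
  have "E = (\<Sum>g\<in>T. 1 * (\<Sum>a\<in>V. f (fst g a + snd g) * F a))"
  proof -
    have "E = (\<Sum>a\<in>V. \<Sum>g\<in>T. f (fst g a + snd g) * F a)"
      unfolding E_def power2_eq_square by (intro sum.cong refl) (simp add: F_def sum_distrib_right)
    thus ?thesis by (simp add: sum.swap[of _ V])
  qed
  hence "E\<^sup>2 \<le> (\<Sum>g\<in>T. 1\<^sup>2) * (\<Sum>g\<in>T. (\<Sum>a\<in>V. f (fst g a + snd g) * F a)\<^sup>2)"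
    using Cauchy_Schwarz_ineq_sum[of "\<lambda>_. 1" "\<lambda>g. \<Sum>a\<in>V. f (fst g a + snd g) * F a" T] by simp
  also have "\<dots> = real (card T) * (\<Sum>g\<in>T. (\<Sum>a\<in>V. f (fst g a + snd g) * F a)\<^sup>2)" by simp
  also have "\<dots> \<le> real (card T) * (2 * real q * real (card isometries) * real (card A) * E)"
  proof (rule mult_left_mono)
    have "(\<Sum>g\<in>T. (\<Sum>a\<in>V. f (fst g a + snd g) * F a)\<^sup>2)
        \<le> (\<Sum>g\<in>isometries \<times> V. (\<Sum>a\<in>V. f (fst g a + snd g) * F a)\<^sup>2)"
      using T by (intro sum_mono2) auto
    also have "\<dots> = (\<Sum>\<theta>\<in>isometries. \<Sum>z\<in>V. (\<Sum>a\<in>V. f (\<theta> a + z) * F a)\<^sup>2)"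
      by (simp add: sum.cartesian_product case_prod_beta)
    also have "\<dots> \<le> 2 * real q * real (card isometries) * (\<Sum>a\<in>V. (f a)\<^sup>2) * E"
      unfolding E_def by (rule rigid_motion_correlation[OF q d mean])
    also have "\<dots> \<le> 2 * real q * real (card isometries) * real (card A) * E"
      using E0 by (intro mult_right_mono mult_left_mono var) auto
    finally show "(\<Sum>g\<in>T. (\<Sum>a\<in>V. f (fst g a + snd g) * F a)\<^sup>2)
        \<le> 2 * real q * real (card isometries) * real (card A) * E" .
  qed simp
  finally have E_sq: "E * E \<le> (real (card T) * (2 * real q * real (card isometries) * real (card A))) * E"
    by (simp add: power2_eq_square mult_ac)
  have E_le: "E \<le> real (card T) * (2 * real q * real (card isometries) * real (card A))"
  proof (cases "E = 0")
    case False
    thus ?thesis using E_sq E0 by (subst (asm) mult_le_cancel_right_pos) auto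
  qed simp
  have "real (card B) * (\<alpha> * real (card T))\<^sup>2 = (\<Sum>a\<in>B. (F a)\<^sup>2)"
  proof -
    have "F a = - (\<alpha> * real (card T))" if "a \<in> B" for a
      using that by (simp add: F_def f_def \<iota>_def B_def)
    thus ?thesis by simp
  qed
  also have "\<dots> \<le> E" unfolding E_def by (intro sum_mono2) (auto simp: B_def)
  finally have "real (card B) * (\<alpha> * real (card T))\<^sup>2
      \<le> real (card T) * (2 * real q * real (card isometries) * real (card A))"
    using E_le by linarith
  hence le: "(real (card T) * real (card A) * real (card B)) * (real (card T) * real (card A))
      \<le> (2 * real q * real (card isometries) * (real q ^ d)\<^sup>2) * (real (card T) * real (card A))"
    by (simp add: \<alpha>_def power2_eq_square field_simps)
  show ?thesis
  proof (cases "real (card T) * real (card A) = 0")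
    case False
    hence "real (card T) * real (card A) > 0" by simp
    with le show ?thesis unfolding B_def by (subst (asm) mult_le_cancel_right_pos) auto
  qed auto
qed

section \<open>Placements of a tuple by rigid motions\<close>

definition place :: "'i set \<Rightarrow> ('i \<Rightarrow> nat \<Rightarrow> 'r) \<Rightarrow> ((nat \<Rightarrow> 'r) \<Rightarrow> (nat \<Rightarrow> 'r)) \<times> (nat \<Rightarrow> 'r) \<Rightarrow> ('i \<Rightarrow> nat \<Rightarrow> 'r)" where
  "place I y g = (\<lambda>i\<in>I. fst g (y i) + snd g)"

lemma place_fiber_le:
  assumes y: "\<And>i. i \<in> I \<Longrightarrow> y i \<in> V" and g: "g0 \<in> isometries \<times> V" "g1 \<in> isometries \<times> V"
  shows "card {g \<in> isometries \<times> V. place I y g = place I y g0} \<le> card {g \<in> isometries \<times> V. place I y g = place I y g1}"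
proof -
  obtain \<theta>0 z0 \<theta>1 z1 where g01: "g0 = (\<theta>0, z0)" "g1 = (\<theta>1, z1)" "\<theta>0 \<in> isometries" "z0 \<in> V" "\<theta>1 \<in> isometries" "z1 \<in> V"
    using g by auto
  obtain \<sigma> where \<sigma>: "\<sigma> \<in> isometries" "\<And>x. x \<in> V \<Longrightarrow> \<sigma> (\<theta>0 x) = x"
    using isometry_inverse[OF g01(3)] by metis
  define \<rho> where "\<rho> = compose V \<theta>1 \<sigma>"
  have \<rho>: "\<rho> \<in> isometries" unfolding \<rho>_def using g01(5) \<sigma>(1) by (rule isometry_comp)
  have \<rho>\<theta>: "\<rho> (\<theta>0 x) = \<theta>1 x" if "x \<in> V" for x
    using that \<sigma> isometry_V[OF g01(3)] by (simp add: \<rho>_def compose_def)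
  define \<Psi> where "\<Psi> g = (compose V \<rho> (fst g), \<rho> (snd g) + (z1 - \<rho> z0))" for g
  show ?thesis
  proof (rule card_inj_on_le[of \<Psi>])
    show "inj_on \<Psi> {g \<in> isometries \<times> V. place I y g = place I y g0}"
    proof (rule inj_onI)
      fix g g' assume g: "g \<in> {g \<in> isometries \<times> V. place I y g = place I y g0}"
        "g' \<in> {g \<in> isometries \<times> V. place I y g = place I y g0}" and eq: "\<Psi> g = \<Psi> g'"
      have PiE: "fst g \<in> V \<rightarrow>\<^sub>E V" "fst g' \<in> V \<rightarrow>\<^sub>E V" "snd g \<in> V" "snd g' \<in> V"
        using g by (auto simp: isometries_def)
      have comp: "compose V \<rho> (fst g) = compose V \<rho> (fst g')" and snd: "\<rho> (snd g) = \<rho> (snd g')"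
        using eq by (simp_all add: \<Psi>_def)
      have "fst g = fst g'"
      proof (rule PiE_ext[OF PiE(1,2)])
        fix v assume v: "v \<in> V"
        have "\<rho> (fst g v) = \<rho> (fst g' v)" using fun_cong[OF comp, of v] v by (simp add: compose_def)
        thus "fst g v = fst g' v" using inj_onD[OF inj_on_isometry[OF \<rho>]] PiE v by blast
      qed
      moreover have "snd g = snd g'" using inj_onD[OF inj_on_isometry[OF \<rho>], of "snd g" "snd g'"] snd PiE by simp
      ultimately show "g = g'" by (rule prod_eqI)
    qed
    show "\<Psi> ` {g \<in> isometries \<times> V. place I y g = place I y g0} \<subseteq> {g \<in> isometries \<times> V. place I y g = place I y g1}"
    proof (rule image_subsetI)
      fix g assume g: "g \<in> {g \<in> isometries \<times> V. place I y g = place I y g0}"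
      hence \<theta>: "fst g \<in> isometries" "snd g \<in> V" by auto
      have "place I y (\<Psi> g) = place I y g1"
      proof (rule ext)
        fix i
        show "place I y (\<Psi> g) i = place I y g1 i"
        proof (cases "i \<in> I")
          case True
          have "fst g (y i) + snd g = \<theta>0 (y i) + z0"
          proof -
            have "place I y g i = place I y g0 i" using g by simp
            thus ?thesis using True g01 by (simp add: place_def)
          qed
          hence "\<rho> (fst g (y i) + snd g) = \<rho> (\<theta>0 (y i) + z0)" by simp
          hence "\<rho> (fst g (y i)) + \<rho> (snd g) = \<theta>1 (y i) + \<rho> z0"
            using y[OF True] g01 \<rho>\<theta> isometry_add[OF \<rho>] isometry_V[OF \<theta>(1)] isometry_V[OF g01(3)] \<theta>(2) by simp
          hence "\<rho> (fst g (y i)) + (\<rho> (snd g) + (z1 - \<rho> z0)) = \<theta>1 (y i) + z1"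
            by (simp add: algebra_simps)
          thus ?thesis using True y[OF True] g01 by (simp add: place_def \<Psi>_def compose_def)
        qed (simp add: place_def)
      qed
      moreover have "\<Psi> g \<in> isometries \<times> V"
        using isometry_comp[OF \<rho> \<theta>(1)] isometry_V[OF \<rho>] \<theta>(2) g01 by (simp add: \<Psi>_def)
      ultimately show "\<Psi> g \<in> {g \<in> isometries \<times> V. place I y g = place I y g1}" by simp
    qed
  qed auto
qed

text \<open>
  Orbit counting: all placements arise from equally many motions.
\<close>

lemma card_placements:
  assumes y: "\<And>i. i \<in> I \<Longrightarrow> y i \<in> V"
  defines "G \<equiv> isometries \<times> V"
  shows "card {g \<in> G. place I y g \<in> X} * card (place I y ` G) = card (place I y ` G \<inter> X) * card G"
proof -
  have finG: "finite G" by (simp add: G_def)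
  define g0 where "g0 = (restrict (\<lambda>x. x) V, 0 :: nat \<Rightarrow> 'r)"
  have g0: "g0 \<in> G" using isometry_id by (simp add: g0_def G_def)
  define h where "h = card {g \<in> G. place I y g = place I y g0}"
  have h: "card {g \<in> G. place I y g = x} = h" if x: "x \<in> place I y ` G" for x
  proof -
    obtain g1 where "g1 \<in> G" "x = place I y g1" using x by blast
    moreover have "card {g \<in> G. place I y g = place I y g1} = h"
      unfolding h_def G_def
      using \<open>g1 \<in> G\<close> g0 unfolding G_def by (intro le_antisym place_fiber_le y)
    ultimately show ?thesis by simp
  qed
  have "card {g \<in> G. place I y g \<in> X} = h * card (place I y ` G \<inter> X)" for X
  proof -
    have "card {g \<in> G. place I y g \<in> X} = (\<Sum>x\<in>place I y ` G \<inter> X. card {g \<in> {g \<in> G. place I y g \<in> X}. place I y g = x})"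
      unfolding card_eq_sum by (rule sum.group[symmetric]) (use finG in auto)
    also have "\<dots> = (\<Sum>x\<in>place I y ` G \<inter> X. h)"
    proof (rule sum.cong[OF refl])
      fix x assume x: "x \<in> place I y ` G \<inter> X"
      hence "{g \<in> {g \<in> G. place I y g \<in> X}. place I y g = x} = {g \<in> G. place I y g = x}" by auto
      thus "card {g \<in> {g \<in> G. place I y g \<in> X}. place I y g = x} = h" using h x by simp
    qed
    finally show ?thesis by simp
  qed
  from this[of X] this[of UNIV] show ?thesis by simp
qed

end

section \<open>Configurations with prescribed distances\<close>

lemma card_PiE_split:
  assumes ij: "i \<in> I" "j \<in> I" "i \<noteq> j" and fin: "finite I" "\<And>l. l \<in> I \<Longrightarrow> finite (B l)"
  shows "card {x \<in> PiE I B. ok x} = (\<Sum>y\<in>PiE (I - {i, j}) B. card {z \<in> B i \<times> B j. ok (y(i := fst z, j := snd z))})"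
proof -
  let ?D = "Sigma (PiE (I - {i, j}) B) (\<lambda>y. {z \<in> B i \<times> B j. ok (y(i := fst z, j := snd z))})"
  have "bij_betw (\<lambda>w. (fst w)(i := fst (snd w), j := snd (snd w))) ?D {x \<in> PiE I B. ok x}"
  proof (rule bij_betwI[where g="\<lambda>x. (restrict x (I - {i, j}), (x i, x j))"])
    show "(\<lambda>w. (fst w)(i := fst (snd w), j := snd (snd w))) \<in> ?D \<rightarrow> {x \<in> PiE I B. ok x}"
    proof
      fix w assume "w \<in> ?D"
      then obtain y a b where yab: "w = (y, (a, b))" "y \<in> PiE (I - {i, j}) B" "a \<in> B i" "b \<in> B j"
        "ok (y(i := a, j := b))" by (auto simp: Sigma_def)
      have "I = insert j (insert i (I - {i, j}))" using ij by auto
      moreover have "y(i := a, j := b) \<in> PiE (insert j (insert i (I - {i, j}))) B"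
        using yab by (intro PiE_fun_upd) auto
      ultimately show "(fst w)(i := fst (snd w), j := snd (snd w)) \<in> {x \<in> PiE I B. ok x}" using yab by simp
    qed
    have upd: "(restrict x (I - {i, j}))(i := x i, j := x j) = x" if "x \<in> PiE I B" for x
      using that ij by (auto simp: fun_eq_iff PiE_iff extensional_def)
    show "(\<lambda>x. (restrict x (I - {i, j}), (x i, x j))) \<in> {x \<in> PiE I B. ok x} \<rightarrow> ?D"
    proof
      fix x assume x: "x \<in> {x \<in> PiE I B. ok x}"
      hence "restrict x (I - {i, j}) \<in> PiE (I - {i, j}) B" "x i \<in> B i" "x j \<in> B j" using ij by auto
      thus "(restrict x (I - {i, j}), (x i, x j)) \<in> ?D" using upd[of x] x by simp
    qed
    fix w assume w: "w \<in> ?D"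
    then obtain y z where "w = (y, z)" "y \<in> PiE (I - {i, j}) B" by (rule SigmaE)
    moreover obtain a b where "z = (a, b)" by (cases z)
    ultimately have yab: "w = (y, (a, b))" "y \<in> PiE (I - {i, j}) B" by simp_all
    have "restrict (y(i := a, j := b)) (I - {i, j}) = y"
      using yab(2) by (auto simp: fun_eq_iff PiE_iff extensional_def)
    thus "(restrict ((fst w)(i := fst (snd w), j := snd (snd w))) (I - {i, j}),
        (((fst w)(i := fst (snd w), j := snd (snd w))) i, ((fst w)(i := fst (snd w), j := snd (snd w))) j)) = w"
      using yab ij by simp
  next
    fix x assume "x \<in> {x \<in> PiE I B. ok x}"
    thus "(fst (restrict x (I - {i, j}), (x i, x j)))(i := fst (snd (restrict x (I - {i, j}), (x i, x j))),
        j := snd (snd (restrict x (I - {i, j}), (x i, x j)))) = x"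
      using ij by (auto simp: fun_eq_iff PiE_iff extensional_def)
  qed
  hence "card {x \<in> PiE I B. ok x} = card ?D" by (rule bij_betw_same_card[symmetric])
  also have "\<dots> = (\<Sum>y\<in>PiE (I - {i, j}) B. card {z \<in> B i \<times> B j. ok (y(i := fst z, j := snd z))})"
    using fin ij by (intro card_SigmaI) (auto intro!: finite_PiE)
  finally show ?thesis .
qed

definition edges :: "'i set \<Rightarrow> 'i set set" where
  "edges I = {{i, j} | i j. i \<in> I \<and> j \<in> I \<and> i \<noteq> j}"

definition star :: "'i set set \<Rightarrow> 'i \<Rightarrow> 'i set set" where
  "star E i = {a \<in> E. i \<in> a}"

lemma finite_edges: "finite I \<Longrightarrow> finite (edges I)"
  by (rule finite_subset[of _ "Pow I"]) (auto simp: edges_def)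

lemma edges_pair: "{i, j} \<in> edges I \<Longrightarrow> i \<in> I \<and> j \<in> I \<and> i \<noteq> j"
  by (auto simp: edges_def doubleton_eq_iff)

lemma card_star:
  assumes E: "E \<subseteq> edges I" and I: "finite I" and ij: "{i, j} \<in> E"
  shows "card (star E i) = Suc (card {l \<in> I - {i, j}. {i, l} \<in> E})"
proof -
  let ?L = "{l \<in> I - {i, j}. {i, l} \<in> E}"
  have ij': "i \<in> I" "j \<in> I" "i \<noteq> j" using edges_pair[of i j I] subsetD[OF E ij] by auto
  have "star E i = (\<lambda>l. {i, l}) ` insert j ?L"
  proof (intro equalityI subsetI)
    fix a assume "a \<in> star E i"
    hence a: "a \<in> E" "i \<in> a" by (auto simp: star_def)
    then obtain u v where uv: "a = {u, v}" "u \<in> I" "v \<in> I" "u \<noteq> v" using E by (auto simp: edges_def)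
    define l where "l = (if u = i then v else u)"
    have "a = {i, l}" "l \<in> I" "l \<noteq> i" using uv a by (auto simp: l_def)
    thus "a \<in> (\<lambda>l. {i, l}) ` insert j ?L" using a by auto
  qed (use ij in \<open>auto simp: star_def\<close>)
  moreover have "inj_on (\<lambda>l. {i, l}) (insert j ?L)" by (rule inj_onI) (simp add: doubleton_eq_iff, blast)
  ultimately show ?thesis using I by (simp add: card_image)
qed

context quadratic_space begin

definition config :: "'i set \<Rightarrow> ('i \<Rightarrow> (nat \<Rightarrow> 'r) set) \<Rightarrow> ('i \<Rightarrow> 'i \<Rightarrow> 'r) \<Rightarrow> 'i set set \<Rightarrow> ('i \<Rightarrow> nat \<Rightarrow> 'r) set" where
  "config I B t E = {x \<in> PiE I B. \<forall>i\<in>I. \<forall>j\<in>I. {i, j} \<in> E \<longrightarrow> nrm (x i - x j) = t i j}"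

text \<open>
  The candidates for the point with index \<open>i\<close> once the points with indices in \<open>J\<close> are fixed.
\<close>

definition link :: "'i set \<Rightarrow> ('i \<Rightarrow> (nat \<Rightarrow> 'r) set) \<Rightarrow> ('i \<Rightarrow> 'i \<Rightarrow> 'r) \<Rightarrow> 'i set set \<Rightarrow> 'i \<Rightarrow> ('i \<Rightarrow> nat \<Rightarrow> 'r) \<Rightarrow> (nat \<Rightarrow> 'r) set" where
  "link J B t E i y = {a \<in> B i. \<forall>l\<in>J. {i, l} \<in> E \<longrightarrow> nrm (a - y l) = t i l}"

text \<open>
  Fix all points except those with indices \<open>i\<close> and \<open>j\<close>; the assumed bound compares the pairs at
  the right distance with all pairs in the two links. In the sum of the errors, Cauchy-Schwarz
  turns the sizes of the links of \<open>i\<close> and of \<open>j\<close> into the numbers of configurations in which the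
  other one of the two points is free.
\<close>

lemma edge_removal:
  fixes B :: "'i \<Rightarrow> (nat \<Rightarrow> 'r) set" and t :: "'i \<Rightarrow> 'i \<Rightarrow> 'r"
  assumes I: "finite I" and E: "E \<subseteq> edges I" and ij: "{i, j} \<in> E" and B: "\<And>l. l \<in> I \<Longrightarrow> B l \<subseteq> V"
    and sym: "\<And>a b. t a b = t b a"
    and lam: "\<mu> \<ge> 0"
    and bound: "\<And>y. y \<in> PiE (I - {i, j}) B \<Longrightarrow>
      \<bar>real q * real (card {z \<in> link (I - {i, j}) B t E i y \<times> link (I - {i, j}) B t E j y. nrm (fst z - snd z) = t i j})
        - real (card (link (I - {i, j}) B t E i y)) * real (card (link (I - {i, j}) B t E j y))\<bar>
      \<le> \<mu> * sqrt (real (card (link (I - {i, j}) B t E i y)) * real (card (link (I - {i, j}) B t E j y)))"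
  shows "\<bar>real q * real (card (config I B t E)) - real (card (config I B t (E - {{i, j}})))\<bar>
      * sqrt (real (card (B i)) * real (card (B j)))
    \<le> \<mu> * sqrt (real (card (config I B t (E - star E i))) * real (card (config I B t (E - star E j))))"
proof -
  define J where "J = I - {i, j}"
  have ijI: "i \<in> I" "j \<in> I" "i \<noteq> j" using edges_pair[of i j I] subsetD[OF E ij] by auto
  have finB: "finite (B l)" if "l \<in> I" for l using B[OF that] finite_V by (rule finite_subset)
  define R where "R y \<longleftrightarrow> (\<forall>a\<in>J. \<forall>b\<in>J. {a, b} \<in> E \<longrightarrow> nrm (y a - y b) = t a b)" for y :: "'i \<Rightarrow> nat \<Rightarrow> 'r"
  define P where "P y = link J B t E i y" for y
  define Q where "Q y = link J B t E j y" for y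
  define Y where "Y = {y \<in> PiE J B. R y}"
  have finY: "finite Y"
  proof (rule finite_subset)
    show "Y \<subseteq> PiE J B" by (auto simp: Y_def)
    show "finite (PiE J B)" using I finB by (auto simp: J_def intro!: finite_PiE)
  qed
  have loop: "{a} \<notin> E" for a using E edges_pair[of a a I] by auto
  have split: "(\<forall>u\<in>I. \<forall>v\<in>I. {u, v} \<in> F \<longrightarrow> C u v) \<longleftrightarrow>
      (\<forall>u\<in>J. \<forall>v\<in>J. {u, v} \<in> F \<longrightarrow> C u v) \<and> (\<forall>l\<in>J. {i, l} \<in> F \<longrightarrow> C i l) \<and> (\<forall>l\<in>J. {j, l} \<in> F \<longrightarrow> C j l)
      \<and> ({i, j} \<in> F \<longrightarrow> C i j)"
    if "F \<subseteq> E" "\<And>u v. C u v \<longleftrightarrow> C v u" for F and C :: "'i \<Rightarrow> 'i \<Rightarrow> bool"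
  proof -
    have JI: "J \<subseteq> I" by (auto simp: J_def)
    have loopF: "{a} \<notin> F" for a using loop that(1) by blast
    show ?thesis
    proof
      assume "\<forall>u\<in>I. \<forall>v\<in>I. {u, v} \<in> F \<longrightarrow> C u v"
      thus "(\<forall>u\<in>J. \<forall>v\<in>J. {u, v} \<in> F \<longrightarrow> C u v) \<and> (\<forall>l\<in>J. {i, l} \<in> F \<longrightarrow> C i l) \<and> (\<forall>l\<in>J. {j, l} \<in> F \<longrightarrow> C j l)
        \<and> ({i, j} \<in> F \<longrightarrow> C i j)" using JI ijI by blast
    next
      assume R: "(\<forall>u\<in>J. \<forall>v\<in>J. {u, v} \<in> F \<longrightarrow> C u v) \<and> (\<forall>l\<in>J. {i, l} \<in> F \<longrightarrow> C i l) \<and> (\<forall>l\<in>J. {j, l} \<in> F \<longrightarrow> C j l)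
        \<and> ({i, j} \<in> F \<longrightarrow> C i j)"
      show "\<forall>u\<in>I. \<forall>v\<in>I. {u, v} \<in> F \<longrightarrow> C u v"
      proof (intro ballI impI)
        fix u v assume uv: "u \<in> I" "v \<in> I" "{u, v} \<in> F"
        have uv': "{v, u} \<in> F" using uv(3) by (simp add: insert_commute)
        have "u \<noteq> v" using loopF[of u] uv(3) by auto
        then consider "u \<in> J" "v \<in> J" | "u = i" "v \<in> J" | "u \<in> J" "v = i" | "u = j" "v \<in> J" | "u \<in> J" "v = j"
          | "u = i" "v = j" | "u = j" "v = i" using uv unfolding J_def by blast
        thus "C u v"
        proof cases
          case 3 thus ?thesis using R uv' that(2)[of u v] by blast
        next
          case 5 thus ?thesis using R uv' that(2)[of u v] by blast
        next
          case 7 thus ?thesis using R uv' that(2)[of u v] by blast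
        qed (use R uv in blast)+
      qed
    qed
  qed
  have conf: "(\<forall>u\<in>I. \<forall>v\<in>I. {u, v} \<in> F \<longrightarrow> nrm ((y(i := a, j := b)) u - (y(i := a, j := b)) v) = t u v) \<longleftrightarrow>
      (\<forall>u\<in>J. \<forall>v\<in>J. {u, v} \<in> F \<longrightarrow> nrm (y u - y v) = t u v) \<and> (\<forall>l\<in>J. {i, l} \<in> F \<longrightarrow> nrm (a - y l) = t i l)
      \<and> (\<forall>l\<in>J. {j, l} \<in> F \<longrightarrow> nrm (b - y l) = t j l) \<and> ({i, j} \<in> F \<longrightarrow> nrm (a - b) = t i j)"
    if "F \<subseteq> E" for F y a b
  proof -
    have J: "l \<noteq> i \<and> l \<noteq> j" if "l \<in> J" for l using that by (auto simp: J_def)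
    have sy: "nrm ((y(i := a, j := b)) u - (y(i := a, j := b)) v) = t u v \<longleftrightarrow>
        nrm ((y(i := a, j := b)) v - (y(i := a, j := b)) u) = t v u" for u v
      by (simp only: nrm_diff_commute[of "(y(i := a, j := b)) u"] sym[of u v])
    show ?thesis unfolding split[OF that, of "\<lambda>u v. nrm ((y(i := a, j := b)) u - (y(i := a, j := b)) v) = t u v", OF sy]
      using J ijI by (auto simp del: fun_upd_apply simp: fun_upd_other fun_upd_same)
  qed
  have count: "card (config I B t F) = (\<Sum>y\<in>Y. f y)"
    if F: "F \<subseteq> E" and RF: "\<And>y. (\<forall>u\<in>J. \<forall>v\<in>J. {u, v} \<in> F \<longrightarrow> nrm (y u - y v) = t u v) \<longleftrightarrow> R y"
      and f: "\<And>y. y \<in> Y \<Longrightarrow> f y = card {z \<in> B i \<times> B j. (\<forall>l\<in>J. {i, l} \<in> F \<longrightarrow> nrm (fst z - y l) = t i l)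
      \<and> (\<forall>l\<in>J. {j, l} \<in> F \<longrightarrow> nrm (snd z - y l) = t j l) \<and> ({i, j} \<in> F \<longrightarrow> nrm (fst z - snd z) = t i j)}"
    for F f
  proof -
    have "card (config I B t F) = (\<Sum>y\<in>PiE J B. card {z \<in> B i \<times> B j.
        \<forall>u\<in>I. \<forall>v\<in>I. {u, v} \<in> F \<longrightarrow> nrm ((y(i := fst z, j := snd z)) u - (y(i := fst z, j := snd z)) v) = t u v})"
      unfolding config_def J_def using ijI I finB by (rule card_PiE_split)
    also have "\<dots> = (\<Sum>y\<in>Y. f y)"
      unfolding conf[OF F] RF
    proof (rule sum.mono_neutral_cong_right)
      show "finite (PiE J B)" using I finB by (auto simp: J_def intro!: finite_PiE)
    qed (auto simp: Y_def f)
    finally show ?thesis .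
  qed
  have sub: "P y \<subseteq> B i" "Q y \<subseteq> B j" for y by (auto simp: P_def Q_def link_def)
  have starJ: "{u, v} \<notin> star E i" "{u, v} \<notin> star E j" if "u \<in> J" "v \<in> J" for u v
    using that by (auto simp: star_def J_def)
  have N1: "card (config I B t E) = (\<Sum>y\<in>Y. card {z \<in> P y \<times> Q y. nrm (fst z - snd z) = t i j})"
  proof (rule count)
    fix y
    show "card {z \<in> P y \<times> Q y. nrm (fst z - snd z) = t i j} = card {z \<in> B i \<times> B j. (\<forall>l\<in>J. {i, l} \<in> E \<longrightarrow> nrm (fst z - y l) = t i l)
      \<and> (\<forall>l\<in>J. {j, l} \<in> E \<longrightarrow> nrm (snd z - y l) = t j l) \<and> ({i, j} \<in> E \<longrightarrow> nrm (fst z - snd z) = t i j)}"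
      using ij by (intro arg_cong[of _ _ card]) (auto simp: P_def Q_def link_def)
  qed (auto simp: R_def)
  have N2: "card (config I B t (E - {{i, j}})) = (\<Sum>y\<in>Y. card (P y) * card (Q y))"
  proof (rule count)
    fix y
    have ne: "{i, l} \<noteq> {i, j}" "{j, l} \<noteq> {i, j}" if "l \<in> J" for l using that by (auto simp: J_def doubleton_eq_iff)
    have "{z \<in> B i \<times> B j. (\<forall>l\<in>J. {i, l} \<in> E - {{i, j}} \<longrightarrow> nrm (fst z - y l) = t i l)
      \<and> (\<forall>l\<in>J. {j, l} \<in> E - {{i, j}} \<longrightarrow> nrm (snd z - y l) = t j l) \<and> ({i, j} \<in> E - {{i, j}} \<longrightarrow> nrm (fst z - snd z) = t i j)}
      = P y \<times> Q y" using ne by (auto simp: P_def Q_def link_def)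
    thus "card (P y) * card (Q y) = card {z \<in> B i \<times> B j. (\<forall>l\<in>J. {i, l} \<in> E - {{i, j}} \<longrightarrow> nrm (fst z - y l) = t i l)
      \<and> (\<forall>l\<in>J. {j, l} \<in> E - {{i, j}} \<longrightarrow> nrm (snd z - y l) = t j l) \<and> ({i, j} \<in> E - {{i, j}} \<longrightarrow> nrm (fst z - snd z) = t i j)}"
      by (simp only: card_cartesian_product)
  next
    fix y
    have "{u, v} \<noteq> {i, j}" if "u \<in> J" "v \<in> J" for u v using that by (auto simp: J_def doubleton_eq_iff)
    thus "(\<forall>u\<in>J. \<forall>v\<in>J. {u, v} \<in> E - {{i, j}} \<longrightarrow> nrm (y u - y v) = t u v) \<longleftrightarrow> R y" by (auto simp: R_def)
  qed auto
  have N3: "card (config I B t (E - star E i)) = (\<Sum>y\<in>Y. card (B i) * card (Q y))"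
  proof (rule count)
    fix y
    have "{z \<in> B i \<times> B j. (\<forall>l\<in>J. {i, l} \<in> E - star E i \<longrightarrow> nrm (fst z - y l) = t i l)
      \<and> (\<forall>l\<in>J. {j, l} \<in> E - star E i \<longrightarrow> nrm (snd z - y l) = t j l) \<and> ({i, j} \<in> E - star E i \<longrightarrow> nrm (fst z - snd z) = t i j)}
      = B i \<times> Q y" using ijI by (auto simp: Q_def link_def star_def J_def)
    thus "card (B i) * card (Q y) = card {z \<in> B i \<times> B j. (\<forall>l\<in>J. {i, l} \<in> E - star E i \<longrightarrow> nrm (fst z - y l) = t i l)
      \<and> (\<forall>l\<in>J. {j, l} \<in> E - star E i \<longrightarrow> nrm (snd z - y l) = t j l) \<and> ({i, j} \<in> E - star E i \<longrightarrow> nrm (fst z - snd z) = t i j)}"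
      by (simp only: card_cartesian_product)
  qed (use starJ in \<open>auto simp: R_def\<close>)
  have N4: "card (config I B t (E - star E j)) = (\<Sum>y\<in>Y. card (P y) * card (B j))"
  proof (rule count)
    fix y
    have "{z \<in> B i \<times> B j. (\<forall>l\<in>J. {i, l} \<in> E - star E j \<longrightarrow> nrm (fst z - y l) = t i l)
      \<and> (\<forall>l\<in>J. {j, l} \<in> E - star E j \<longrightarrow> nrm (snd z - y l) = t j l) \<and> ({i, j} \<in> E - star E j \<longrightarrow> nrm (fst z - snd z) = t i j)}
      = P y \<times> B j" using ijI by (auto simp: P_def link_def star_def J_def)
    thus "card (P y) * card (B j) = card {z \<in> B i \<times> B j. (\<forall>l\<in>J. {i, l} \<in> E - star E j \<longrightarrow> nrm (fst z - y l) = t i l)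
      \<and> (\<forall>l\<in>J. {j, l} \<in> E - star E j \<longrightarrow> nrm (snd z - y l) = t j l) \<and> ({i, j} \<in> E - star E j \<longrightarrow> nrm (fst z - snd z) = t i j)}"
      by (simp only: card_cartesian_product)
  qed (use starJ in \<open>auto simp: R_def\<close>)
  define p where "p y = real (card (P y))" for y
  define r where "r y = real (card (Q y))" for y
  have "real q * real (card (config I B t E)) - real (card (config I B t (E - {{i, j}})))
      = (\<Sum>y\<in>Y. real q * real (card {z \<in> P y \<times> Q y. nrm (fst z - snd z) = t i j}) - p y * r y)"
    unfolding N1 N2 by (simp add: p_def r_def sum_distrib_left sum_subtractf)
  also have "\<bar>\<dots>\<bar> \<le> (\<Sum>y\<in>Y. \<mu> * (sqrt (p y) * sqrt (r y)))"
  proof (intro order_trans[OF sum_abs] sum_mono)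
    fix y assume "y \<in> Y"
    hence "y \<in> PiE (I - {i, j}) B" by (simp add: Y_def J_def)
    from bound[OF this]
    show "\<bar>real q * real (card {z \<in> P y \<times> Q y. nrm (fst z - snd z) = t i j}) - p y * r y\<bar> \<le> \<mu> * (sqrt (p y) * sqrt (r y))"
      by (simp add: p_def r_def P_def Q_def J_def real_sqrt_mult)
  qed
  also have "\<dots> = \<mu> * (\<Sum>y\<in>Y. sqrt (p y) * sqrt (r y))" by (simp add: sum_distrib_left)
  also have "\<dots> \<le> \<mu> * (sqrt (\<Sum>y\<in>Y. p y) * sqrt (\<Sum>y\<in>Y. r y))"
  proof (rule mult_left_mono[OF _ lam])
    have "(\<Sum>y\<in>Y. sqrt (p y) * sqrt (r y)) = (\<Sum>y\<in>Y. cmod (of_real (sqrt (p y))) * cmod (of_real (sqrt (r y))))"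
      by (intro sum.cong refl) (simp add: p_def r_def)
    also have "\<dots> \<le> sqrt (\<Sum>y\<in>Y. (cmod (of_real (sqrt (p y))))\<^sup>2) * sqrt (\<Sum>y\<in>Y. (cmod (of_real (sqrt (r y))))\<^sup>2)"
      by (rule sum_norm_mult_le)
    also have "\<dots> = sqrt (\<Sum>y\<in>Y. p y) * sqrt (\<Sum>y\<in>Y. r y)" by (simp add: p_def r_def)
    finally show "(\<Sum>y\<in>Y. sqrt (p y) * sqrt (r y)) \<le> sqrt (\<Sum>y\<in>Y. p y) * sqrt (\<Sum>y\<in>Y. r y)" .
  qed
  finally have "\<bar>real q * real (card (config I B t E)) - real (card (config I B t (E - {{i, j}})))\<bar>
      * sqrt (real (card (B i)) * real (card (B j)))
    \<le> \<mu> * (sqrt (\<Sum>y\<in>Y. p y) * sqrt (\<Sum>y\<in>Y. r y)) * sqrt (real (card (B i)) * real (card (B j)))"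
    by (intro mult_right_mono) auto
  also have "\<dots> = \<mu> * sqrt (real (card (config I B t (E - star E i))) * real (card (config I B t (E - star E j))))"
    unfolding N3 N4 by (simp add: p_def r_def real_sqrt_mult mult_ac flip: sum_distrib_left sum_distrib_right)
  finally show ?thesis .
qed

lemma config_empty: "finite I \<Longrightarrow> card (config I B t {}) = (\<Prod>i\<in>I. card (B i))"
  by (simp add: config_def card_PiE)

text \<open>
  Induction on the number of edges. The error of one removal involves configurations with all
  edges at \<open>i\<close> or at \<open>j\<close> deleted; by induction they are at most twice as many as expected, and
  the assumption on \<open>\<mu>\<close> says that the error is then at most \<open>\<eta>\<close> times the main term. The errors
  of all removals add up.
\<close>

lemma config_count:
  fixes B :: "'i \<Rightarrow> (nat \<Rightarrow> 'r) set" and t :: "'i \<Rightarrow> 'i \<Rightarrow> 'r"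
  assumes I: "finite I" and B: "\<And>l. l \<in> I \<Longrightarrow> B l \<subseteq> V" and Bne: "\<And>l. l \<in> I \<Longrightarrow> B l \<noteq> {}"
    and sym: "\<And>a b. t a b = t b a"
    and \<eta>: "\<eta> \<ge> 0" "real (card (edges I)) * \<eta> \<le> 1"
    and pair: "\<And>E i j. E \<subseteq> edges I \<Longrightarrow> {i, j} \<in> E \<Longrightarrow> \<exists>\<mu>\<ge>0.
      2 * \<mu> * sqrt (real q) ^ (card (star E i) + card (star E j)) \<le> \<eta> * real q * sqrt (real (card (B i)) * real (card (B j))) \<and>
      (\<forall>y\<in>PiE (I - {i, j}) B.
        \<bar>real q * real (card {z \<in> link (I - {i, j}) B t E i y \<times> link (I - {i, j}) B t E j y. nrm (fst z - snd z) = t i j})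
          - real (card (link (I - {i, j}) B t E i y)) * real (card (link (I - {i, j}) B t E j y))\<bar>
        \<le> \<mu> * sqrt (real (card (link (I - {i, j}) B t E i y)) * real (card (link (I - {i, j}) B t E j y))))"
    and E: "E \<subseteq> edges I"
  defines "M \<equiv> \<Prod>i\<in>I. real (card (B i))"
  shows "\<bar>real q ^ card E * real (card (config I B t E)) - M\<bar> \<le> real (card E) * \<eta> * M"
  using E
proof (induction "card E" arbitrary: E rule: less_induct)
  case less
  have finE: "finite E" using less.prems finite_edges[OF I] by (rule finite_subset)
  have M0: "M \<ge> 0" unfolding M_def by (intro prod_nonneg) auto
  show ?case
  proof (cases "E = {}")
    case True
    thus ?thesis using config_empty[OF I, of B t] by (simp add: M_def)
  next
    case False
    then obtain a where a: "a \<in> E" by blast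
    obtain i j where "a = {i, j}" using subsetD[OF less.prems a] by (auto simp: edges_def)
    with a have ij: "{i, j} \<in> E" by simp
    have ijI: "i \<in> I" "j \<in> I" "i \<noteq> j" using edges_pair[of i j I] subsetD[OF less.prems ij] by auto
    obtain \<mu> where lam: "\<mu> \<ge> 0"
      "2 * \<mu> * sqrt (real q) ^ (card (star E i) + card (star E j)) \<le> \<eta> * real q * sqrt (real (card (B i)) * real (card (B j)))"
      "\<And>y. y \<in> PiE (I - {i, j}) B \<Longrightarrow>
        \<bar>real q * real (card {z \<in> link (I - {i, j}) B t E i y \<times> link (I - {i, j}) B t E j y. nrm (fst z - snd z) = t i j})
          - real (card (link (I - {i, j}) B t E i y)) * real (card (link (I - {i, j}) B t E j y))\<bar>
        \<le> \<mu> * sqrt (real (card (link (I - {i, j}) B t E i y)) * real (card (link (I - {i, j}) B t E j y)))"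
      using pair[OF less.prems ij] by blast
    define s where "s = sqrt (real q)"
    define b where "b = sqrt (real (card (B i)) * real (card (B j)))"
    define N where "N F = real (card (config I B t F))" for F
    have b0: "b > 0"
    proof -
      have "card (B l) > 0" if "l \<in> I" for l using B[OF that] Bne[OF that] finite_V by (meson card_gt_0_iff finite_subset)
      thus ?thesis using ijI by (simp add: b_def)
    qed
    have s0: "s > 0" "s ^ 2 = real q" by (simp_all add: s_def)
    have star_bound: "N (E - star E l) * s ^ (2 * (card E - card (star E l))) \<le> 2 * M" if l: "l \<in> {i, j}" for l
    proof -
      have sub: "star E l \<subseteq> E" by (auto simp: star_def)
      have ne: "star E l \<noteq> {}" using ij l by (auto simp: star_def)
      have c: "card (E - star E l) = card E - card (star E l)" using finE sub by (meson card_Diff_subset finite_subset)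
      moreover have "card (star E l) > 0" using finE sub ne by (meson card_gt_0_iff finite_subset)
      moreover have "card E > 0" using finE False by (simp add: card_gt_0_iff)
      ultimately have "\<bar>real q ^ card (E - star E l) * N (E - star E l) - M\<bar> \<le> real (card (E - star E l)) * \<eta> * M"
        unfolding N_def using less.prems by (intro less.hyps) auto
      also have "\<dots> \<le> 1 * M"
      proof (rule mult_right_mono[OF _ M0])
        have "card (E - star E l) \<le> card (edges I)" using less.prems finite_edges[OF I] by (intro card_mono) auto
        hence "real (card (E - star E l)) * \<eta> \<le> real (card (edges I)) * \<eta>" using \<eta>(1) by (intro mult_right_mono) auto
        thus "real (card (E - star E l)) * \<eta> \<le> 1" using \<eta>(2) by linarith
      qed
      finally have "real q ^ card (E - star E l) * N (E - star E l) \<le> 2 * M" by linarith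
      thus ?thesis unfolding c power_mult s0(2) by (simp add: mult.commute)
    qed
    define m where "m = 2 * card E - card (star E i) - card (star E j)"
    have star_le: "card (star E l) \<le> card E" for l using finE by (intro card_mono) (auto simp: star_def)
    have m: "m = (card E - card (star E i)) + (card E - card (star E j))"
      "m + (card (star E i) + card (star E j)) = 2 * card E"
      using star_le[of i] star_le[of j] by (simp_all add: m_def)
    have "sqrt (N (E - star E i) * N (E - star E j)) * s ^ m \<le> 2 * M"
    proof -
      have "(sqrt (N (E - star E i) * N (E - star E j)) * s ^ m)\<^sup>2
          = (N (E - star E i) * s ^ (2 * (card E - card (star E i)))) * (N (E - star E j) * s ^ (2 * (card E - card (star E j))))"
        by (simp add: N_def m(1) power_mult_distrib power_add mult_ac flip: power_mult)
      also have "\<dots> \<le> (2 * M) * (2 * M)"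
        by (rule mult_mono[OF star_bound star_bound]) (use s0(1) M0 in \<open>simp_all add: N_def\<close>)
      finally have "(sqrt (N (E - star E i) * N (E - star E j)) * s ^ m)\<^sup>2 \<le> (2 * M)\<^sup>2"
        by (simp add: power2_eq_square)
      thus ?thesis using M0 by (rule_tac power2_le_imp_le) auto
    qed
    hence key: "\<mu> * s ^ (card (star E i) + card (star E j)) * (sqrt (N (E - star E i) * N (E - star E j)) * s ^ m)
        \<le> \<mu> * s ^ (card (star E i) + card (star E j)) * (2 * M)"
      using lam(1) s0(1) by (intro mult_left_mono) auto
    define X where "X = real q ^ card E * N E - real q ^ (card E - 1) * N (E - {{i, j}})"
    have cE: "card E > 0" using finE False by (simp add: card_gt_0_iff)
    hence qE: "real q ^ card E = real q * real q ^ (card E - 1)" by (cases "card E") auto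
    have "real q * \<bar>X\<bar> * b = real q ^ card E * (\<bar>real q * N E - N (E - {{i, j}})\<bar> * b)"
    proof -
      have "X = real q ^ (card E - 1) * (real q * N E - N (E - {{i, j}}))" unfolding X_def qE by (simp add: algebra_simps)
      hence "\<bar>X\<bar> = real q ^ (card E - 1) * \<bar>real q * N E - N (E - {{i, j}})\<bar>" by (simp add: abs_mult)
      thus ?thesis unfolding qE by (simp only: mult_ac)
    qed
    also have "\<dots> \<le> real q ^ card E * (\<mu> * sqrt (N (E - star E i) * N (E - star E j)))"
      unfolding N_def b_def using edge_removal[OF I less.prems ij B sym lam(1,3)] by (intro mult_left_mono) auto
    also have "\<dots> = \<mu> * s ^ (card (star E i) + card (star E j)) * (sqrt (N (E - star E i) * N (E - star E j)) * s ^ m)"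
    proof -
      have "real q ^ card E = s ^ m * s ^ (card (star E i) + card (star E j))"
        unfolding power_add[symmetric] m(2) power_mult s0(2) ..
      thus ?thesis by (simp only: mult_ac)
    qed
    also have "\<dots> \<le> \<mu> * s ^ (card (star E i) + card (star E j)) * (2 * M)" by (rule key)
    also have "\<dots> = (2 * \<mu> * s ^ (card (star E i) + card (star E j))) * M" by (simp only: mult_ac)
    also have "\<dots> \<le> (\<eta> * real q * b) * M"
      using lam(2) unfolding s_def[symmetric] b_def[symmetric] by (rule mult_right_mono[OF _ M0])
    finally have "(real q * b) * \<bar>X\<bar> \<le> (real q * b) * (\<eta> * M)" by (simp only: mult_ac)
    hence X: "\<bar>X\<bar> \<le> \<eta> * M" using b0 by (subst (asm) mult_le_cancel_left_pos) auto
    have c1: "card (E - {{i, j}}) = card E - 1" using ij finE by simp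
    have "\<bar>real q ^ card (E - {{i, j}}) * N (E - {{i, j}}) - M\<bar> \<le> real (card (E - {{i, j}})) * \<eta> * M"
      unfolding N_def using less.prems cE c1 by (intro less.hyps) auto
    hence "\<bar>real q ^ (card E - 1) * N (E - {{i, j}}) - M\<bar> \<le> real (card E - 1) * \<eta> * M" unfolding c1 .
    moreover have "real (card E) * \<eta> * M = real (card E - 1) * \<eta> * M + \<eta> * M"
      using cE by (cases "card E") (auto simp: algebra_simps)
    ultimately show ?thesis using X unfolding X_def N_def by linarith
  qed
qed

text \<open>
  After translating \<open>h\<close> to the origin, polarization turns the distance between \<open>a\<close> and \<open>b\<close> into
  their dot product.
\<close>

lemma pairs_with_common_neighbour:
  assumes P: "P \<subseteq> V" and Q: "Q \<subseteq> V" and h: "h \<in> V" and t: "t \<in> K" and \<alpha>: "\<alpha> \<in> K" and \<beta>: "\<beta> \<in> K" "\<beta> \<noteq> 0"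
    and Ph: "\<And>a. a \<in> P \<Longrightarrow> nrm (a - h) = \<alpha>" and Qh: "\<And>b. b \<in> Q \<Longrightarrow> nrm (b - h) = \<beta>"
  shows "\<bar>real q * real (card {z \<in> P \<times> Q. nrm (fst z - snd z) = t}) - real (card P) * real (card Q)\<bar>
    \<le> sqrt 2 * sqrt (real q) ^ (d + 1) * sqrt (real (card P) * real (card Q))"
proof -
  define s where "s = kinv (2 * e) * (\<alpha> + \<beta> - t)"
  have sK: "s \<in> K" using t \<alpha> \<beta> by (simp add: s_def)
  have e2: "2 * e \<noteq> 0" using two_mult_eq_0[of e] by simp
  have s: "2 * s = \<alpha> + \<beta> - t"
  proof -
    have "2 * s = (2 * e) * s" using sK by (simp add: mult.assoc)
    also have "\<dots> = \<alpha> + \<beta> - t" unfolding s_def using e2 t \<alpha> \<beta> by simp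
    finally show ?thesis .
  qed
  let ?sh = "\<lambda>x. x - h"
  have inj: "inj_on ?sh A" for A by (auto simp: inj_on_def)
  have "dot (a - h) (b - h) = s \<longleftrightarrow> nrm (a - b) = t" if "a \<in> P" "b \<in> Q" for a b
  proof -
    have V: "a \<in> V" "b \<in> V" using that P Q by auto
    have "a - b = (a - h) - (b - h)" by simp
    hence "nrm (a - b) = \<alpha> + \<beta> - 2 * dot (a - h) (b - h)"
      using nrm_diff[of "a - h" "b - h"] Ph[OF that(1)] Qh[OF that(2)] by simp
    also have "\<dots> = t + 2 * (s - dot (a - h) (b - h))" using s by (simp add: algebra_simps)
    finally have "nrm (a - b) = t \<longleftrightarrow> 2 * (s - dot (a - h) (b - h)) = 0" by simp
    thus ?thesis using two_mult_eq_0[of "s - dot (a - h) (b - h)"] sK V h by auto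
  qed
  hence "{z \<in> ?sh ` P \<times> ?sh ` Q. dot (fst z) (snd z) = s} = (\<lambda>z. (fst z - h, snd z - h)) ` {z \<in> P \<times> Q. nrm (fst z - snd z) = t}"
    by (auto simp: image_iff) (metis fst_conv snd_conv)+
  moreover have "inj_on (\<lambda>z. (fst z - h, snd z - h)) {z \<in> P \<times> Q. nrm (fst z - snd z) = t}"
    by (auto simp: inj_on_def)
  ultimately have "card {z \<in> ?sh ` P \<times> ?sh ` Q. dot (fst z) (snd z) = s} = card {z \<in> P \<times> Q. nrm (fst z - snd z) = t}"
    by (simp add: card_image)
  moreover have "\<bar>real q * real (card {z \<in> ?sh ` P \<times> ?sh ` Q. dot (fst z) (snd z) = s}) - real (card (?sh ` P)) * real (card (?sh ` Q))\<bar>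
    \<le> sqrt 2 * sqrt (real q) ^ (d + 1) * sqrt (real (card (?sh ` P)) * real (card (?sh ` Q)))"
    using P Q h Qh by (intro dot_pairs[OF _ _ sK \<beta>(2)]) auto
  ultimately show ?thesis by (simp add: card_image[OF inj])
qed

end

lemma sqrt_mult_ge:
  assumes "(m::real) \<ge> 0" "a \<ge> m" "b \<ge> m" shows "m \<le> sqrt (a * b)"
proof -
  have "m * m \<le> a * b" using assms by (intro mult_mono) auto
  hence "sqrt (m * m) \<le> sqrt (a * b)" by (rule real_sqrt_le_mono)
  thus ?thesis using assms by simp
qed

context quadratic_space begin

lemma kloosterman_trivial: "unit_character \<epsilon> \<Longrightarrow> cmod (kloosterman \<epsilon> a b) \<le> real q"
proof -
  assume \<epsilon>: "unit_character \<epsilon>"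
  have "cmod (kloosterman \<epsilon> a b) \<le> (\<Sum>x\<in>K - {0}. 1)"
    unfolding kloosterman_def
  proof (rule sum_norm_le)
    fix x assume "x \<in> K - {0}"
    hence "cmod (\<epsilon> x) = 1" using \<epsilon> unfolding unit_character_def by blast
    thus "cmod (\<epsilon> x * chi (a * x + b * kinv x)) \<le> 1" by (simp add: norm_mult)
  qed
  thus ?thesis using card_units q_pos(1) by (simp add: of_nat_diff)
qed

text \<open>
  In a removal of the edge \<open>{i, j}\<close>, the degrees of \<open>i\<close> and \<open>j\<close> decide how small the error has
  to be. If \<open>i\<close> and \<open>j\<close> have a common neighbour, the degrees can be as large as \<open>k - 1\<close>, and the
  estimate for dot products is strong enough. If not, the degrees have sum at most \<open>k\<close>. For
  \<open>k \<ge> 3\<close> this is at most \<open>2 k - 3\<close>, and the trivial bound for Kloosterman sums suffices. For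
  \<open>k = 2\<close> a nontrivial bound \<open>\<kappa>\<close> is needed, in balance with the product of the two set sizes.
\<close>

lemma config_estimate:
  fixes B :: "'i \<Rightarrow> (nat \<Rightarrow> 'r) set" and t :: "'i \<Rightarrow> 'i \<Rightarrow> 'r"
  assumes I: "finite I" "card I = k" "k \<ge> 2" and B: "\<And>l. l \<in> I \<Longrightarrow> B l \<subseteq> V" and Bne: "\<And>l. l \<in> I \<Longrightarrow> B l \<noteq> {}"
    and t: "\<And>a b. t a b = t b a" "\<And>a b. t a b \<in> K" "\<And>a b. a \<in> I \<Longrightarrow> b \<in> I \<Longrightarrow> a \<noteq> b \<Longrightarrow> t a b \<noteq> 0"
    and \<eta>: "\<eta> \<ge> 0" "real (card (edges I)) * \<eta> \<le> 1"
    and big: "\<And>l. l \<in> I \<Longrightarrow> 2 * sqrt 2 * sqrt (real q) ^ (d + 2 * k - 1) \<le> \<eta> * real q * real (card (B l))"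
    and k2: "k = 2 \<Longrightarrow> \<exists>\<kappa>. (\<forall>a\<in>K. \<forall>b\<in>K. a \<noteq> 0 \<longrightarrow> cmod (kloosterman (\<lambda>x. of_real (eta x) ^ d) a b) \<le> \<kappa>) \<and>
      (\<forall>i\<in>I. \<forall>j\<in>I. i \<noteq> j \<longrightarrow> 2 * sqrt (real q) ^ d * \<kappa> \<le> \<eta> * sqrt (real (card (B i)) * real (card (B j))))"
    and E: "E \<subseteq> edges I"
  shows "\<bar>real q ^ card E * real (card (config I B t E)) - (\<Prod>i\<in>I. real (card (B i)))\<bar>
    \<le> real (card E) * \<eta> * (\<Prod>i\<in>I. real (card (B i)))"
proof (rule config_count[OF I(1) B Bne t(1) \<eta> _ E])
  fix E and i j :: 'i
  assume E: "E \<subseteq> edges I" and ij: "{i, j} \<in> E"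
  define s where "s = sqrt (real q)"
  have s1: "s \<ge> 1" "s ^ 2 = real q" using q_ge_3 by (simp_all add: s_def)
  have ijI: "i \<in> I" "j \<in> I" "i \<noteq> j" using edges_pair[of i j I] subsetD[OF E ij] by auto
  define J where "J = I - {i, j}"
  define Li where "Li = {l \<in> J. {i, l} \<in> E}"
  define Lj where "Lj = {l \<in> J. {j, l} \<in> E}"
  have finJ: "finite J" "card J = k - 2" using I ijI by (simp_all add: J_def card_Diff_subset)
  have star_i: "card (star E i) = Suc (card Li)" unfolding Li_def J_def by (rule card_star[OF E I(1) ij])
  have star_j: "card (star E j) = Suc (card Lj)"
  proof -
    have "{j, i} \<in> E" using ij by (simp add: insert_commute)
    hence "card (star E j) = Suc (card {l \<in> I - {j, i}. {j, l} \<in> E})" by (rule card_star[OF E I(1)])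
    thus ?thesis by (simp add: Lj_def J_def insert_commute)
  qed
  have L_sub: "Li \<subseteq> J" "Lj \<subseteq> J" by (auto simp: Li_def Lj_def)
  have big': "2 * sqrt 2 * s ^ (d + 2 * k - 1) \<le> \<eta> * real q * sqrt (real (card (B i)) * real (card (B j)))"
  proof -
    have "2 * sqrt 2 * s ^ (d + 2 * k - 1) \<le> sqrt ((\<eta> * real q * real (card (B i))) * (\<eta> * real q * real (card (B j))))"
      using big[OF ijI(1)] big[OF ijI(2)] s1 unfolding s_def[symmetric] by (intro sqrt_mult_ge) auto
    also have "\<dots> = sqrt ((\<eta> * real q)\<^sup>2 * (real (card (B i)) * real (card (B j))))"
      by (simp add: power2_eq_square mult_ac)
    also have "\<dots> = \<eta> * real q * sqrt (real (card (B i)) * real (card (B j)))"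
      using \<eta>(1) unfolding real_sqrt_mult by simp
    finally show ?thesis .
  qed
  have linkV: "link J B t E i y \<subseteq> V" "link J B t E j y \<subseteq> V" for y
    using B[OF ijI(1)] B[OF ijI(2)] by (auto simp: link_def)
  let ?stmt = "\<lambda>\<mu>. 2 * \<mu> * s ^ (card (star E i) + card (star E j)) \<le> \<eta> * real q * sqrt (real (card (B i)) * real (card (B j)))"
  let ?bound = "\<lambda>\<mu> y. \<bar>real q * real (card {z \<in> link J B t E i y \<times> link J B t E j y. nrm (fst z - snd z) = t i j})
          - real (card (link J B t E i y)) * real (card (link J B t E j y))\<bar>
        \<le> \<mu> * sqrt (real (card (link J B t E i y)) * real (card (link J B t E j y)))"
  have sphere: "?bound (s ^ d * \<kappa>) y"
    if "\<And>a b. a \<in> K \<Longrightarrow> b \<in> K \<Longrightarrow> a \<noteq> 0 \<Longrightarrow> cmod (kloosterman (\<lambda>x. of_real (eta x) ^ d) a b) \<le> \<kappa>" for \<kappa> y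
    unfolding s_def using t(2)[of i j] t(3)[OF ijI] that by (intro distance_pairs linkV) auto
  have "\<exists>\<mu>\<ge>0. ?stmt \<mu> \<and> (\<forall>y\<in>PiE J B. ?bound \<mu> y)"
  proof (cases "Li \<inter> Lj = {}")
    case False
    then obtain h where h: "h \<in> J" "{i, h} \<in> E" "{j, h} \<in> E" by (auto simp: Li_def Lj_def)
    have hI: "h \<in> I" "h \<noteq> i" "h \<noteq> j" using h by (auto simp: J_def)
    have "card Li \<le> k - 2" "card Lj \<le> k - 2" using card_mono[OF finJ(1)] L_sub finJ(2) by auto
    hence "(d + 1) + (card (star E i) + card (star E j)) \<le> d + 2 * k - 1" using star_i star_j I(3) by linarith
    hence "s ^ ((d + 1) + (card (star E i) + card (star E j))) \<le> s ^ (d + 2 * k - 1)" using s1 by (intro power_increasing)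
    hence "2 * (sqrt 2 * s ^ (d + 1)) * s ^ (card (star E i) + card (star E j)) \<le> 2 * sqrt 2 * s ^ (d + 2 * k - 1)"
      by (simp add: power_add mult_ac)
    hence "?stmt (sqrt 2 * s ^ (d + 1))" using big' by (rule order_trans)
    moreover have "?bound (sqrt 2 * s ^ (d + 1)) y" if y: "y \<in> PiE J B" for y
    proof -
      have yh: "y h \<in> V" using y h B[OF hI(1)] by auto
      show ?thesis unfolding s_def
      proof (rule pairs_with_common_neighbour[OF linkV yh])
        show "t j h \<noteq> 0" using t(3)[OF ijI(2) hI(1)] hI by auto
        show "\<And>a. a \<in> link J B t E i y \<Longrightarrow> nrm (a - y h) = t i h" using h by (auto simp: link_def)
        show "\<And>a. a \<in> link J B t E j y \<Longrightarrow> nrm (a - y h) = t j h" using h by (auto simp: link_def)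
      qed (rule t(2))+
    qed
    moreover have "sqrt 2 * s ^ (d + 1) \<ge> 0" using s1 by simp
    ultimately show ?thesis by blast
  next
    case True
    have "card Li + card Lj = card (Li \<union> Lj)"
      using True L_sub finJ(1) by (intro card_Un_disjoint[symmetric]) (auto intro: finite_subset)
    also have "\<dots> \<le> k - 2" using L_sub finJ by (metis Un_least card_mono)
    finally have L_le: "card Li + card Lj \<le> k - 2" .
    show ?thesis
    proof (cases "k = 2")
      case True
      then obtain \<kappa> where \<kappa>: "\<And>a b. a \<in> K \<Longrightarrow> b \<in> K \<Longrightarrow> a \<noteq> 0 \<Longrightarrow> cmod (kloosterman (\<lambda>x. of_real (eta x) ^ d) a b) \<le> \<kappa>"
        "2 * s ^ d * \<kappa> \<le> \<eta> * sqrt (real (card (B i)) * real (card (B j)))"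
        using k2 ijI unfolding s_def by blast
      have "\<kappa> \<ge> 0" using order_trans[OF norm_ge_zero \<kappa>(1)[of e 0]] by simp
      have "card (star E i) + card (star E j) = 2" using star_i star_j L_le True by simp
      hence "?stmt (s ^ d * \<kappa>)" using mult_left_mono[OF \<kappa>(2), of "real q"] s1(2) by (simp add: mult_ac)
      moreover have "s ^ d * \<kappa> \<ge> 0" using s1 \<open>\<kappa> \<ge> 0\<close> by simp
      ultimately show ?thesis using sphere[OF \<kappa>(1)] by blast
    next
      case False
      hence "2 + d + (card (star E i) + card (star E j)) \<le> d + 2 * k - 1"
        using star_i star_j L_le I(3) by linarith
      hence "s ^ (2 + d + (card (star E i) + card (star E j))) \<le> s ^ (d + 2 * k - 1)" using s1 by (intro power_increasing)
      also have "\<dots> \<le> sqrt 2 * s ^ (d + 2 * k - 1)" using s1 by simp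
      finally have "2 * (s ^ d * real q) * s ^ (card (star E i) + card (star E j)) \<le> 2 * sqrt 2 * s ^ (d + 2 * k - 1)"
        by (simp add: power_add s1(2)[symmetric] power2_eq_square mult_ac)
      hence "?stmt (s ^ d * real q)" using big' by (rule order_trans)
      moreover have "?bound (s ^ d * real q) y" for y
        by (rule sphere) (rule kloosterman_trivial[OF unit_character_eta_power])
      moreover have "s ^ d * real q \<ge> 0" using s1 by simp
      ultimately show ?thesis by blast
    qed
  qed
  thus "\<exists>\<mu>\<ge>0. 2 * \<mu> * sqrt (real q) ^ (card (star E i) + card (star E j))
      \<le> \<eta> * real q * sqrt (real (card (B i)) * real (card (B j))) \<and>
      (\<forall>y\<in>PiE (I - {i, j}) B.
        \<bar>real q * real (card {z \<in> link (I - {i, j}) B t E i y \<times> link (I - {i, j}) B t E j y. nrm (fst z - snd z) = t i j})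
          - real (card (link (I - {i, j}) B t E i y)) * real (card (link (I - {i, j}) B t E j y))\<bar>
        \<le> \<mu> * sqrt (real (card (link (I - {i, j}) B t E i y)) * real (card (link (I - {i, j}) B t E j y))))"
    unfolding J_def s_def .
qed

section \<open>Degenerate configurations\<close>

lemma gram_from_distances:
  assumes "a \<in> V" "b \<in> V" "a' \<in> V" "b' \<in> V" "nrm a = nrm a'" "nrm b = nrm b'" "nrm (a - b) = nrm (a' - b')"
  shows "dot a b = dot a' b'"
proof -
  have "2 * (dot a b - dot a' b') = 0" using assms(5-7) by (simp add: nrm_diff algebra_simps)
  thus ?thesis using two_mult_eq_0[of "dot a b - dot a' b'"] assms by simp
qed

text \<open>
  A configuration without its point \<open>x j\<close>, completed by any point of \<open>B j\<close>, is a configuration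
  for the edges that avoid \<open>j\<close>.
\<close>

lemma link_card_le:
  assumes I: "finite I" "j \<in> I" and B: "\<And>l. l \<in> I \<Longrightarrow> B l \<subseteq> V"
  shows "card ((\<lambda>x. restrict x (I - {j})) ` config I B t (edges I)) * card (B j) \<le> card (config I B t (edges I - star (edges I) j))"
proof -
  let ?Z = "(\<lambda>x. restrict x (I - {j})) ` config I B t (edges I)"
  let ?f = "\<lambda>w. (fst w)(j := snd w)"
  have finB: "finite (B l)" if "l \<in> I" for l using B[OF that] finite_V by (rule finite_subset)
  have finC: "finite (config I B t E)" for E
    by (rule finite_subset[of _ "PiE I B"]) (auto simp: config_def intro!: finite_PiE I finB)
  have "card (?Z \<times> B j) \<le> card (config I B t (edges I - star (edges I) j))"
  proof (rule card_inj_on_le[of ?f])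
    show "inj_on ?f (?Z \<times> B j)"
    proof (rule inj_onI)
      fix w w' assume w: "w \<in> ?Z \<times> B j" "w' \<in> ?Z \<times> B j" and eq: "?f w = ?f w'"
      have "snd w = snd w'" using fun_cong[OF eq, of j] by simp
      moreover have "fst w = fst w'"
      proof (rule ext)
        fix i
        show "fst w i = fst w' i"
        proof (cases "i = j")
          case True
          thus ?thesis using w by auto
        next
          case False
          thus ?thesis using fun_cong[OF eq, of i] by simp
        qed
      qed
      ultimately show "w = w'" by (simp add: prod_eq_iff)
    qed
    show "?f ` (?Z \<times> B j) \<subseteq> config I B t (edges I - star (edges I) j)"
    proof (rule image_subsetI)
      fix w assume "w \<in> ?Z \<times> B j"
      then obtain x b where xb: "w = (restrict x (I - {j}), b)" "x \<in> config I B t (edges I)" "b \<in> B j" by auto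
      have x: "x \<in> PiE I B" "\<And>i l. i \<in> I \<Longrightarrow> l \<in> I \<Longrightarrow> {i, l} \<in> edges I \<Longrightarrow> nrm (x i - x l) = t i l"
        using xb(2) by (auto simp: config_def)
      have "(restrict x (I - {j}))(j := b) \<in> PiE I B"
        using x(1) xb(3) I(2) by (auto simp: PiE_iff extensional_def)
      moreover have "nrm (((restrict x (I - {j}))(j := b)) i - ((restrict x (I - {j}))(j := b)) l) = t i l"
        if il: "i \<in> I" "l \<in> I" "{i, l} \<in> edges I - star (edges I) j" for i l
      proof -
        have "i \<noteq> j" "l \<noteq> j" using il(3) by (auto simp: star_def)
        thus ?thesis using il x(2)[of i l] by simp
      qed
      ultimately show "?f w \<in> config I B t (edges I - star (edges I) j)" using xb(1) by (simp add: config_def)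
    qed
  qed (rule finC)
  thus ?thesis by (simp add: card_cartesian_product)
qed

text \<open>
  The Gram matrix of the linearly independent vectors \<open>y i - y i0\<close> may be singular. The
  coefficient vectors in its kernel correspond to vectors in the span that are orthogonal to the
  span, hence form a totally isotropic set, which is moreover orthogonal to the nonisotropic
  vector \<open>y j0 - y i0\<close>.
\<close>

lemma card_relations:
  assumes I: "i0 \<in> I" "j0 \<in> I" "j0 \<noteq> i0" and y: "\<And>i. i \<in> I \<Longrightarrow> y i \<in> V"
    and ind: "independent (I - {i0}) (\<lambda>i. y i - y i0)" and nz: "nrm (y j0 - y i0) \<noteq> 0"
  shows "real (card {c \<in> (I - {i0}) \<rightarrow>\<^sub>E K. \<forall>j\<in>I - {i0}. dot (lincomb (I - {i0}) c (\<lambda>i. y i - y i0)) (y j - y i0) = 0})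
    \<le> sqrt (real q) ^ (d - 1)"
proof -
  let ?J = "I - {i0}" and ?v = "\<lambda>i. y i - y i0"
  let ?R = "{c \<in> ?J \<rightarrow>\<^sub>E K. \<forall>j\<in>?J. dot (lincomb ?J c ?v) (?v j) = 0}"
  have vV: "?v i \<in> V" if "i \<in> ?J" for i using y that I by auto
  have inj: "inj_on (\<lambda>c. lincomb ?J c ?v) ?R"
  proof (rule inj_onI)
    fix c c' assume c: "c \<in> ?R" "c' \<in> ?R" and eq: "lincomb ?J c ?v = lincomb ?J c' ?v"
    have "lincomb ?J (\<lambda>i. c i - c' i) ?v = lincomb ?J c ?v - lincomb ?J c' ?v"
      by (simp add: lincomb_def fun_eq_iff minus_apply left_diff_distrib sum_subtractf)
    hence 0: "lincomb ?J (\<lambda>i. c i - c' i) ?v = 0" using eq by simp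
    have cK: "c i - c' i \<in> K" if "i \<in> ?J" for i
    proof (rule diff_K)
      show "c i \<in> K" using c(1) that by blast
      show "c' i \<in> K" using c(2) that by blast
    qed
    show "c = c'"
    proof (rule PiE_ext[of c ?J "\<lambda>_. K" c'])
      fix i assume i: "i \<in> ?J"
      have "c i - c' i = 0" using independentD[OF ind cK 0 i] .
      thus "c i = c' i" by simp
    qed (use c in auto)
  qed
  have "q * (card ((\<lambda>c. lincomb ?J c ?v) ` ?R))\<^sup>2 \<le> q ^ d"
  proof (rule isotropic_card)
    show "(\<lambda>c. lincomb ?J c ?v) ` ?R \<subseteq> V" by (intro image_subsetI lincomb_V vV)
    show "?v j0 \<in> V" "nrm (?v j0) \<noteq> 0" using vV[of j0] I nz by auto
    show "dot x (?v j0) = 0" if "x \<in> (\<lambda>c. lincomb ?J c ?v) ` ?R" for x using that I by auto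
    fix x z assume x: "x \<in> (\<lambda>c. lincomb ?J c ?v) ` ?R" and z: "z \<in> (\<lambda>c. lincomb ?J c ?v) ` ?R"
    obtain c where c: "z = lincomb ?J c ?v" using z by blast
    have "dot x (?v j) = 0" if "j \<in> ?J" for j using x that by blast
    thus "dot x z = 0" unfolding c dot_lincomb_right by (simp add: sum.neutral)
  qed
  hence sq: "q * (card ?R)\<^sup>2 \<le> q ^ d" by (simp only: card_image[OF inj])
  have "d \<noteq> 0"
  proof
    assume "d = 0"
    hence "nrm (?v j0) = 0" unfolding dot_def by simp
    thus False using nz by contradiction
  qed
  hence "q * (card ?R)\<^sup>2 \<le> q * q ^ (d - 1)" using sq by (cases d) auto
  hence "(card ?R)\<^sup>2 \<le> q ^ (d - 1)" by simp
  hence "(real (card ?R))\<^sup>2 \<le> real (q ^ (d - 1))" by (simp only: of_nat_power[symmetric] of_nat_le_iff)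
  also have "\<dots> = (sqrt (real q) ^ (d - 1))\<^sup>2" by (simp flip: power_mult add: mult.commute) (simp add: power_mult)
  finally show ?thesis by (rule power2_le_imp_le) simp
qed

text \<open>
  A degenerate configuration satisfies a linear relation, and pairing the relation with the
  difference vectors shows that its coefficients lie in the kernel of the Gram matrix, which is
  the same as that of \<open>y\<close>. For a fixed relation with \<open>c j \<noteq> 0\<close>, the point \<open>x j\<close> is determined by
  the others.
\<close>

lemma card_degenerate:
  fixes y :: "'i \<Rightarrow> nat \<Rightarrow> 'r" and B :: "'i \<Rightarrow> (nat \<Rightarrow> 'r) set"
  assumes I: "finite I" "i0 \<in> I" "j0 \<in> I" "j0 \<noteq> i0" and y: "\<And>i. i \<in> I \<Longrightarrow> y i \<in> V"
    and ind: "independent (I - {i0}) (\<lambda>i. y i - y i0)" and nz: "nrm (y j0 - y i0) \<noteq> 0"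
    and B: "\<And>l. l \<in> I \<Longrightarrow> B l \<subseteq> V"
    and z: "\<And>j. j \<in> I \<Longrightarrow> real (card ((\<lambda>x. restrict x (I - {j})) ` config I B (\<lambda>i j. nrm (y i - y j)) (edges I))) \<le> z"
  shows "real (card {x \<in> config I B (\<lambda>i j. nrm (y i - y j)) (edges I). \<not> independent (I - {i0}) (\<lambda>i. x i - x i0)})
    \<le> sqrt (real q) ^ (d - 1) * z"
proof -
  let ?J = "I - {i0}" and ?v = "\<lambda>i. y i - y i0"
  let ?C = "config I B (\<lambda>i j. nrm (y i - y j)) (edges I)"
  define R where "R = {c \<in> ?J \<rightarrow>\<^sub>E K. \<forall>j\<in>?J. dot (lincomb ?J c ?v) (?v j) = 0}"
  have finB: "finite (B l)" if "l \<in> I" for l using B[OF that] finite_V by (rule finite_subset)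
  have finC: "finite ?C"
    by (rule finite_subset[of _ "PiE I B"]) (auto simp: config_def intro!: finite_PiE I finB)
  have finR: "finite R" by (rule finite_subset[of _ "?J \<rightarrow>\<^sub>E K"]) (auto simp: R_def intro!: finite_PiE I)
  define S where "S c = {x \<in> ?C. lincomb ?J c (\<lambda>i. x i - x i0) = 0}" for c
  have xV: "x i \<in> V" if "x \<in> ?C" "i \<in> I" for x i using that B[OF that(2)] by (auto simp: config_def)
  have dist: "nrm (x i - x j) = nrm (y i - y j)" if "x \<in> ?C" "i \<in> I" "j \<in> I" for x i j
  proof (cases "i = j")
    case False
    hence "{i, j} \<in> edges I" using that by (auto simp: edges_def)
    thus ?thesis using that by (auto simp: config_def)
  qed simp
  have gram: "dot (x i - x i0) (x j - x i0) = dot (?v i) (?v j)" if "x \<in> ?C" "i \<in> I" "j \<in> I" for x i j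
  proof (rule gram_from_distances)
    show "x i - x i0 \<in> V" "x j - x i0 \<in> V" using xV[OF that(1)] that I by simp_all
    show "?v i \<in> V" "?v j \<in> V" using y that I by simp_all
    show "nrm (x i - x i0) = nrm (?v i)" "nrm (x j - x i0) = nrm (?v j)" using dist[OF that(1)] that I by blast+
    have "x i - x i0 - (x j - x i0) = x i - x j" "?v i - ?v j = y i - y j" by simp_all
    thus "nrm (x i - x i0 - (x j - x i0)) = nrm (?v i - ?v j)" using dist[OF that] by (simp only:)
  qed
  have Snull: "real (card (S c)) \<le> z" if c: "c \<in> R" "\<exists>j\<in>?J. c j \<noteq> 0" for c
  proof -
    obtain j where j: "j \<in> ?J" "c j \<noteq> 0" using c by blast
    have cK: "c i \<in> K" if "i \<in> ?J" for i using c that by (auto simp: R_def)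
    have "inj_on (\<lambda>x. restrict x (I - {j})) (S c)"
    proof (rule inj_onI)
      fix x x' assume x: "x \<in> S c" "x' \<in> S c" and eq: "restrict x (I - {j}) = restrict x' (I - {j})"
      have same: "x i = x' i" if "i \<in> I" "i \<noteq> j" for i using fun_cong[OF eq, of i] that by simp
      have "i0 \<noteq> j" using j by auto
      hence i0: "x i0 = x' i0" using same I by simp
      have "lincomb ?J c (\<lambda>i. x i - x i0) - lincomb ?J c (\<lambda>i. x' i - x' i0) = smul (c j) (x j - x' j)"
      proof (rule ext)
        fix l
        have "(lincomb ?J c (\<lambda>i. x i - x i0) - lincomb ?J c (\<lambda>i. x' i - x' i0)) l = (\<Sum>i\<in>?J. c i * (x i l - x' i l))"
          using i0 by (simp add: lincomb_def minus_apply algebra_simps flip: sum_subtractf)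
        also have "\<dots> = (\<Sum>i\<in>?J. if i = j then c j * (x j l - x' j l) else 0)"
          using same by (intro sum.cong refl) auto
        also have "\<dots> = c j * (x j l - x' j l)" using I j by simp
        finally show "(lincomb ?J c (\<lambda>i. x i - x i0) - lincomb ?J c (\<lambda>i. x' i - x' i0)) l = smul (c j) (x j - x' j) l"
          by (simp add: smul_def minus_apply)
      qed
      hence "smul (c j) (x j - x' j) = 0" using x by (simp add: S_def)
      hence "smul (kinv (c j)) (smul (c j) (x j - x' j)) = 0" by simp
      moreover have "x j - x' j \<in> V" using x xV j by (auto simp: S_def)
      ultimately have "x j = x' j" using cK[OF j(1)] j(2) by simp
      hence all: "x i = x' i" if "i \<in> I" for i using same that by (cases "i = j") auto
      show "x = x'"
        by (rule PiE_ext[of x I B x']) (use x all in \<open>auto simp: S_def config_def\<close>)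
    qed
    hence "card (S c) = card ((\<lambda>x. restrict x (I - {j})) ` S c)" by (simp add: card_image)
    also have "\<dots> \<le> card ((\<lambda>x. restrict x (I - {j})) ` ?C)"
      using finC by (intro card_mono) (auto simp: S_def)
    finally have "real (card (S c)) \<le> real (card ((\<lambda>x. restrict x (I - {j})) ` ?C))" by simp
    also have "\<dots> \<le> z" using z j by blast
    finally show ?thesis .
  qed
  have z0: "z \<ge> 0" using order_trans[OF of_nat_0_le_iff z[OF I(2)]] .
  define R' where "R' = {c \<in> R. \<exists>j\<in>?J. c j \<noteq> 0}"
  have "{x \<in> ?C. \<not> independent ?J (\<lambda>i. x i - x i0)} \<subseteq> (\<Union>c\<in>R'. S c)"
  proof
    fix x assume "x \<in> {x \<in> ?C. \<not> independent ?J (\<lambda>i. x i - x i0)}"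
    hence x: "x \<in> ?C" "\<not> independent ?J (\<lambda>i. x i - x i0)" by auto
    have "\<forall>i\<in>?J. x i - x i0 \<in> V" using xV[OF x(1)] I by auto
    then obtain c0 where c0: "\<forall>i\<in>?J. c0 i \<in> K" "lincomb ?J c0 (\<lambda>i. x i - x i0) = 0" "\<exists>i\<in>?J. c0 i \<noteq> 0"
      using x(2) I(1) unfolding independent_def by auto
    define c where "c = restrict c0 ?J"
    have lc: "lincomb ?J c w = lincomb ?J c0 w" for w :: "'i \<Rightarrow> nat \<Rightarrow> 'r"
      unfolding lincomb_def c_def by (intro ext sum.cong) auto
    have "dot (lincomb ?J c ?v) (?v j) = 0" if j: "j \<in> ?J" for j
    proof -
      have "dot (lincomb ?J c ?v) (?v j) = (\<Sum>i\<in>?J. c i * dot (x i - x i0) (x j - x i0))"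
        unfolding dot_lincomb_left using gram[OF x(1)] j by (intro sum.cong refl) auto
      also have "\<dots> = dot (lincomb ?J c (\<lambda>i. x i - x i0)) (x j - x i0)" by (simp add: dot_lincomb_left)
      finally show ?thesis using c0(2) by (simp add: lc)
    qed
    hence "c \<in> R" using c0(1) by (auto simp: R_def c_def)
    moreover have "\<exists>j\<in>?J. c j \<noteq> 0" using c0(3) by (auto simp: c_def)
    ultimately have "c \<in> R'" by (simp add: R'_def)
    moreover have "x \<in> S c" using x(1) c0(2) by (simp add: S_def lc)
    ultimately show "x \<in> (\<Union>c\<in>R'. S c)" by blast
  qed
  hence "card {x \<in> ?C. \<not> independent ?J (\<lambda>i. x i - x i0)} \<le> card (\<Union>c\<in>R'. S c)"
    using finR finC by (intro card_mono) (auto simp: R'_def S_def)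
  also have "\<dots> \<le> (\<Sum>c\<in>R'. card (S c))" using finR by (intro card_UN_le) (auto simp: R'_def)
  finally have "real (card {x \<in> ?C. \<not> independent ?J (\<lambda>i. x i - x i0)}) \<le> (\<Sum>c\<in>R'. real (card (S c)))"
    by (simp only: of_nat_sum[symmetric] of_nat_le_iff)
  also have "\<dots> \<le> (\<Sum>c\<in>R'. z)" using Snull by (intro sum_mono) (auto simp: R'_def)
  also have "\<dots> = real (card R') * z" by simp
  also have "\<dots> \<le> real (card R) * z" using finR z0 by (intro mult_right_mono) (auto simp: R'_def intro!: card_mono)
  also have "\<dots> \<le> sqrt (real q) ^ (d - 1) * z"
    using card_relations[OF I(2-4) y ind nz] z0 unfolding R_def by (intro mult_right_mono)
  finally show ?thesis .
qed

end

section \<open>Distance vectors\<close>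

context quadratic_space begin

text \<open>
  If \<open>w0\<close> is one point of the fibre, every other point differs from \<open>w0\<close> by a vector orthogonal
  to all differences \<open>y i - y i0\<close>. The orthogonal complement has \<open>q^(d - k + 1)\<close> elements, with
  \<open>k\<close> the number of points, and contains a nonisotropic vector, since it is too large to be
  totally isotropic and orthogonal to the nonisotropic vector \<open>y j0 - y i0\<close>. So the one
  remaining norm condition cuts it down by the factor \<open>q / 2\<close>.
\<close>

lemma distance_fiber:
  fixes y :: "'i \<Rightarrow> nat \<Rightarrow> 'r"
  assumes I: "finite I" "i0 \<in> I" "j0 \<in> I" "j0 \<noteq> i0" and small: "2 * card I \<le> d + 2"
    and y: "\<And>i. i \<in> I \<Longrightarrow> y i \<in> V"
    and ind: "independent (I - {i0}) (\<lambda>i. y i - y i0)" and nz: "nrm (y j0 - y i0) \<noteq> 0"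
  shows "q ^ card I * card {w \<in> V. \<forall>i\<in>I. nrm (w - y i) = \<tau> i} \<le> 2 * q ^ d"
proof (cases "{w \<in> V. \<forall>i\<in>I. nrm (w - y i) = \<tau> i} = {}")
  case True
  thus ?thesis by (simp only: card.empty)
next
  case False
  let ?J = "I - {i0}" and ?F = "{w \<in> V. \<forall>i\<in>I. nrm (w - y i) = \<tau> i}"
  obtain w0 where w0: "w0 \<in> V" "\<And>i. i \<in> I \<Longrightarrow> nrm (w0 - y i) = \<tau> i" using False by blast
  define W where "W = {h \<in> V. \<forall>i\<in>?J. dot h (y i - y i0) = 0}"
  have WV: "W \<subseteq> V" by (auto simp: W_def)
  have cJ: "Suc (card ?J) = card I" using card_Suc_Diff1[OF I(1,2)] .
  have W: "q ^ card ?J * card W = q ^ d" unfolding W_def using card_linear_system[OF ind, of "\<lambda>_. 0"] by simp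
  have "\<exists>h\<in>W. nrm h \<noteq> 0"
  proof (rule ccontr)
    assume "\<not> ?thesis"
    hence iso: "nrm h = 0" if "h \<in> W" for h using that by blast
    have add: "x + z \<in> W" if "x \<in> W" "z \<in> W" for x z using that by (auto simp: W_def dot_linear)
    have pairs: "dot x z = 0" if "x \<in> W" "z \<in> W" for x z
    proof -
      have "2 * dot x z = nrm (x + z) - nrm x - nrm z"
        using dot_commute[of z x] by (simp add: dot_linear algebra_simps)
      hence "2 * dot x z = 0" using iso add that by simp
      thus ?thesis using two_mult_eq_0[of "dot x z"] that WV by auto
    qed
    have "q * (card W)\<^sup>2 \<le> q ^ d"
    proof (rule isotropic_card[OF WV pairs])
      show "y j0 - y i0 \<in> V" "nrm (y j0 - y i0) \<noteq> 0" using y I nz by auto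
      show "dot x (y j0 - y i0) = 0" if "x \<in> W" for x using that I by (auto simp: W_def)
    qed
    hence "(q ^ card ?J) ^ 2 * (q * (card W)\<^sup>2) \<le> (q ^ card ?J) ^ 2 * q ^ d" by (rule mult_le_mono2)
    moreover have "(q ^ card ?J) ^ 2 * (q * (card W)\<^sup>2) = q * (q ^ card ?J * card W)\<^sup>2" by (simp add: power_mult_distrib mult_ac)
    ultimately have "q * (q ^ d)\<^sup>2 \<le> (q ^ card ?J) ^ 2 * q ^ d" by (simp only: W)
    moreover have "q * (q ^ d)\<^sup>2 = q ^ (2 * d + 1)"
      by (simp only: power_even_eq[symmetric] power_Suc[symmetric] Suc_eq_plus1)
    moreover have "(q ^ card ?J) ^ 2 * q ^ d = q ^ (2 * card ?J + d)"
      by (simp only: power_even_eq[symmetric] power_add)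
    ultimately have "q ^ (2 * d + 1) \<le> q ^ (2 * card ?J + d)" by (simp only:)
    moreover have "1 < q" using q_ge_3 by simp
    ultimately have "2 * d + 1 \<le> 2 * card ?J + d" by (simp only: power_increasing_iff)
    thus False using small cJ by linarith
  qed
  then obtain h where h: "h \<in> W" "nrm h \<noteq> 0" by blast
  have u0: "w0 - y i0 \<in> V" using w0 y I by simp
  have t0: "\<tau> i0 \<in> K" using w0(2)[OF I(2)] u0 dot_K(1)[OF u0] by metis
  have "card ?F \<le> card {x \<in> W. nrm ((w0 - y i0) + x) = \<tau> i0}"
  proof (rule card_inj_on_le[of "\<lambda>w. w - w0"])
    show "(\<lambda>w. w - w0) ` ?F \<subseteq> {x \<in> W. nrm ((w0 - y i0) + x) = \<tau> i0}"
    proof (rule image_subsetI)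
      fix w assume "w \<in> ?F"
      hence w: "w \<in> V" "\<And>i. i \<in> I \<Longrightarrow> nrm (w - y i) = \<tau> i" by auto
      have "dot (w - w0) (y i - y i0) = 0" if i: "i \<in> ?J" for i
      proof -
        have "nrm (w - y i) - nrm (w0 - y i) - (nrm (w - y i0) - nrm (w0 - y i0)) = 0"
          using w(2) w0(2) i I by simp
        moreover have "nrm (w - y i) - nrm (w0 - y i) - (nrm (w - y i0) - nrm (w0 - y i0)) = - (2 * dot (w - w0) (y i - y i0))"
          using dot_commute[of "y i0" w] dot_commute[of "y i" w] dot_commute[of "y i0" w0] dot_commute[of "y i" w0]
          by (simp add: nrm_diff dot_linear algebra_simps)
        ultimately have "2 * dot (w - w0) (y i - y i0) = 0" by simp
        thus ?thesis using two_mult_eq_0[of "dot (w - w0) (y i - y i0)"] w w0 by auto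
      qed
      hence "w - w0 \<in> W" using w w0 by (simp add: W_def)
      moreover have "(w0 - y i0) + (w - w0) = w - y i0" by simp
      ultimately show "w - w0 \<in> {x \<in> W. nrm ((w0 - y i0) + x) = \<tau> i0}" using w(2)[OF I(2)] by simp
    qed
    show "inj_on (\<lambda>w. w - w0) ?F" by (auto simp: inj_on_def)
    show "finite {x \<in> W. nrm ((w0 - y i0) + x) = \<tau> i0}" using WV finite_V by (auto intro: finite_subset)
  qed
  hence "q ^ card I * card ?F \<le> q ^ card ?J * (q * card {x \<in> W. nrm ((w0 - y i0) + x) = \<tau> i0})"
    unfolding cJ[symmetric] by simp
  also have "\<dots> \<le> q ^ card ?J * (2 * card W)"
  proof (rule mult_le_mono2, rule card_quadric[OF WV _ _ h(2) u0 t0])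
    show "x + smul c h \<in> W" if "x \<in> W" "c \<in> K" for x c using that h by (auto simp: W_def dot_linear)
    show "h \<in> V" using h WV by blast
  qed
  also have "\<dots> = 2 * q ^ d" unfolding W[symmetric] by simp
  finally show ?thesis .
qed

text \<open>
  The difference vectors of \<open>x\<close> and of \<open>y\<close> have the same Gram matrix, so an isometry takes one
  to the other.
\<close>

lemma nondegenerate_config_is_placement:
  fixes y :: "'i \<Rightarrow> nat \<Rightarrow> 'r"
  assumes q5: "q \<ge> 5" and I: "finite I" "i0 \<in> I" and small: "2 * card I \<le> d + 2"
    and y: "\<And>i. i \<in> I \<Longrightarrow> y i \<in> V" and ind: "independent (I - {i0}) (\<lambda>i. y i - y i0)"
    and x: "x \<in> config I B (\<lambda>i j. nrm (y i - y j)) (edges I)" and B: "\<And>i. i \<in> I \<Longrightarrow> B i \<subseteq> V"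
    and indx: "independent (I - {i0}) (\<lambda>i. x i - x i0)"
  shows "x \<in> place I y ` (isometries \<times> V)"
proof -
  let ?J = "I - {i0}"
  have xV: "x i \<in> V" if "i \<in> I" for i using that x B[OF that] by (auto simp: config_def)
  have dist: "nrm (x i - x j) = nrm (y i - y j)" if "i \<in> I" "j \<in> I" for i j
  proof (cases "i = j")
    case False
    hence "{i, j} \<in> edges I" using that by (auto simp: edges_def)
    thus ?thesis using that x by (auto simp: config_def)
  qed simp
  have "\<exists>\<theta>\<in>isometries. \<forall>i\<in>?J. \<theta> (y i - y i0) = x i - x i0"
  proof (rule witt[OF q5 ind indx])
    show "2 * card ?J \<le> d" using small I by simp
    fix i j assume ij: "i \<in> ?J" "j \<in> ?J"
    show "dot (y i - y i0) (y j - y i0) = dot (x i - x i0) (x j - x i0)"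
    proof (rule gram_from_distances)
      show "x i - x i0 \<in> V" "x j - x i0 \<in> V" "y i - y i0 \<in> V" "y j - y i0 \<in> V" using xV y ij I by simp_all
      show "nrm (y i - y i0) = nrm (x i - x i0)" "nrm (y j - y i0) = nrm (x j - x i0)"
        by (rule dist[symmetric]; use ij I in blast)+
      have "x i - x i0 - (x j - x i0) = x i - x j" "y i - y i0 - (y j - y i0) = y i - y j" by simp_all
      moreover have "nrm (x i - x j) = nrm (y i - y j)" by (rule dist) (use ij in auto)
      ultimately show "nrm (y i - y i0 - (y j - y i0)) = nrm (x i - x i0 - (x j - x i0))" by (simp only:)
    qed
  qed
  then obtain \<theta> where \<theta>: "\<theta> \<in> isometries" "\<forall>i\<in>?J. \<theta> (y i - y i0) = x i - x i0" by blast
  define z where "z = x i0 - \<theta> (y i0)"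
  have zV: "z \<in> V" using xV y I isometry_V[OF \<theta>(1)] by (simp add: z_def)
  have eq: "\<theta> (y i) + z = x i" if i: "i \<in> I" for i
  proof (cases "i = i0")
    case False
    hence "\<theta> (y i) - \<theta> (y i0) = x i - x i0" using \<theta>(2) i isometry_diff[OF \<theta>(1), of "y i" "y i0"] y I by simp
    thus ?thesis by (simp add: z_def algebra_simps)
  qed (simp add: z_def)
  have "x \<in> PiE I B" using x by (auto simp: config_def)
  hence "x = place I y (\<theta>, z)" using eq by (auto simp: place_def fun_eq_iff PiE_iff extensional_def)
  thus ?thesis using \<theta>(1) zV by blast
qed

lemma placements_subset_config:
  fixes y :: "'i \<Rightarrow> nat \<Rightarrow> 'r"
  assumes y: "\<And>i. i \<in> I \<Longrightarrow> y i \<in> V"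
  shows "place I y ` (isometries \<times> V) \<subseteq> config I (\<lambda>_. V) (\<lambda>i j. nrm (y i - y j)) E"
proof (rule image_subsetI)
  fix g assume "g \<in> isometries \<times> V"
  hence g: "fst g \<in> isometries" "snd g \<in> V" by auto
  have "place I y g \<in> PiE I (\<lambda>_. V)" using y g isometry_V[OF g(1)] by (auto simp: place_def)
  moreover have "nrm (place I y g i - place I y g j) = nrm (y i - y j)" if "i \<in> I" "j \<in> I" for i j
  proof -
    have "place I y g i - place I y g j = fst g (y i - y j)"
      using that y isometry_diff[OF g(1), of "y i" "y j"] by (simp add: place_def)
    thus ?thesis using isometry_dot[OF g(1)] y that by simp
  qed
  ultimately show "place I y g \<in> config I (\<lambda>_. V) (\<lambda>i j. nrm (y i - y j)) E" by (simp add: config_def)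
qed

lemma card_star_edges:
  assumes "finite I" "j \<in> I" "card I \<ge> 2"
  shows "card (star (edges I) j) = card I - 1"
proof -
  have "\<not> I \<subseteq> {j}"
  proof
    assume "I \<subseteq> {j}"
    hence "card I \<le> card {j}" by (intro card_mono) auto
    thus False using assms(3) by simp
  qed
  then obtain i where i: "i \<in> I" "i \<noteq> j" by blast
  have "{j, i} \<in> edges I" using assms i by (auto simp: edges_def)
  hence "card (star (edges I) j) = Suc (card {l \<in> I - {j, i}. {j, l} \<in> edges I})"
    by (rule card_star[OF subset_refl assms(1)])
  also have "{l \<in> I - {j, i}. {j, l} \<in> edges I} = I - {j, i}" using assms by (auto simp: edges_def)
  also have "card \<dots> = card I - 2" using assms i by (simp add: card_Diff_subset)
  finally show ?thesis using assms by simp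
qed

text \<open>
  With \<open>C\<close> the number of pairs of indices, the configurations in \<open>B\<close> number at least \<open>3/4\<close> of
  \<open>M / q^C\<close>, with \<open>M\<close> the product of the set sizes, the degenerate ones at most \<open>1/4\<close> of it, and
  the other ones are placements. On the other hand the total number of placements is at most
  \<open>2 q^(d k) / q^C\<close>. The quotient is the proportion of rigid motions that place \<open>y\<close> in \<open>B\<close>.
\<close>

lemma card_placements_in_product:
  fixes y :: "'i \<Rightarrow> nat \<Rightarrow> 'r" and B :: "'i \<Rightarrow> (nat \<Rightarrow> 'r) set"
  assumes q5: "q \<ge> 5" and I: "finite I" "card I = k" "k \<ge> 2" "i0 \<in> I" and small: "2 * k \<le> d + 2"
    and y: "\<And>i. i \<in> I \<Longrightarrow> y i \<in> V" and nz: "\<And>i j. i \<in> I \<Longrightarrow> j \<in> I \<Longrightarrow> i \<noteq> j \<Longrightarrow> nrm (y i - y j) \<noteq> 0"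
    and ind: "independent (I - {i0}) (\<lambda>i. y i - y i0)"
    and B: "\<And>i. i \<in> I \<Longrightarrow> B i \<subseteq> V" and Bne: "\<And>i. i \<in> I \<Longrightarrow> B i \<noteq> {}"
    and \<eta>: "\<eta> > 0" "real (card (edges I)) * \<eta> \<le> 1 / 4"
    and big: "\<And>l. l \<in> I \<Longrightarrow> 2 * sqrt 2 * sqrt (real q) ^ (d + 2 * k - 1) \<le> \<eta> * real q * real (card (B l))"
    and k2: "k = 2 \<Longrightarrow> \<exists>\<kappa>. (\<forall>a\<in>K. \<forall>b\<in>K. a \<noteq> 0 \<longrightarrow> cmod (kloosterman (\<lambda>x. of_real (eta x) ^ d) a b) \<le> \<kappa>) \<and>
      (\<forall>i\<in>I. \<forall>j\<in>I. i \<noteq> j \<longrightarrow> 2 * sqrt (real q) ^ d * \<kappa> \<le> \<eta> * sqrt (real (card (B i)) * real (card (B j))))"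
  shows "(\<Prod>i\<in>I. real (card (B i))) * real (card (isometries \<times> V))
    \<le> 4 * real q ^ (d * k) * real (card {g \<in> isometries \<times> V. place I y g \<in> PiE I B})"
proof -
  define C where "C = card (edges I)"
  define M where "M = (\<Prod>i\<in>I. real (card (B i)))"
  define s where "s = sqrt (real q)"
  define t where "t i j = nrm (y i - y j)" for i j
  define G where "G = isometries \<times> V"
  define b where "b = 2 * sqrt 2 * s ^ (d + 2 * k - 1) / (\<eta> * real q)"
  have s1: "s \<ge> 1" "s ^ 2 = real q" using q_ge_3 by (simp_all add: s_def)
  have M0: "M \<ge> 0" unfolding M_def by (intro prod_nonneg) auto
  have finB: "finite (B l)" if "l \<in> I" for l using B[OF that] finite_V by (rule finite_subset)
  have "\<exists>j0\<in>I. j0 \<noteq> i0"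
  proof (rule ccontr)
    assume "\<not> ?thesis"
    hence "card I \<le> card {i0}" by (intro card_mono) auto
    thus False using I by simp
  qed
  then obtain j0 where j0: "j0 \<in> I" "j0 \<noteq> i0" by blast
  have "{j0, i0} \<in> edges I" using j0 I by (auto simp: edges_def)
  hence C1: "C \<ge> 1" unfolding C_def using finite_edges[OF I(1)] by (metis One_nat_def Suc_leI card_gt_0_iff empty_iff)
  have \<eta>4: "\<eta> \<le> 1 / 4"
  proof -
    have "1 * \<eta> \<le> real C * \<eta>" using C1 \<eta>(1) by (intro mult_right_mono) auto
    thus ?thesis using \<eta>(2) by (simp add: C_def)
  qed
  have t_eq: "t = (\<lambda>i j. nrm (y i - y j))" by (simp add: t_def fun_eq_iff)
  have tsym: "t a b = t b a" for a b unfolding t_def by (rule nrm_diff_commute)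
  \<comment> \<open>The estimate for configurations takes distances for all indices, so \<open>t\<close> is
    extended by zero.\<close>
  define t' where "t' a c = (if a \<in> I \<and> c \<in> I then t a c else 0)" for a c
  have t': "t' a c = t' c a" "t' a c \<in> K" for a c using tsym[of a c] y by (auto simp: t'_def t_def)
  have t'nz: "t' a c \<noteq> 0" if "a \<in> I" "c \<in> I" "a \<noteq> c" for a c using that nz by (simp add: t'_def t_def)
  have conf': "config I X t' E = config I X t E" for X E by (auto simp: config_def t'_def)
  have \<eta>': "\<eta> \<ge> 0" "real (card (edges I)) * \<eta> \<le> 1" using \<eta> by auto
  have est: "\<bar>real q ^ card E * real (card (config I B t E)) - M\<bar> \<le> 1 / 4 * M" if E: "E \<subseteq> edges I" for E
  proof -
    have "\<bar>real q ^ card E * real (card (config I B t' E)) - M\<bar> \<le> real (card E) * \<eta> * M"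
      unfolding M_def by (rule config_estimate[OF I(1-3) B Bne t' t'nz \<eta>' big k2 E])
    also have "\<dots> \<le> 1 / 4 * M"
    proof (rule mult_right_mono[OF _ M0])
      have "real (card E) * \<eta> \<le> real (card (edges I)) * \<eta>"
        using E finite_edges[OF I(1)] \<eta>(1) by (intro mult_right_mono) (auto intro: card_mono)
      thus "real (card E) * \<eta> \<le> 1 / 4" using \<eta>(2) by linarith
    qed
    finally show ?thesis unfolding conf' .
  qed
  have estV: "real q ^ C * real (card (config I (\<lambda>_. V) t (edges I))) \<le> 2 * real q ^ (d * k)"
  proof -
    have mono: "real (card (B l)) \<le> real (card V)" if "l \<in> I" for l using B[OF that] by (simp add: card_mono)
    have "\<bar>real q ^ card (edges I) * real (card (config I (\<lambda>_. V) t' (edges I))) - (\<Prod>i\<in>I. real (card V))\<bar>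
        \<le> real (card (edges I)) * \<eta> * (\<Prod>i\<in>I. real (card V))"
    proof (rule config_estimate[OF I(1-3) _ _ t' t'nz \<eta>' _ _ subset_refl])
      show "V \<noteq> {}" using zero_V by blast
      show "2 * sqrt 2 * sqrt (real q) ^ (d + 2 * k - 1) \<le> \<eta> * real q * real (card V)" if "l \<in> I" for l
        by (rule order_trans[OF big[OF that]], rule mult_left_mono[OF mono[OF that]]) (use \<eta>(1) in simp)
      assume "k = 2"
      then obtain \<kappa> where \<kappa>: "\<forall>a\<in>K. \<forall>b\<in>K. a \<noteq> 0 \<longrightarrow> cmod (kloosterman (\<lambda>x. of_real (eta x) ^ d) a b) \<le> \<kappa>"
        "\<forall>i\<in>I. \<forall>j\<in>I. i \<noteq> j \<longrightarrow> 2 * sqrt (real q) ^ d * \<kappa> \<le> \<eta> * sqrt (real (card (B i)) * real (card (B j)))"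
        using k2 by blast
      have "2 * sqrt (real q) ^ d * \<kappa> \<le> \<eta> * sqrt (real (card V) * real (card V))" if ij: "i \<in> I" "j \<in> I" "i \<noteq> j" for i j
      proof -
        have "sqrt (real (card (B i)) * real (card (B j))) \<le> sqrt (real (card V) * real (card V))"
          using mono ij by (intro real_sqrt_le_mono mult_mono) auto
        hence "\<eta> * sqrt (real (card (B i)) * real (card (B j))) \<le> \<eta> * sqrt (real (card V) * real (card V))"
          using \<eta>(1) by (intro mult_left_mono) auto
        thus ?thesis using \<kappa>(2) ij by fastforce
      qed
      thus "\<exists>\<kappa>. (\<forall>a\<in>K. \<forall>b\<in>K. a \<noteq> 0 \<longrightarrow> cmod (kloosterman (\<lambda>x. of_real (eta x) ^ d) a b) \<le> \<kappa>) \<and>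
        (\<forall>i\<in>I. \<forall>j\<in>I. i \<noteq> j \<longrightarrow> 2 * sqrt (real q) ^ d * \<kappa> \<le> \<eta> * sqrt (real (card V) * real (card V)))"
        using \<kappa>(1) by blast
    qed auto
    also have "(\<Prod>i\<in>I. real (card V)) = real q ^ (d * k)" using I by (simp add: card_V power_mult)
    finally have "\<bar>real q ^ C * real (card (config I (\<lambda>_. V) t (edges I))) - real q ^ (d * k)\<bar>
        \<le> (real C * \<eta>) * real q ^ (d * k)" unfolding conf' C_def .
    also have "\<dots> \<le> 1 * real q ^ (d * k)" using \<eta>'(2) by (intro mult_right_mono) (auto simp: C_def)
    finally show ?thesis by linarith
  qed
  have b0: "b > 0" using s1 \<eta>(1) by (simp add: b_def)
  have b_le: "b \<le> real (card (B l))" if "l \<in> I" for l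
    using big[OF that] \<eta>(1) by (simp add: b_def s_def divide_le_eq mult_ac)
  define z where "z = 2 * M / (real q ^ (C - (k - 1)) * b)"
  have z: "real (card ((\<lambda>x. restrict x (I - {j})) ` config I B t (edges I))) \<le> z" if j: "j \<in> I" for j
  proof -
    let ?Z = "real (card ((\<lambda>x. restrict x (I - {j})) ` config I B t (edges I)))"
    have sub: "star (edges I) j \<subseteq> edges I" by (auto simp: star_def)
    have "card (edges I - star (edges I) j) = C - (k - 1)"
      using card_star_edges[OF I(1) j] I finite_edges[OF I(1)] sub
      by (simp add: C_def card_Diff_subset finite_subset)
    hence "\<bar>real q ^ (C - (k - 1)) * real (card (config I B t (edges I - star (edges I) j))) - M\<bar> \<le> 1 / 4 * M"
      using est[OF Diff_subset, of "star (edges I) j"] by (simp only:)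
    hence "real q ^ (C - (k - 1)) * real (card (config I B t (edges I - star (edges I) j))) \<le> 2 * M"
      using M0 by linarith
    moreover have "?Z * b \<le> real (card (config I B t (edges I - star (edges I) j)))"
    proof -
      have "?Z * b \<le> ?Z * real (card (B j))" using b_le[OF j] by (intro mult_left_mono) auto
      also have "\<dots> \<le> real (card (config I B t (edges I - star (edges I) j)))"
        by (simp only: of_nat_mult[symmetric] of_nat_le_iff) (rule link_card_le[OF I(1) j B])
      finally show ?thesis .
    qed
    ultimately have "real q ^ (C - (k - 1)) * (?Z * b) \<le> 2 * M"
      by (meson mult_left_mono order_trans zero_le_power of_nat_0_le_iff)
    thus ?thesis using b0 by (simp add: z_def le_divide_eq mult_ac)
  qed
  let ?Deg = "{x \<in> config I B t (edges I). \<not> independent (I - {i0}) (\<lambda>i. x i - x i0)}"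
  let ?Good = "{x \<in> config I B t (edges I). independent (I - {i0}) (\<lambda>i. x i - x i0)}"
  have "d \<ge> 1"
  proof (rule ccontr)
    assume "\<not> d \<ge> 1"
    hence "V = {0}" by (auto simp: V_def zero_fun_def)
    hence "y j0 - y i0 = 0" using y j0 I by auto
    thus False using nz[OF j0(1) I(4) j0(2)] by simp
  qed
  have kC: "k - 1 \<le> C"
  proof -
    have "card (star (edges I) i0) \<le> card (edges I)" using finite_edges[OF I(1)] by (intro card_mono) (auto simp: star_def)
    thus ?thesis using card_star_edges[OF I(1,4)] I by (simp add: C_def)
  qed
  have finC: "finite (config I X t E)" if "\<And>i. i \<in> I \<Longrightarrow> finite (X i)" for X E
    by (rule finite_subset[of _ "PiE I X"]) (auto simp: config_def intro!: finite_PiE I that)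
  have "real (card ?Deg) \<le> s ^ (d - 1) * z"
    unfolding s_def t_eq
    by (rule card_degenerate[OF I(1,4) j0 y ind nz[OF j0(1) I(4) j0(2)] B z[unfolded t_eq]])
  hence "real q ^ C * real (card ?Deg) \<le> real q ^ C * (s ^ (d - 1) * z)" by (intro mult_left_mono) auto
  also have "\<dots> \<le> M / 4"
  proof -
    have "real q ^ C = real q ^ (C - (k - 1)) * s ^ (2 * (k - 1))"
      using kC unfolding power_mult s1(2) by (simp flip: power_add)
    hence "real q ^ C * (s ^ (d - 1) * z) = 2 * M * (s ^ (2 * (k - 1)) * s ^ (d - 1)) / b"
      using b0 by (simp add: z_def)
    also have "s ^ (2 * (k - 1)) * s ^ (d - 1) = b * (\<eta> / (2 * sqrt 2))"
    proof -
      have "s ^ (d + 2 * k - 1) = s ^ (2 * (k - 1)) * s ^ (d - 1) * s ^ 2"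
      proof -
        have "d + 2 * k - 1 = 2 * (k - 1) + (d - 1) + 2" using I(3) \<open>d \<ge> 1\<close> by linarith
        thus ?thesis by (simp only: power_add)
      qed
      thus ?thesis using \<eta>(1) by (simp add: b_def s1(2))
    qed
    also have "2 * M * (b * (\<eta> / (2 * sqrt 2))) / b = M * (\<eta> / sqrt 2)" using b0 by (simp add: field_simps)
    also have "\<dots> \<le> M * (1 / 4)"
    proof (rule mult_left_mono[OF _ M0])
      have "\<eta> / sqrt 2 \<le> \<eta> / 1" using \<eta>(1) by (intro divide_left_mono) auto
      thus "\<eta> / sqrt 2 \<le> 1 / 4" using \<eta>4 by linarith
    qed
    finally show ?thesis by simp
  qed
  finally have deg: "real q ^ C * real (card ?Deg) \<le> M / 4" .
  have "real q ^ C * real (card (config I B t (edges I))) \<ge> 3 / 4 * M"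
    using est[OF subset_refl] unfolding C_def by linarith
  moreover have "card (config I B t (edges I)) = card ?Deg + card ?Good"
  proof -
    have "config I B t (edges I) = ?Deg \<union> ?Good" by blast
    hence "card (config I B t (edges I)) = card (?Deg \<union> ?Good)" by (rule arg_cong)
    also have "\<dots> = card ?Deg + card ?Good"
      using finC[OF finB] by (intro card_Un_disjoint) auto
    finally show ?thesis .
  qed
  ultimately have good: "M / 2 \<le> real q ^ C * real (card ?Good)" using deg by (simp add: distrib_left)
  have "card ?Good \<le> card (place I y ` G \<inter> PiE I B)"
  proof (rule card_mono)
    show "finite (place I y ` G \<inter> PiE I B)" unfolding G_def by auto
    show "?Good \<subseteq> place I y ` G \<inter> PiE I B"
    proof
      fix x assume x: "x \<in> ?Good"
      have "x \<in> place I y ` G" unfolding G_def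
        by (rule nondegenerate_config_is_placement[OF q5 I(1,4) _ y ind _ B])
           (use x small I(2) in \<open>auto simp: t_eq\<close>)
      moreover have "x \<in> PiE I B" using x by (simp add: config_def)
      ultimately show "x \<in> place I y ` G \<inter> PiE I B" by simp
    qed
  qed
  hence good': "M / 2 \<le> real q ^ C * real (card (place I y ` G \<inter> PiE I B))"
    using good by (meson mult_left_mono of_nat_le_iff order_trans zero_le_power of_nat_0_le_iff)
  have "card (place I y ` G) \<le> card (config I (\<lambda>_. V) t (edges I))"
  proof (rule card_mono)
    show "finite (config I (\<lambda>_. V) t (edges I))" by (rule finC) simp
    show "place I y ` G \<subseteq> config I (\<lambda>_. V) t (edges I)"
      unfolding G_def t_def by (rule placements_subset_config[OF y])
  qed
  hence all: "real q ^ C * real (card (place I y ` G)) \<le> 2 * real q ^ (d * k)"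
    using estV by (meson mult_left_mono of_nat_le_iff order_trans zero_le_power of_nat_0_le_iff)
  define T where "T = {g \<in> G. place I y g \<in> PiE I B}"
  have TG: "card T * card (place I y ` G) = card (place I y ` G \<inter> PiE I B) * card G"
    unfolding T_def G_def by (rule card_placements[OF y])
  have "M / 2 * real (card G) \<le> real q ^ C * real (card (place I y ` G \<inter> PiE I B)) * real (card G)"
    using good' by (intro mult_right_mono) auto
  also have "\<dots> = real q ^ C * real (card (place I y ` G \<inter> PiE I B) * card G)" by simp
  also have "\<dots> = real (card T) * (real q ^ C * real (card (place I y ` G)))"
    unfolding TG[symmetric] by simp
  also have "\<dots> \<le> real (card T) * (2 * real q ^ (d * k))" using all by (intro mult_left_mono) auto
  finally show ?thesis unfolding M_def[symmetric] T_def G_def by (simp add: mult_ac)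
qed

text \<open>
  The hypothesis on the product of the sizes makes \<open>|T| |A|\<close> at least \<open>4 q |G|\<close>, so at most half
  of the points are missed by the motions in \<open>T\<close>. The remaining half meets at least \<open>q^k / 4\<close>
  fibres of the distance map. The parameter \<open>\<eta>\<close> is the relative error that each edge removal may
  have.
\<close>

theorem distance_vectors:
  fixes y :: "'i \<Rightarrow> nat \<Rightarrow> 'r" and B :: "'i \<Rightarrow> (nat \<Rightarrow> 'r) set"
  assumes q: "q \<ge> 160" and d: "d \<ge> 2" and I: "finite I" "card I = k" "k \<ge> 2" "i0 \<in> I" and small: "2 * k \<le> d + 2"
    and y: "\<And>i. i \<in> I \<Longrightarrow> y i \<in> V" and nz: "\<And>i j. i \<in> I \<Longrightarrow> j \<in> I \<Longrightarrow> i \<noteq> j \<Longrightarrow> nrm (y i - y j) \<noteq> 0"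
    and ind: "independent (I - {i0}) (\<lambda>i. y i - y i0)"
    and B: "\<And>i. i \<in> I \<Longrightarrow> B i \<subseteq> V" and A: "A \<subseteq> V"
    and \<eta>: "\<eta> > 0" "real (card (edges I)) * \<eta> \<le> 1 / 4"
    and big: "\<And>l. l \<in> I \<Longrightarrow> 2 * sqrt 2 * sqrt (real q) ^ (d + 2 * k - 1) \<le> \<eta> * real q * real (card (B l))"
    and k2: "k = 2 \<Longrightarrow> \<exists>\<kappa>. (\<forall>a\<in>K. \<forall>b\<in>K. a \<noteq> 0 \<longrightarrow> cmod (kloosterman (\<lambda>x. of_real (eta x) ^ d) a b) \<le> \<kappa>) \<and>
      (\<forall>i\<in>I. \<forall>j\<in>I. i \<noteq> j \<longrightarrow> 2 * sqrt (real q) ^ d * \<kappa> \<le> \<eta> * sqrt (real (card (B i)) * real (card (B j))))"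
    and prod: "16 * real q ^ (d * k + 1) \<le> (\<Prod>i\<in>I. real (card (B i))) * real (card A)"
  shows "real q ^ k \<le> 4 * real (card ((\<lambda>w. \<lambda>i\<in>I. nrm (w - y i)) `
    {w \<in> V. \<exists>g\<in>isometries \<times> V. (\<forall>i\<in>I. fst g (y i) + snd g \<in> B i) \<and> fst g w + snd g \<in> A}))"
proof -
  define G where "G = isometries \<times> V"
  define M where "M = (\<Prod>i\<in>I. real (card (B i)))"
  define T where "T = {g \<in> G. place I y g \<in> PiE I B}"
  define W where "W = {w \<in> V. \<exists>g\<in>G. (\<forall>i\<in>I. fst g (y i) + snd g \<in> B i) \<and> fst g w + snd g \<in> A}"
  define miss where "miss = {w \<in> V. \<forall>g\<in>T. fst g w + snd g \<notin> A}"
  define D where "D w = (\<lambda>i\<in>I. nrm (w - y i))" for w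
  have q5: "q \<ge> 5" using q by simp
  have T_iff: "g \<in> T \<longleftrightarrow> g \<in> G \<and> (\<forall>i\<in>I. fst g (y i) + snd g \<in> B i)" for g
    by (auto simp: T_def place_def PiE_iff)
  have Bne: "B l \<noteq> {}" if "l \<in> I" for l
  proof
    assume "B l = {}"
    hence "2 * sqrt 2 * sqrt (real q) ^ (d + 2 * k - 1) \<le> 0" using big[OF that] by simp
    moreover have "2 * sqrt 2 * sqrt (real q) ^ (d + 2 * k - 1) > 0" by simp
    ultimately show False by linarith
  qed
  have cG: "real (card G) > 0"
  proof -
    have "V \<noteq> {}" using zero_V by blast
    hence "G \<noteq> {}" using isometry_id unfolding G_def Times_empty by blast
    moreover have "finite G" by (simp add: G_def)
    ultimately show ?thesis by (simp add: card_gt_0_iff)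
  qed
  have T1: "M * real (card G) \<le> 4 * real q ^ (d * k) * real (card T)"
    unfolding M_def T_def G_def by (rule card_placements_in_product[OF q5 I small y nz ind B Bne \<eta> big k2])
  have "real q ^ (d * k) * (16 * real q * real (card G)) = 16 * real q ^ (d * k + 1) * real (card G)" by simp
  also have "\<dots> \<le> M * real (card A) * real (card G)"
    unfolding M_def using prod by (intro mult_right_mono) auto
  also have "\<dots> = M * real (card G) * real (card A)" by simp
  also have "\<dots> \<le> 4 * real q ^ (d * k) * real (card T) * real (card A)" using T1 by (intro mult_right_mono) auto
  also have "\<dots> = real q ^ (d * k) * (4 * (real (card T) * real (card A)))" by simp
  finally have "16 * real q * real (card G) \<le> 4 * (real (card T) * real (card A))"
    by (rule mult_left_le_imp_le) simp
  hence TA: "4 * real q * real (card G) \<le> real (card T) * real (card A)" by linarith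
  have "4 * real q * real (card G) * real (card miss) \<le> real (card T) * real (card A) * real (card miss)"
    using TA by (intro mult_right_mono) auto
  also have "\<dots> \<le> 2 * real q * real (card isometries) * (real q ^ d)\<^sup>2"
    unfolding miss_def by (rule rigid_motion_mixing[OF q d _ A]) (auto simp: T_def G_def)
  also have "\<dots> = (4 * real q * real (card G)) * (real q ^ d / 2)"
    by (simp add: G_def card_cartesian_product card_V power2_eq_square)
  finally have miss: "real (card miss) \<le> real q ^ d / 2" using cG by (subst (asm) mult_le_cancel_left_pos) auto
  have "V \<subseteq> W \<union> miss" unfolding W_def miss_def using T_iff by blast
  moreover have "W \<union> miss \<subseteq> V" by (auto simp: W_def miss_def)
  ultimately have "V = W \<union> miss" by (rule equalityI)
  hence "card V \<le> card W + card miss" by (metis card_Un_le)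
  hence W_large: "real q ^ d / 2 \<le> real (card W)" using miss by (simp add: card_V flip: of_nat_power)
  have finW: "finite W" by (simp add: W_def)
  have "\<exists>j0\<in>I. j0 \<noteq> i0"
  proof (rule ccontr)
    assume "\<not> ?thesis"
    hence "card I \<le> card {i0}" by (intro card_mono) auto
    thus False using I by simp
  qed
  then obtain j0 where j0: "j0 \<in> I" "j0 \<noteq> i0" by blast
  have fib: "q ^ k * card {w \<in> W. D w = \<tau>} \<le> 2 * q ^ d" for \<tau>
  proof -
    have "card {w \<in> W. D w = \<tau>} \<le> card {w \<in> V. \<forall>i\<in>I. nrm (w - y i) = \<tau> i}"
      by (rule card_mono) (auto simp: W_def D_def)
    hence "q ^ k * card {w \<in> W. D w = \<tau>} \<le> q ^ k * card {w \<in> V. \<forall>i\<in>I. nrm (w - y i) = \<tau> i}" by (rule mult_le_mono2)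
    also have "\<dots> \<le> 2 * q ^ d"
      using distance_fiber[OF I(1,4) j0 _ y ind nz[OF j0(1) I(4) j0(2)], of \<tau>] small I(2) by simp
    finally show ?thesis .
  qed
  have "card W = (\<Sum>\<tau>\<in>D ` W. card {w \<in> W. D w = \<tau>})"
    unfolding card_eq_sum by (rule sum.group[symmetric]) (use finW in auto)
  hence "q ^ k * card W = (\<Sum>\<tau>\<in>D ` W. q ^ k * card {w \<in> W. D w = \<tau>})" by (simp add: sum_distrib_left)
  also have "\<dots> \<le> (\<Sum>\<tau>\<in>D ` W. 2 * q ^ d)" by (intro sum_mono fib)
  also have "\<dots> = card (D ` W) * (2 * q ^ d)" by simp
  finally have "real (q ^ k * card W) \<le> real (card (D ` W) * (2 * q ^ d))" by (simp only: of_nat_le_iff)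
  hence "real q ^ k * real (card W) \<le> real (card (D ` W)) * (2 * real q ^ d)" by simp
  moreover have "real q ^ k * (real q ^ d / 2) \<le> real q ^ k * real (card W)" by (rule mult_left_mono[OF W_large]) simp
  ultimately have "real q ^ k * (real q ^ d / 2) \<le> real (card (D ` W)) * (2 * real q ^ d)" by linarith
  hence "real q ^ d * real q ^ k \<le> real q ^ d * (4 * real (card (D ` W)))" by (simp add: mult_ac)
  hence "real q ^ k \<le> 4 * real (card (D ` W))" by (rule mult_left_le_imp_le) simp
  thus ?thesis unfolding D_def W_def G_def .
qed

end

section \<open>A commutative ring that contains every field on the natural numbers\<close>

text \<open>
  The product of all commutative rings on sets of natural numbers. A type cannot depend on a
  field that is fixed within a proof, so a single type has to serve for all of them. Records
  that are not commutative rings get the dummy component \<open>0\<close>.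
\<close>

typedef ring_product = "{f :: nat ring \<Rightarrow> nat. \<forall>F. if cring F then f F \<in> carrier F else f F = 0}"
proof
  show "(\<lambda>F. if cring F then \<zero>\<^bsub>F\<^esub> else 0) \<in> {f :: nat ring \<Rightarrow> nat. \<forall>F. if cring F then f F \<in> carrier F else f F = 0}"
    by (simp add: cring.cring_simprules)
qed

setup_lifting type_definition_ring_product

text \<open>
  The field with two elements; it makes the product nontrivial, as the type class requires.
\<close>

lemma nontrivial_cring_on_nat: "\<exists>F :: nat ring. cring F \<and> \<one>\<^bsub>F\<^esub> \<noteq> \<zero>\<^bsub>F\<^esub>"
proof -
  let ?F = "\<lparr>carrier = {0, 1}, monoid.mult = (*), one = 1, zero = 0, add = (\<lambda>x y. (x + y) mod 2)\<rparr> :: nat ring"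
  have "cring ?F"
    by (intro cringI abelian_groupI comm_monoidI) auto
  moreover have "\<one>\<^bsub>?F\<^esub> \<noteq> \<zero>\<^bsub>?F\<^esub>" by simp
  ultimately show ?thesis by blast
qed

instantiation ring_product :: comm_ring_1
begin

lift_definition zero_ring_product :: ring_product is "\<lambda>F. if cring F then \<zero>\<^bsub>F\<^esub> else 0"
  by (simp add: cring.cring_simprules)

lift_definition one_ring_product :: ring_product is "\<lambda>F. if cring F then \<one>\<^bsub>F\<^esub> else 0"
  by (simp add: cring.cring_simprules)

lift_definition plus_ring_product :: "ring_product \<Rightarrow> ring_product \<Rightarrow> ring_product"
  is "\<lambda>f g F. if cring F then f F \<oplus>\<^bsub>F\<^esub> g F else 0"
  by (simp add: cring.cring_simprules)

lift_definition uminus_ring_product :: "ring_product \<Rightarrow> ring_product"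
  is "\<lambda>f F. if cring F then \<ominus>\<^bsub>F\<^esub> f F else 0"
  by (simp add: cring.cring_simprules)

lift_definition minus_ring_product :: "ring_product \<Rightarrow> ring_product \<Rightarrow> ring_product"
  is "\<lambda>f g F. if cring F then f F \<ominus>\<^bsub>F\<^esub> g F else 0"
  by (simp add: cring.cring_simprules)

lift_definition times_ring_product :: "ring_product \<Rightarrow> ring_product \<Rightarrow> ring_product"
  is "\<lambda>f g F. if cring F then f F \<otimes>\<^bsub>F\<^esub> g F else 0"
  by (simp add: cring.cring_simprules)

instance
proof
  fix a b c :: ring_product
  show "a * b * c = a * (b * c)" by transfer (simp add: fun_eq_iff cring.cring_simprules)
  show "a * b = b * a" by transfer (simp add: fun_eq_iff cring.cring_simprules)
  show "1 * a = a" by transfer (simp add: fun_eq_iff cring.cring_simprules(12))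
  show "a + b + c = a + (b + c)" by transfer (simp add: fun_eq_iff cring.cring_simprules)
  show "a + b = b + a" by transfer (simp add: fun_eq_iff cring.cring_simprules)
  show "0 + a = a" by transfer (simp add: fun_eq_iff cring.cring_simprules)
  show "- a + a = 0" by transfer (simp add: fun_eq_iff cring.cring_simprules)
  show "a - b = a + - b" by transfer (simp add: fun_eq_iff cring.cring_simprules)
  show "(a + b) * c = a * c + b * c" by transfer (simp add: fun_eq_iff cring.cring_simprules)
  show "(0 :: ring_product) \<noteq> 1"
    using nontrivial_cring_on_nat by transfer (simp add: fun_eq_iff, metis)
qed

end

lift_definition component :: "nat ring \<Rightarrow> ring_product \<Rightarrow> nat" is "\<lambda>F f. f F" .

text \<open>
  The element with component \<open>a\<close> at \<open>F\<close> and zero elsewhere. Its products with arbitrary elements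
  are of the same form, so the image of \<open>F\<close> is an ideal.
\<close>

lift_definition embed :: "nat ring \<Rightarrow> nat \<Rightarrow> ring_product"
  is "\<lambda>F a G. if cring G then if G = F \<and> a \<in> carrier F then a else \<zero>\<^bsub>G\<^esub> else 0"
  by (simp add: cring.cring_simprules)

locale odd_finite_field = field F for F :: "nat ring" (structure) +
  fixes d :: nat
  assumes finite_carrier: "finite (carrier F)" and odd_carrier: "odd (card (carrier F))"
begin

lemma component_closed [simp]: "component F x \<in> carrier F"
  using is_cring by transfer metis

lemma component_embed [simp]: "a \<in> carrier F \<Longrightarrow> component F (embed F a) = a"
  using is_cring by transfer simp

lemma embed_zero [simp]: "embed F \<zero> = 0"
  by transfer (simp add: fun_eq_iff)

lemma embed_add: "a \<in> carrier F \<Longrightarrow> b \<in> carrier F \<Longrightarrow> embed F (a \<oplus> b) = embed F a + embed F b"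
  using is_cring by transfer (auto simp: fun_eq_iff cring.cring_simprules)

lemma embed_mult_component: "a \<in> carrier F \<Longrightarrow> embed F a * x = embed F (a \<otimes> component F x)"
  using is_cring by transfer (auto simp: fun_eq_iff cring.cring_simprules)

lemma embed_mult: "a \<in> carrier F \<Longrightarrow> b \<in> carrier F \<Longrightarrow> embed F (a \<otimes> b) = embed F a * embed F b"
  by (simp add: embed_mult_component)

lemma embed_eq_iff [simp]: "a \<in> carrier F \<Longrightarrow> b \<in> carrier F \<Longrightarrow> embed F a = embed F b \<longleftrightarrow> a = b"
  by (metis component_embed)

lemma embed_component: "x \<in> embed F ` carrier F \<Longrightarrow> embed F (component F x) = x"
  by auto

text \<open>
  The unit \<open>e\<close> of the image is the idempotent with component one at \<open>F\<close> and zero elsewhere.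
\<close>

lemma finite_field_ideal_embed: "finite_field_ideal (embed F ` carrier F) (embed F \<one>)"
proof
  show "finite (embed F ` carrier F)" using finite_carrier by simp
  show "0 \<in> embed F ` carrier F" using embed_zero zero_closed by (metis imageI)
  show "embed F \<one> \<in> embed F ` carrier F" by simp
  show "embed F \<one> \<noteq> 0" using embed_eq_iff[of \<one> \<zero>] by simp
  have "inj_on (embed F) (carrier F)" by (rule inj_onI) simp
  thus "odd (card (embed F ` carrier F))" using odd_carrier by (simp add: card_image)
  fix x assume x: "x \<in> embed F ` carrier F"
  then obtain a where a: "a \<in> carrier F" "x = embed F a" by blast
  show "embed F \<one> * x = x" using a by (simp add: embed_mult_component)
  show "x * y \<in> embed F ` carrier F" for y using a by (simp add: embed_mult_component)
  show "x + y \<in> embed F ` carrier F" if "y \<in> embed F ` carrier F" for y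
    using that a by (auto simp flip: embed_add)
  show "\<exists>y\<in>embed F ` carrier F. x * y = embed F \<one>" if "x \<noteq> 0"
  proof -
    have "a \<noteq> \<zero>" using that a by auto
    hence "inv a \<in> carrier F" "a \<otimes> inv a = \<one>" using a field_Units by auto
    thus ?thesis using a by (intro bexI[of _ "embed F (inv a)"]) (auto simp flip: embed_mult)
  qed
qed

sublocale Q: quadratic_space "embed F ` carrier F" "embed F \<one>" d
  by (intro quadratic_space.intro finite_field_ideal_embed)

lemma embed_minus: 
  assumes "a \<in> carrier F" "b \<in> carrier F" shows "embed F (a \<ominus> b) = embed F a - embed F b"
proof -
  have "a \<ominus> b \<oplus> b = a" using assms by (simp add: cring.cring_simprules(15) is_cring a_assoc l_neg minus_eq)
  hence "embed F a = embed F (a \<ominus> b) + embed F b" using assms by (simp flip: embed_add)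
  thus ?thesis by simp
qed

lemma embed_finsum:
  assumes "finite I" "\<And>i. i \<in> I \<Longrightarrow> f i \<in> carrier F"
  shows "embed F (\<Oplus>i\<in>I. f i) = (\<Sum>i\<in>I. embed F (f i))"
  using assms by (induction I rule: finite_induct) (simp_all add: embed_add Pi_def)

section \<open>Coordinate vectors\<close>

definition vec :: "(nat \<Rightarrow> nat) \<Rightarrow> nat \<Rightarrow> ring_product" where
  "vec x = (\<lambda>i. if i \<in> {1..d} then embed F (x i) else 0)"

definition unvec :: "(nat \<Rightarrow> ring_product) \<Rightarrow> nat \<Rightarrow> nat" where
  "unvec u = (\<lambda>i\<in>{1..d}. component F (u i))"

lemma carrier_func_space: "carrier (func_space S) = S \<rightarrow>\<^sub>E carrier F"
  by (simp add: func_space_def)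

lemma unvec_closed [simp]: "unvec u \<in> carrier (coord_space F d)"
  by (simp add: carrier_func_space unvec_def)

lemma vec_closed [simp]: "x \<in> carrier (coord_space F d) \<Longrightarrow> vec x \<in> Q.V"
  by (auto simp: carrier_func_space vec_def Q.V_def)

lemma unvec_vec [simp]: "x \<in> carrier (coord_space F d) \<Longrightarrow> unvec (vec x) = x"
  by (auto simp: carrier_func_space vec_def unvec_def fun_eq_iff PiE_iff extensional_def)

lemma vec_unvec [simp]: "u \<in> Q.V \<Longrightarrow> vec (unvec u) = u"
  by (auto simp: vec_def unvec_def fun_eq_iff Q.V_def embed_component)

lemma vec_eq_iff: "x \<in> carrier (coord_space F d) \<Longrightarrow> y \<in> carrier (coord_space F d) \<Longrightarrow> vec x = vec y \<longleftrightarrow> x = y"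
  by (metis unvec_vec)

lemma func_space_minus:
  assumes "x \<in> carrier (func_space S)" "y \<in> carrier (func_space S)"
  shows "x \<ominus>\<^bsub>func_space S\<^esub> y = (\<lambda>i\<in>S. x i \<ominus> y i)"
  using assms func_space_neg[of y S]
  by (simp add: a_minus_def) (simp add: func_space_def fun_eq_iff restrict_def)

lemma vec_add: "x \<in> carrier (coord_space F d) \<Longrightarrow> y \<in> carrier (coord_space F d) \<Longrightarrow>
    vec (x \<oplus>\<^bsub>coord_space F d\<^esub> y) = vec x + vec y"
  by (auto simp: vec_def func_space_def fun_eq_iff embed_add PiE_iff plus_fun_def)

lemma vec_minus: "x \<in> carrier (coord_space F d) \<Longrightarrow> y \<in> carrier (coord_space F d) \<Longrightarrow>
    vec (x \<ominus>\<^bsub>coord_space F d\<^esub> y) = vec x - vec y"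
  by (auto simp: func_space_minus vec_def carrier_func_space fun_eq_iff embed_minus PiE_iff fun_diff_def)

lemma coord_minus_closed:
  "x \<in> carrier (coord_space F d) \<Longrightarrow> y \<in> carrier (coord_space F d) \<Longrightarrow> x \<ominus>\<^bsub>coord_space F d\<^esub> y \<in> carrier (coord_space F d)"
  by (auto simp: func_space_minus carrier_func_space PiE_iff)

lemma embed_sq_norm:
  assumes x: "x \<in> carrier (coord_space F d)"
  shows "embed F (sq_norm F d x) = Q.nrm (vec x)"
proof -
  have xi: "x i \<in> carrier F" if "i \<in> {1..d}" for i using x that unfolding carrier_func_space by (rule PiE_mem)
  have "embed F (sq_norm F d x) = (\<Sum>i\<in>{1..d}. embed F (x i [^] (2::nat)))"
    unfolding sq_norm_def by (rule embed_finsum) (use xi in auto)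
  also have "\<dots> = Q.nrm (vec x)"
    unfolding Q.dot_def by (intro sum.cong refl) (use xi in \<open>auto simp: vec_def numeral_2_eq_2 embed_mult\<close>)
  finally show ?thesis .
qed

end

section \<open>Congruence of simplices\<close>

context odd_finite_field
begin

definition unit_vec :: "nat \<Rightarrow> nat \<Rightarrow> nat" where
  "unit_vec j = (\<lambda>i\<in>{1..d}. if i = j then \<one> else \<zero>)"

definition column :: "(nat \<Rightarrow> nat \<Rightarrow> nat) \<Rightarrow> nat \<Rightarrow> nat \<Rightarrow> ring_product" where
  "column g j = vec (\<lambda>i\<in>{1..d}. g i j)"

lemma unit_vec_closed [simp]: "unit_vec j \<in> carrier (coord_space F d)"
  by (simp add: carrier_func_space unit_vec_def)

lemma func_space_add_closed:
  "x \<in> carrier (func_space S) \<Longrightarrow> y \<in> carrier (func_space S) \<Longrightarrow> x \<oplus>\<^bsub>func_space S\<^esub> y \<in> carrier (func_space S)"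
  by (auto simp: func_space_def)

lemma vec_unit_vec: "j \<in> {1..d} \<Longrightarrow> vec (unit_vec j) i = (if i = j then embed F \<one> else 0)"
  by (auto simp: vec_def unit_vec_def)

lemma dot_unit_vec:
  "i \<in> {1..d} \<Longrightarrow> j \<in> {1..d} \<Longrightarrow> Q.dot (vec (unit_vec i)) (vec (unit_vec j)) = (if i = j then embed F \<one> else 0)"
  unfolding Q.dot_def by (simp only: vec_unit_vec) (simp add: if_distrib [of "\<lambda>z. z * _"] cong: if_cong)

lemma vec_eq_lincomb_unit_vec:
  assumes x: "x \<in> carrier (coord_space F d)"
  shows "vec x = Q.lincomb {1..d} (\<lambda>j. embed F (x j)) (\<lambda>j. vec (unit_vec j))"
proof
  fix i
  have xi: "x i \<in> carrier F" if "i \<in> {1..d}" for i using x that unfolding carrier_func_space by (rule PiE_mem)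
  have "Q.lincomb {1..d} (\<lambda>j. embed F (x j)) (\<lambda>j. vec (unit_vec j)) i
      = (\<Sum>j\<in>{1..d}. if j = i then embed F (x j) else 0)"
    unfolding Q.lincomb_def
  proof (rule sum.cong[OF refl])
    fix j assume j: "j \<in> {1..d}"
    have "embed F (x j) * embed F \<one> = embed F (x j)" using embed_mult[OF xi[OF j] one_closed] xi[OF j] by simp
    thus "embed F (x j) * vec (unit_vec j) i = (if j = i then embed F (x j) else 0)"
      unfolding vec_unit_vec[OF j] by (cases "j = i") simp_all
  qed
  also have "\<dots> = vec x i" by (simp only: sum.delta[OF finite_atLeastAtMost] vec_def)
  finally show "vec x i = Q.lincomb {1..d} (\<lambda>j. embed F (x j)) (\<lambda>j. vec (unit_vec j)) i" by (rule sym)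
qed

lemma apply_matrix_closed:
  assumes g: "g \<in> {1..d} \<rightarrow>\<^sub>E ({1..d} \<rightarrow>\<^sub>E carrier F)" and x: "x \<in> carrier (coord_space F d)"
  shows "apply_matrix F d g x \<in> carrier (coord_space F d)"
proof -
  have xi: "x i \<in> carrier F" if "i \<in> {1..d}" for i using x that unfolding carrier_func_space by (rule PiE_mem)
  have gi: "g i j \<in> carrier F" if "i \<in> {1..d}" "j \<in> {1..d}" for i j using PiE_mem[OF PiE_mem[OF g that(1)] that(2)] .
  have "(\<Oplus>j\<in>{1..d}. g i j \<otimes> x j) \<in> carrier F" if "i \<in> {1..d}" for i
    by (rule finsum_closed) (use xi gi that in auto)
  thus ?thesis unfolding apply_matrix_def carrier_func_space restrict_PiE_iff by blast
qed

lemma vec_apply_matrix: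
  assumes g: "g \<in> {1..d} \<rightarrow>\<^sub>E ({1..d} \<rightarrow>\<^sub>E carrier F)" and x: "x \<in> carrier (coord_space F d)"
  shows "vec (apply_matrix F d g x) = Q.lincomb {1..d} (\<lambda>j. embed F (x j)) (column g)"
proof
  fix i
  have xi: "x i \<in> carrier F" if "i \<in> {1..d}" for i using x that unfolding carrier_func_space by (rule PiE_mem)
  have gi: "g i j \<in> carrier F" if "i \<in> {1..d}" "j \<in> {1..d}" for i j using PiE_mem[OF PiE_mem[OF g that(1)] that(2)] .
  show "vec (apply_matrix F d g x) i = Q.lincomb {1..d} (\<lambda>j. embed F (x j)) (column g) i"
  proof (cases "i \<in> {1..d}")
    case True
    have "vec (apply_matrix F d g x) i = embed F (\<Oplus>j\<in>{1..d}. g i j \<otimes> x j)"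
      unfolding vec_def apply_matrix_def by (simp only: True if_True restrict_apply')
    also have "\<dots> = (\<Sum>j\<in>{1..d}. embed F (g i j \<otimes> x j))"
      by (rule embed_finsum) (use xi gi True in auto)
    also have "\<dots> = Q.lincomb {1..d} (\<lambda>j. embed F (x j)) (column g) i"
      unfolding Q.lincomb_def column_def vec_def
      by (intro sum.cong refl) (use xi gi True in \<open>auto simp: embed_mult mult.commute\<close>)
    finally show ?thesis .
  next
    case False
    show ?thesis unfolding vec_def Q.lincomb_def column_def by (simp only: False if_False mult_zero_right sum.neutral_const)
  qed
qed

lemma embed_column_product:
  assumes g: "g \<in> {1..d} \<rightarrow>\<^sub>E ({1..d} \<rightarrow>\<^sub>E carrier F)" and ij: "i \<in> {1..d}" "j \<in> {1..d}"
  shows "embed F (\<Oplus>l\<in>{1..d}. g l i \<otimes> g l j) = Q.dot (column g i) (column g j)"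
proof -
  have gi: "g i j \<in> carrier F" if "i \<in> {1..d}" "j \<in> {1..d}" for i j using PiE_mem[OF PiE_mem[OF g that(1)] that(2)] .
  have "embed F (\<Oplus>l\<in>{1..d}. g l i \<otimes> g l j) = (\<Sum>l\<in>{1..d}. embed F (g l i \<otimes> g l j))"
    by (rule embed_finsum) (use gi ij in auto)
  also have "\<dots> = Q.dot (column g i) (column g j)"
    unfolding Q.dot_def column_def vec_def
    by (intro sum.cong refl) (use gi ij in \<open>auto simp: embed_mult\<close>)
  finally show ?thesis .
qed

lemma orthogonal_matrix_columns:
  assumes g: "g \<in> {1..d} \<rightarrow>\<^sub>E ({1..d} \<rightarrow>\<^sub>E carrier F)"
  shows "g \<in> orthogonal_matrices F d \<longleftrightarrow>
    (\<forall>i\<in>{1..d}. \<forall>j\<in>{1..d}. Q.dot (column g i) (column g j) = (if i = j then embed F \<one> else 0))"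
proof -
  have gi: "g i j \<in> carrier F" if "i \<in> {1..d}" "j \<in> {1..d}" for i j using PiE_mem[OF PiE_mem[OF g that(1)] that(2)] .
  have "(\<Oplus>l\<in>{1..d}. g l i \<otimes> g l j) = (if i = j then \<one> else \<zero>)
      \<longleftrightarrow> Q.dot (column g i) (column g j) = (if i = j then embed F \<one> else 0)"
    if ij: "i \<in> {1..d}" "j \<in> {1..d}" for i j
  proof -
    have "(\<Oplus>l\<in>{1..d}. g l i \<otimes> g l j) \<in> carrier F" using gi ij by (intro finsum_closed) auto
    hence "(\<Oplus>l\<in>{1..d}. g l i \<otimes> g l j) = (if i = j then \<one> else \<zero>)
        \<longleftrightarrow> embed F (\<Oplus>l\<in>{1..d}. g l i \<otimes> g l j) = embed F (if i = j then \<one> else \<zero>)"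
      by (subst embed_eq_iff) auto
    also have "embed F (if i = j then \<one> else \<zero>) = (if i = j then embed F \<one> else 0)" by simp
    finally show ?thesis unfolding embed_column_product[OF g ij] .
  qed
  thus ?thesis using g unfolding orthogonal_matrices_def by blast
qed

lemma nrm_lincomb_orthonormal:
  assumes v: "\<And>i j. i \<in> {1..d} \<Longrightarrow> j \<in> {1..d} \<Longrightarrow> Q.dot (v i) (v j) = (if i = j then embed F \<one> else 0)"
    and c: "\<And>i. i \<in> {1..d} \<Longrightarrow> c i \<in> embed F ` carrier F"
  shows "Q.nrm (Q.lincomb {1..d} c v) = (\<Sum>i\<in>{1..d}. c i * c i)"
proof -
  have "Q.nrm (Q.lincomb {1..d} c v) = (\<Sum>i\<in>{1..d}. c i * (\<Sum>j\<in>{1..d}. c j * Q.dot (v j) (v i)))"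
    by (simp only: Q.dot_lincomb_left Q.dot_lincomb_right)
  also have "\<dots> = (\<Sum>i\<in>{1..d}. c i * c i)"
  proof (rule sum.cong[OF refl])
    fix i assume i: "i \<in> {1..d}"
    have "(\<Sum>j\<in>{1..d}. c j * Q.dot (v j) (v i)) = (\<Sum>j\<in>{1..d}. if j = i then c j else 0)"
    proof (rule sum.cong[OF refl])
      fix j assume j: "j \<in> {1..d}"
      show "c j * Q.dot (v j) (v i) = (if j = i then c j else 0)"
        using Q.e_mult[OF c[OF j]] unfolding v[OF j i] by (cases "j = i") (simp_all add: mult.commute[of _ "embed F \<one>"])
    qed
    also have "\<dots> = c i" using i by (simp only: sum.delta[OF finite_atLeastAtMost] if_True)
    finally show "c i * (\<Sum>j\<in>{1..d}. c j * Q.dot (v j) (v i)) = c i * c i" by (simp only:)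
  qed
  finally show ?thesis .
qed

text \<open>
  The matrix of an isometry has the images of the unit vectors as its columns, and these are
  orthonormal.
\<close>

lemma congruence_relI:
  assumes \<theta>: "\<theta> \<in> Q.isometries" and z: "z \<in> Q.V" and xy: "x \<in> simplices F d m" "y \<in> simplices F d m"
    and eq: "\<And>i. i \<in> {1..m+1} \<Longrightarrow> vec (y i) = \<theta> (vec (x i)) + z"
  shows "(x, y) \<in> congruence_rel F d m"
proof -
  define g where "g = (\<lambda>i\<in>{1..d}. \<lambda>j\<in>{1..d}. component F (\<theta> (vec (unit_vec j)) i))"
  have g: "g \<in> {1..d} \<rightarrow>\<^sub>E ({1..d} \<rightarrow>\<^sub>E carrier F)" by (simp add: g_def)
  have gcol: "column g j = \<theta> (vec (unit_vec j))" if j: "j \<in> {1..d}" for j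
  proof -
    have "\<theta> (vec (unit_vec j)) \<in> Q.V" by (rule Q.isometry_V[OF \<theta> vec_closed[OF unit_vec_closed]])
    hence "vec (unvec (\<theta> (vec (unit_vec j)))) = \<theta> (vec (unit_vec j))" by (rule vec_unvec)
    moreover have "(\<lambda>i\<in>{1..d}. g i j) = unvec (\<theta> (vec (unit_vec j)))"
      unfolding unvec_def g_def using j by (intro restrict_ext) simp
    ultimately show ?thesis unfolding column_def by simp
  qed
  have "g \<in> orthogonal_matrices F d"
    unfolding orthogonal_matrix_columns[OF g]
  proof (intro ballI)
    fix i j assume ij: "i \<in> {1..d}" "j \<in> {1..d}"
    have "Q.dot (column g i) (column g j) = Q.dot (vec (unit_vec i)) (vec (unit_vec j))"
      unfolding gcol[OF ij(1)] gcol[OF ij(2)] by (rule Q.isometry_dot[OF \<theta> vec_closed[OF unit_vec_closed] vec_closed[OF unit_vec_closed]])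
    thus "Q.dot (column g i) (column g j) = (if i = j then embed F \<one> else 0)" by (simp only: dot_unit_vec[OF ij])
  qed
  moreover have "\<forall>i\<in>{1..m+1}. apply_matrix F d g (x i) \<oplus>\<^bsub>coord_space F d\<^esub> unvec z = y i"
  proof
    fix i assume i: "i \<in> {1..m+1}"
    have xi: "x i \<in> carrier (coord_space F d)" using xy(1) i unfolding simplices_def by (rule PiE_mem)
    have yi: "y i \<in> carrier (coord_space F d)" using xy(2) i unfolding simplices_def by (rule PiE_mem)
    have xj: "x i j \<in> carrier F" if "j \<in> {1..d}" for j using xi that unfolding carrier_func_space by (rule PiE_mem)
    have "vec (apply_matrix F d g (x i)) = Q.lincomb {1..d} (\<lambda>j. embed F (x i j)) (column g)"
      by (rule vec_apply_matrix[OF g xi])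
    also have "\<dots> = Q.lincomb {1..d} (\<lambda>j. embed F (x i j)) (\<lambda>j. \<theta> (vec (unit_vec j)))"
      unfolding Q.lincomb_def by (simp only: gcol cong: sum.cong)
    also have "\<dots> = \<theta> (Q.lincomb {1..d} (\<lambda>j. embed F (x i j)) (\<lambda>j. vec (unit_vec j)))"
      by (rule Q.isometry_lincomb[OF \<theta> finite_atLeastAtMost, symmetric], intro ballI conjI imageI xj vec_closed unit_vec_closed)
    also have "\<dots> = \<theta> (vec (x i))" by (simp only: vec_eq_lincomb_unit_vec[OF xi, symmetric])
    finally have ap: "vec (apply_matrix F d g (x i)) = \<theta> (vec (x i))" .
    have apC: "apply_matrix F d g (x i) \<in> carrier (coord_space F d)"
      by (rule apply_matrix_closed[OF g xi])
    have "vec (apply_matrix F d g (x i) \<oplus>\<^bsub>coord_space F d\<^esub> unvec z) = vec (y i)"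
      using vec_add[OF apC unvec_closed, of z] by (simp only: ap eq[OF i] vec_unvec[OF z])
    moreover have "apply_matrix F d g (x i) \<oplus>\<^bsub>coord_space F d\<^esub> unvec z \<in> carrier (coord_space F d)"
      by (rule func_space_add_closed[OF apC unvec_closed])
    ultimately show "apply_matrix F d g (x i) \<oplus>\<^bsub>coord_space F d\<^esub> unvec z = y i" by (simp only: vec_eq_iff[OF _ yi])
  qed
  ultimately show ?thesis
    unfolding congruence_rel_def using xy unvec_closed[of z] by blast
qed

text \<open>
  Orthogonal columns are an orthonormal system, so the difference of two image points has the
  same norm as the difference of the points.
\<close>

lemma congruent_distances:
  assumes xy: "(x, y) \<in> congruence_rel F d m" and ij: "i \<in> {1..m+1}" "j \<in> {1..m+1}"
  shows "Q.nrm (vec (y i) - vec (y j)) = Q.nrm (vec (x i) - vec (x j))"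
proof -
  obtain g z where g: "g \<in> orthogonal_matrices F d" and z: "z \<in> carrier (coord_space F d)"
    and eq: "\<And>i. i \<in> {1..m+1} \<Longrightarrow> apply_matrix F d g (x i) \<oplus>\<^bsub>coord_space F d\<^esub> z = y i"
    and x: "x \<in> simplices F d m"
    using xy unfolding congruence_rel_def by blast
  have gP: "g \<in> {1..d} \<rightarrow>\<^sub>E ({1..d} \<rightarrow>\<^sub>E carrier F)" using g unfolding orthogonal_matrices_def by blast
  have xi: "x i \<in> carrier (coord_space F d)" if "i \<in> {1..m+1}" for i
    using x that unfolding simplices_def by (rule PiE_mem)
  have xl: "x i l \<in> carrier F" if "i \<in> {1..m+1}" "l \<in> {1..d}" for i l
    using xi[OF that(1)] that(2) unfolding carrier_func_space by (rule PiE_mem)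
  have y: "vec (y i) = Q.lincomb {1..d} (\<lambda>l. embed F (x i l)) (column g) + vec z" if i: "i \<in> {1..m+1}" for i
  proof -
    have apC: "apply_matrix F d g (x i) \<in> carrier (coord_space F d)"
      by (rule apply_matrix_closed[OF gP xi[OF i]])
    show ?thesis unfolding eq[OF i, symmetric] vec_add[OF apC z] vec_apply_matrix[OF gP xi[OF i]] ..
  qed
  define c where "c l = embed F (x i l) - embed F (x j l)" for l
  have "vec (y i) - vec (y j) = Q.lincomb {1..d} c (column g)"
    unfolding y[OF ij(1)] y[OF ij(2)] c_def Q.lincomb_def
    by (simp add: fun_eq_iff minus_apply plus_fun_apply left_diff_distrib sum_subtractf)
  hence "Q.nrm (vec (y i) - vec (y j)) = Q.nrm (Q.lincomb {1..d} c (column g))" by (simp only:)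
  also have "\<dots> = (\<Sum>l\<in>{1..d}. c l * c l)"
    by (rule nrm_lincomb_orthonormal) (use g orthogonal_matrix_columns[OF gP] xl ij in \<open>auto simp: c_def\<close>)
  also have "\<dots> = Q.nrm (vec (x i) - vec (x j))"
    unfolding Q.dot_def by (intro sum.cong refl) (simp add: vec_def c_def minus_apply)
  finally show ?thesis .
qed

end

section \<open>Nondegenerate simplices\<close>

context odd_finite_field
begin

lemma coord_vectorspace: "vectorspace F (coord_space F d)"
  by (intro vectorspace.intro func_space_is_module field_axioms)

lemma vec_smult:
  "a \<in> carrier F \<Longrightarrow> x \<in> carrier (coord_space F d) \<Longrightarrow> vec (a \<odot>\<^bsub>coord_space F d\<^esub> x) = Q.smul (embed F a) (vec x)"
  by (auto simp: vec_def func_space_def Q.smul_def fun_eq_iff embed_mult PiE_iff)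

lemma vec_zero: "vec \<zero>\<^bsub>coord_space F d\<^esub> = 0"
  by (auto simp: vec_def func_space_def fun_eq_iff zero_fun_apply)

lemma vec_module_lincomb:
  assumes A: "finite A" "A \<subseteq> carrier (coord_space F d)" and a: "\<And>v. v \<in> A \<Longrightarrow> a v \<in> carrier F"
  shows "vec (module.lincomb (coord_space F d) a A) = Q.lincomb A (\<lambda>v. embed F (a v)) vec"
proof -
  interpret M: vectorspace F "coord_space F d" by (rule coord_vectorspace)
  show ?thesis using A a
  proof (induction A rule: finite_induct)
    case empty
    show ?case by (simp only: M.lincomb_def M.finsum_empty vec_zero Q.lincomb_def sum.empty zero_fun_def)
  next
    case (insert v A)
    have f: "(\<lambda>v. a v \<odot>\<^bsub>coord_space F d\<^esub> v) \<in> A \<rightarrow> carrier (coord_space F d)"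
      using insert.prems by (intro Pi_I M.smult_closed) auto
    have v: "a v \<odot>\<^bsub>coord_space F d\<^esub> v \<in> carrier (coord_space F d)"
      using insert.prems by (intro M.smult_closed) auto
    have "M.lincomb a (insert v A) = a v \<odot>\<^bsub>coord_space F d\<^esub> v \<oplus>\<^bsub>coord_space F d\<^esub> M.lincomb a A"
      unfolding M.lincomb_def by (rule M.finsum_insert[OF insert.hyps f]) (rule v)
    moreover have "M.lincomb a A \<in> carrier (coord_space F d)"
      unfolding M.lincomb_def by (rule M.finsum_closed[OF f])
    ultimately have "vec (M.lincomb a (insert v A)) = vec (a v \<odot>\<^bsub>coord_space F d\<^esub> v) + vec (M.lincomb a A)"
      using vec_add[OF v] by (simp only:)
    also have "\<dots> = Q.smul (embed F (a v)) (vec v) + Q.lincomb A (\<lambda>v. embed F (a v)) vec"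
      using insert by (subst vec_smult) auto
    finally show ?case by (simp only: Q.lincomb_insert[OF insert.hyps])
  qed
qed

text \<open>
  The \<open>m\<close> difference vectors generate a space of dimension \<open>m\<close>. Therefore they form a basis, and
  in particular are pairwise distinct, which is what turns independence of the set into
  independence of the family.
\<close>

lemma nondegenerate_independent:
  assumes \<Delta>: "\<Delta> \<in> simplices F d m" and nd: "nondegenerate F d m \<Delta>" and md: "m \<le> d"
  shows "Q.independent {2..m+1} (\<lambda>i. vec (\<Delta> i) - vec (\<Delta> 1))"
proof -
  interpret M: vectorspace F "coord_space F d" by (rule coord_vectorspace)
  let ?w = "\<lambda>i. \<Delta> i \<ominus>\<^bsub>coord_space F d\<^esub> \<Delta> 1" and ?J = "{2..m+1}"
  let ?S = "?w ` ?J"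
  have \<Delta>C: "\<Delta> i \<in> carrier (coord_space F d)" if "i \<in> {1..m+1}" for i
    using \<Delta> that unfolding simplices_def by (rule PiE_mem)
  have w: "?w i \<in> carrier (coord_space F d)" "vec (?w i) = vec (\<Delta> i) - vec (\<Delta> 1)" if "i \<in> ?J" for i
  proof -
    have i: "\<Delta> i \<in> carrier (coord_space F d)" "\<Delta> 1 \<in> carrier (coord_space F d)" using \<Delta>C that by auto
    show "?w i \<in> carrier (coord_space F d)" by (rule coord_minus_closed[OF i])
    show "vec (?w i) = vec (\<Delta> i) - vec (\<Delta> 1)" by (rule vec_minus[OF i])
  qed
  have S: "finite ?S" "?S \<subseteq> carrier (coord_space F d)" using w(1) by blast+
  have sub: "submodule F (M.span ?S) (coord_space F d)" by (rule M.span_is_submodule[OF S(2)])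
  interpret W: vectorspace F "M.span_vs ?S"
    by (intro vectorspace.intro M.submodule_is_module sub field_axioms)
  have own: "?S \<subseteq> M.span ?S" by (rule M.in_own_span[OF S(2)])
  have dim: "W.dim = m" using nd md unfolding nondegenerate_def simplex_dim_def by simp
  have "card ?S \<le> card ?J" by (rule card_image_le) simp
  hence cS: "card ?S \<le> m" by simp
  have "W.basis ?S"
  proof (rule W.dim_gen_is_basis[OF S(1)])
    show "?S \<subseteq> carrier (M.span_vs ?S)" using own by simp
    show "W.gen_set ?S" using M.span_li_not_depend(1)[OF own sub] by simp
    show "card ?S \<le> W.dim" using cS dim by simp
  qed
  hence "W.dim = card ?S" and "W.lin_indpt ?S" using W.dim_basis[OF S(1)] unfolding W.basis_def by blast+
  hence "card ?S = card ?J" and ind: "M.lin_indpt ?S"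
    using dim M.span_li_not_depend(2)[OF own sub] by simp_all
  hence inj: "inj_on ?w ?J" by (intro eq_card_imp_inj_on) simp_all
  show ?thesis unfolding Q.independent_def
  proof (intro conjI allI impI ballI)
    show "finite ?J" by simp
    show "vec (\<Delta> i) - vec (\<Delta> 1) \<in> Q.V" if "i \<in> ?J" for i
      unfolding w(2)[OF that, symmetric] by (rule vec_closed[OF w(1)[OF that]])
    fix c i assume c: "\<forall>i\<in>?J. c i \<in> embed F ` carrier F" and 0: "Q.lincomb ?J c (\<lambda>i. vec (\<Delta> i) - vec (\<Delta> 1)) = 0"
      and i: "i \<in> ?J"
    define a where "a v = component F (c (inv_into ?J ?w v))" for v
    have aw: "embed F (a (?w i)) = c i" if "i \<in> ?J" for i
      using c that unfolding a_def inv_into_f_f[OF inj that] by (intro embed_component) blast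
    have aC: "a v \<in> carrier F" for v by (simp add: a_def)
    have "vec (M.lincomb a ?S) = Q.lincomb ?S (\<lambda>v. embed F (a v)) vec"
      by (rule vec_module_lincomb[OF S aC])
    also have "\<dots> = Q.lincomb ?J c (\<lambda>i. vec (\<Delta> i) - vec (\<Delta> 1))"
      unfolding Q.lincomb_def sum.reindex[OF inj] comp_def by (simp only: aw w(2) cong: sum.cong)
    also have "\<dots> = vec \<zero>\<^bsub>coord_space F d\<^esub>" by (simp only: 0 vec_zero)
    finally have lc: "M.lincomb a ?S = \<zero>\<^bsub>coord_space F d\<^esub>"
      by (subst (asm) vec_eq_iff) (use S aC in \<open>auto intro!: M.lincomb_closed simp del: One_nat_def\<close>)
    show "c i = 0"
    proof (rule ccontr)
      assume "c i \<noteq> 0"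
      hence "a (?w i) \<noteq> \<zero>" using aw[OF i] embed_zero by metis
      hence "M.lin_dep ?S" unfolding M.lin_dep_def using S(1) lc i aC by blast
      thus False using ind by contradiction
    qed
  qed
qed

section \<open>Congruence classes\<close>

lemma finite_simplices: "finite (simplices F d m)"
  unfolding simplices_def carrier_func_space by (intro finite_PiE) (auto intro!: finite_PiE finite_carrier)

text \<open>
  A point \<open>w\<close> that is reached gives the simplex with the points \<open>g y_i\<close> in position \<open>s i\<close> and
  \<open>g w\<close> in position \<open>l\<close>. Its class determines the distance vector of \<open>w\<close>, so a choice of
  representatives maps the admissible classes onto a set that contains all distance vectors.
\<close>

lemma distance_vectors_le_congruence_classes:
  assumes k: "k \<ge> 1" and \<Delta>: "\<Delta> \<in> simplices F d (k - 1)"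
    and s: "s \<in> {1..k} \<rightarrow> {1..k+1}" "inj_on s {1..k}" and l: "l \<in> {1..k+1}" "l \<notin> s ` {1..k}"
    and A: "\<And>i. i \<in> {1..k+1} \<Longrightarrow> A i \<subseteq> carrier (coord_space F d)"
  shows "card ((\<lambda>w. \<lambda>i\<in>{1..k}. Q.nrm (w - vec (\<Delta> i))) `
      {w \<in> Q.V. \<exists>g\<in>Q.isometries \<times> Q.V. (\<forall>i\<in>{1..k}. fst g (vec (\<Delta> i)) + snd g \<in> vec ` A (s i)) \<and> fst g w + snd g \<in> vec ` A l})
    \<le> num_congruence_classes F d k (\<lambda>x. has_vertices_in k A x \<and> contains_copy F d k \<Delta> x)"
    (is "card (?D ` ?W) \<le> _")
proof -
  let ?P = "\<lambda>x. has_vertices_in k A x \<and> contains_copy F d k \<Delta> x"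
  let ?R = "congruence_rel F d k"
  let ?C = "{C \<in> simplices F d k // ?R. \<exists>x\<in>C. ?P x}"
  let ?\<tau> = "\<lambda>x. \<lambda>i\<in>{1..k}. Q.nrm (vec (x l) - vec (x (s i)))"
  have sk: "s i \<in> {1..k+1}" if "i \<in> {1..k}" for i using s(1) that by blast
  have "card (s ` {1..k}) = k" using card_image[OF s(2)] by simp
  hence "card (insert l (s ` {1..k})) = k + 1" using l(2) by simp
  hence cover: "insert l (s ` {1..k}) = {1..k+1}"
    using sk l(1) by (intro card_subset_eq) auto
  have finC: "finite ?C"
    by (rule finite_subset[of _ "Pow (simplices F d k)"])
       (auto simp: quotient_def congruence_rel_def finite_simplices simp del: One_nat_def)
  have \<Delta>C: "\<Delta> i \<in> carrier (coord_space F d)" if "i \<in> {1..k}" for i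
  proof -
    have "i \<in> {1..k - 1 + 1}" using that k by simp
    thus ?thesis using \<Delta> unfolding simplices_def by (rule PiE_mem[rotated])
  qed
  have "?D ` ?W \<subseteq> (\<lambda>C. ?\<tau> (SOME x. x \<in> C)) ` ?C"
  proof (rule image_subsetI)
    fix w assume "w \<in> ?W"
    then obtain \<theta> z where w: "w \<in> Q.V" and \<theta>: "\<theta> \<in> Q.isometries" and z: "z \<in> Q.V"
      and B: "\<And>i. i \<in> {1..k} \<Longrightarrow> \<theta> (vec (\<Delta> i)) + z \<in> vec ` A (s i)" and Al: "\<theta> w + z \<in> vec ` A l" by auto
    define x where "x = (\<lambda>j\<in>{1..k+1}. unvec ((if j = l then \<theta> w else \<theta> (vec (\<Delta> (inv_into {1..k} s j)))) + z))"
    have xs: "x \<in> simplices F d k"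
      unfolding simplices_def x_def restrict_PiE_iff by (intro ballI unvec_closed)
    have \<theta>V: "\<theta> u + z \<in> Q.V" if "u \<in> Q.V" for u using Q.isometry_V[OF \<theta> that] z by (rule Q.add_V)
    have x_l: "vec (x l) = \<theta> w + z"
      unfolding x_def using l(1) vec_unvec[OF \<theta>V[OF w]] by (simp only: restrict_apply' simp_thms if_True)
    have x_s: "vec (x (s i)) = \<theta> (vec (\<Delta> i)) + z" if i: "i \<in> {1..k}" for i
    proof -
      have "s i \<noteq> l" using l(2) i by blast
      thus ?thesis
        unfolding x_def using sk[OF i] vec_unvec[OF \<theta>V[OF vec_closed[OF \<Delta>C[OF i]]]]
        by (simp only: restrict_apply' if_False inv_into_f_f[OF s(2) i])
    qed
    have xC: "x j \<in> carrier (coord_space F d)" if "j \<in> {1..k+1}" for j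
      using xs that unfolding simplices_def by (rule PiE_mem)
    have A_mem: "x j \<in> A j" if j: "j \<in> {1..k+1}" and v: "vec (x j) \<in> vec ` A j" for j
    proof -
      obtain a where a: "a \<in> A j" "vec (x j) = vec a" using v by blast
      hence "x j = a" using vec_eq_iff[OF xC[OF j]] A[OF j] by blast
      thus ?thesis using a by simp
    qed
    have vert: "has_vertices_in k A x" unfolding has_vertices_in_def
    proof
      fix j assume j: "j \<in> {1..k+1}"
      hence "j = l \<or> (\<exists>i\<in>{1..k}. j = s i)" using cover by blast
      hence "vec (x j) \<in> vec ` A j"
      proof (elim disjE bexE)
        assume "j = l"
        thus ?thesis using Al x_l by (simp only:)
      next
        fix i assume i: "i \<in> {1..k}" "j = s i"
        show ?thesis unfolding i(2) x_s[OF i(1)] by (rule B[OF i(1)])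
      qed
      thus "x j \<in> A j" by (rule A_mem[OF j])
    qed
    obtain \<rho> where \<rho>: "\<rho> \<in> Q.isometries" and \<rho>\<theta>: "\<And>u. u \<in> Q.V \<Longrightarrow> \<rho> (\<theta> u) = u"
      "\<And>u. u \<in> Q.V \<Longrightarrow> \<theta> (\<rho> u) = u" by (rule Q.isometry_inverse[OF \<theta>]) (rule that)
    have "((\<lambda>i\<in>{1..k}. x (s i)), \<Delta>) \<in> congruence_rel F d (k - 1)"
    proof (rule congruence_relI[OF \<rho>, of "- \<rho> z"])
      have k1: "k - 1 + 1 = k" using k by simp
      show "- \<rho> z \<in> Q.V" using Q.isometry_V[OF \<rho> z] by (rule Q.minus_V)
      show "(\<lambda>i\<in>{1..k}. x (s i)) \<in> simplices F d (k - 1)"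
        unfolding simplices_def k1 restrict_PiE_iff by (intro ballI xC sk)
      show "\<Delta> \<in> simplices F d (k - 1)" by (rule \<Delta>)
      fix i assume "i \<in> {1..k - 1 + 1}"
      hence i: "i \<in> {1..k}" unfolding k1 .
      have y: "vec (\<Delta> i) \<in> Q.V" by (rule vec_closed[OF \<Delta>C[OF i]])
      have "\<rho> (\<theta> (vec (\<Delta> i)) + z) = vec (\<Delta> i) + \<rho> z"
        using Q.isometry_add[OF \<rho> Q.isometry_V[OF \<theta> y] z] \<rho>\<theta>[OF y] by (simp only:)
      hence "vec (\<Delta> i) = \<rho> (vec (x (s i))) + - \<rho> z" unfolding x_s[OF i] by simp
      thus "vec (\<Delta> i) = \<rho> (vec ((\<lambda>i\<in>{1..k}. x (s i)) i)) + - \<rho> z" using i by (simp only: restrict_apply')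
    qed
    hence copy: "contains_copy F d k \<Delta> x" unfolding contains_copy_def using s by blast
    have "(x, x) \<in> ?R"
      by (rule congruence_relI[OF Q.isometry_id Q.zero_V xs xs])
         (use vec_closed[OF xC] in \<open>simp only: restrict_apply' add_0_right\<close>)
    hence xcl: "x \<in> ?R `` {x}" by blast
    have cl: "?R `` {x} \<in> ?C" using xs xcl vert copy by (blast intro: quotientI)
    have same: "?\<tau> x' = ?D w" if "x' \<in> ?R `` {x}" for x'
    proof (rule restrict_ext)
      fix i assume i: "i \<in> {1..k}"
      have y: "vec (\<Delta> i) \<in> Q.V" by (rule vec_closed[OF \<Delta>C[OF i]])
      have "(x, x') \<in> ?R" using that by blast
      hence "Q.nrm (vec (x' l) - vec (x' (s i))) = Q.nrm (vec (x l) - vec (x (s i)))"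
        by (rule congruent_distances[OF _ l(1) sk[OF i]])
      also have "\<dots> = Q.nrm (\<theta> w - \<theta> (vec (\<Delta> i)))" unfolding x_l x_s[OF i] by simp
      also have "\<dots> = Q.nrm (\<theta> (w - vec (\<Delta> i)))" unfolding Q.isometry_diff[OF \<theta> w y] ..
      also have "\<dots> = Q.nrm (w - vec (\<Delta> i))" by (rule Q.isometry_dot[OF \<theta>]; rule Q.diff_V[OF w y])
      finally show "Q.nrm (vec (x' l) - vec (x' (s i))) = Q.nrm (w - vec (\<Delta> i))" .
    qed
    have "(SOME x'. x' \<in> ?R `` {x}) \<in> ?R `` {x}" using xcl by (rule someI[of "\<lambda>x'. x' \<in> ?R `` {x}"])
    hence "?D w = ?\<tau> (SOME x'. x' \<in> ?R `` {x})" by (rule same[symmetric])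
    thus "?D w \<in> (\<lambda>C. ?\<tau> (SOME x. x \<in> C)) ` ?C" using cl by (rule image_eqI)
  qed
  hence "card (?D ` ?W) \<le> card ?C" using finC by (meson card_image_le card_mono finite_imageI order_trans)
  thus ?thesis unfolding num_congruence_classes_def .
qed

end

section \<open>The lower bound for one choice of the remaining set\<close>

context quadratic_space
begin

text \<open>
  One bound for both moments. For \<open>d = 2\<close> the twist is trivial and the sixth moment applies. For
  \<open>d \<ge> 3\<close> the fourth moment gives the exponent \<open>9/2\<close> for the sixth power, which is less than
  \<open>d + 2\<close>.
\<close>

lemma kloosterman_eta_bound:
  assumes d: "d \<ge> 2" and ab: "a \<in> K" "b \<in> K" "a \<noteq> 0"
  shows "cmod (kloosterman (\<lambda>x. of_real (eta x) ^ d) a b) ^ 6 \<le> 140 * real q ^ (d + 2)"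
proof (cases "d = 2")
  case True
  have "kloosterman (\<lambda>x. of_real (eta x) ^ d) a b = kloosterman (\<lambda>_. 1) a b"
    unfolding kloosterman_def
  proof (rule sum.cong[OF refl])
    fix x assume "x \<in> K - {0}"
    hence "eta x ^ d = 1" using eta_sq[of x] True by (simp add: power2_eq_square)
    thus "of_real (eta x) ^ d * chi (a * x + b * kinv x) = 1 * chi (a * x + b * kinv x)"
      by (simp flip: of_real_power)
  qed
  hence "cmod (kloosterman (\<lambda>x. of_real (eta x) ^ d) a b) ^ 6 = cmod (kloosterman (\<lambda>_. 1) a b) ^ 6" by (simp only:)
  also have "\<dots> \<le> 140 * real q ^ 4" by (rule kloosterman_bound_6) (use ab in auto)
  finally show ?thesis using True by simp
next
  case False
  let ?x = "cmod (kloosterman (\<lambda>x. of_real (eta x) ^ d) a b)"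
  have q1: "real q \<ge> 1" using q_ge_3 by simp
  have "?x ^ 4 \<le> 10 * real q ^ 3" by (rule kloosterman_bound_4[OF unit_character_eta_power]) (use ab in auto)
  hence "(?x ^ 4) ^ 3 \<le> (10 * real q ^ 3) ^ 3" by (intro power_mono) auto
  also have "\<dots> = 1000 * real q ^ 9" by (simp add: power_mult_distrib flip: power_mult)
  also have "\<dots> \<le> 19600 * real q ^ 10" using q1 by (intro mult_mono power_increasing) auto
  also have "\<dots> = (140 * real q ^ 5)\<^sup>2" by (simp add: power_mult_distrib flip: power_mult)
  finally have "(?x ^ 6)\<^sup>2 \<le> (140 * real q ^ 5)\<^sup>2" by (simp flip: power_mult)
  hence "?x ^ 6 \<le> 140 * real q ^ 5" by (rule power2_le_imp_le) simp
  also have "\<dots> \<le> 140 * real q ^ (d + 2)" using False d q1 by (intro mult_left_mono power_increasing) auto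
  finally show ?thesis .
qed

end

lemma sqrt_power_eq_powr: "x > 0 \<Longrightarrow> sqrt x ^ n = x powr (real n / 2)"
  by (simp add: powr_half_sqrt[symmetric] powr_powr flip: powr_realpow)

context odd_finite_field
begin

lemma Q_q: "Q.q = card (carrier F)"
  unfolding Q.q_def by (rule card_image) (simp add: inj_on_def)

text \<open>
  The constant \<open>12 * 2^k\<close> comes from the error \<open>\<eta> = 1 / (4 * 2^k)\<close> that is allowed for each of
  the fewer than \<open>2^k\<close> pairs of indices. For \<open>k = 2\<close> the required inequality between the two
  sets and the Kloosterman sums is a comparison of sixth powers.
\<close>

lemma congruence_classes_lower_bound:
  assumes k: "2 \<le> k" "k \<le> d" "2 * k \<le> d + 2" and q: "q = card (carrier F)" "q \<ge> 160"
    and \<Delta>: "\<Delta> \<in> simplices F d (k - 1)" "nondegenerate F d (k - 1) \<Delta>" "\<zero> \<notin> side_lengths F d (k - 1) \<Delta>"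
    and s: "s \<in> {1..k} \<rightarrow> {1..k+1}" "inj_on s {1..k}" and l: "l \<in> {1..k+1}" "l \<notin> s ` {1..k}"
    and A: "\<And>i. i \<in> {1..k+1} \<Longrightarrow> A i \<subseteq> carrier (coord_space F d)"
    and big: "\<And>i. i \<in> {1..k} \<Longrightarrow> 12 * 2 ^ k * real q powr ((real d - 1) / 2 + real k - 1) \<le> real (card (A (s i)))"
    and prod: "16 * real q ^ (d * k + 1) \<le> (\<Prod>i\<in>{1..k+1}. real (card (A i)))"
    and two: "k = 2 \<Longrightarrow> (12 * 2 ^ k * 160 ^ d)\<^sup>2 * real q ^ (4 * d + 2) \<le> (real (card (A (s 1))) * real (card (A (s 2)))) ^ 3"
  shows "real q ^ k \<le> 4 * real (num_congruence_classes F d k (\<lambda>x. has_vertices_in k A x \<and> contains_copy F d k \<Delta> x))"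
proof -
  let ?I = "{1..k}"
  define \<eta> :: real where "\<eta> = 1 / (4 * 2 ^ k)"
  have Qq: "Q.q = q" using Q_q q(1) by simp
  have q0: "real q > 0" using q(2) by simp
  have sk: "s i \<in> {1..k+1}" if "i \<in> ?I" for i using s(1) that by blast
  have k1: "k - 1 + 1 = k" using k(1) by simp
  have \<Delta>C: "\<Delta> i \<in> carrier (coord_space F d)" if "i \<in> ?I" for i
    using \<Delta>(1) that unfolding simplices_def k1 by (rule PiE_mem)
  have cardA: "card (vec ` A i) = card (A i)" if "i \<in> {1..k+1}" for i
    by (rule card_image, rule inj_onI) (use vec_eq_iff A[OF that] in blast)
  have nz: "Q.nrm (vec (\<Delta> i) - vec (\<Delta> j)) \<noteq> 0" if ij: "i \<in> ?I" "j \<in> ?I" "i \<noteq> j" for i j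
  proof
    let ?x = "\<Delta> i \<ominus>\<^bsub>coord_space F d\<^esub> \<Delta> j"
    have x: "?x \<in> carrier (coord_space F d)" by (rule coord_minus_closed[OF \<Delta>C[OF ij(1)] \<Delta>C[OF ij(2)]])
    have xi: "?x i \<in> carrier F" if "i \<in> {1..d}" for i using x that unfolding carrier_func_space by (rule PiE_mem)
    have c: "sq_norm F d ?x \<in> carrier F" unfolding sq_norm_def by (intro finsum_closed Pi_I nat_pow_closed xi)
    assume "Q.nrm (vec (\<Delta> i) - vec (\<Delta> j)) = 0"
    hence "embed F (sq_norm F d ?x) = embed F \<zero>"
      using embed_sq_norm[OF x] vec_minus[OF \<Delta>C[OF ij(1)] \<Delta>C[OF ij(2)]] by (simp only: embed_zero)
    hence "sq_norm F d ?x = \<zero>" using embed_eq_iff[OF c zero_closed] by simp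
    hence "\<zero> \<in> side_lengths F d (k - 1) \<Delta>" unfolding side_lengths_def k1 mem_Collect_eq
      by (intro exI[of _ i] exI[of _ j] conjI ij) (rule sym)
    thus False using \<Delta>(3) by contradiction
  qed
  have "{2..k - 1 + 1} = ?I - {1}" using k(1) by auto
  hence ind: "Q.independent (?I - {1}) (\<lambda>i. vec (\<Delta> i) - vec (\<Delta> 1))"
    using nondegenerate_independent[OF \<Delta>(1,2)] k by simp
  have "real (card (edges ?I)) \<le> real (card (Pow ?I))"
    by (intro of_nat_mono card_mono) (auto simp: edges_def)
  hence edges: "real (card (edges ?I)) * \<eta> \<le> 1 / 4" by (simp add: card_Pow \<eta>_def divide_simps)
  have expo: "real q * real q powr ((real d - 1) / 2 + real k - 1) = sqrt (real q) ^ (d + 2 * k - 1)"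
  proof -
    have "real q * real q powr ((real d - 1) / 2 + real k - 1) = real q powr (1 + ((real d - 1) / 2 + real k - 1))"
      using q0 by (simp only: powr_add[of _ 1] powr_one')
    also have "1 + ((real d - 1) / 2 + real k - 1) = real (d + 2 * k - 1) / 2"
      using k by (simp add: of_nat_diff field_simps)
    finally show ?thesis using sqrt_power_eq_powr[OF q0] by simp
  qed
  have sqrt2: "sqrt 2 \<le> 3 / 2" by (rule real_le_lsqrt) (simp_all add: power2_eq_square)
  have "real q ^ k \<le> 4 * real (card ((\<lambda>w. \<lambda>i\<in>?I. Q.nrm (w - vec (\<Delta> i))) `
      {w \<in> Q.V. \<exists>g\<in>Q.isometries \<times> Q.V. (\<forall>i\<in>?I. fst g (vec (\<Delta> i)) + snd g \<in> vec ` A (s i)) \<and> fst g w + snd g \<in> vec ` A l}))"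
  proof (rule Q.distance_vectors[where ?i0.0 = 1 and \<eta> = \<eta> and y = "\<lambda>i. vec (\<Delta> i)", unfolded Qq])
    show "160 \<le> q" "2 \<le> d" "finite ?I" "card ?I = k" "2 \<le> k" "1 \<in> ?I" "2 * k \<le> d + 2" using q k by auto
    show "vec (\<Delta> i) \<in> Q.V" if "i \<in> ?I" for i by (rule vec_closed[OF \<Delta>C[OF that]])
    show "Q.nrm (vec (\<Delta> i) - vec (\<Delta> j)) \<noteq> 0" if "i \<in> ?I" "j \<in> ?I" "i \<noteq> j" for i j by (rule nz[OF that])
    show "Q.independent (?I - {1}) (\<lambda>i. vec (\<Delta> i) - vec (\<Delta> 1))" by (rule ind)
    show "vec ` A (s i) \<subseteq> Q.V" if "i \<in> ?I" for i using A[OF sk[OF that]] vec_closed by blast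
    show "vec ` A l \<subseteq> Q.V" using A[OF l(1)] vec_closed by blast
    show "0 < \<eta>" by (simp add: \<eta>_def)
    show "real (card (edges ?I)) * \<eta> \<le> 1 / 4" by (rule edges)
    show "2 * sqrt 2 * sqrt (real q) ^ (d + 2 * k - 1) \<le> \<eta> * real q * real (card (vec ` A (s i)))" if i: "i \<in> ?I" for i
    proof -
      have "2 * sqrt 2 * sqrt (real q) ^ (d + 2 * k - 1) \<le> 3 * sqrt (real q) ^ (d + 2 * k - 1)"
        using sqrt2 by (intro mult_right_mono) auto
      also have "\<dots> = \<eta> * real q * (12 * 2 ^ k * real q powr ((real d - 1) / 2 + real k - 1))"
        unfolding expo[symmetric] \<eta>_def by simp
      also have "\<dots> \<le> \<eta> * real q * real (card (A (s i)))"
        by (rule mult_left_mono[OF big[OF i]]) (simp add: \<eta>_def)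
      finally show ?thesis unfolding cardA[OF sk[OF i]] .
    qed
    show "16 * real q ^ (d * k + 1) \<le> (\<Prod>i\<in>?I. real (card (vec ` A (s i)))) * real (card (vec ` A l))"
    proof -
      have cs: "card (s ` ?I) = k" using card_image[OF s(2)] by simp
      hence "card (insert l (s ` ?I)) = k + 1" using l(2) by simp
      hence cover: "insert l (s ` ?I) = {1..k+1}" using sk l(1) by (intro card_subset_eq) auto
      have "(\<Prod>i\<in>{1..k+1}. real (card (A i))) = real (card (A l)) * (\<Prod>i\<in>s ` ?I. real (card (A i)))"
        unfolding cover[symmetric] by (rule prod.insert) (use l(2) in auto)
      also have "(\<Prod>i\<in>s ` ?I. real (card (A i))) = (\<Prod>i\<in>?I. real (card (vec ` A (s i))))"
        unfolding prod.reindex[OF s(2)] comp_def by (intro prod.cong refl) (simp only: cardA sk)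
      finally show ?thesis using prod cardA[OF l(1)] by (simp only: mult.commute)
    qed
    assume k2: "k = 2"
    define \<kappa> where "\<kappa> = root 6 (140 * real q ^ (d + 2))"
    have \<kappa>: "\<kappa> \<ge> 0" "\<kappa> ^ 6 = 140 * real q ^ (d + 2)" by (simp_all add: \<kappa>_def)
    have kl: "cmod (Q.kloosterman (\<lambda>x. of_real (Q.eta x) ^ d) a b) \<le> \<kappa>"
      if "a \<in> embed F ` carrier F" "b \<in> embed F ` carrier F" "a \<noteq> 0" for a b
      by (rule power_le_imp_le_base[of _ 5]) (use Q.kloosterman_eta_bound[OF _ that] k \<kappa> Qq in simp_all)
    let ?P = "real (card (A (s 1))) * real (card (A (s 2)))"
    have pos: "2 * sqrt (real q) ^ d * \<kappa> \<le> \<eta> * sqrt ?P"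
    proof (rule power_le_imp_le_base[of _ 5])
      have "(2 * t ^ d * \<kappa>) ^ Suc 5 = 64 * (t ^ 2) ^ (3 * d) * \<kappa> ^ 6" for t
        by (simp add: power_mult_distrib mult.commute flip: power_mult)
      hence "(2 * sqrt (real q) ^ d * \<kappa>) ^ Suc 5 = 64 * (sqrt (real q) ^ 2) ^ (3 * d) * \<kappa> ^ 6" .
      also have "\<dots> = 8960 * real q ^ (4 * d + 2)" unfolding \<kappa>(2) by (simp flip: power_add)
      also have "\<dots> \<le> \<eta> ^ 6 * (12 * 2 ^ k * 160 ^ d)\<^sup>2 * real q ^ (4 * d + 2)"
      proof (rule mult_right_mono)
        have "(12 * 2 ^ k * 160 ^ 2 :: real) \<le> 12 * 2 ^ k * 160 ^ d"
          using k by (intro mult_left_mono power_increasing) auto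
        hence "\<eta> ^ 6 * (12 * 2 ^ k * 160 ^ 2)\<^sup>2 \<le> \<eta> ^ 6 * (12 * 2 ^ k * 160 ^ d)\<^sup>2"
          by (intro mult_left_mono power_mono) (auto simp: \<eta>_def)
        moreover have "8960 \<le> \<eta> ^ 6 * (12 * 2 ^ k * 160 ^ 2)\<^sup>2" by (simp add: \<eta>_def k2 power_divide)
        ultimately show "8960 \<le> \<eta> ^ 6 * (12 * 2 ^ k * 160 ^ d)\<^sup>2" by linarith
      qed simp
      also have "\<dots> \<le> \<eta> ^ 6 * ?P ^ 3"
        using mult_left_mono[OF two[OF k2], of "\<eta> ^ 6"] by (simp add: \<eta>_def mult.assoc)
      also have "\<dots> = (\<eta> * sqrt ?P) ^ Suc 5"
      proof -
        have "t ^ 6 = (t ^ 2) ^ 3" for t :: real by (simp flip: power_mult)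
        hence "sqrt ?P ^ 6 = (sqrt ?P ^ 2) ^ 3" .
        also have "\<dots> = ?P ^ 3" by simp
        finally show ?thesis by (simp add: power_mult_distrib)
      qed
      finally show "(2 * sqrt (real q) ^ d * \<kappa>) ^ Suc 5 \<le> (\<eta> * sqrt ?P) ^ Suc 5" .
    qed (simp add: \<eta>_def)
    have pairs: "2 * sqrt (real q) ^ d * \<kappa> \<le> \<eta> * sqrt (real (card (vec ` A (s i))) * real (card (vec ` A (s j))))"
      if ij: "i \<in> ?I" "j \<in> ?I" "i \<noteq> j" for i j
    proof -
      have "i = 1 \<and> j = 2 \<or> i = 2 \<and> j = 1" using ij k2 by auto
      hence "real (card (A (s i))) * real (card (A (s j))) = ?P" by (auto simp: mult.commute)
      thus ?thesis using pos unfolding cardA[OF sk[OF ij(1)]] cardA[OF sk[OF ij(2)]] by (simp only:)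
    qed
    show "\<exists>\<kappa>. (\<forall>a\<in>embed F ` carrier F. \<forall>b\<in>embed F ` carrier F. a \<noteq> 0 \<longrightarrow>
          cmod (Q.kloosterman (\<lambda>x. of_real (Q.eta x) ^ d) a b) \<le> \<kappa>) \<and>
        (\<forall>i\<in>?I. \<forall>j\<in>?I. i \<noteq> j \<longrightarrow>
          2 * sqrt (real q) ^ d * \<kappa> \<le> \<eta> * sqrt (real (card (vec ` A (s i))) * real (card (vec ` A (s j)))))"
      by (intro exI[of _ \<kappa>] conjI ballI impI kl pairs)
  qed
  also have "\<dots> \<le> 4 * real (num_congruence_classes F d k (\<lambda>x. has_vertices_in k A x \<and> contains_copy F d k \<Delta> x))"
    using distance_vectors_le_congruence_classes[OF _ \<Delta>(1) s l A] k by simp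
  finally show ?thesis .
qed

end

section \<open>The choice of the sets and of the constants\<close>

text \<open>
  The product of the two largest numbers is at least the power \<open>2/3\<close> of the product of all
  three. If one of the first two is left out, the third number is at least as large and so
  satisfies the lower bound \<open>T\<close> as well.
\<close>

lemma two_largest_of_three:
  fixes a :: "nat \<Rightarrow> real"
  assumes low: "\<And>i. i \<in> {1..2} \<Longrightarrow> T \<le> a i" and a0: "\<And>i. i \<in> {1..3} \<Longrightarrow> 0 \<le> a i"
    and P: "P \<le> (\<Prod>i\<in>{1..3}. a i)" "0 \<le> P"
  obtains s l where "s \<in> {1..2::nat} \<rightarrow> {1..3::nat}" "inj_on s {1..2::nat}" "l \<in> {1..3}" "l \<notin> s ` {1..2}"
    "\<And>i. i \<in> {1..2} \<Longrightarrow> T \<le> a (s i)" "P\<^sup>2 \<le> (a (s 1) * a (s 2)) ^ 3"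
proof -
  have I: "{1..3} = {1, 2, 3::nat}" "{1..2} = {1, 2::nat}" by auto
  have a: "0 \<le> a 1" "0 \<le> a 2" "0 \<le> a 3" "T \<le> a 1" "T \<le> a 2" using a0 low by auto
  have P': "P \<le> a 1 * a 2 * a 3" using P(1) unfolding I(1) by (simp add: mult.assoc)
  have ineq: "P\<^sup>2 \<le> (x * y) ^ 3" if "0 \<le> z" "z \<le> x" "z \<le> y" "P \<le> x * y * z" for x y z
  proof -
    have "P\<^sup>2 \<le> (x * y * z)\<^sup>2" using that P(2) by (intro power_mono) auto
    also have "\<dots> = (x * y)\<^sup>2 * (z * z)" by (simp add: power_mult_distrib power2_eq_square)
    also have "\<dots> \<le> (x * y)\<^sup>2 * (x * y)" using that by (intro mult_left_mono mult_mono) auto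
    also have "\<dots> = (x * y) ^ 3" by (simp add: power2_eq_square power3_eq_cube)
    finally show ?thesis .
  qed
  note choose = that
  have conc: thesis if s: "s1 \<in> {1, 2, 3}" "s2 \<in> {1, 2, 3}" "s1 \<noteq> s2" and l: "l \<in> {1, 2, 3}" "l \<noteq> s1" "l \<noteq> s2"
    and z: "a l \<le> a s1" "a l \<le> a s2" "T \<le> a s1" "T \<le> a s2" for s1 s2 l :: nat
  proof (rule choose[of "\<lambda>i. if i = 1 then s1 else s2" l])
    have "a 1 * a 2 * a 3 = a s1 * a s2 * a l" using s l by (auto simp: mult_ac)
    moreover have "0 \<le> a l" using l a by auto
    ultimately show "P\<^sup>2 \<le> (a (if 1 = (1::nat) then s1 else s2) * a (if 2 = (1::nat) then s1 else s2)) ^ 3"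
      using ineq[of "a l" "a s1" "a s2"] z P' by simp
  qed (use s l z in \<open>auto simp: I inj_on_def split: if_splits\<close>)
  consider "a 3 \<le> a 1" "a 3 \<le> a 2" | "a 1 \<le> a 2" "a 1 \<le> a 3" | "a 2 \<le> a 1" "a 2 \<le> a 3" by linarith
  thus thesis
  proof cases
    case 1
    show thesis by (rule conc[of 1 2 3]) (use 1 a in auto)
  next
    case 2
    show thesis by (rule conc[of 2 3 1]) (use 2 a in auto)
  next
    case 3
    show thesis by (rule conc[of 1 3 2]) (use 3 a in auto)
  qed
qed

theorem theorem1p4:
  fixes d k :: nat
  assumes "2 \<le> k" and "k \<le> d"
  shows "\<exists>K c :: real. K > 0 \<and> c > 0 \<and>
    (\<forall>(q :: nat) (F :: nat ring) (\<Delta> :: nat \<Rightarrow> nat \<Rightarrow> nat) (A :: nat \<Rightarrow> (nat \<Rightarrow> nat) set).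
       primepow q \<longrightarrow> odd q \<longrightarrow> field F \<longrightarrow> card (carrier F) = q \<longrightarrow>
       \<Delta> \<in> simplices F d (k - 1) \<longrightarrow> nondegenerate F d (k - 1) \<Delta> \<longrightarrow>
       \<zero>\<^bsub>F\<^esub> \<notin> side_lengths F d (k - 1) \<Delta> \<longrightarrow>
       (\<forall>i\<in>{1..k+1}. A i \<subseteq> carrier (coord_space F d)) \<longrightarrow>
       (\<Prod>i=1..k+1. real (card (A i))) \<ge> K * real q ^ (d * k + 1) \<longrightarrow>
       (\<forall>i\<in>{1..k}. real (card (A i)) \<ge> K * real q powr ((real d - 1) / 2 + real k - 1)) \<longrightarrow>
       real (num_congruence_classes F d k
               (\<lambda>x. has_vertices_in k A x \<and> contains_copy F d k \<Delta> x)) \<ge> c * real q ^ k)"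
proof -
  \<comment> \<open>The factor \<open>160^d\<close> forces \<open>q \<ge> 160\<close>, from where on spheres are known to be large.\<close>
  define K :: real where "K = 12 * 2 ^ k * 160 ^ d"
  have K12: "K \<ge> 12 * 2 ^ k" and K160: "K \<ge> 160 ^ d" and K16: "K \<ge> 16"
  proof -
    have p: "(1::real) \<le> 2 ^ k" "(1::real) \<le> 160 ^ d" by simp_all
    have "(12 * 2 ^ k) * 1 \<le> (12 * 2 ^ k) * (160 ^ d :: real)" using p by (intro mult_left_mono) auto
    thus "K \<ge> 12 * 2 ^ k" by (simp add: K_def)
    have "1 * 160 ^ d \<le> (12 * 2 ^ k) * (160 ^ d :: real)" by (rule mult_right_mono) (use p(1) in linarith, simp)
    thus "K \<ge> 160 ^ d" by (simp add: K_def)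
    have "(160::real) ^ 1 \<le> 160 ^ d" using assms by (intro power_increasing) auto
    thus "K \<ge> 16" using \<open>K \<ge> 160 ^ d\<close> by simp
  qed
  have "real (num_congruence_classes F d k (\<lambda>x. has_vertices_in k A x \<and> contains_copy F d k \<Delta> x)) \<ge> 1 / 4 * real q ^ k"
    if "odd q" and F: "field F" and q: "card (carrier F) = q"
      and \<Delta>: "\<Delta> \<in> simplices F d (k - 1)" "nondegenerate F d (k - 1) \<Delta>" "\<zero>\<^bsub>F\<^esub> \<notin> side_lengths F d (k - 1) \<Delta>"
      and A: "\<forall>i\<in>{1..k+1}. A i \<subseteq> carrier (coord_space F d)"
      and prod: "(\<Prod>i=1..k+1. real (card (A i))) \<ge> K * real q ^ (d * k + 1)"
      and big: "\<forall>i\<in>{1..k}. real (card (A i)) \<ge> K * real q powr ((real d - 1) / 2 + real k - 1)"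
    for q and F :: "nat ring" and \<Delta> A
  proof -
    have "q > 0" using \<open>odd q\<close> by (cases q) auto
    hence finF: "finite (carrier F)" using q card_gt_0_iff by metis
    interpret odd_finite_field F d
      by (intro odd_finite_field.intro F odd_finite_field_axioms.intro finF) (use q \<open>odd q\<close> in simp)
    have q1: "real q \<ge> 1" using \<open>q > 0\<close> by simp
    have cV: "real (card (A i)) \<le> real q ^ d" if "i \<in> {1..k+1}" for i
    proof -
      have "card (A i) \<le> card (carrier (coord_space F d))"
      proof (rule card_mono)
        show "finite (carrier (coord_space F d))"
          unfolding carrier_func_space by (intro finite_PiE) (auto simp: finF)
        show "A i \<subseteq> carrier (coord_space F d)" using A that by blast
      qed
      also have "card (carrier (coord_space F d)) = q ^ d"
        unfolding carrier_func_space using q by (simp add: card_PiE)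
      finally show ?thesis by (simp flip: of_nat_power)
    qed
    have q160: "q \<ge> 160"
    proof (rule ccontr)
      assume "\<not> q \<ge> 160"
      hence lt: "real q ^ d < 160 ^ d" using assms by (intro power_strict_mono) auto
      have "K * real q ^ (d * k + 1) \<le> (\<Prod>i\<in>{1..k+1}. real q ^ d)"
        by (rule order_trans[OF prod], rule prod_mono) (use cV in auto)
      also have "\<dots> = real q ^ d * real q ^ (d * k)" by (simp add: power_mult)
      also have "\<dots> \<le> real q ^ d * real q ^ (d * k + 1)" using q1 by (intro mult_left_mono power_increasing) auto
      finally have "K \<le> real q ^ d" using q1 by (intro mult_right_le_imp_le[of K "real q ^ (d * k + 1)"]) auto
      thus False using lt K160 by linarith
    qed
    have small: "2 * k \<le> d + 2"
    proof (rule ccontr)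
      assume "\<not> ?thesis"
      hence "real (d + 3) \<le> real (2 * k)" by (intro of_nat_mono) simp
      hence "real d \<le> (real d - 1) / 2 + real k - 1" by (simp add: field_simps)
      hence "real q powr real d \<le> real q powr ((real d - 1) / 2 + real k - 1)" using q1 by (rule powr_mono)
      moreover have "K * real q powr ((real d - 1) / 2 + real k - 1) \<le> real q powr real d"
      proof -
        have "1 \<in> {1..k}" "1 \<in> {1..k+1}" using assms(1) by simp_all
        hence "K * real q powr ((real d - 1) / 2 + real k - 1) \<le> real q ^ d" using big cV by (meson order_trans)
        thus ?thesis using q160 by (simp add: powr_realpow)
      qed
      moreover have "0 < real q powr real d" using q160 by simp
      moreover have "2 * real q powr ((real d - 1) / 2 + real k - 1) \<le> K * real q powr ((real d - 1) / 2 + real k - 1)"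
        using K16 by (intro mult_right_mono) auto
      ultimately show False by linarith
    qed
    have prod16: "16 * real q ^ (d * k + 1) \<le> (\<Prod>i\<in>{1..k+1}. real (card (A i)))"
      by (rule order_trans[OF mult_right_mono[OF K16] prod]) simp
    have big12: "12 * 2 ^ k * real q powr ((real d - 1) / 2 + real k - 1) \<le> real (card (A i))"
      if "K * real q powr ((real d - 1) / 2 + real k - 1) \<le> real (card (A i))" for i
      by (rule order_trans[OF mult_right_mono[OF K12] that]) simp
    have AC: "A i \<subseteq> carrier (coord_space F d)" if "i \<in> {1..k+1}" for i using A that by blast
    note bound = congruence_classes_lower_bound[OF assms small q[symmetric] q160 \<Delta> _ _ _ _ AC _ prod16]
    have "real q ^ k \<le> 4 * real (num_congruence_classes F d k (\<lambda>x. has_vertices_in k A x \<and> contains_copy F d k \<Delta> x))"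
    proof (cases "k = 2")
      case False
      show ?thesis
      proof (rule bound[of "\<lambda>i. i" "k + 1"])
        show "12 * 2 ^ k * real q powr ((real d - 1) / 2 + real k - 1) \<le> real (card (A i))" if "i \<in> {1..k}" for i
          using big that by (intro big12) blast
      qed (use False in auto)
    next
      case True
      obtain s l where s: "s \<in> {1..2::nat} \<rightarrow> {1..3::nat}" "inj_on s {1..2}" and l: "l \<in> {1..3}" "l \<notin> s ` {1..2}"
        and low: "\<And>i. i \<in> {1..2} \<Longrightarrow> K * real q powr ((real d - 1) / 2 + real k - 1) \<le> real (card (A (s i)))"
        and two: "(K * real q ^ (d * k + 1))\<^sup>2 \<le> (real (card (A (s 1))) * real (card (A (s 2)))) ^ 3"
      proof (rule two_largest_of_three)
        show "K * real q powr ((real d - 1) / 2 + real k - 1) \<le> real (card (A i))" if "i \<in> {1..2}" for i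
          using big that True by blast
        show "K * real q ^ (d * k + 1) \<le> (\<Prod>i\<in>{1..3}. real (card (A i)))" using prod True by simp
        show "0 \<le> K * real q ^ (d * k + 1)" using K16 by simp
      qed (rule of_nat_0_le_iff, rule that)
      have kI: "{1..k} = {1..2}" "{1..k+1} = {1..3}" using True by simp_all
      show ?thesis
      proof (rule bound[of s l])
        show "s \<in> {1..k} \<rightarrow> {1..k+1}" "inj_on s {1..k}" "l \<in> {1..k+1}" "l \<notin> s ` {1..k}"
          using s l by (simp_all only: kI not_False_eq_True)
        show "12 * 2 ^ k * real q powr ((real d - 1) / 2 + real k - 1) \<le> real (card (A (s i)))" if "i \<in> {1..k}" for i
          using low that True by (intro big12) blast
        have "(12 * 2 ^ k * 160 ^ d)\<^sup>2 * real q ^ (4 * d + 2) = (K * real q ^ (d * k + 1))\<^sup>2"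
          unfolding K_def[symmetric] power_mult_distrib power_mult[symmetric] by (simp add: True algebra_simps)
        thus "(12 * 2 ^ k * 160 ^ d)\<^sup>2 * real q ^ (4 * d + 2) \<le> (real (card (A (s 1))) * real (card (A (s 2)))) ^ 3"
          using two by (simp only:)
      qed
    qed
    thus ?thesis by simp
  qed
  moreover have "K > 0" using K16 by simp
  ultimately show ?thesis by (intro exI[of _ K] exI[of _ "1 / 4 :: real"]) auto
qed

end
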